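(* Let $\mathfrak A$ be the class of all finite structures on a single quaternary relation that are isomorphic to $(T_H,R)$ for some boron tree $T$, and let $c=[\mathbf T_3\subset\mathbf T_4]\in\Theta(\mathfrak A)$. There is a ring isomorphism $$\mathbb Z[x]/(2x^2+x)\to\Theta(\mathfrak A),\qquad x\mapsto c.$$ This induces an isomorphism $\mathbb Z[\tfrac16]\cong\Theta^*(\mathfrak A)$.
   Context: A boron tree is a finite tree in which all internal vertices have valence three; internal vertices are called boron atoms and leaves hydrogen atoms (the empty tree and the one-vertex tree, with $0$ and $1$ hydrogen atoms, are allowed). For a boron tree $T$, $T_H$ is its set of hydrogen atoms, with quaternary relation $R$: $R(w,x;y,z)$ holds if the geodesic in $T$ joining $w$ and $x$ meets the geodesic joining $y$ and $z$. The tree $T$ can be recovered from $(T_H,R)$, and the two are identified. For $0\le i\le5$, $\mathbf T_i$ is the unique (up to isomorphism) boron tree with $i$ hydrogen atoms; for $0\le i\le3$ there is a unique embedding $\mathbf T_i\subset\mathbf T_{i+1}$ up to isomorphism. An embedding $Y\to X$ of structures is an injection inducing an isomorphism of $Y$ with the induced substructure on its image. An amalgamation of embeddings $i\colon Y\to X$, $j\colon Y\to Y'$ is a triple $(X',i',j')$ with $X'$ a structure and $i'\colon Y'\to X'$, $j'\colon X\to X'$ embeddings with $i'\circ j=j'\circ i$ and $X'=\mathrm{im}(i')\cup\mathrm{im}(j')$, considered up to the evident notion of isomorphism. $\Theta(\mathfrak A)$ is the commutative ring generated by classes $[i]$ (also written $[Y\subset X]$) for embeddings $i\colon Y\to X$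 of structures in $\mathfrak A$, with relations: (a) $[i]=1$ if $i$ is an isomorphism; (b) $[i\circ j]=[i][j]$ for composable embeddings; (c) for embeddings $i\colon Y\to X$, $j\colon Y\to Y'$ in $\mathfrak A$, if $(X'_\alpha,i'_\alpha,j'_\alpha)$, $1\le\alpha\le r$, are the amalgamations of $(i,j)$ in $\mathfrak A$ (one from each isomorphism class), then $[i]=\sum_{\alpha=1}^r[i'_\alpha]$. $\Theta^*(\mathfrak A)$ is the localization of $\Theta(\mathfrak A)$ obtained by inverting $[i]$ for all embeddings $i$ in $\mathfrak A$. *)

theory Defs
  imports
    "HOL-Algebra.Algebraic_Closure_Type"
    "HOL-Algebra.QuotRing"
    "HOL-Library.FuncSet"
    "HOL-Library.Poly_Mapping"
    "HOL-Library.Infinite_Typeclass"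
    "Graph_Theory.Pair_Digraph"
begin

section \<open>Boron trees\<close>

text \<open>
  An undirected finite simple graph is a \<^locale>\<open>pair_graph\<close>: a finite loopless symmetric
  digraph whose arcs are ordered pairs of vertices. A tree is a graph in which any two vertices are
  joined by exactly one path without repeated vertices; the graph without vertices is admitted. (The
  constant \<open>tree\<close> of the theory \<open>Digraph_Component\<close> is unsuitable: in a symmetric digraph it
  counts every edge as a cycle, and it excludes the empty graph.)
\<close>

definition tree_graph :: "'v pair_pre_digraph \<Rightarrow> bool" where
  "tree_graph T \<longleftrightarrow> pair_graph T \<and>
     (\<forall>u \<in> pverts T. \<forall>v \<in> pverts T. \<exists>!p. pre_digraph.apath (with_proj T) u p v)"

definition geodesic :: "'v pair_pre_digraph \<Rightarrow> 'v \<Rightarrow> 'v \<Rightarrow> 'v set" where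
  "geodesic T u v =
     set (pre_digraph.awalk_verts (with_proj T) u (THE p. pre_digraph.apath (with_proj T) u p v))"

text \<open>
  A leaf is a vertex of valence at most one; valence zero occurs only in the one-vertex tree, whose
  vertex counts as a hydrogen atom.
\<close>

definition hydrogen :: "'v pair_pre_digraph \<Rightarrow> 'v set" where
  "hydrogen T = {v \<in> pverts T. out_degree (with_proj T) v \<le> 1}"

definition boron_tree :: "'v pair_pre_digraph \<Rightarrow> bool" where
  "boron_tree T \<longleftrightarrow> tree_graph T \<and>
     (\<forall>v \<in> pverts T - hydrogen T. out_degree (with_proj T) v = 3)"


section \<open>Structures with one quaternary relation\<close>

datatype 'a qstruct = QStruct (points: "'a set") (quad: "('a \<times> 'a \<times> 'a \<times> 'a) set")

definition finite_qstruct :: "'a qstruct \<Rightarrow> bool" where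
  "finite_qstruct V \<longleftrightarrow> finite (points V) \<and>
     quad V \<subseteq> points V \<times> points V \<times> points V \<times> points V"

definition is_embedding :: "('a \<Rightarrow> 'b) \<Rightarrow> 'a qstruct \<Rightarrow> 'b qstruct \<Rightarrow> bool" where
  "is_embedding f U V \<longleftrightarrow> f \<in> PiE (points U) (\<lambda>_. points V) \<and> inj_on f (points U) \<and>
     (\<forall>w \<in> points U. \<forall>x \<in> points U. \<forall>y \<in> points U. \<forall>z \<in> points U.
        (w, x, y, z) \<in> quad U \<longleftrightarrow> (f w, f x, f y, f z) \<in> quad V)"

definition is_isomorphism :: "('a \<Rightarrow> 'b) \<Rightarrow> 'a qstruct \<Rightarrow> 'b qstruct \<Rightarrow> bool" where
  "is_isomorphism f U V \<longleftrightarrow> is_embedding f U V \<and> f ` points U = points V"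

definition hydrogen_structure :: "'v pair_pre_digraph \<Rightarrow> 'v qstruct" where
  "hydrogen_structure T = QStruct (hydrogen T)
     {(w, x, y, z). w \<in> hydrogen T \<and> x \<in> hydrogen T \<and> y \<in> hydrogen T \<and> z \<in> hydrogen T \<and>
        geodesic T w x \<inter> geodesic T y z \<noteq> {}}"

text \<open>
  Structures live on finite subsets of a fixed type \<open>'a\<close>. When \<open>'a\<close> is infinite, every
  finite structure has an isomorphic copy there, so the set below represents the whole class.
  Likewise it suffices to take trees with vertices in \<open>nat\<close>.
\<close>

definition boron_class :: "'a qstruct set" where
  "boron_class = {V. finite_qstruct V \<and>
     (\<exists>(T :: nat pair_pre_digraph) f. boron_tree T \<and> is_isomorphism f V (hydrogen_structure T))}"

text \<open>
  The copies of the boron tree with \<open>n\<close> hydrogen atoms (a single isomorphism class for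
  \<open>n \<le> 5\<close>).
\<close>

definition boron_T :: "nat \<Rightarrow> 'a qstruct set" where
  "boron_T n = {V \<in> boron_class. card (points V) = n}"


section \<open>Embeddings and amalgamations\<close>

datatype 'a emb = Emb (src: "'a qstruct") (tgt: "'a qstruct") (fn: "'a \<Rightarrow> 'a")

definition embs :: "'a qstruct set \<Rightarrow> 'a emb set" where
  "embs \<AA> = {e. src e \<in> \<AA> \<and> tgt e \<in> \<AA> \<and> is_embedding (fn e) (src e) (tgt e)}"

definition emb_comp :: "'a emb \<Rightarrow> 'a emb \<Rightarrow> 'a emb" where
  "emb_comp i j = Emb (src j) (tgt i) (compose (points (src j)) (fn i) (fn j))"

text \<open>
  For \<open>i : Y \<rightarrow> X\<close> and \<open>j : Y \<rightarrow> Y'\<close>, an amalgamation \<open>(X', i', j')\<close> is encoded by the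
  pair \<open>(i', j')\<close>, as \<open>X'\<close> is the common target of \<open>i' : Y' \<rightarrow> X'\<close> and \<open>j' : X \<rightarrow> X'\<close>.
\<close>

definition amalgamations :: "'a qstruct set \<Rightarrow> 'a emb \<Rightarrow> 'a emb \<Rightarrow> ('a emb \<times> 'a emb) set" where
  "amalgamations \<AA> i j = {(i', j'). i' \<in> embs \<AA> \<and> j' \<in> embs \<AA> \<and>
     src i' = tgt j \<and> src j' = tgt i \<and> tgt i' = tgt j' \<and>
     emb_comp i' j = emb_comp j' i \<and>
     points (tgt i') = fn i' ` points (src i') \<union> fn j' ` points (src j')}"

definition amalg_iso :: "'a emb \<times> 'a emb \<Rightarrow> 'a emb \<times> 'a emb \<Rightarrow> bool" where
  "amalg_iso a b \<longleftrightarrow> (\<exists>h. is_isomorphism h (tgt (fst a)) (tgt (fst b)) \<and>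
     emb_comp (Emb (tgt (fst a)) (tgt (fst b)) h) (fst a) = fst b \<and>
     emb_comp (Emb (tgt (fst a)) (tgt (fst b)) h) (snd a) = snd b)"

definition amalg_representatives ::
    "'a qstruct set \<Rightarrow> 'a emb \<Rightarrow> 'a emb \<Rightarrow> ('a emb \<times> 'a emb) set \<Rightarrow> bool" where
  "amalg_representatives \<AA> i j M \<longleftrightarrow> finite M \<and> M \<subseteq> amalgamations \<AA> i j \<and>
     (\<forall>a \<in> amalgamations \<AA> i j. \<exists>!m. m \<in> M \<and> amalg_iso a m)"


section \<open>The ring of an amalgamation class\<close>

text \<open>
  The free commutative ring on a set \<open>E\<close>: polynomials with integer coefficients, as finitely
  supported functions on monomials, in which only variables from \<open>E\<close> occur.
\<close>

definition free_comm_ring :: "'e set \<Rightarrow> (('e \<Rightarrow>\<^sub>0 nat) \<Rightarrow>\<^sub>0 int) ring" where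
  "free_comm_ring E = ring_of_type_algebra
     \<lparr>carrier := {p. \<forall>m \<in> Poly_Mapping.keys p. Poly_Mapping.keys m \<subseteq> E}\<rparr>"

definition gen :: "'e \<Rightarrow> ('e \<Rightarrow>\<^sub>0 nat) \<Rightarrow>\<^sub>0 int" where
  "gen e = Poly_Mapping.single (Poly_Mapping.single e 1) 1"

definition theta_relations :: "'a qstruct set \<Rightarrow> (('a emb \<Rightarrow>\<^sub>0 nat) \<Rightarrow>\<^sub>0 int) set" where
  "theta_relations \<AA> =
     {gen i - 1 | i. i \<in> embs \<AA> \<and> is_isomorphism (fn i) (src i) (tgt i)} \<union>
     {gen (emb_comp i j) - gen i * gen j | i j. i \<in> embs \<AA> \<and> j \<in> embs \<AA> \<and> tgt j = src i} \<union>
     {gen i - (\<Sum>m\<in>M. gen (fst m)) | i j M. i \<in> embs \<AA> \<and> j \<in> embs \<AA> \<and> src i = src j \<and>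
        amalg_representatives \<AA> i j M}"

definition theta_ideal :: "'a qstruct set \<Rightarrow> (('a emb \<Rightarrow>\<^sub>0 nat) \<Rightarrow>\<^sub>0 int) set" where
  "theta_ideal \<AA> = Idl\<^bsub>free_comm_ring (embs \<AA>)\<^esub> (theta_relations \<AA>)"

definition Theta :: "'a qstruct set \<Rightarrow> (('a emb \<Rightarrow>\<^sub>0 nat) \<Rightarrow>\<^sub>0 int) set ring" where
  "Theta \<AA> = free_comm_ring (embs \<AA>) Quot theta_ideal \<AA>"

definition theta_class :: "'a qstruct set \<Rightarrow> 'a emb \<Rightarrow> (('a emb \<Rightarrow>\<^sub>0 nat) \<Rightarrow>\<^sub>0 int) set" where
  "theta_class \<AA> i = theta_ideal \<AA> +>\<^bsub>free_comm_ring (embs \<AA>)\<^esub> gen i"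


section \<open>Localization\<close>

inductive_set mult_closure :: "('r, 'm) ring_scheme \<Rightarrow> 'r set \<Rightarrow> 'r set"
  for R :: "('r, 'm) ring_scheme" and G :: "'r set" where
  one: "\<one>\<^bsub>R\<^esub> \<in> mult_closure R G"
| mult: "g \<in> G \<Longrightarrow> s \<in> mult_closure R G \<Longrightarrow> g \<otimes>\<^bsub>R\<^esub> s \<in> mult_closure R G"

text \<open>
  Fractions over a multiplicative set \<open>S\<close>: \<open>a/s = b/t\<close> iff \<open>u t a = u s b\<close> for some
  \<open>u \<in> S\<close>.
\<close>

definition frac_rel :: "('r, 'm) ring_scheme \<Rightarrow> 'r set \<Rightarrow> (('r \<times> 'r) \<times> ('r \<times> 'r)) set" where
  "frac_rel R S = {((a, s), (b, t)). a \<in> carrier R \<and> s \<in> S \<and> b \<in> carrier R \<and> t \<in> S \<and>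
     (\<exists>u \<in> S. u \<otimes>\<^bsub>R\<^esub> (t \<otimes>\<^bsub>R\<^esub> a) = u \<otimes>\<^bsub>R\<^esub> (s \<otimes>\<^bsub>R\<^esub> b))}"

definition ring_frac :: "('r, 'm) ring_scheme \<Rightarrow> 'r set \<Rightarrow> 'r \<Rightarrow> 'r \<Rightarrow> ('r \<times> 'r) set" where
  "ring_frac R S a s = frac_rel R S `` {(a, s)}"

definition localization :: "('r, 'm) ring_scheme \<Rightarrow> 'r set \<Rightarrow> ('r \<times> 'r) set ring" where
  "localization R S =
     \<lparr>carrier = (carrier R \<times> S) // frac_rel R S,
      monoid.mult = (\<lambda>P Q. \<Union>(a, s) \<in> P. \<Union>(b, t) \<in> Q. ring_frac R S (a \<otimes>\<^bsub>R\<^esub> b) (s \<otimes>\<^bsub>R\<^esub> t)),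
      monoid.one = ring_frac R S \<one>\<^bsub>R\<^esub> \<one>\<^bsub>R\<^esub>,
      ring.zero = ring_frac R S \<zero>\<^bsub>R\<^esub> \<one>\<^bsub>R\<^esub>,
      ring.add = (\<lambda>P Q. \<Union>(a, s) \<in> P. \<Union>(b, t) \<in> Q.
               ring_frac R S (t \<otimes>\<^bsub>R\<^esub> a \<oplus>\<^bsub>R\<^esub> s \<otimes>\<^bsub>R\<^esub> b) (s \<otimes>\<^bsub>R\<^esub> t))\<rparr>"

definition theta_denominators :: "'a qstruct set \<Rightarrow> (('a emb \<Rightarrow>\<^sub>0 nat) \<Rightarrow>\<^sub>0 int) set set" where
  "theta_denominators \<AA> = mult_closure (Theta \<AA>) (theta_class \<AA> ` embs \<AA>)"

definition Theta_star ::
    "'a qstruct set \<Rightarrow>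
     ((('a emb \<Rightarrow>\<^sub>0 nat) \<Rightarrow>\<^sub>0 int) set \<times> (('a emb \<Rightarrow>\<^sub>0 nat) \<Rightarrow>\<^sub>0 int) set) set ring" where
  "Theta_star \<AA> = localization (Theta \<AA>) (theta_denominators \<AA>)"

definition to_Theta_star ::
    "'a qstruct set \<Rightarrow> (('a emb \<Rightarrow>\<^sub>0 nat) \<Rightarrow>\<^sub>0 int) set \<Rightarrow>
     ((('a emb \<Rightarrow>\<^sub>0 nat) \<Rightarrow>\<^sub>0 int) set \<times> (('a emb \<Rightarrow>\<^sub>0 nat) \<Rightarrow>\<^sub>0 int) set) set" where
  "to_Theta_star \<AA> r = ring_frac (Theta \<AA>) (theta_denominators \<AA>) r \<one>\<^bsub>Theta \<AA>\<^esub>"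


section \<open>The rings \<open>\<int>[x]/(2x\<^sup>2 + x)\<close> and \<open>\<int>[1/6]\<close>\<close>

definition Zx_ideal :: "int poly set" where
  "Zx_ideal = Idl\<^bsub>ring_of_type_algebra\<^esub> {[:0, 1, 2:]}"

definition Zx_quot :: "int poly set ring" where
  "Zx_quot = ring_of_type_algebra Quot Zx_ideal"

definition Zx_class :: "int poly \<Rightarrow> int poly set" where
  "Zx_class p = Zx_ideal +>\<^bsub>ring_of_type_algebra\<^esub> p"

definition Z_one_sixth :: "rat ring" where
  "Z_one_sixth = ring_of_type_algebra \<lparr>carrier := {of_int a / 6 ^ n | (a :: int) (n :: nat). True}\<rparr>"

end

theory Submission
  imports Defs
begin

text \<open>
  Write \<open>D w x y z\<close> when the geodesics \<open>w x\<close> and \<open>y z\<close> are disjoint. Boron structures are the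
  models of a few universal axioms for \<open>D\<close>, and a new point is attached to a boron tree by choosing
  an edge, that is, a split of the old points into two sides. So the amalgamations of two one-point
  extensions can be listed explicitly. Additivity along them shows, by induction on the number of
  points, that the class of a one-point extension depends only on whether the edge is a pendant edge
  (class \<open>c\<close>) or an inner one (class \<open>- 1 - c\<close>), the classes for fewer than three old points
  being \<open>3 + 3 c\<close>, \<open>2 + 3 c\<close>, \<open>1 + 3 c\<close>. Adding two points in either order gives
  \<open>2 c\<^sup>2 + c = 0\<close>, so the ring is a quotient of \<open>\<int>[x]/(2x\<^sup>2 + x)\<close>.

  Conversely, for every root \<open>c\<close> of \<open>2 x\<^sup>2 + x\<close> in a commutative ring the product of these values along
  a chain of one-point extensions is independent of the chain and respects all relations. The
  resulting homomorphisms for the rational roots \<open>0\<close> and \<open>- 1 / 2\<close> together detect every element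
  of \<open>\<int>[x]/(2x\<^sup>2 + x)\<close>, which gives the isomorphism. At \<open>- 1 / 2\<close> all embeddings have values that
  are products of \<open>3 / 2\<close>, \<open>1 / 2\<close> and \<open>- 1 / 2\<close>, and inverting \<open>c\<close> kills the kernel of the
  evaluation at \<open>- 1 / 2\<close>.
\<close>

section \<open>Disjointness of geodesics\<close>

text \<open>Replacing \<open>R\<close> by its complement \<open>D\<close> makes the class axiomatic:
  \<open>D w x y z\<close> is the quartet \<open>w x | y z\<close>. In \<open>dstruct\<close> the
  third axiom says that an edge separating two pairs leaves any further point on one of its sides,
  and the last one that no internal vertex has more than three branches. As \<open>D\<close> is
  false outside \<open>H\<close>, equal structures are equal functions. The obstacle is relation (c)
  for arbitrary pairs of embeddings, whose amalgamations are not listed explicitly. Stacking removes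
  it: amalgamations of a composite arise from amalgamating its factors in turn, so additivity passes
  from one-point extensions to all embeddings, in each argument separately. The quadratic relation
  is used in two opposite directions: a five-point structure forces it in the ring, and it makes the
  product of values independent of the order in which points are added. In the uniqueness half each
  additivity equation is arranged to contain a single unknown value. The configuration that resists
  is four old points split two against two, where the equation has three terms and the two others
  must be known beforehand.\<close>

definition dstruct :: "'a set \<Rightarrow> ('a \<Rightarrow> 'a \<Rightarrow> 'a \<Rightarrow> 'a \<Rightarrow> bool) \<Rightarrow> bool" where
  "dstruct H D \<longleftrightarrow>
     (\<forall>w x y z. D w x y z \<longrightarrow> w \<in> H \<and> x \<in> H \<and> y \<in> H \<and> z \<in> H) \<and>
     (\<forall>w x y z. D w x y z \<longrightarrow> D x w y z \<and> D y z w x \<and> \<not> D w y x z) \<and>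
     (\<forall>w x y z u. D w x y z \<longrightarrow> u \<in> H \<longrightarrow> D u x y z \<or> D w x y u) \<and>
     (\<forall>x\<in>H. \<forall>y\<in>H. \<forall>z\<in>H. x \<noteq> y \<longrightarrow> x \<noteq> z \<longrightarrow> D x x y z) \<and>
     (\<forall>w\<in>H. \<forall>x\<in>H. \<forall>y\<in>H. \<forall>z\<in>H. distinct [w, x, y, z] \<longrightarrow>
        D w x y z \<or> D w y x z \<or> D w z x y)"

text \<open>
  \<open>split H D A B\<close>: cutting some edge of the tree separates \<open>A\<close> from \<open>B\<close>.
  \<open>edge_at D H x A B\<close>: the point \<open>x\<close> is attached in the middle of the edge that separates them.
\<close>

definition split :: "'a set \<Rightarrow> ('a \<Rightarrow> 'a \<Rightarrow> 'a \<Rightarrow> 'a \<Rightarrow> bool) \<Rightarrow> 'a set \<Rightarrow> 'a set \<Rightarrow> bool" where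
  "split H D A B \<longleftrightarrow> A \<noteq> {} \<and> B \<noteq> {} \<and> A \<inter> B = {} \<and> A \<union> B = H \<and>
     (\<forall>a\<in>A. \<forall>a'\<in>A. \<forall>b\<in>B. \<forall>b'\<in>B. D a a' b b')"

definition edge_at :: "('a \<Rightarrow> 'a \<Rightarrow> 'a \<Rightarrow> 'a \<Rightarrow> bool) \<Rightarrow> 'a set \<Rightarrow> 'a \<Rightarrow> 'a set \<Rightarrow> 'a set \<Rightarrow> bool" where
  "edge_at D H x A B \<longleftrightarrow> A \<noteq> {} \<and> B \<noteq> {} \<and> A \<inter> B = {} \<and> A \<union> B = H \<and>
     (\<forall>a\<in>A. \<forall>a'\<in>A. \<forall>b\<in>B. D a a' x b) \<and> (\<forall>b\<in>B. \<forall>b'\<in>B. \<forall>a\<in>A. D b b' x a)"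

definition rel_restrict :: "'a set \<Rightarrow> ('a \<Rightarrow> 'a \<Rightarrow> 'a \<Rightarrow> 'a \<Rightarrow> bool) \<Rightarrow> 'a \<Rightarrow> 'a \<Rightarrow> 'a \<Rightarrow> 'a \<Rightarrow> bool" where
  "rel_restrict H D w x y z \<longleftrightarrow> w \<in> H \<and> x \<in> H \<and> y \<in> H \<and> z \<in> H \<and> D w x y z"

lemma edge_at_sym: "edge_at D H x A B \<Longrightarrow> edge_at D H x B A"
  unfolding edge_at_def by auto

context
  fixes H :: "'a set" and D
  assumes dD: "dstruct H D"
begin

lemma
  shows d_in: "D w x y z \<Longrightarrow> w \<in> H \<and> x \<in> H \<and> y \<in> H \<and> z \<in> H"
    and d_swap: "D w x y z \<Longrightarrow> D x w y z"
    and d_flip: "D w x y z \<Longrightarrow> D y z w x"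
    and d_excl: "D w x y z \<Longrightarrow> \<not> D w y x z"
    and d_tr: "D w x y z \<Longrightarrow> u \<in> H \<Longrightarrow> D u x y z \<or> D w x y u"
    and d_deg: "x \<in> H \<Longrightarrow> y \<in> H \<Longrightarrow> z \<in> H \<Longrightarrow> x \<noteq> y \<Longrightarrow> x \<noteq> z \<Longrightarrow> D x x y z"
    and d_cub: "w \<in> H \<Longrightarrow> x \<in> H \<Longrightarrow> y \<in> H \<Longrightarrow> z \<in> H \<Longrightarrow> w \<noteq> x \<Longrightarrow> w \<noteq> y \<Longrightarrow> w \<noteq> z \<Longrightarrow>
       x \<noteq> y \<Longrightarrow> x \<noteq> z \<Longrightarrow> y \<noteq> z \<Longrightarrow> D w x y z \<or> D w y x z \<or> D w z x y"
proof -
  note * = dD[unfolded dstruct_def, THEN conjunct1]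
    dD[unfolded dstruct_def, THEN conjunct2, THEN conjunct1]
    dD[unfolded dstruct_def, THEN conjunct2, THEN conjunct2, THEN conjunct1]
    dD[unfolded dstruct_def, THEN conjunct2, THEN conjunct2, THEN conjunct2, THEN conjunct1]
    dD[unfolded dstruct_def, THEN conjunct2, THEN conjunct2, THEN conjunct2, THEN conjunct2]
  show "D w x y z \<Longrightarrow> w \<in> H \<and> x \<in> H \<and> y \<in> H \<and> z \<in> H" by (rule *(1)[rule_format])
  show "D w x y z \<Longrightarrow> D x w y z" "D w x y z \<Longrightarrow> D y z w x" "D w x y z \<Longrightarrow> \<not> D w y x z"
    using *(2) by blast+
  show "D w x y z \<Longrightarrow> u \<in> H \<Longrightarrow> D u x y z \<or> D w x y u" by (rule *(3)[rule_format])
  show "x \<in> H \<Longrightarrow> y \<in> H \<Longrightarrow> z \<in> H \<Longrightarrow> x \<noteq> y \<Longrightarrow> x \<noteq> z \<Longrightarrow> D x x y z"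
    by (rule *(4)[rule_format])
  show "w \<in> H \<Longrightarrow> x \<in> H \<Longrightarrow> y \<in> H \<Longrightarrow> z \<in> H \<Longrightarrow> w \<noteq> x \<Longrightarrow> w \<noteq> y \<Longrightarrow> w \<noteq> z \<Longrightarrow>
       x \<noteq> y \<Longrightarrow> x \<noteq> z \<Longrightarrow> y \<noteq> z \<Longrightarrow> D w x y z \<or> D w y x z \<or> D w z x y"
    by (rule *(5)[rule_format]) simp_all
qed

lemma split_sym: "split H D A B \<Longrightarrow> split H D B A"
  unfolding split_def using d_flip by (metis Int_commute Un_commute)

lemma d_swap': "D w x y z \<Longrightarrow> D w x z y"
  by (meson d_swap d_flip)

text \<open>Exclusion applied to \<open>D w x w z\<close> forbids \<open>D w w x z\<close>, which
  the degenerate axiom provides when \<open>w\<close> differs from \<open>x\<close> and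
  \<open>z\<close>. If \<open>w\<close> equals one of them, exclusion contradicts the hypothesis
  itself, up to symmetry.\<close>

lemma d_ne: "D w x y z \<Longrightarrow> w \<noteq> y \<and> w \<noteq> z \<and> x \<noteq> y \<and> x \<noteq> z"
proof -
  have *: False if "D w x w z" for w x z
    using d_excl[OF that] that d_deg[of w x z] d_in[OF that] by (metis d_excl d_flip d_swap d_swap')
  show "D w x y z \<Longrightarrow> w \<noteq> y \<and> w \<noteq> z \<and> x \<noteq> y \<and> x \<noteq> z"
    using * d_swap d_swap' by metis
qed

text \<open>Relative to a fixed geodesic \<open>a b\<close>, being joined by a geodesic that avoids
  it is transitive. Otherwise \<open>d_tr\<close> moves \<open>d\<close> and \<open>c\<close> into
  place and yields the quartets \<open>x c | a d\<close> and \<open>x d | a c\<close>, which exclude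
  each other.\<close>

lemma d_trans: "D a b x c \<Longrightarrow> D a b x d \<Longrightarrow> D a b c d"
proof (rule ccontr)
  assume h: "D a b x c" "D a b x d" "\<not> D a b c d"
  have in': "a \<in> H" "b \<in> H" "c \<in> H" "d \<in> H" "x \<in> H" using h d_in by blast+
  have "D x c a d" using d_tr[OF d_flip[OF h(1)], of d] h(3) in' by (metis d_flip d_swap)
  moreover have "D x d a c" using d_tr[OF d_flip[OF h(2)], of c] h(3) in' by (metis d_flip d_swap d_swap')
  ultimately show False by (metis d_excl d_swap')
qed

text \<open>The points joined to \<open>y\<close> without meeting the geodesic \<open>w x\<close>
  are the leaves of one component of its complement. The edge by which this component hangs on the
  geodesic gives the split.\<close>

lemma d_split_exists:
  assumes "D w x y z"
  obtains A B where "split H D A B" "w \<in> A" "x \<in> A" "y \<in> B" "z \<in> B"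
proof -
  define B where "B = {u. D w x y u}"
  have BH: "B \<subseteq> H" unfolding B_def using d_in by blast
  have w: "w \<in> H - B" "x \<in> H - B" "y \<in> B" "z \<in> B"
    using assms d_in[OF assms] d_ne[of w x y w] d_ne[of w x y x]
      d_trans[OF d_swap'[OF assms] d_swap'[OF assms]]
    unfolding B_def by blast+
  have 1: "D a x y b \<and> D a w y b" if "a \<in> H - B" "b \<in> B" for a b
    using that d_tr[of w x y b a] d_tr[of x w y b a] unfolding B_def by (metis DiffD1 DiffD2 d_swap mem_Collect_eq)
  have 2: "D a a' y b" if "a \<in> H - B" "a' \<in> H - B" "b \<in> B" for a a' b
    using 1[OF that(1,3)] 1[OF that(2,3)] by (metis d_flip d_swap d_trans)
  have "D a a' b b'" if "a \<in> H - B" "a' \<in> H - B" "b \<in> B" "b' \<in> B" for a a' b b'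
    using 2[OF that(1,2,3)] 2[OF that(1,2,4)] by (metis d_trans)
  then have "split H D (H - B) B" unfolding split_def using w BH by auto
  then show ?thesis using w that by blast
qed

lemma dstruct_restrict:
  assumes "K \<subseteq> H" shows "dstruct K (rel_restrict K D)"
  unfolding dstruct_def rel_restrict_def
proof (intro conjI allI ballI impI)
  fix w x y z assume "w \<in> K" "x \<in> K" "y \<in> K" "z \<in> K" "distinct [w, x, y, z]"
  then show "(w \<in> K \<and> x \<in> K \<and> y \<in> K \<and> z \<in> K \<and> D w x y z) \<or> (w \<in> K \<and> y \<in> K \<and> x \<in> K \<and> z \<in> K \<and> D w y x z) \<or>
    (w \<in> K \<and> z \<in> K \<and> x \<in> K \<and> y \<in> K \<and> D w z x y)"
    using d_cub[of w x y z] assms by auto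
qed (use assms in \<open>(blast intro: d_swap d_flip d_deg dest: d_excl d_tr)+\<close>)

text \<open>Points in all four intersections would realise the quartets \<open>p q | r s\<close> and
  \<open>p r | q s\<close> at once.\<close>

lemma splits_compatible:
  assumes "split H D A B" "split H D C E"
  shows "A \<subseteq> C \<or> A \<subseteq> E \<or> B \<subseteq> C \<or> B \<subseteq> E"
proof (rule ccontr)
  assume "\<not> ?thesis"
  moreover have "A \<union> B = C \<union> E" using assms unfolding split_def by auto
  ultimately obtain p q r s where p: "p \<in> A" "p \<in> C" and q: "q \<in> A" "q \<in> E" and r: "r \<in> B" "r \<in> C"
    and s: "s \<in> B" "s \<in> E" by blast
  then have "D p q r s" "D p r q s" using assms unfolding split_def by auto
  then show False using d_excl by blast
qed

lemma split_edge_at: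
  assumes "edge_at D K x A B" 
  shows "split K D A B"
  using assms unfolding split_def edge_at_def by (metis d_trans d_flip)

text \<open>Attaching \<open>x\<close> subdivides the edge \<open>A | B\<close>; this is the half
  nearer to \<open>A\<close>.\<close>

lemma edge_at_split1:
  assumes "edge_at D K x A B" "H = insert x K" "x \<notin> K"
  shows "split H D A (insert x B)"
  unfolding split_def
proof (intro conjI ballI)
  fix a a' b b' assume "a \<in> A" "a' \<in> A" "b \<in> insert x B" "b' \<in> insert x B"
  then have "b = x \<and> b' = x \<or> D a a' b b'"
    using assms(1) split_edge_at[OF assms(1)] unfolding split_def edge_at_def
    by (metis d_swap' insert_iff)
  then show "D a a' b b'" using assms \<open>a \<in> A\<close> \<open>a' \<in> A\<close> unfolding edge_at_def
    by (metis UnCI d_deg d_flip insert_iff)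
qed (use assms in \<open>auto simp: edge_at_def\<close>)

text \<open>A point \<open>c\<close> of \<open>A\<close> outside \<open>A'\<close> would be
  separated from \<open>a\<close> by the second edge. Any \<open>b\<close> in \<open>B\<close> is
  there on the side of \<open>a\<close> or of \<open>c\<close>, which gives \<open>D a b x c\<close>
  or \<open>D c b x a\<close>, against \<open>D a c x b\<close>.\<close>

lemma edge_at_unique_subset:
  assumes "edge_at D K x A B" "edge_at D K x A' B'" "a \<in> A" "a \<in> A'"
  shows "A \<subseteq> A'"
proof
  fix c assume c: "c \<in> A"
  obtain b where b: "b \<in> B" using assms unfolding edge_at_def by auto
  have K: "A \<union> B = K" "A' \<union> B' = K" using assms unfolding edge_at_def by auto
  have 1: "D a c x b" using assms c b unfolding edge_at_def by auto
  show "c \<in> A'"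
  proof (rule ccontr)
    assume "c \<notin> A'"
    then have c': "c \<in> B'" using c K by auto
    have "b \<in> A' \<or> b \<in> B'" using b K by auto
    then have "D a b x c \<or> D c b x a"
      using assms c' unfolding edge_at_def by auto
    then show False using 1 by (metis d_excl d_flip d_swap d_swap')
  qed
qed

lemma edge_at_unique:
  assumes "edge_at D K x A B" "edge_at D K x A' B'"
  shows "A = A' \<and> B = B' \<or> A = B' \<and> B = A'"
proof -
  have *: "A = A' \<and> B = B'" if h: "edge_at D K x A B" "edge_at D K x A' B'" "a \<in> A" "a \<in> A'" for a A B A' B'
  proof -
    have "A = A'" using edge_at_unique_subset h by blast
    then show ?thesis using h unfolding edge_at_def by blast
  qed
  obtain a where a: "a \<in> A" using assms unfolding edge_at_def by auto
  then have "a \<in> A' \<or> a \<in> B'" using assms unfolding edge_at_def by blast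
  then show ?thesis using *[OF assms a] *[OF assms(1) edge_at_sym[OF assms(2)] a] by blast
qed

text \<open>The neighbour of \<open>x\<close> lies on some geodesic \<open>a b\<close>, and then
  every geodesic from \<open>x\<close> to a point of \<open>K\<close> meets it. Such a pair is found
  by maximising the number of points \<open>c\<close> whose geodesic \<open>x c\<close> meets
  \<open>a b\<close>; the two sides consist of the points branching off towards \<open>a\<close> and
  towards \<open>b\<close>.\<close>

lemma edge_at_exists:
  assumes "finite K" "H = insert x K" "x \<notin> K" "2 \<le> card K"
  obtains A B where "edge_at D K x A B"
proof -
  define cl where "cl p = {c\<in>K. \<not> D (fst p) (snd p) x c}" for p
  obtain p where p: "p \<in> K \<times> K" "\<And>q. q \<in> K \<times> K \<Longrightarrow> card (cl q) \<le> card (cl p)"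
  proof -
    let ?S = "(\<lambda>q. card (cl q)) ` (K \<times> K)"
    have fin: "finite ?S" and "?S \<noteq> {}" using assms(1,4) by auto
    then obtain p where "p \<in> K \<times> K" "card (cl p) = Max ?S" using Max_in by (metis (no_types, lifting) imageE)
    then show ?thesis using that fin by (metis (no_types, lifting) Max_ge image_eqI)
  qed
  obtain a b where ab: "p = (a, b)" by (cases p)
  have aH: "a \<in> K" "b \<in> K" using p(1) ab by auto
  \<comment> \<open>If \<open>x c\<close> misses \<open>a b\<close>, replacing \<open>b\<close> by
    \<open>c\<close> keeps all geodesics from \<open>x\<close> that met \<open>a b\<close> and gains
    the one to \<open>c\<close>, against maximality.\<close>
  have nD: "\<not> D a b x c" if c: "c \<in> K" for c
  proof
    assume d: "D a b x c"
    have "cl p \<subset> cl (a, c)"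
    proof
      show "cl p \<subseteq> cl (a, c)"
      proof
        fix e assume e: "e \<in> cl p"
        then have e: "e \<in> K" "\<not> D a b x e" by (auto simp: cl_def ab)
        have "\<not> D a c x e"
        proof
          assume f: "D a c x e"
          have "D e x a b \<or> D c x a e" using d_tr[of c x a b e] d e assms(2) by (metis d_flip d_swap insertCI)
          then show False using e f by (metis d_excl d_flip d_swap d_swap')
        qed
        then show "e \<in> cl (a, c)" using e by (auto simp: cl_def)
      qed
      have "c \<in> cl (a, c)" using c d_ne[of a c x c] by (auto simp: cl_def)
      moreover have "c \<notin> cl p" using d by (auto simp: cl_def ab)
      ultimately show "cl p \<noteq> cl (a, c)" by blast
    qed
    then have "card (cl p) < card (cl (a, c))"
      using assms(1) by (intro psubset_card_mono) (auto simp: cl_def)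
    then show False using p(2)[of "(a, c)"] aH c by force
  qed
  have ab': "a \<noteq> b"
  proof
    assume "a = b"
    obtain c where "c \<in> K" "c \<noteq> a" using assms(4)
      by (metis One_nat_def card_le_Suc0_iff_eq[OF assms(1)] aH(1) not_less_eq_eq numeral_2_eq_2)
    then show False using nD[of c] \<open>a = b\<close> d_deg[of a x c] aH assms by auto
  qed
  define A where "A = {c\<in>K. D a c x b}"
  define B where "B = {c\<in>K. D b c x a}"
  have KH: "c \<in> K \<Longrightarrow> c \<in> H \<and> c \<noteq> x" for c using assms by auto
  have aA: "a \<in> A" "b \<in> B" using aH ab' d_deg[of a x b] d_deg[of b x a] KH assms(2) by (auto simp: A_def B_def)
  have disj: "A \<inter> B = {}"
    using d_excl[OF d_swap'[OF d_swap]] d_swap[OF d_swap'] unfolding A_def B_def by blast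
  have un: "A \<union> B = K"
  proof -
    have "c \<in> A \<or> c \<in> B" if c: "c \<in> K" for c
    proof (cases "c = a \<or> c = b")
      case False
      have "D a b x c \<or> D a x b c \<or> D a c b x"
        using d_cub[of a b x c] False KH[OF c] KH[OF aH(1)] KH[OF aH(2)] ab' assms(2) by blast
      then show ?thesis using nD[OF c] c d_swap'[of a c b x] d_swap'[OF d_flip[of a x b c]] unfolding A_def B_def by blast
    qed (use aA in auto)
    then show ?thesis unfolding A_def B_def by auto
  qed
  \<comment> \<open>Stated for arbitrary \<open>a\<close> and \<open>b\<close>, because it is
    applied once in each order.\<close>
  have gen: "D c c' x e" if nD: "\<And>c. c \<in> K \<Longrightarrow> \<not> D a b x c" and
     c: "D a c x b" "c \<in> K" "D a c' x b" "c' \<in> K" and e: "D b e x a" "e \<in> K" for a b c c' e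
  proof -
    have 0: "D c c' x b" using c by (metis d_flip d_swap d_trans d_swap')
    have "D e x c c' \<or> D b x c e" using d_tr[OF d_flip[OF d_swap'[OF 0]], of e] KH[OF e(2)] by blast
    moreover have "\<not> D b x c e"
    proof
      assume h: "D b x c e"
      have "D c b x a \<or> D e b x c" using d_tr[OF d_swap[OF e(1)], of c] KH[OF c(2)] by blast
      moreover have "\<not> D c b x a" using d_excl[OF d_swap'[OF d_swap[OF c(1)]]] d_swap' by blast
      moreover have "\<not> D e b x c" using d_excl[OF d_swap'[OF h]] d_swap by blast
      ultimately show False by blast
    qed
    ultimately show ?thesis by (metis d_flip d_swap d_swap')
  qed
  have "edge_at D K x A B"
    unfolding edge_at_def
  proof (intro conjI ballI)
    show "A \<noteq> {}" "B \<noteq> {}" using aA by auto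
    show "D c c' x e" if "c \<in> A" "c' \<in> A" "e \<in> B" for c c' e
      using that gen[of a b c c' e] nD unfolding A_def B_def by blast
    show "D c c' x e" if "c \<in> B" "c' \<in> B" "e \<in> A" for c c' e
      using that gen[of b a c c' e] nD d_swap unfolding A_def B_def by blast
  qed (fact disj un)+
  then show ?thesis using that by blast
qed

end

section \<open>Attaching a new point to an edge\<close>

text \<open>
  The splits of the tree obtained from attaching \<open>p\<close> to the edge \<open>A | B\<close>; two geodesics are disjoint
  iff some split separates them.
\<close>

definition ext_split ::
  "'a set \<Rightarrow> ('a \<Rightarrow> 'a \<Rightarrow> 'a \<Rightarrow> 'a \<Rightarrow> bool) \<Rightarrow> 'a set \<Rightarrow> 'a set \<Rightarrow> 'a \<Rightarrow> 'a set \<Rightarrow> 'a set \<Rightarrow> bool" where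
  "ext_split H D A B p S T \<longleftrightarrow> S \<union> T = insert p H \<and> S \<inter> T = {} \<and>
     (S = {p} \<or> T = {p} \<or> split H D (S - {p}) (T - {p}) \<and>
        (p \<in> S \<longrightarrow> A \<subseteq> S \<or> B \<subseteq> S) \<and> (p \<in> T \<longrightarrow> A \<subseteq> T \<or> B \<subseteq> T))"

definition ext_rel ::
  "'a set \<Rightarrow> ('a \<Rightarrow> 'a \<Rightarrow> 'a \<Rightarrow> 'a \<Rightarrow> bool) \<Rightarrow> 'a set \<Rightarrow> 'a set \<Rightarrow> 'a \<Rightarrow> 'a \<Rightarrow> 'a \<Rightarrow> 'a \<Rightarrow> 'a \<Rightarrow> bool" where
  "ext_rel H D A B p w x y z \<longleftrightarrow>
     (\<exists>S T. ext_split H D A B p S T \<and> w \<in> S \<and> x \<in> S \<and> y \<in> T \<and> z \<in> T)"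

context
  fixes H :: "'a set" and D A B p
  assumes dH: "dstruct H D" and AB: "split H D A B" and p: "p \<notin> H"
begin

lemma ext_split_sym: "ext_split H D A B p S T \<Longrightarrow> ext_split H D A B p T S"
  unfolding ext_split_def using split_sym[OF dH] by blast

text \<open>If \<open>A\<close> or \<open>B\<close> lies in both \<open>S\<close> and
  \<open>S'\<close>, a point \<open>c\<close> of it stands in for \<open>p\<close>: points in the
  three other intersections would give two exclusive quartets of \<open>D\<close>. Otherwise
  \<open>S\<close> contains one side and \<open>S'\<close> the other, so \<open>T\<close> and
  \<open>T'\<close> lie in different sides.\<close>

lemma ext_splits_compatible:
  assumes "ext_split H D A B p S T" "ext_split H D A B p S' T'" "p \<in> S" "p \<in> S'"
  shows "S \<inter> T' = {} \<or> T \<inter> S' = {} \<or> T \<inter> T' = {}"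
proof (cases "S = {p} \<or> S' = {p}")
  case True
  then show ?thesis using assms unfolding ext_split_def by blast
next
  case False
  have pT: "p \<notin> T" "p \<notin> T'" using assms unfolding ext_split_def by blast+
  have s: "split H D (S - {p}) T" "split H D (S' - {p}) T'" "A \<subseteq> S \<or> B \<subseteq> S" "A \<subseteq> S' \<or> B \<subseteq> S'"
    using assms False pT unfolding ext_split_def by auto
  have un: "A \<union> B = H" "A \<inter> B = {}" "A \<noteq> {}" "B \<noteq> {}" using AB unfolding split_def by auto
  have *: ?thesis if C: "C \<subseteq> S" "C \<subseteq> S'" "C \<noteq> {}" "C \<subseteq> H" for C
  proof (rule ccontr)
    assume "\<not> ?thesis"
    then obtain q r s where q: "q \<in> S" "q \<in> T'" and r: "r \<in> T" "r \<in> S'" and s': "s \<in> T" "s \<in> T'" by blast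
    obtain c where c: "c \<in> C" using C by auto
    have "c \<noteq> p" "q \<noteq> p" "r \<noteq> p" using c C p q r pT by auto
    then have "c \<in> S - {p}" "q \<in> S - {p}" "c \<in> S' - {p}" "r \<in> S' - {p}" using c C q r by auto
    then have "D c q r s" "D c r q s" using s(1,2) q r s' unfolding split_def by simp_all
    then show False using d_excl[OF dH] by blast
  qed
  have "T \<inter> T' = {}" if "A \<subseteq> S \<and> B \<subseteq> S' \<or> B \<subseteq> S \<and> A \<subseteq> S'"
  proof -
    have "S \<union> T = insert p H \<and> S \<inter> T = {}" "S' \<union> T' = insert p H \<and> S' \<inter> T' = {}"
      using assms(1,2) unfolding ext_split_def by simp_all
    then have "T \<subseteq> H" "T' \<subseteq> H" "T \<inter> S = {}" "T' \<inter> S' = {}" using pT by blast+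
    then show ?thesis using that un by blast
  qed
  then show ?thesis using * un s by blast
qed

text \<open>Compatibility with \<open>A | B\<close> puts \<open>A\<close> or \<open>B\<close> inside
  one of the two parts, and \<open>p\<close> is added to that part.\<close>

lemma ext_split_lift:
  assumes "split H D S T"
  shows "\<exists>S' T'. ext_split H D A B p S' T' \<and> S \<subseteq> S' \<and> T \<subseteq> T'"
proof -
  have eq: "insert p S - {p} = S" "insert p T - {p} = T" "S - {p} = S" "T - {p} = T"
    using assms p unfolding split_def by auto
  have h: "S \<union> T = H" "S \<inter> T = {}" using assms unfolding split_def by auto
  consider "A \<subseteq> S \<or> B \<subseteq> S" | "A \<subseteq> T \<or> B \<subseteq> T" using splits_compatible[OF dH AB assms] by blast
  then show ?thesis
  proof cases
    case 1
    then have "ext_split H D A B p (insert p S) T" unfolding ext_split_def eq using assms h p by auto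
    then show ?thesis by blast
  next
    case 2
    then have "ext_split H D A B p S (insert p T)" unfolding ext_split_def eq using assms h p by auto
    then show ?thesis by blast
  qed
qed

lemma ext_rel_iff:
  assumes "w \<in> H" "x \<in> H" "y \<in> H" "z \<in> H"
  shows "ext_rel H D A B p w x y z \<longleftrightarrow> D w x y z"
proof
  assume "ext_rel H D A B p w x y z"
  then obtain S T where "ext_split H D A B p S T" "w \<in> S" "x \<in> S" "y \<in> T" "z \<in> T"
    unfolding ext_rel_def by blast
  then have "split H D (S - {p}) (T - {p})" "w \<in> S - {p}" "x \<in> S - {p}" "y \<in> T - {p}" "z \<in> T - {p}"
    using assms p unfolding ext_split_def by auto
  then show "D w x y z" unfolding split_def by blast
next
  assume "D w x y z"
  then obtain S T where "split H D S T" "w \<in> S" "x \<in> S" "y \<in> T" "z \<in> T" using d_split_exists[OF dH] by metis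
  moreover from this(1) obtain S' T' where "ext_split H D A B p S' T'" "S \<subseteq> S'" "T \<subseteq> T'"
    using ext_split_lift by blast
  ultimately show "ext_rel H D A B p w x y z" unfolding ext_rel_def by blast
qed

text \<open>The two halves of the subdivided edge, \<open>A | insert p B\<close> and
  \<open>B | insert p A\<close>, provide the required separations.\<close>

lemma edge_at_ext_rel: "edge_at (ext_rel H D A B p) H p A B"
proof -
  have un: "A \<union> B = H" "A \<inter> B = {}" "A \<noteq> {}" "B \<noteq> {}" "p \<notin> A" "p \<notin> B" using AB p unfolding split_def by auto
  have "insert p A - {p} = A" "insert p B - {p} = B" "A - {p} = A" "B - {p} = B" using un by auto
  then have "ext_split H D A B p A (insert p B)" "ext_split H D A B p B (insert p A)"
    unfolding ext_split_def using un AB split_sym[OF dH AB] by auto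
  then show ?thesis unfolding edge_at_def ext_rel_def using un by blast
qed

text \<open>A split \<open>S | T\<close> separating \<open>a b\<close> from \<open>c d\<close>
  divides \<open>A\<close> and has \<open>d\<close> in \<open>T\<close>. By compatibility all of
  \<open>B\<close> lies in \<open>T\<close>, where \<open>p\<close> may join.\<close>

lemma ext_rel_cub1:
  assumes "a \<in> A" "b \<in> A" "c \<in> A" "d \<in> B" "D a b c d"
  shows "ext_rel H D A B p a b p c"
proof -
  obtain S T where S: "split H D S T" "a \<in> S" "b \<in> S" "c \<in> T" "d \<in> T" using d_split_exists[OF dH assms(5)] by metis
  have "B \<subseteq> T" using splits_compatible[OF dH AB S(1)] assms S unfolding split_def by blast
  moreover have "S - {p} = S" "insert p T - {p} = T" using S p unfolding split_def by auto
  ultimately have "ext_split H D A B p S (insert p T)" unfolding ext_split_def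
    using S p unfolding split_def by auto
  then show ?thesis using S unfolding ext_rel_def by blast
qed

lemma ext_rel_swapAB: "ext_rel H D A B p = ext_rel H D B A p"
  unfolding ext_rel_def ext_split_def by (auto simp: fun_eq_iff)

end

text \<open>For \<open>c\<close> across the edge, the edge itself separates. For \<open>c\<close> on
  the same side, any \<open>d\<close> beyond the edge plays the role of \<open>p\<close>: the
  quartet on \<open>a\<close>, \<open>b\<close>, \<open>c\<close>, \<open>d\<close> is resolved by
  \<open>D\<close>, and \<open>ext_rel_cub1\<close> replaces \<open>d\<close> by
  \<open>p\<close>.\<close>

lemma ext_rel_cub2:
  assumes dH: "dstruct H D" and AB: "split H D A B" and p: "p \<notin> H"
    and "a \<in> A" "b \<in> A" "c \<in> H" "distinct [a, b, c]"
  shows "ext_rel H D A B p a b p c \<or> ext_rel H D A B p a c p b \<or> ext_rel H D A B p b c p a"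
proof (cases "c \<in> B")
  case True
  then show ?thesis using edge_at_ext_rel[OF dH AB p] assms unfolding edge_at_def by blast
next
  case False
  obtain d where d: "d \<in> B" using AB unfolding split_def by auto
  have c: "c \<in> A" using False assms unfolding split_def by auto
  have "a \<in> H" "b \<in> H" "d \<in> H" "a \<noteq> d" "b \<noteq> d" "c \<noteq> d" "a \<noteq> b" "a \<noteq> c" "b \<noteq> c"
    using assms c d unfolding split_def by auto
  then have "D a b c d \<or> D a c b d \<or> D b c a d"
    using d_cub[OF dH, of a b c d] d_flip[OF dH, of a d b c] \<open>c \<in> H\<close> by blast
  then show ?thesis using ext_rel_cub1[OF dH AB p \<open>a \<in> A\<close> \<open>b \<in> A\<close> c d] ext_rel_cub1[OF dH AB p \<open>a \<in> A\<close> c \<open>b \<in> A\<close> d]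
     ext_rel_cub1[OF dH AB p \<open>b \<in> A\<close> c \<open>a \<in> A\<close> d] by blast
qed

text \<open>The axioms become statements about splits: exclusion is the compatibility of two splits,
  and transitivity the fact that \<open>u\<close> lies in one of the two parts.\<close>

lemma dstruct_ext_rel:
  assumes dH: "dstruct H D" and AB: "split H D A B" and p: "p \<notin> H"
  shows "dstruct (insert p H) (ext_rel H D A B p)"
proof -
  let ?E = "ext_rel H D A B p" and ?s = "ext_split H D A B p"
  note comp = ext_splits_compatible[OF dH AB p] and sym = ext_split_sym[OF dH AB p]
  have un: "A \<union> B = H" "A \<inter> B = {}" "A \<noteq> {}" "B \<noteq> {}" using AB unfolding split_def by auto
  have sH: "S \<union> T = insert p H \<and> S \<inter> T = {}" if "?s S T" for S T using that unfolding ext_split_def by blast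
  have flip: "?E y z w x" if "?E w x y z" for w x y z using that sym unfolding ext_rel_def by blast
  have swap: "?E x w y z" if "?E w x y z" for w x y z using that unfolding ext_rel_def by blast
  have swap': "?E w x z y" if "?E w x y z" for w x y z using that unfolding ext_rel_def by blast
  have cub0: "?E a b p c \<or> ?E a c p b \<or> ?E b c p a" if h: "a \<in> H" "b \<in> H" "c \<in> H" "distinct [a, b, c]" for a b c
  proof -
    have *: "?E a b p c \<or> ?E a c p b \<or> ?E b c p a" if "a \<in> A \<and> b \<in> A \<or> a \<in> B \<and> b \<in> B" "c \<in> H" "distinct [a, b, c]" for a b c
    proof (cases "a \<in> A \<and> b \<in> A")
      case True
      then show ?thesis using ext_rel_cub2[OF dH AB p, of a b c] that by blast
    next
      case False
      then show ?thesis using ext_rel_cub2[OF dH split_sym[OF dH AB] p, of a b c] that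
        unfolding ext_rel_swapAB[OF dH AB p] by blast
    qed
    \<comment> \<open>Two of three points always lie on the same side of
      \<open>A | B\<close>.\<close>
    have "a \<in> A \<and> b \<in> A \<or> a \<in> B \<and> b \<in> B \<or> a \<in> A \<and> c \<in> A \<or> a \<in> B \<and> c \<in> B \<or> b \<in> A \<and> c \<in> A \<or> b \<in> B \<and> c \<in> B"
      using h un by blast
    moreover have "distinct [a, c, b]" "distinct [b, c, a]" using h by auto
    ultimately show ?thesis using *[of a b c] *[of a c b] *[of b c a] h swap by blast
  qed
  show ?thesis unfolding dstruct_def
  proof (intro conjI allI impI ballI)
    fix w x y z assume e: "?E w x y z"
    show "w \<in> insert p H" "x \<in> insert p H" "y \<in> insert p H" "z \<in> insert p H"
      using e sH unfolding ext_rel_def by blast+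
    show "?E x w y z" "?E y z w x" using swap[OF e] flip[OF e] by simp_all
    show "\<not> ?E w y x z"
    proof
      assume "?E w y x z"
      then obtain S T S' T' where s: "?s S T" "?s S' T'" and "w \<in> S" "x \<in> S" "y \<in> T" "z \<in> T"
        "w \<in> S'" "y \<in> S'" "x \<in> T'" "z \<in> T'" using e unfolding ext_rel_def by blast
      then have ne: "S \<inter> S' \<noteq> {}" "S \<inter> T' \<noteq> {}" "T \<inter> S' \<noteq> {}" "T \<inter> T' \<noteq> {}" by blast+
      \<comment> \<open>Exchanging parts where necessary puts \<open>p\<close> into the first part
        of both splits, as the compatibility lemma demands.\<close>
      have "p \<in> S \<and> p \<in> S' \<or> p \<in> S \<and> p \<in> T' \<or> p \<in> T \<and> p \<in> S' \<or> p \<in> T \<and> p \<in> T'"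
        using sH[OF s(1)] sH[OF s(2)] by blast
      then show False using comp[OF s] comp[OF s(1) sym[OF s(2)]] comp[OF sym[OF s(1)] s(2)]
        comp[OF sym[OF s(1)] sym[OF s(2)]] ne by blast
    qed
  next
    fix w x y z u assume e: "?E w x y z" "u \<in> insert p H"
    then obtain S T where s: "?s S T" "w \<in> S" "x \<in> S" "y \<in> T" "z \<in> T" unfolding ext_rel_def by blast
    then have "u \<in> S \<or> u \<in> T" using sH e by blast
    then show "?E u x y z \<or> ?E w x y u" using s unfolding ext_rel_def by blast
  next
    fix x y z assume h: "x \<in> insert p H" "y \<in> insert p H" "z \<in> insert p H" "x \<noteq> y" "x \<noteq> z"
    show "?E x x y z"
    proof (cases "x = p")
      case True
      then have "?s {p} H" using p unfolding ext_split_def by auto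
      then show ?thesis using True h unfolding ext_rel_def by blast
    next
      case False
      have eq: "{x} - {p} = {x}" "insert p (H - {x}) - {p} = H - {x}" using False p by auto
      have ne: "H - {x} \<noteq> {}" using un by auto
      have "split H D {x} (H - {x})" unfolding split_def using h False ne d_deg[OF dH] by auto
      moreover have "A \<subseteq> insert p (H - {x}) \<or> B \<subseteq> insert p (H - {x})" using un h by blast
      ultimately have "?s {x} (insert p (H - {x}))" unfolding ext_split_def eq using False h by auto
      then show ?thesis using h unfolding ext_rel_def by blast
    qed
  next
    fix w x y z assume h: "w \<in> insert p H" "x \<in> insert p H" "y \<in> insert p H" "z \<in> insert p H" "distinct [w, x, y, z]"
    show "?E w x y z \<or> ?E w y x z \<or> ?E w z x y"
    proof (cases "p \<in> {w, x, y, z}")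
      case False
      then show ?thesis using h d_cub[OF dH, of w x y z] ext_rel_iff[OF dH AB p] by auto
    next
      case True
      then consider "w = p" | "x = p" | "y = p" | "z = p" by auto
      then show ?thesis
      proof cases
        case 1
        then have "?E x y p z \<or> ?E x z p y \<or> ?E y z p x" using h by (intro cub0) auto
        then show ?thesis using 1 flip by blast
      next
        case 2
        then have "?E w y p z \<or> ?E w z p y \<or> ?E y z p w" using h by (intro cub0) auto
        then show ?thesis using 2 flip swap by blast
      next
        case 3
        then have "?E w x p z \<or> ?E w z p x \<or> ?E x z p w" using h by (intro cub0) auto
        then show ?thesis using 3 flip[of x z p w] swap[of p w x z] swap' by blast
      next
        case 4
        then have "?E w x p y \<or> ?E w y p x \<or> ?E x y p w" using h by (intro cub0) auto
        then show ?thesis using 4 flip[of x y p w] swap[of p w x y] swap' by blast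
      qed
    qed
  qed
qed

text \<open>With the same facts for the other side, these determine every \<open>D a b p c\<close>
  from the edge and the relation on \<open>H\<close>. The geodesic between opposite points passes
  through the place where \<open>p\<close> is attached, and for three points on one side any
  \<open>t\<close> across the edge can replace \<open>p\<close>.\<close>

lemma edge_at_det:
  assumes d: "dstruct (insert p H) D" and e: "edge_at D H p A B" and p: "p \<notin> H"
  shows "a \<in> A \<Longrightarrow> b \<in> B \<Longrightarrow> c \<in> H \<Longrightarrow> \<not> D a b p c"
    and "a \<in> A \<Longrightarrow> b \<in> A \<Longrightarrow> c \<in> B \<Longrightarrow> D a b p c"
    and "a \<in> A \<Longrightarrow> b \<in> A \<Longrightarrow> c \<in> A \<Longrightarrow> t \<in> B \<Longrightarrow> D a b p c \<longleftrightarrow> D a b c t"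
proof -
  have 2: "D a b p c" if "a \<in> A" "b \<in> A" "c \<in> B" for a b c using e that unfolding edge_at_def by blast
  have E2: "D a b p c" if "a \<in> B" "b \<in> B" "c \<in> A" for a b c using e that unfolding edge_at_def by blast
  show "D a b p c" if "a \<in> A" "b \<in> A" "c \<in> B" by (rule 2[OF that])
  show "\<not> D a b p c" if ab: "a \<in> A" "b \<in> B" "c \<in> H"
  proof
    assume h: "D a b p c"
    have "c \<in> A \<or> c \<in> B" using ab(3) e unfolding edge_at_def by blast
    then show False
    proof
      assume "c \<in> A" then have "D a c p b" using 2 ab by blast
      then show False using d_excl[OF d d_swap'[OF d h]] d_swap'[OF d] by blast
    next
      assume "c \<in> B" then have "D b c p a" using E2 ab by blast
      then show False using d_excl[OF d d_swap'[OF d d_swap[OF d h]]] d_swap'[OF d] by blast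
    qed
  qed
  show "D a b p c \<longleftrightarrow> D a b c t" if h: "a \<in> A" "b \<in> A" "c \<in> A" "t \<in> B"
    using 2[OF h(1,2,4)] d_trans[OF d] d_swap'[OF d] by blast
qed

text \<open>Degenerate quadruples are decided by the axioms and those within \<open>H\<close> by
  agreement. For the others symmetry moves \<open>p\<close> to the third place, where
  \<open>edge_at_det\<close> decides. Exchanging \<open>D\<close> and \<open>E\<close> gives the
  reverse inclusion.\<close>

lemma edge_at_extension_le:
  assumes d: "dstruct (insert p H) D" "dstruct (insert p H) E" and p: "p \<notin> H"
    and e: "edge_at D H p A B" "edge_at E H p A B"
    and agree: "\<And>w x y z. w \<in> H \<Longrightarrow> x \<in> H \<Longrightarrow> y \<in> H \<Longrightarrow> z \<in> H \<Longrightarrow> D w x y z \<longleftrightarrow> E w x y z"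
    and D: "D w x y z"
  shows "E w x y z"
proof -
  have un: "A \<union> B = H" "A \<noteq> {}" "B \<noteq> {}" using e unfolding edge_at_def by auto
  have 1: "E a b p c" if h: "D a b p c" for a b c
  proof (cases "a = p \<or> b = p \<or> c = p")
    case True
    then have "c = p" "a \<noteq> p" "b \<noteq> p" using d_ne[OF d(1) h] by auto
    then show ?thesis using d_in[OF d(1) h] d_deg[OF d(2), of p a b] d_flip[OF d(2)] by auto
  next
    case False
    have abc: "a \<in> H" "b \<in> H" "c \<in> H" using False d_in[OF d(1) h] by auto
    have *: "E a b p c" if e: "edge_at D H p A B" "edge_at E H p A B" and "a \<in> A" for A B
    proof -
      have un: "A \<union> B = H" "A \<noteq> {}" "B \<noteq> {}" using e unfolding edge_at_def by auto
      obtain t where t: "t \<in> B" using un by auto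
      have b: "b \<in> A" using edge_at_det(1)[OF d(1) e(1) p \<open>a \<in> A\<close>] h un abc by blast
      show ?thesis
      proof (cases "c \<in> A")
        case True
        then have "D a b c t" using edge_at_det(3)[OF d(1) e(1) p \<open>a \<in> A\<close> b] t h by blast
        then have "E a b c t" using agree abc t un by blast
        then show ?thesis using edge_at_det(3)[OF d(2) e(2) p \<open>a \<in> A\<close> b True t] by blast
      next
        case False
        then show ?thesis using edge_at_det(2)[OF d(2) e(2) p \<open>a \<in> A\<close> b] abc un by blast
      qed
    qed
    show ?thesis using *[OF e] *[OF edge_at_sym[OF e(1)] edge_at_sym[OF e(2)]] abc un by blast
  qed
  have 2: "E x x y z" if "D x x y z" for x y z using that d_ne[OF d(1) that] d_in[OF d(1) that] d_deg[OF d(2)] by blast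
  note ne = d_ne[OF d(1) D] and i = d_in[OF d(1) D]
  consider "w = x" | "y = z" | "w = p" | "x = p" | "y = p" | "z = p" | "w \<in> H" "x \<in> H" "y \<in> H" "z \<in> H"
    using i by blast
  then show ?thesis
  proof cases
    case 1 then show ?thesis using D 2 by blast
  next
    case 2 then show ?thesis using \<open>\<And>z y x. D x x y z \<Longrightarrow> E x x y z\<close> d_flip[OF d(1) D] d_flip[OF d(2)] by blast
  next
    case 3 then show ?thesis using 1 d_flip[OF d(1) D] d_flip[OF d(2)] by blast
  next
    case 4 then show ?thesis using 1 d_flip[OF d(1) d_swap[OF d(1) D]] d_flip[OF d(2)] d_swap[OF d(2)] by blast
  next
    case 5 then show ?thesis using 1 D by blast
  next
    case 6 then show ?thesis using 1 d_swap'[OF d(1) D] d_swap'[OF d(2)] by blast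
  next
    case 7 then show ?thesis using agree D by blast
  qed
qed

lemma edge_at_extension_unique:
  assumes "dstruct (insert p H) D" "dstruct (insert p H) E" and "p \<notin> H"
    and "edge_at D H p A B" "edge_at E H p A B"
    and "rel_restrict H D = rel_restrict H E"
  shows "D = E"
proof -
  have "D w x y z \<longleftrightarrow> E w x y z" if "w \<in> H" "x \<in> H" "y \<in> H" "z \<in> H" for w x y z
    using assms(6) that unfolding rel_restrict_def fun_eq_iff by blast
  then have "D w x y z \<longleftrightarrow> E w x y z" for w x y z
    using edge_at_extension_le[OF assms(1,2,3,4,5)] edge_at_extension_le[OF assms(2,1,3,5,4)] by blast
  then show ?thesis by (simp add: fun_eq_iff)
qed

section \<open>Structures with at most three points, and the lifting of splits\<close>

definition disjoint_rel :: "'a set \<Rightarrow> 'a \<Rightarrow> 'a \<Rightarrow> 'a \<Rightarrow> 'a \<Rightarrow> bool" where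
  "disjoint_rel H w x y z \<longleftrightarrow> {w, x, y, z} \<subseteq> H \<and> {w, x} \<inter> {y, z} = {}"

text \<open>Four distinct points do not fit into \<open>H\<close>, so exclusion, transitivity and
  the last axiom meet degenerate quadruples only.\<close>

lemma dstruct_disjoint_rel:
  assumes "finite H" "card H \<le> 3" shows "dstruct H (disjoint_rel H)"
  unfolding dstruct_def disjoint_rel_def
proof (intro conjI allI impI ballI)
  fix w x y z assume h: "w \<in> H" "x \<in> H" "y \<in> H" "z \<in> H" "distinct [w, x, y, z]"
  then have "card {w, x, y, z} \<le> card H" using assms by (intro card_mono) auto
  then have False using assms h by auto
  then show "{w, x, y, z} \<subseteq> H \<and> {w, x} \<inter> {y, z} = {} \<or> {w, y, x, z} \<subseteq> H \<and> {w, y} \<inter> {x, z} = {} \<or>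
    {w, z, x, y} \<subseteq> H \<and> {w, z} \<inter> {x, y} = {}" by blast
next
  fix w x y z assume h: "{w, x, y, z} \<subseteq> H \<and> {w, x} \<inter> {y, z} = {}"
  show "\<not> ({w, y, x, z} \<subseteq> H \<and> {w, y} \<inter> {x, z} = {})"
  proof
    assume "{w, y, x, z} \<subseteq> H \<and> {w, y} \<inter> {x, z} = {}"
    then have dis: "distinct [w, x, y, z]" using h by auto
    have "card {w, x, y, z} \<le> card H" using assms h by (intro card_mono) auto
    then show False using assms dis by auto
  qed
next
  fix w x y z u assume h: "{w, x, y, z} \<subseteq> H \<and> {w, x} \<inter> {y, z} = {}" "u \<in> H"
  have "u = y \<or> u = z \<or> u \<noteq> y \<and> u \<noteq> z" by auto
  moreover have "u = w \<or> u = x \<or> y = z \<or> w = x \<or> u = y \<or> u = z"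
  proof (rule ccontr)
    assume "\<not> ?thesis"
    then have dis: "distinct [w, x, y, z]" using h by auto
    have "card {w, x, y, z} \<le> card H" using assms h by (intro card_mono) auto
    then show False using assms dis by auto
  qed
  ultimately show "{u, x, y, z} \<subseteq> H \<and> {u, x} \<inter> {y, z} = {} \<or> {w, x, y, u} \<subseteq> H \<and> {w, x} \<inter> {y, u} = {}"
    using h by auto
qed auto

lemma dstruct_small:
  assumes d: "dstruct H D" and "finite H" "card H \<le> 3" shows "D = disjoint_rel H"
proof -
  have "D w x y z" if h: "disjoint_rel H w x y z" for w x y z
  proof -
    have "w = x \<or> y = z"
    proof (rule ccontr)
      assume "\<not> ?thesis"
      then have dis: "distinct [w, x, y, z]" using h unfolding disjoint_rel_def by auto
      have "card {w, x, y, z} \<le> card H" using assms h unfolding disjoint_rel_def by (intro card_mono) auto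
      then show False using assms dis by auto
    qed
    then show ?thesis using h d_deg[OF d] d_flip[OF d] unfolding disjoint_rel_def by auto
  qed
  moreover have "disjoint_rel H w x y z" if h: "D w x y z" for w x y z
    using d_in[OF d h] d_ne[OF d h] unfolding disjoint_rel_def by auto
  ultimately show ?thesis unfolding fun_eq_iff by blast
qed

lemma rel_restrict_disjoint_rel: "K \<subseteq> H \<Longrightarrow> rel_restrict K (disjoint_rel H) = disjoint_rel K"
  unfolding rel_restrict_def disjoint_rel_def by (auto simp: fun_eq_iff)

definition extensions ::
  "'a set \<Rightarrow> ('a \<Rightarrow> 'a \<Rightarrow> 'a \<Rightarrow> 'a \<Rightarrow> bool) \<Rightarrow> 'a \<Rightarrow> ('a \<Rightarrow> 'a \<Rightarrow> 'a \<Rightarrow> 'a \<Rightarrow> bool) set" where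
  "extensions H D p = {E. dstruct (insert p H) E \<and> rel_restrict H E = D}"

lemma extension_with_edge:
  assumes dH: "dstruct H D" and AB: "split H D A B" and p: "p \<notin> H"
  shows "\<exists>E\<in>extensions H D p. edge_at E H p A B"
proof
  show "edge_at (ext_rel H D A B p) H p A B" using edge_at_ext_rel[OF assms] .
  have "rel_restrict H (ext_rel H D A B p) w x y z \<longleftrightarrow> D w x y z" for w x y z
    unfolding rel_restrict_def using ext_rel_iff[OF assms, of w x y z] d_in[OF dH] by blast
  then show "ext_rel H D A B p \<in> extensions H D p"
    unfolding extensions_def using dstruct_ext_rel[OF assms] by (simp add: fun_eq_iff)
qed

text \<open>Compatibility with the edge of \<open>y\<close> puts one part of the split inside
  \<open>A0\<close> or \<open>B0\<close>. Then \<open>y\<close> joins the other part, next to a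
  point \<open>t\<close> from beyond its own edge.\<close>

lemma split_lift:
  assumes d: "dstruct (insert y H) D" and y: "y \<notin> H" and e: "edge_at D H y A0 B0" and s: "split H D A B"
  shows "split (insert y H) D (insert y A) B \<or> split (insert y H) D A (insert y B)"
proof -
  have lift: "split (insert y H) D A (insert y B)" if s: "split H D A B" and e: "edge_at D H y A0 B0" and "A \<subseteq> A0" for A B A0 B0
  proof -
    have un: "A \<union> B = H" "A \<inter> B = {}" "A \<noteq> {}" "B \<noteq> {}" "A0 \<union> B0 = H" "A0 \<inter> B0 = {}" "B0 \<noteq> {}"
      using s e unfolding split_def edge_at_def by auto
    obtain t where t: "t \<in> B0" using un by auto
    have tB: "t \<in> B" using un t \<open>A \<subseteq> A0\<close> by blast
    have 0: "D a a' y b" if "a \<in> A" "a' \<in> A" "b \<in> B" for a a' b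
    proof -
      have "D a a' t y" using e that t \<open>A \<subseteq> A0\<close> d_swap'[OF d] unfolding edge_at_def by blast
      moreover have "D a a' t b" using s that tB unfolding split_def by blast
      ultimately show ?thesis using d_trans[OF d] by blast
    qed
    have "D a a' b b'" if h: "a \<in> A" "a' \<in> A" "b \<in> insert y B" "b' \<in> insert y B" for a a' b b'
    proof -
      have "D a a' y y" using 0[OF h(1,2) tB] d_trans[OF d] d_swap'[OF d] by blast
      then show ?thesis using h 0[OF h(1,2)] d_swap'[OF d] s unfolding split_def by blast
    qed
    then show ?thesis unfolding split_def using un y by auto
  qed
  have fl: "split (insert y H) D (insert y B) A" if "split (insert y H) D A (insert y B)" for A B using split_sym[OF d that] .
  have dH: "split H D B A" using s unfolding split_def using d_flip[OF d] by (metis Int_commute Un_commute)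
  have s0: "split H D A0 B0" using split_edge_at[OF d e] .
  have "A \<subseteq> A0 \<or> A \<subseteq> B0 \<or> B \<subseteq> A0 \<or> B \<subseteq> B0"
  proof (rule ccontr)
    assume "\<not> ?thesis"
    moreover have "A \<union> B = A0 \<union> B0" using s s0 unfolding split_def by auto
    ultimately obtain p q r s' where "p \<in> A" "p \<in> A0" "q \<in> A" "q \<in> B0" "r \<in> B" "r \<in> A0" "s' \<in> B" "s' \<in> B0" by blast
    then have "D p q r s'" "D p r q s'" using s s0 unfolding split_def by auto
    then show False using d_excl[OF d] by blast
  qed
  then consider "A \<subseteq> A0" | "A \<subseteq> B0" | "B \<subseteq> A0" | "B \<subseteq> B0" by blast
  then show ?thesis
  proof cases
    case 1 then show ?thesis using lift[OF s e] by blast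
  next
    case 2 then show ?thesis using lift[OF s edge_at_sym[OF e]] by blast
  next
    case 3 then show ?thesis using fl[OF lift[OF dH e]] by blast
  next
    case 4 then show ?thesis using fl[OF lift[OF dH edge_at_sym[OF e]]] by blast
  qed
qed

text \<open>Used in contraposition: unless \<open>y\<close> sits on the edge \<open>A | B\<close>
  itself, it cannot be placed on either side of that split at will.\<close>

lemma edge_at_if_split_both:
  assumes d: "dstruct (insert y H) D" and "y \<notin> H"
    and "split (insert y H) D (insert y A) B" "split (insert y H) D A (insert y B)"
  shows "edge_at D H y A B"
  unfolding edge_at_def
proof (intro conjI ballI)
  note u = assms(3,4)[unfolded split_def]
  have dis: "insert y A \<inter> B = {}" "A \<inter> insert y B = {}" "insert y A \<union> B = insert y H"
    using u by blast+
  show "A \<noteq> {}" "B \<noteq> {}" using u by blast+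
  show "A \<inter> B = {}" using dis by blast
  have "y \<notin> A" "y \<notin> B" using dis by blast+
  then show "A \<union> B = H" using dis assms(2) by (metis Un_insert_left insert_ident Un_iff)
  show "D a a' y b" if "a \<in> A" "a' \<in> A" "b \<in> B" for a a' b
    using assms(4) that unfolding split_def by simp
  show "D b b' y a" if "b \<in> B" "b' \<in> B" "a \<in> A" for a b b'
    using assms(3) that d_flip[OF d, of y a b b'] unfolding split_def by simp
qed

section \<open>Pairs of one-point extensions\<close>

text \<open>The amalgamations of the extensions by \<open>y\<close> and by \<open>x\<close> in which
  the two new points remain distinct.\<close>

definition fibre ::
  "'a set \<Rightarrow> 'a \<Rightarrow> 'a \<Rightarrow> ('a \<Rightarrow> 'a \<Rightarrow> 'a \<Rightarrow> 'a \<Rightarrow> bool) \<Rightarrow> ('a \<Rightarrow> 'a \<Rightarrow> 'a \<Rightarrow> 'a \<Rightarrow> bool) \<Rightarrow>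
   ('a \<Rightarrow> 'a \<Rightarrow> 'a \<Rightarrow> 'a \<Rightarrow> bool) set" where
  "fibre H x y D D' = {E \<in> extensions (insert y H) D x. rel_restrict (insert x H) E = D'}"

text \<open>The condition for identifying \<open>x\<close> with \<open>y\<close> in an amalgamation:
  both are attached to \<open>H\<close> in the same way.\<close>

definition same_type ::
  "'a set \<Rightarrow> ('a \<Rightarrow> 'a \<Rightarrow> 'a \<Rightarrow> 'a \<Rightarrow> bool) \<Rightarrow> 'a \<Rightarrow> ('a \<Rightarrow> 'a \<Rightarrow> 'a \<Rightarrow> 'a \<Rightarrow> bool) \<Rightarrow> 'a \<Rightarrow> bool" where
  "same_type H D y D' x \<longleftrightarrow> (\<forall>a\<in>H. \<forall>b\<in>H. \<forall>c\<in>H. D a b y c \<longleftrightarrow> D' a b x c)"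

text \<open>The edge at which \<open>x\<close> sits is the pendant edge of \<open>a\<close>; in
  other words, \<open>x\<close> and \<open>a\<close> form a cherry.\<close>

definition leaf_at :: "'a set \<Rightarrow> ('a \<Rightarrow> 'a \<Rightarrow> 'a \<Rightarrow> 'a \<Rightarrow> bool) \<Rightarrow> 'a \<Rightarrow> bool" where
  "leaf_at H D x \<longleftrightarrow> (\<exists>a\<in>H. \<forall>b\<in>H - {a}. \<forall>b'\<in>H - {a}. D a x b b')"

text \<open>
  Let \<open>v\<close> be the value of an inner edge. Adding two points at the same edge over three points, the
  second one may coincide with the first or use two pendant edges or one inner edge, so
  \<open>c = 1 + 2 * c + v\<close>. The three small cases follow from \<open>c\<close> in the same way.
\<close>

definition point_value ::
  "'r::comm_ring_1 \<Rightarrow> 'a set \<Rightarrow> ('a \<Rightarrow> 'a \<Rightarrow> 'a \<Rightarrow> 'a \<Rightarrow> bool) \<Rightarrow> 'a \<Rightarrow> 'r" where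
  "point_value c H D x =
     (if card H = 0 then 3 + 3 * c else if card H = 1 then 2 + 3 * c else if card H = 2 then 1 + 3 * c
      else if leaf_at H D x then c else - 1 - c)"

lemma edge_at_parts:
  assumes "edge_at D H x A B"
  shows "A \<noteq> {}" "B \<noteq> {}" "A \<inter> B = {}" "A \<union> B = H" "A \<subseteq> H" "B \<subseteq> H"
proof -
  show *: "A \<noteq> {}" "B \<noteq> {}" "A \<inter> B = {}" "A \<union> B = H" using assms unfolding edge_at_def by simp_all
  show "A \<subseteq> H" "B \<subseteq> H" using *(4) by blast+
qed

lemma edge_at_side:
  assumes "edge_at D H x A B" "y \<in> H"
  obtains P Q where "edge_at D H x P Q" "y \<in> P"
  using assms edge_at_sym[OF assms(1)] edge_at_parts(4)[OF assms(1)] by blast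

lemma edge_at_cong:
  assumes "\<And>a b c. a \<in> H \<Longrightarrow> b \<in> H \<Longrightarrow> c \<in> H \<Longrightarrow> D a b x c \<longleftrightarrow> E a b y c"
  shows "edge_at D H x A B \<longleftrightarrow> edge_at E H y A B"
proof (cases "A \<union> B = H")
  case True
  then have "a \<in> A \<Longrightarrow> a \<in> H" "a \<in> B \<Longrightarrow> a \<in> H" for a by blast+
  then show ?thesis unfolding edge_at_def using assms by simp
next
  case False
  then show ?thesis unfolding edge_at_def by simp
qed

lemma edge_at_rel_restrict:
  assumes "insert x H \<subseteq> K" shows "edge_at (rel_restrict K E) H x A B \<longleftrightarrow> edge_at E H x A B"
  by (rule edge_at_cong) (use assms in \<open>auto simp: rel_restrict_def\<close>)

lemma edge_at_subset:
  assumes "edge_at E K x P Q" "H \<subseteq> K" "P \<inter> H \<noteq> {}" "Q \<inter> H \<noteq> {}"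
  shows "edge_at E H x (P \<inter> H) (Q \<inter> H)"
proof -
  have "P \<inter> H \<union> Q \<inter> H = H" "P \<inter> H \<inter> (Q \<inter> H) = {}" using assms by (auto dest: edge_at_parts)
  then show ?thesis using assms unfolding edge_at_def by simp
qed

text \<open>The edge \<open>{y} | H\<close> means that \<open>x\<close> and \<open>y\<close> hang on
  a common vertex, so \<open>d_trans\<close> exchanges them.\<close>

lemma twin_type:
  assumes d: "dstruct K E" and e: "edge_at E (insert y H) x {y} H" and h: "a \<in> H" "b \<in> H" "c \<in> H"
  shows "E a b x c \<longleftrightarrow> E a b y c"
proof -
  have "E a b x y" using e h unfolding edge_at_def by blast
  then show ?thesis using d_trans[OF d] d_swap'[OF d] by blast
qed

lemma twin_swap:
  assumes d: "dstruct K E" and e: "edge_at E (insert y H) x {y} H" and "insert x (insert y H) \<subseteq> K" "x \<notin> insert y H"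
  shows "edge_at E (insert x H) y {x} H"
proof -
  have 1: "\<forall>b\<in>H. \<forall>b'\<in>H. E b b' x y" using e unfolding edge_at_def by simp
  have ne: "H \<noteq> {}" "y \<notin> H" using edge_at_parts[OF e] by auto
  have "E x x y b" if "b \<in> H" for b using d_deg[OF d, of x y b] assms that by auto
  then show ?thesis unfolding edge_at_def using 1 ne assms d_swap'[OF d] by simp
qed

text \<open>A witness \<open>a\<close> for \<open>leaf_at\<close> makes \<open>{a} | H - {a}\<close>
  an edge for \<open>x\<close>, and uniqueness of the edge identifies it with
  \<open>A | B\<close>.\<close>

lemma leaf_at_iff:
  assumes d: "dstruct (insert x H) D" and e: "edge_at D H x A B" and x: "x \<notin> H"
    and fin: "finite H" "3 \<le> card H"
  shows "leaf_at H D x \<longleftrightarrow> is_singleton A \<or> is_singleton B"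
proof -
  have *: "leaf_at H D x" if "edge_at D H x A B" "is_singleton A" for A B
  proof -
    obtain a where a: "A = {a}" using \<open>is_singleton A\<close> by (auto simp: is_singleton_def)
    then have B: "B = H - {a}" "a \<in> H" using that(1) by (auto dest: edge_at_parts)
    have "D b b' a x" if "b \<in> B" "b' \<in> B" for b b'
      using that \<open>edge_at D H x A B\<close> a d_swap'[OF d] unfolding edge_at_def by blast
    then show ?thesis unfolding leaf_at_def using B d_flip[OF d] by blast
  qed
  show ?thesis
  proof
    assume "leaf_at H D x"
    then obtain a where a: "a \<in> H" "\<And>b b'. b \<in> H - {a} \<Longrightarrow> b' \<in> H - {a} \<Longrightarrow> D a x b b'"
      unfolding leaf_at_def by blast
    have "H - {a} \<noteq> {}"
    proof
      assume "H - {a} = {}"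
      then have "card H \<le> card {a}" by (intro card_mono) auto
      then show False using fin(2) by simp
    qed
    moreover have "D a a x b" if "b \<in> H - {a}" for b using d_deg[OF d, of a x b] a that x by auto
    moreover have "D b b' x a" if "b \<in> H - {a}" "b' \<in> H - {a}" for b b'
      using a(2)[OF that] d_flip[OF d] d_swap[OF d] by blast
    ultimately have "edge_at D H x {a} (H - {a})" unfolding edge_at_def using a by auto
    then have "A = {a} \<or> B = {a}" using edge_at_unique[OF d e] by blast
    then show "is_singleton A \<or> is_singleton B" by (auto simp: is_singleton_def)
  next
    assume "is_singleton A \<or> is_singleton B"
    then show "leaf_at H D x" using *[OF e] *[OF edge_at_sym[OF e]] by blast
  qed
qed

lemma point_value_edge:
  assumes "dstruct (insert x H) D" "edge_at D H x A B" "x \<notin> H" "finite H" "3 \<le> card H"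
  shows "point_value c H D x = (if is_singleton A \<or> is_singleton B then c else - 1 - c)"
  using leaf_at_iff[OF assms] assms(5) unfolding point_value_def by auto

lemma point_value_cong:
  assumes "\<And>a b c. a \<in> H \<Longrightarrow> b \<in> H \<Longrightarrow> c \<in> H \<Longrightarrow> D a x b c \<longleftrightarrow> E a y b c"
  shows "point_value c H D x = point_value c H E y"
proof -
  have "leaf_at H D x \<longleftrightarrow> leaf_at H E y" unfolding leaf_at_def using assms by simp
  then show ?thesis unfolding point_value_def by simp
qed

lemma point_value_type_cong:
  assumes d: "dstruct K D" "dstruct K' E"
    and *: "\<And>a b c. a \<in> H \<Longrightarrow> b \<in> H \<Longrightarrow> c \<in> H \<Longrightarrow> D a b x c \<longleftrightarrow> E a b y c"
  shows "point_value c H D x = point_value c H E y"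
proof (rule point_value_cong)
  fix a b c assume "a \<in> H" "b \<in> H" "c \<in> H"
  then have "D b c x a \<longleftrightarrow> E b c y a" using * by blast
  then show "D a x b c \<longleftrightarrow> E a y b c"
    using d_flip[OF d(1)] d_swap[OF d(1)] d_flip[OF d(2)] d_swap[OF d(2)] d_swap'[OF d(1)] d_swap'[OF d(2)] by blast
qed

text \<open>A tree with two or three leaves has pendant edges only.\<close>

lemma edge_at_singleton_side:
  assumes "edge_at D H x A B" "finite H" "card H = 2 \<or> card H = 3"
  shows "is_singleton A \<or> is_singleton B"
proof -
  have AB: "A \<union> B = H" "A \<inter> B = {}" "A \<noteq> {}" "B \<noteq> {}" using assms unfolding edge_at_def by auto
  then have f: "finite A" "finite B" using assms(2) by auto
  then have "card A + card B = card H" using AB by (metis card_Un_disjoint)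
  moreover have "card A \<noteq> 0" "card B \<noteq> 0" using f AB by auto
  ultimately have "card A = 1 \<or> card B = 1" using assms(3) by presburger
  then show ?thesis by (simp add: is_singleton_altdef)
qed

lemma not_both_singleton:
  assumes "edge_at D H x A B" "finite H" "3 \<le> card H" "is_singleton A"
  shows "\<not> is_singleton B"
proof
  assume "is_singleton B"
  then have "card A = 1" "card B = 1" using assms by (auto simp: is_singleton_altdef)
  then have "card (A \<union> B) \<le> 2" using card_Un_le[of A B] by simp
  then show False using assms unfolding edge_at_def by auto
qed

lemma is_singleton_insert: "is_singleton (insert y A) \<longleftrightarrow> A \<subseteq> {y}"
  by (auto simp: is_singleton_def)

section \<open>Amalgamating two one-point extensions\<close>

locale two_extensions =
  fixes H :: "'a set" and x y D D'
  assumes fin: "finite H" and x: "x \<notin> H" and y: "y \<notin> H" and xy: "x \<noteq> y"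
    and dD: "dstruct (insert y H) D" and dD': "dstruct (insert x H) D'"
    and agree: "rel_restrict H D = rel_restrict H D'"
begin

lemma agree': "a \<in> H \<Longrightarrow> b \<in> H \<Longrightarrow> c \<in> H \<Longrightarrow> e \<in> H \<Longrightarrow> D a b c e \<longleftrightarrow> D' a b c e"
  using agree unfolding rel_restrict_def fun_eq_iff by blast

lemma same_type_edge: "same_type H D y D' x \<Longrightarrow> edge_at D H y A B \<longleftrightarrow> edge_at D' H x A B"
  by (rule edge_at_cong) (simp add: same_type_def)

text \<open>\<open>edge_at_det\<close> computes both types from the edge and the relation on
  \<open>H\<close>, where \<open>D\<close> and \<open>D'\<close> agree.\<close>

lemma same_typeI:
  assumes e: "edge_at D H y A B" "edge_at D' H x A B"
  shows "same_type H D y D' x"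
  unfolding same_type_def
proof (intro ballI)
  fix a b c assume h: "a \<in> H" "b \<in> H" "c \<in> H"
  have *: "D a b y c \<longleftrightarrow> D' a b x c" if e: "edge_at D H y A B" "edge_at D' H x A B" and a: "a \<in> A" for A B
  proof -
    have un: "A \<union> B = H" "B \<noteq> {}" using e unfolding edge_at_def by auto
    then obtain t where t: "t \<in> B" by blast
    note 1 = edge_at_det[OF dD e(1) y] and 2 = edge_at_det[OF dD' e(2) x]
    have "t \<in> H" using t un by blast
    consider "b \<in> B" | "b \<in> A" "c \<in> B" | "b \<in> A" "c \<in> A" using h un by blast
    then show ?thesis
    proof cases
      case 1 then show ?thesis using edge_at_det(1)[OF dD e(1) y a 1 h(3)] edge_at_det(1)[OF dD' e(2) x a 1 h(3)] by blast
    next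
      case 2 then show ?thesis using edge_at_det(2)[OF dD e(1) y a 2] edge_at_det(2)[OF dD' e(2) x a 2] by blast
    next
      case 3 then show ?thesis using edge_at_det(3)[OF dD e(1) y a 3 t] edge_at_det(3)[OF dD' e(2) x a 3 t]
          agree'[OF h \<open>t \<in> H\<close>] by blast
    qed
  qed
  have "a \<in> A \<or> a \<in> B" using h e unfolding edge_at_def by blast
  then show "D a b y c \<longleftrightarrow> D' a b x c"
    using *[OF e] *[OF edge_at_sym[OF e(1)] edge_at_sym[OF e(2)]] by blast
qed

context
  assumes card: "2 \<le> card H"
begin

lemma ex_edge: "\<exists>A B. edge_at D' H x A B"
  using edge_at_exists[OF dD' fin refl x card] by blast

lemma ext_facts:
  assumes "E \<in> extensions (insert y H) D x"
  shows "dstruct (insert x (insert y H)) E" "rel_restrict (insert y H) E = D"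
    and "\<And>a b c e. a \<in> insert y H \<Longrightarrow> b \<in> insert y H \<Longrightarrow> c \<in> insert y H \<Longrightarrow> e \<in> insert y H \<Longrightarrow> E a b c e \<longleftrightarrow> D a b c e"
  using assms unfolding extensions_def by (auto simp: rel_restrict_def)

lemma restrict_E:
  assumes E: "E \<in> extensions (insert y H) D x"
    and e: "edge_at E H x A B" "edge_at D' H x A B"
  shows "rel_restrict (insert x H) E = D'"
proof (rule edge_at_extension_unique)
  show "dstruct (insert x H) (rel_restrict (insert x H) E)"
    by (rule dstruct_restrict[OF ext_facts(1)[OF E]]) blast
  show "edge_at (rel_restrict (insert x H) E) H x A B" using e(1) edge_at_rel_restrict[of x H "insert x H" E] by simp
  have "rel_restrict H (rel_restrict (insert x H) E) = rel_restrict H D"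
    using ext_facts(3)[OF E] unfolding rel_restrict_def fun_eq_iff by auto
  then show "rel_restrict H (rel_restrict (insert x H) E) = rel_restrict H D'" using agree by simp
qed (use dD' x e in auto)

text \<open>On the pendant edge of \<open>y\<close> the new point copies the type of
  \<open>y\<close> over \<open>H\<close>, so the restriction is \<open>D'\<close> only if that type
  is the prescribed one.\<close>

lemma fibre_edge_twin:
  assumes E: "E \<in> extensions (insert y H) D x" and e: "edge_at E (insert y H) x {y} H"
  shows "E \<in> fibre H x y D D' \<longleftrightarrow> same_type H D y D' x"
proof -
  have t: "E a b x c \<longleftrightarrow> D a b y c" if "a \<in> H" "b \<in> H" "c \<in> H" for a b c
    using twin_type[OF ext_facts(1)[OF E] e that] ext_facts(3)[OF E, of a b y c] that by blast
  show ?thesis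
  proof
    assume "E \<in> fibre H x y D D'"
    then have "E a b x c \<longleftrightarrow> D' a b x c" if "a \<in> H" "b \<in> H" "c \<in> H" for a b c
      using that unfolding fibre_def rel_restrict_def by auto
    then show "same_type H D y D' x" unfolding same_type_def using t by blast
  next
    assume s: "same_type H D y D' x"
    obtain A B where AB: "edge_at D' H x A B" using ex_edge by blast
    have "edge_at E H x A B \<longleftrightarrow> edge_at D' H x A B"
      by (rule edge_at_cong) (use s t in \<open>simp add: same_type_def\<close>)
    then show "E \<in> fibre H x y D D'" using restrict_E[OF E] AB E unfolding fibre_def by blast
  qed
qed

lemma edge_at_drop:
  assumes "edge_at E (insert y H) x (insert y A) B" "A \<noteq> {}" "y \<notin> A"
  shows "edge_at E H x A B"
proof -
  note u = edge_at_parts(4,3,2)[OF assms(1)]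
  have "y \<notin> B" using u(2) by blast
  then have "a \<in> H" if "a \<in> A \<or> a \<in> B" for a
    using that u(1) assms(3) by (metis UnCI insertCI insertE)
  then have "A \<subseteq> H" "B \<subseteq> H" by blast+
  then have "insert y A \<inter> H = A" "B \<inter> H = B" using y by blast+
  then show ?thesis using edge_at_subset[OF assms(1), of H] assms(2) u by auto
qed

lemma fibre_edge:
  assumes E: "E \<in> extensions (insert y H) D x" and e: "edge_at E (insert y H) x (insert y A) B" and A: "A \<noteq> {}" "y \<notin> A"
  shows "E \<in> fibre H x y D D' \<longleftrightarrow> edge_at D' H x A B"
proof
  assume "E \<in> fibre H x y D D'"
  then have "D' = rel_restrict (insert x H) E" unfolding fibre_def by simp
  then show "edge_at D' H x A B" using edge_at_drop[OF e A] edge_at_rel_restrict[of x H "insert x H"] by simp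
next
  assume "edge_at D' H x A B"
  then show "E \<in> fibre H x y D D'" using restrict_E[OF E edge_at_drop[OF e A]] E unfolding fibre_def by simp
qed

text \<open>Forgetting \<open>y\<close> turns the edge of \<open>x\<close> into an edge of
  \<open>H\<close>. It collapses only if it is \<open>{y} | H\<close>, and then \<open>x\<close>
  inherits the type of \<open>y\<close>; otherwise it must become \<open>A | B\<close>, with
  \<open>y\<close> on one of the two sides.\<close>

lemma fibre_cases:
  assumes E: "E \<in> fibre H x y D D'" and AB: "edge_at D' H x A B"
  shows "edge_at E (insert y H) x {y} H \<and> same_type H D y D' x \<or>
    edge_at E (insert y H) x (insert y A) B \<or> edge_at E (insert y H) x (insert y B) A"
proof -
  have E': "E \<in> extensions (insert y H) D x" using E unfolding fibre_def by simp
  have "2 \<le> card (insert y H)" using card fin y by simp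
  then obtain P Q where PQ: "edge_at E (insert y H) x P Q" 
    using edge_at_exists[OF ext_facts(1)[OF E'], of "insert y H" x] fin x xy by auto
  then obtain P Q where PQ: "edge_at E (insert y H) x P Q" "y \<in> P"
    using edge_at_side[OF PQ insertI1] by blast
  note u = edge_at_parts(4,3)[OF PQ(1)]
  show ?thesis
  proof (cases "P = {y}")
    case True
    then have "y \<notin> Q" "insert y Q = insert y H" using u(1,2) by simp_all
then have "Q = H" using insert_ident y by metis
    then show ?thesis using fibre_edge_twin[OF E'] PQ True E by blast
  next
    case False
    define P' where "P' = P - {y}"
    have P: "P = insert y P'" "y \<notin> P'" "P' \<noteq> {}" using False PQ(2) unfolding P'_def by auto
    then have "edge_at D' H x P' Q" using fibre_edge[OF E', of P' Q] PQ E by simp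
    then have "P' = A \<and> Q = B \<or> P' = B \<and> Q = A" using edge_at_unique[OF dD' AB] by blast
    then show ?thesis using PQ P by blast
  qed
qed

lemma extension_with_edge_unique:
  assumes "E \<in> extensions (insert y H) D x" "E' \<in> extensions (insert y H) D x"
    "edge_at E (insert y H) x A B" "edge_at E' (insert y H) x A B"
  shows "E = E'"
  using edge_at_extension_unique[OF ext_facts(1)[OF assms(1)] ext_facts(1)[OF assms(2)] _ assms(3,4)]
    ext_facts(2)[OF assms(1)] ext_facts(2)[OF assms(2)] x xy by simp

lemma split_D: assumes "edge_at D' H x A B" shows "split H D A B"
proof -
  have "split H D' A B" using split_edge_at[OF dD' assms] .
  moreover have "A \<union> B = H" using assms unfolding edge_at_def by blast
  ultimately show ?thesis using agree' unfolding split_def by (metis UnCI)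
qed

text \<open>Some side of \<open>A | B\<close> takes \<open>y\<close>, and only one does, since
  otherwise \<open>y\<close> would sit on that edge and have the type of \<open>x\<close>. That
  side, named \<open>A\<close> here, is not a singleton \<open>{a}\<close>, because the pendant edge
  of \<open>a\<close> always admits \<open>y\<close> on the other side. Hence adding
  \<open>y\<close> does not change whether the edge of \<open>x\<close> is pendant.\<close>

lemma fibre_different:
  assumes ns: "\<not> same_type H D y D' x"
  obtains E A B where "fibre H x y D D' = {E}" "edge_at D' H x A B"
    "edge_at E (insert y H) x (insert y A) B" "\<not> is_singleton A"
proof -
  obtain A0 B0 where e0: "edge_at D H y A0 B0" using edge_at_exists[OF dD fin refl y card] by blast
  obtain A B where AB: "edge_at D' H x A B" using ex_edge by blast
  note result = that
  have main: thesis if AB: "edge_at D' H x A B" and s: "split (insert y H) D (insert y A) B" for A B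
  proof -
    have nAB: "y \<notin> A" "A \<noteq> {}" "y \<notin> B" "A \<subseteq> H" "B \<noteq> {}" using AB y by (auto dest: edge_at_parts)
    have u: "A \<union> B = H" "A \<inter> B = {}" using AB by (auto dest: edge_at_parts)
    have nb: "\<not> split (insert y H) D A (insert y B)"
      using edge_at_if_split_both[OF dD y s] same_typeI[OF _ AB] ns by blast
    obtain E where E: "E \<in> extensions (insert y H) D x" "edge_at E (insert y H) x (insert y A) B"
      using extension_with_edge[OF dD s, of x] x xy by auto
    have 1: "E \<in> fibre H x y D D'" using fibre_edge[OF E nAB(2,1)] AB by blast
    have 2: "E' = E" if E': "E' \<in> fibre H x y D D'" for E'
    proof -
      have ext: "E' \<in> extensions (insert y H) D x" using E' unfolding fibre_def by simp
      have "\<not> edge_at E' (insert y H) x (insert y B) A"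
      proof
        assume "edge_at E' (insert y H) x (insert y B) A"
        then have "split (insert y H) E' A (insert y B)" by (rule split_edge_at[OF ext_facts(1)[OF ext] edge_at_sym])
        then have "split (insert y H) D A (insert y B)" 
          using ext_facts(2)[OF ext] u nAB unfolding split_def rel_restrict_def by auto
        then show False using nb by simp
      qed
      then show ?thesis using fibre_cases[OF E' AB] ns extension_with_edge_unique[OF ext E(1) _ E(2)] by blast
    qed
    have "\<not> is_singleton A"
    proof
      assume "is_singleton A"
      then obtain a where a: "A = {a}" by (auto simp: is_singleton_def)
      have "split (insert y H) D A (insert y B)"
        unfolding split_def a using a nAB u d_deg[OF dD, of a] by auto
      then show False using nb by simp
    qed
    moreover have "fibre H x y D D' = {E}" using 1 2 by blast
    ultimately show thesis using result[OF _ AB E(2)] by blast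
  qed
  show thesis using split_lift[OF dD y e0 split_D[OF AB]] main[OF AB] main[OF edge_at_sym[OF AB]] split_sym[OF dD] by blast
qed

text \<open>Attaching \<open>y\<close> subdivides the edge \<open>A | B\<close>, and
  \<open>x\<close> may go to the pendant edge of \<open>y\<close> or to either half.\<close>

lemma fibre_same:
  assumes s: "same_type H D y D' x" and AB: "edge_at D' H x A B"
  obtains E1 E2 E3 where "fibre H x y D D' = {E1, E2, E3}" "distinct [E1, E2, E3]"
    "edge_at E1 (insert y H) x {y} H" "edge_at E2 (insert y H) x (insert y A) B"
    "edge_at E3 (insert y H) x (insert y B) A"
proof -
  have e: "edge_at D H y A B" using AB same_type_edge[OF s] by blast
  have nAB: "y \<notin> A" "A \<noteq> {}" "y \<notin> B" "A \<subseteq> H" "B \<noteq> {}" "H \<noteq> {}" using AB y by (auto dest: edge_at_parts)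
  have "D y y b b'" if "b \<in> H" "b' \<in> H" for b b' using d_deg[OF dD, of y b b'] that y by auto
  then have s1: "split (insert y H) D {y} H" unfolding split_def using nAB y by auto
  have s2: "split (insert y H) D (insert y A) B" "split (insert y H) D (insert y B) A"
    using edge_at_split1[OF dD e refl y] edge_at_split1[OF dD edge_at_sym[OF e] refl y] split_sym[OF dD] by blast+
  have x': "x \<notin> insert y H" using x xy by simp
  obtain E1 where E1: "E1 \<in> extensions (insert y H) D x" "edge_at E1 (insert y H) x {y} H"
    using extension_with_edge[OF dD s1 x'] by blast
  obtain E2 where E2: "E2 \<in> extensions (insert y H) D x" "edge_at E2 (insert y H) x (insert y A) B"
    using extension_with_edge[OF dD s2(1) x'] by blast
  obtain E3 where E3: "E3 \<in> extensions (insert y H) D x" "edge_at E3 (insert y H) x (insert y B) A"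
    using extension_with_edge[OF dD s2(2) x'] by blast
  have in1: "E1 \<in> fibre H x y D D'" using fibre_edge_twin[OF E1] s by blast
  have in2: "E2 \<in> fibre H x y D D'" using fibre_edge[OF E2 nAB(2,1)] AB by blast
  have in3: "E3 \<in> fibre H x y D D'" using fibre_edge[OF E3 nAB(5,3)] edge_at_sym[OF AB] by blast
  have all: "E = E1 \<or> E = E2 \<or> E = E3" if E: "E \<in> fibre H x y D D'" for E
  proof -
    have ext: "E \<in> extensions (insert y H) D x" using E unfolding fibre_def by simp
    show ?thesis using fibre_cases[OF E AB] extension_with_edge_unique[OF ext E1(1) _ E1(2)]
       extension_with_edge_unique[OF ext E2(1) _ E2(2)] extension_with_edge_unique[OF ext E3(1) _ E3(2)] by blast
  qed
  have ABn: "A \<inter> B = {}" using AB unfolding edge_at_def by blast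
  have n: "{y} \<noteq> insert y A" "{y} \<noteq> B" "{y} \<noteq> insert y B" "{y} \<noteq> A" "insert y A \<noteq> insert y B" "insert y A \<noteq> A"
    using nAB ABn by auto
  have "E1 \<noteq> E2" using edge_at_unique[OF ext_facts(1)[OF E1(1)] E1(2), of "insert y A" B] E2(2) n by blast
  moreover have "E1 \<noteq> E3" using edge_at_unique[OF ext_facts(1)[OF E1(1)] E1(2), of "insert y B" A] E3(2) n by blast
  moreover have "E2 \<noteq> E3" using edge_at_unique[OF ext_facts(1)[OF E2(1)] E2(2), of "insert y B" A] E3(2) n by blast
  ultimately have dis: "distinct [E1, E2, E3]" by simp
  have "fibre H x y D D' = {E1, E2, E3}" using in1 in2 in3 all by blast
  then show ?thesis using that dis E1 E2 E3 by blast
qed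

end

lemma fibre_small:
  assumes "card H \<le> 1"
  shows "fibre H x y D D' = {disjoint_rel (insert x (insert y H))}" "same_type H D y D' x"
proof -
  have f: "finite (insert x (insert y H))" "finite (insert y H)" "finite (insert x H)" using fin by auto
  have c: "card (insert x (insert y H)) \<le> 3" "card (insert y H) \<le> 3" "card (insert x H) \<le> 3"
    using assms fin x y xy by auto
  have D: "D = disjoint_rel (insert y H)" "D' = disjoint_rel (insert x H)"
    using dstruct_small dD dD' f c by blast+
  have "E = disjoint_rel (insert x (insert y H))" if "E \<in> fibre H x y D D'" for E
    using that dstruct_small[OF _ f(1) c(1)] unfolding fibre_def extensions_def by blast
  moreover have "disjoint_rel (insert x (insert y H)) \<in> fibre H x y D D'"
    unfolding fibre_def extensions_def D using dstruct_disjoint_rel[OF f(1) c(1)]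
      rel_restrict_disjoint_rel[OF subset_insertI] rel_restrict_disjoint_rel[of "insert x H" "insert x (insert y H)"]
    by auto
  ultimately show "fibre H x y D D' = {disjoint_rel (insert x (insert y H))}" by blast
  show "same_type H D y D' x" unfolding D same_type_def disjoint_rel_def using x y by auto
qed

lemma finite_fibre: "finite (fibre H x y D D')"
proof (cases "2 \<le> card H")
  case True
  show ?thesis
  proof (cases "same_type H D y D' x")
    case s: True
    obtain A B where "edge_at D' H x A B" using ex_edge[OF True] by blast
    then obtain E1 E2 E3 where "fibre H x y D D' = {E1, E2, E3}" using fibre_same[OF True s] by metis
    then show ?thesis by simp
  next
    case False
    then obtain E where "fibre H x y D D' = {E}" using fibre_different[OF True] by metis
    then show ?thesis by simp
  qed
next
  case False
  then show ?thesis using fibre_small by simp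
qed

text \<open>Over at most one point the fibre is a single structure, and the values
  \<open>3 + 3 * c\<close>, \<open>2 + 3 * c\<close>, \<open>1 + 3 * c\<close> drop by one at each
  step. For points of different type the value does not change. For points of the same type the
  identities are \<open>1 + 3 * c = 1 + c + c + c\<close> over two points,
  \<open>c = 1 + c + c + (- 1 - c)\<close> on a pendant edge and
  \<open>- 1 - c = 1 + c + 2 * (- 1 - c)\<close> on an inner one.\<close>

theorem point_value_additive:
  "point_value c H D' x =
     (if same_type H D y D' x then 1 else 0) + (\<Sum>E\<in>fibre H x y D D'. point_value c (insert y H) E x)"
proof -
  have cy: "card (insert y H) = Suc (card H)" using fin y by simp
  consider "card H = 0" | "card H = 1" | "2 \<le> card H" by linarith
  then show ?thesis
  proof cases
    case 1 then show ?thesis using fibre_small cy by (simp add: point_value_def)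
  next
    case 2 then show ?thesis using fibre_small cy by (simp add: point_value_def)
  next
    case card: 3
    have x': "x \<notin> insert y H" and f': "finite (insert y H)" using x xy fin by auto
    have c3: "3 \<le> card (insert y H)" using card cy by simp
    have dE: "dstruct (insert x (insert y H)) E" if "E \<in> fibre H x y D D'" for E
      using that unfolding fibre_def extensions_def by blast
    show ?thesis
    proof (cases "same_type H D y D' x")
      case False
      obtain E A B where E: "fibre H x y D D' = {E}" "edge_at D' H x A B"
          "edge_at E (insert y H) x (insert y A) B" "\<not> is_singleton A" using fibre_different[OF card False] by blast
      \<comment> \<open>Over two points there is only one edge, with both sides singletons, whereas
        \<open>A\<close> is not one.\<close>
      have c3': "3 \<le> card H"
      proof (rule ccontr)
        assume "\<not> ?thesis"
        then have c2: "card H = 2" using card by simp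
        then have "is_singleton B" "is_singleton A \<or> is_singleton B" using edge_at_singleton_side[OF E(2) fin] E(4) by auto
        moreover have u: "A \<union> B = H" "A \<inter> B = {}" using E(2) by (auto dest: edge_at_parts)
        ultimately have "card A + 1 = 2" using c2 fin by (metis card_Un_disjoint finite_Un is_singleton_altdef)
        then show False using E(4) by (simp add: is_singleton_altdef)
      qed
      have "A \<noteq> {}" "y \<notin> A" using E(2) y by (auto dest: edge_at_parts)
      then have "\<not> is_singleton (insert y A)" unfolding is_singleton_insert by blast
      then have "point_value c (insert y H) E x = point_value c H D' x"
        using point_value_edge[OF _ E(3) x' f' c3, of c] dE E(1) point_value_edge[OF dD' E(2) x fin c3', of c] E(4) by simp
      then show ?thesis using False E(1) by simp
    next
      case True
      obtain A B where AB: "edge_at D' H x A B" using ex_edge[OF card] by blast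
      obtain E1 E2 E3 where E: "fibre H x y D D' = {E1, E2, E3}" "distinct [E1, E2, E3]"
        "edge_at E1 (insert y H) x {y} H" "edge_at E2 (insert y H) x (insert y A) B"
        "edge_at E3 (insert y H) x (insert y B) A" using fibre_same[OF card True AB] by blast
      have "A \<noteq> {}" "y \<notin> A" "B \<noteq> {}" "y \<notin> B" using AB y by (auto dest: edge_at_parts)
      then have ns: "\<not> is_singleton (insert y A)" "\<not> is_singleton (insert y B)" unfolding is_singleton_insert by blast+
      have v: "point_value c (insert y H) E1 x = c"
          "point_value c (insert y H) E2 x = (if is_singleton B then c else - 1 - c)"
          "point_value c (insert y H) E3 x = (if is_singleton A then c else - 1 - c)"
        using point_value_edge[OF _ E(3) x' f' c3, of c] point_value_edge[OF _ E(4) x' f' c3, of c]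
          point_value_edge[OF _ E(5) x' f' c3, of c] dE E(1) ns by auto
      have S: "(\<Sum>E\<in>fibre H x y D D'. point_value c (insert y H) E x) =
         c + (if is_singleton B then c else - 1 - c) + (if is_singleton A then c else - 1 - c)"
        unfolding E(1) using E(2) v by (simp add: add.assoc)
      show ?thesis
      proof (cases "card H = 2")
        case c2: True
        have u: "A \<union> B = H" "A \<inter> B = {}" using AB by (auto dest: edge_at_parts)
        have "finite A" "finite B" using u fin by auto
        then have "card A + card B = 2" "card A \<noteq> 0" "card B \<noteq> 0" using u c2 card_Un_disjoint[of A B] \<open>A \<noteq> {}\<close> \<open>B \<noteq> {}\<close> by auto
        then have "is_singleton A" "is_singleton B" unfolding is_singleton_altdef by linarith+
        then show ?thesis using S c2 True by (simp add: point_value_def)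
      next
        case False
        then have c3': "3 \<le> card H" using card by simp
        have "point_value c H D' x = (if is_singleton A \<or> is_singleton B then c else - 1 - c)"
          using point_value_edge[OF dD' AB x fin c3'] .
        moreover have "\<not> (is_singleton A \<and> is_singleton B)" using not_both_singleton[OF AB fin c3'] by blast
        ultimately show ?thesis using S True by auto
      qed
    qed
  qed
qed

end

text \<open>The quadratic relation says that \<open>c * c = c * (- 1 - c)\<close>, so after a factor
  \<open>c\<close> the choice between the two edge values is immaterial. This settles the case of
  two points on a common pendant edge that are not twins; in the others the factors on the two sides
  agree in pairs.\<close>

theorem point_value_commute:
  fixes c :: "'r::comm_ring_1"
  assumes c: "2 * c ^ 2 + c = 0" and d: "dstruct (insert x (insert y H)) E" and fin: "finite H"
    and x: "x \<notin> H" and y: "y \<notin> H" and xy: "x \<noteq> y"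
  shows "point_value c H E x * point_value c (insert x H) E y = point_value c H E y * point_value c (insert y H) E x"
proof -
  have cc: "c * u = c * v" if "u \<in> {c, - 1 - c}" "v \<in> {c, - 1 - c}" for u v
  proof -
    have "c * c = c * (- 1 - c)" using c by (simp add: algebra_simps power2_eq_square eq_neg_iff_add_eq_0)
    then show ?thesis using that by auto
  qed
  have cx: "card (insert x H) = Suc (card H)" "card (insert y H) = Suc (card H)" using fin x y by auto
  have dx: "dstruct (insert y (insert x H)) E" using d by (simp add: insert_commute)
  have fx: "finite (insert x H)" "finite (insert y H)" "x \<notin> insert y H" "y \<notin> insert x H" using fin x y xy by auto
  consider "card H \<le> 1" | "card H = 2" | "3 \<le> card H" by linarith
  then show ?thesis
  proof cases
    case 1
    then show ?thesis using cx by (auto simp: point_value_def)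
  next
    case 2
    have c3: "card (insert x H) = 3" "card (insert y H) = 3" using cx 2 by auto
    obtain A B where AB: "edge_at E (insert y H) x A B" using edge_at_exists[OF d fx(2) refl fx(3)] c3 by auto
    obtain P Q where PQ: "edge_at E (insert x H) y P Q" using edge_at_exists[OF dx fx(1) refl fx(4)] c3 by auto
    have "point_value c (insert y H) E x = c" using point_value_edge[OF d AB fx(3,2)] edge_at_singleton_side[OF AB fx(2)] c3 by simp
    moreover have "point_value c (insert x H) E y = c" using point_value_edge[OF dx PQ fx(4,1)] edge_at_singleton_side[OF PQ fx(1)] c3 by simp
    ultimately show ?thesis using 2 by (simp add: point_value_def)
  next
    case 3
    define Ex where "Ex = rel_restrict (insert x H) E"
    define Ey where "Ey = rel_restrict (insert y H) E"
    have dEx: "dstruct (insert x H) Ex" unfolding Ex_def using dstruct_restrict[OF d] by blast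
    have dEy: "dstruct (insert y H) Ey" unfolding Ey_def using dstruct_restrict[OF d] by blast
    have vx: "point_value c H E x = point_value c H Ex x" by (rule point_value_cong) (auto simp: Ex_def rel_restrict_def)
    have vy: "point_value c H E y = point_value c H Ey y" by (rule point_value_cong) (auto simp: Ey_def rel_restrict_def)
    have edgex: "edge_at Ex H x A B \<longleftrightarrow> edge_at E H x A B" for A B unfolding Ex_def by (rule edge_at_rel_restrict) simp
    have edgey: "edge_at Ey H y A B \<longleftrightarrow> edge_at E H y A B" for A B unfolding Ey_def by (rule edge_at_rel_restrict) simp
    have val: "point_value c H E x = (if is_singleton A \<or> is_singleton B then c else - 1 - c)" if "edge_at E H x A B" for A B
      unfolding vx using point_value_edge[OF dEx _ x fin 3] edgex that by blast
    have val': "point_value c H E y = (if is_singleton A \<or> is_singleton B then c else - 1 - c)" if "edge_at E H y A B" for A B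
      unfolding vy using point_value_edge[OF dEy _ y fin 3] edgey that by blast
    have c3: "3 \<le> card (insert x H)" "3 \<le> card (insert y H)" using cx 3 by auto
    note val2 = point_value_edge[OF d _ fx(3,2) c3(2)] and val2' = point_value_edge[OF dx _ fx(4,1) c3(1)]
    have in2: "point_value c (insert y H) E x \<in> {c, - 1 - c}" "point_value c (insert x H) E y \<in> {c, - 1 - c}"
      using c3 unfolding point_value_def by auto
    \<comment> \<open>\<open>x\<close> and \<open>y\<close> form a cherry: they have the same type
      over \<open>H\<close>, and each is pendant once the other is present.\<close>
    have twin: ?thesis if e: "edge_at E (insert y H) x {y} H"
    proof -
      have "point_value c H E x = point_value c H E y"
        by (rule point_value_type_cong[OF d d]) (rule twin_type[OF d e])
      moreover have "point_value c (insert y H) E x = c" using val2[OF e] by (simp add: is_singleton_def)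
      moreover have "point_value c (insert x H) E y = c"
        using val2'[OF twin_swap[OF d e _ fx(3)]] by (simp add: is_singleton_def)
      ultimately show ?thesis by simp
    qed
    have edges: "(\<exists>A B. edge_at E (insert y H) x (insert y A) B \<and> edge_at E H x A B) \<or> edge_at E (insert y H) x {y} H"
      if d: "dstruct (insert x (insert y H)) E" and x: "x \<notin> H" and y: "y \<notin> H" and xy: "x \<noteq> y" and c: "3 \<le> card (insert y H)" for x y
    proof -
      obtain P Q where PQ: "edge_at E (insert y H) x P Q" 
        using edge_at_exists[OF d, of "insert y H" x] fin x xy c by auto
      then obtain P Q where PQ: "edge_at E (insert y H) x P Q" "y \<in> P"
        using edge_at_side[OF PQ insertI1] by blast
      note u = edge_at_parts(4,3,2)[OF PQ(1)]
      show ?thesis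
      proof (cases "P = {y}")
        case True
        then have "y \<notin> Q" "insert y Q = insert y H" using u(1,2) by simp_all
then have "Q = H" using insert_ident y by metis
        then show ?thesis using PQ True by blast
      next
        case False
        define P' where "P' = P - {y}"
        have P: "P = insert y P'" "y \<notin> P'" "P' \<noteq> {}" using False PQ(2) unfolding P'_def by auto
        have "P' \<subseteq> insert y H" "Q \<subseteq> insert y H" "y \<notin> Q" using u(1,2) P(1) by auto
        then have i: "P \<inter> H = P'" "Q \<inter> H = Q" using P y by auto
        then have "edge_at E H x P' Q" using edge_at_subset[OF PQ(1), of H] P u by auto
        then show ?thesis using PQ P by blast
      qed
    qed
    have nsing: "\<not> is_singleton (insert y A)" if "edge_at E H x A B" "y \<notin> H" for x y A B
      using that unfolding edge_at_def is_singleton_insert by blast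
    \<comment> \<open>\<open>x\<close> sits on the pendant edge of \<open>a\<close> with
      \<open>y\<close> on the side of \<open>a\<close>, so \<open>y\<close> sits on that pendant
      edge as well.\<close>
    have leaf: "edge_at E H y A B" if d: "dstruct (insert x (insert y H)) E" and x: "x \<notin> H" and y: "y \<notin> H" and xy: "x \<noteq> y"
      and e: "edge_at E (insert y H) x (insert y A) B" "edge_at E H x A B" "is_singleton A" for x y A B
    proof -
      obtain a where a: "A = {a}" using e(3) by (auto simp: is_singleton_def)
      have u: "A \<union> B = H" "A \<inter> B = {}" "B \<noteq> {}" using e(2) by (auto dest: edge_at_parts)
      have "split (insert y H) E (insert y A) B" using split_edge_at[OF d e(1)] .
      then have 1: "E b b' y a" if "b \<in> B" "b' \<in> B" for b b'
        using that a d_flip[OF d, of y a b b'] unfolding split_def by simp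
      have 2: "E a a y b" if "b \<in> B" for b using d_deg[OF d, of a y b] a u that y by auto
      show ?thesis unfolding edge_at_def using u a 1 2 by simp
    qed
    show ?thesis
    proof (cases "edge_at E (insert y H) x {y} H \<or> edge_at E (insert x H) y {x} H")
      case True
      then show ?thesis
      proof
        assume "edge_at E (insert x H) y {x} H"
        then have "edge_at E (insert y H) x {y} H" using twin_swap[OF dx _ _ fx(4)] by blast
        then show ?thesis by (rule twin)
      qed (rule twin)
    next
      case False
      obtain A B where AB: "edge_at E (insert y H) x (insert y A) B" "edge_at E H x A B"
        using edges[OF d x y xy c3(2)] False by blast
      obtain A' B' where AB': "edge_at E (insert x H) y (insert x A') B'" "edge_at E H y A' B'"
        using edges[OF dx y x xy[symmetric] c3(1)] False by blast
      show ?thesis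
      proof (cases "is_singleton A \<or> is_singleton A'")
        case True
        then have "point_value c H E x = c \<and> point_value c H E y = c"
        proof
          assume s: "is_singleton A"
          then show ?thesis using val[OF AB(2)] val'[OF leaf[OF d x y xy AB s]] by simp
        next
          assume s: "is_singleton A'"
          then show ?thesis using val'[OF AB'(2)] val[OF leaf[OF dx y x xy[symmetric] AB' s]] by simp
        qed
        then show ?thesis using cc[OF in2(2,1)] by (simp only:)
      next
        case False
        \<comment> \<open>Here neither point changes whether the edge of the other is
          pendant.\<close>
        have "point_value c H E x = (if is_singleton B then c else - 1 - c)" using val[OF AB(2)] False by simp
        moreover have "point_value c H E y = (if is_singleton B' then c else - 1 - c)" using val'[OF AB'(2)] False by simp
        moreover have "point_value c (insert y H) E x = (if is_singleton B then c else - 1 - c)"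
          using val2[OF AB(1), of c] nsing[OF AB(2) y] by simp
        moreover have "point_value c (insert x H) E y = (if is_singleton B' then c else - 1 - c)"
          using val2'[OF AB'(1), of c] nsing[OF AB'(2) x] by simp
        ultimately show ?thesis by (simp only: mult.commute)
      qed
    qed
  qed
qed

lemma dstructI:
  assumes "\<And>w x y z. D w x y z \<Longrightarrow> w \<in> H \<and> x \<in> H \<and> y \<in> H \<and> z \<in> H"
    and "\<And>w x y z. D w x y z \<Longrightarrow> D x w y z" and "\<And>w x y z. D w x y z \<Longrightarrow> D y z w x"
    and "\<And>w x y z. D w x y z \<Longrightarrow> \<not> D w y x z"
    and "\<And>w x y z u. D w x y z \<Longrightarrow> u \<in> H \<Longrightarrow> D u x y z \<or> D w x y u"
    and "\<And>x y z. x \<in> H \<Longrightarrow> y \<in> H \<Longrightarrow> z \<in> H \<Longrightarrow> x \<noteq> y \<Longrightarrow> x \<noteq> z \<Longrightarrow> D x x y z"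
    and "\<And>w x y z. w \<in> H \<Longrightarrow> x \<in> H \<Longrightarrow> y \<in> H \<Longrightarrow> z \<in> H \<Longrightarrow> distinct [w, x, y, z] \<Longrightarrow>
      D w x y z \<or> D w y x z \<or> D w z x y"
  shows "dstruct H D"
  unfolding dstruct_def
proof (intro conjI allI ballI impI)
  fix w x y z assume D: "D w x y z"
  show "w \<in> H" "x \<in> H" "y \<in> H" "z \<in> H" using assms(1)[OF D] by simp_all
  show "D x w y z" "D y z w x" "\<not> D w y x z" using assms(2-4)[OF D] by simp_all
next
  fix w x y z u assume "D w x y z" "u \<in> H"
  then show "D u x y z \<or> D w x y u" by (rule assms(5))
next
  fix x y z assume "x \<in> H" "y \<in> H" "z \<in> H" "x \<noteq> y" "x \<noteq> z"
  then show "D x x y z" by (rule assms(6))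
next
  fix w x y z assume "w \<in> H" "x \<in> H" "y \<in> H" "z \<in> H" "distinct [w, x, y, z]"
  then show "D w x y z \<or> D w y x z \<or> D w z x y" by (rule assms(7))
qed

section \<open>Boron trees and disjointness structures\<close>

definition vpath :: "('v \<times> 'v) set \<Rightarrow> 'v \<Rightarrow> 'v list \<Rightarrow> 'v \<Rightarrow> bool" where
  "vpath E u vs v \<longleftrightarrow> vs \<noteq> [] \<and> hd vs = u \<and> last vs = v \<and> distinct vs \<and> successively (\<lambda>a b. (a, b) \<in> E) vs"

lemma pcas_pawalk_verts:
  assumes "pcas u p v" "set p \<subseteq> E"
  shows "pawalk_verts u p \<noteq> [] \<and> hd (pawalk_verts u p) = u \<and> last (pawalk_verts u p) = v \<and>
    successively (\<lambda>a b. (a, b) \<in> E) (pawalk_verts u p) \<and> zip (pawalk_verts u p) (tl (pawalk_verts u p)) = p"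
  using assms
proof (induction p arbitrary: u)
  case (Cons e p)
  then have IH: "pawalk_verts (snd e) p \<noteq> []" "hd (pawalk_verts (snd e) p) = snd e" "last (pawalk_verts (snd e) p) = v"
    "successively (\<lambda>a b. (a, b) \<in> E) (pawalk_verts (snd e) p)"
    "zip (pawalk_verts (snd e) p) (tl (pawalk_verts (snd e) p)) = p" by auto
  obtain vs where vs: "pawalk_verts (snd e) p = snd e # vs" using IH(1,2) by (metis list.collapse)
  show ?case using Cons.prems IH unfolding pawalk_verts.simps vs by auto
qed simp

lemma pcas_zip:
  assumes "vs \<noteq> []" "successively (\<lambda>a b. (a, b) \<in> E) vs"
  shows "pcas (hd vs) (zip vs (tl vs)) (last vs) \<and> set (zip vs (tl vs)) \<subseteq> E \<and>
    pawalk_verts (hd vs) (zip vs (tl vs)) = vs"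
  using assms
proof (induction vs)
  case (Cons a vs)
  show ?case
  proof (cases vs)
    case (Cons b ws)
    then show ?thesis using Cons.IH Cons.prems by auto
  qed auto
qed simp

lemma apath_iff_vpath:
  assumes "u \<in> pverts T"
  shows "pre_digraph.apath (with_proj T) u p v \<longleftrightarrow>
    (\<exists>vs. vpath (parcs T) u vs v \<and> p = zip vs (tl vs) \<and> pawalk_verts u p = vs)"
proof
  assume "pre_digraph.apath (with_proj T) u p v"
  then have "pcas u p v" "set p \<subseteq> parcs T" "distinct (pawalk_verts u p)"
    by (simp_all add: pre_digraph.apath_def pre_digraph.awalk_def cas_with_proj_eq awalk_verts_with_proj_eq)
  then show "\<exists>vs. vpath (parcs T) u vs v \<and> p = zip vs (tl vs) \<and> pawalk_verts u p = vs"
    using pcas_pawalk_verts[of u p v "parcs T"] unfolding vpath_def by auto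
next
  assume "\<exists>vs. vpath (parcs T) u vs v \<and> p = zip vs (tl vs) \<and> pawalk_verts u p = vs"
  then obtain vs where "vpath (parcs T) u vs v" "p = zip vs (tl vs)" by blast
  then show "pre_digraph.apath (with_proj T) u p v"
    using pcas_zip[of vs "parcs T"] assms
    by (simp add: vpath_def pre_digraph.apath_def pre_digraph.awalk_def cas_with_proj_eq awalk_verts_with_proj_eq)
qed

definition vtree :: "'v set \<Rightarrow> ('v \<times> 'v) set \<Rightarrow> bool" where
  "vtree V E \<longleftrightarrow> finite V \<and> E \<subseteq> V \<times> V \<and> sym E \<and> irrefl E \<and> (\<forall>u\<in>V. \<forall>v\<in>V. \<exists>!vs. vpath E u vs v)"

definition vgeo :: "('v \<times> 'v) set \<Rightarrow> 'v \<Rightarrow> 'v \<Rightarrow> 'v list" where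
  "vgeo E u v = (THE vs. vpath E u vs v)"

definition seg :: "('v \<times> 'v) set \<Rightarrow> 'v \<Rightarrow> 'v \<Rightarrow> 'v set" where
  "seg E u v = set (vgeo E u v)"

lemma ex1_apath_iff:
  assumes "u \<in> pverts T"
  shows "(\<exists>!p. pre_digraph.apath (with_proj T) u p v) \<longleftrightarrow> (\<exists>!vs. vpath (parcs T) u vs v)"
proof
  assume h: "\<exists>!p. pre_digraph.apath (with_proj T) u p v"
  then obtain p where p: "pre_digraph.apath (with_proj T) u p v"
    "\<And>q. pre_digraph.apath (with_proj T) u q v \<Longrightarrow> q = p" by blast
  have *: "pre_digraph.apath (with_proj T) u (zip vs (tl vs)) v \<and> pawalk_verts u (zip vs (tl vs)) = vs"
    if vs: "vpath (parcs T) u vs v" for vs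
  proof -
    have "pawalk_verts u (zip vs (tl vs)) = vs" using vs pcas_zip[of vs "parcs T"] unfolding vpath_def by auto
    then show ?thesis using apath_iff_vpath[OF assms] vs by blast
  qed
  obtain vs where "vpath (parcs T) u vs v" using p(1) apath_iff_vpath[OF assms] by blast
  moreover have "ws = pawalk_verts u p" if "vpath (parcs T) u ws v" for ws
    using *[OF that] p(2) by metis
  ultimately show "\<exists>!vs. vpath (parcs T) u vs v" by metis
next
  assume "\<exists>!vs. vpath (parcs T) u vs v"
  then obtain vs where vs: "vpath (parcs T) u vs v" "\<And>ws. vpath (parcs T) u ws v \<Longrightarrow> ws = vs" by blast
  have "pawalk_verts u (zip vs (tl vs)) = vs" using vs(1) pcas_zip[of vs "parcs T"] unfolding vpath_def by auto
  then have "pre_digraph.apath (with_proj T) u (zip vs (tl vs)) v" using apath_iff_vpath[OF assms] vs(1) by blast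
  then show "\<exists>!p. pre_digraph.apath (with_proj T) u p v"
    using vs(2) apath_iff_vpath[OF assms] by metis
qed

lemma tree_graph_iff_vtree: "tree_graph T \<longleftrightarrow> vtree (pverts T) (parcs T)"
proof -
  have "pair_graph T \<longleftrightarrow> finite (pverts T) \<and> parcs T \<subseteq> pverts T \<times> pverts T \<and> sym (parcs T) \<and> irrefl (parcs T)"
  proof
    assume "pair_graph T"
    then interpret pair_graph T .
    show "finite (pverts T) \<and> parcs T \<subseteq> pverts T \<times> pverts T \<and> sym (parcs T) \<and> irrefl (parcs T)"
      using sym_arcs by (auto simp: irrefl_def symmetric_def dest: in_arcsD1 in_arcsD2 no_loops')
  next
    assume h: "finite (pverts T) \<and> parcs T \<subseteq> pverts T \<times> pverts T \<and> sym (parcs T) \<and> irrefl (parcs T)"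
    then have "finite (parcs T)" by (meson finite_SigmaI finite_subset)
    then show "pair_graph T" using h
      by unfold_locales (auto simp: irrefl_def symmetric_def)
  qed
  moreover have "(\<forall>u\<in>pverts T. \<forall>v\<in>pverts T. \<exists>!p. pre_digraph.apath (with_proj T) u p v) \<longleftrightarrow>
      (\<forall>u\<in>pverts T. \<forall>v\<in>pverts T. \<exists>!vs. vpath (parcs T) u vs v)"
    by (intro ball_cong refl ex1_apath_iff)
  ultimately show ?thesis unfolding tree_graph_def vtree_def by simp
qed

lemma geodesic_eq_seg:
  assumes "tree_graph T" "u \<in> pverts T" "v \<in> pverts T"
  shows "geodesic T u v = seg (parcs T) u v"
proof -
  obtain p where p: "pre_digraph.apath (with_proj T) u p v" "\<And>q. pre_digraph.apath (with_proj T) u q v \<Longrightarrow> q = p"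
    using assms unfolding tree_graph_def by blast
  then have the: "(THE p. pre_digraph.apath (with_proj T) u p v) = p" by blast
  obtain vs where vs: "vpath (parcs T) u vs v" "pawalk_verts u p = vs" using p apath_iff_vpath[OF assms(2)] by blast
  have "vtree (pverts T) (parcs T)" using assms(1) tree_graph_iff_vtree by blast
  then have "\<exists>!vs. vpath (parcs T) u vs v" using assms(2,3) unfolding vtree_def by simp
  then have "vgeo (parcs T) u v = vs" unfolding vgeo_def using vs(1) by (rule the1_equality)
  then show ?thesis unfolding geodesic_def the seg_def using vs by (simp add: awalk_verts_with_proj_eq)
qed

lemma out_degree_card: "out_degree (with_proj T) v = card {w. (v, w) \<in> parcs T}"
proof -
  have "out_arcs (with_proj T) v = Pair v ` {w. (v, w) \<in> parcs T}" unfolding out_arcs_def by auto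
  then show ?thesis unfolding out_degree_def by (simp add: card_image inj_on_def)
qed

lemma vpath_rev: "sym E \<Longrightarrow> vpath E u vs v \<Longrightarrow> vpath E v (rev vs) u"
  unfolding vpath_def by (auto simp: hd_rev last_rev successively_rev elim: successively_mono dest: symD)

lemma vpath_appendD:
  assumes "vpath E u (xs @ w # ys) v"
  shows "vpath E u (xs @ [w]) w" "vpath E w (w # ys) v"
  using assms unfolding vpath_def by (auto simp: successively_append_iff hd_append)

lemma vpath_append:
  assumes "vpath E u (xs @ [w]) w" "vpath E w (w # ys) v" "set xs \<inter> set ys = {}"
  shows "vpath E u (xs @ w # ys) v"
  using assms unfolding vpath_def by (auto simp: successively_append_iff hd_append)

lemma list_crossing:
  assumes "vs \<noteq> []" "hd vs \<in> P" "last vs \<notin> P"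
  shows "\<exists>xs p q ys. vs = xs @ p # q # ys \<and> p \<in> P \<and> q \<notin> P"
  using assms
proof (induction vs)
  case (Cons a vs)
  show ?case
  proof (cases vs)
    case (Cons b ws)
    show ?thesis
    proof (cases "b \<in> P")
      case True
      then obtain xs p q ys where "vs = xs @ p # q # ys \<and> p \<in> P \<and> q \<notin> P" using Cons.IH Cons.prems Cons by auto
      then show ?thesis by (metis append_Cons)
    next
      case False
      then have "a # vs = [] @ a # b # ws" using Cons by simp
      then show ?thesis using False Cons.prems by (metis list.sel(1))
    qed
  qed (use Cons.prems in auto)
qed simp

section \<open>Geodesics of a tree and the two sides of an edge\<close>

context
  fixes V :: "'v set" and E
  assumes T: "vtree V E"
begin

lemma E_V: "(p, q) \<in> E \<Longrightarrow> p \<in> V \<and> q \<in> V \<and> p \<noteq> q \<and> (q, p) \<in> E"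
  using T unfolding vtree_def irrefl_def sym_def by blast

lemma vgeo: assumes "u \<in> V" "v \<in> V" shows "vpath E u (vgeo E u v) v"
  unfolding vgeo_def by (rule theI') (use T assms in \<open>auto simp: vtree_def\<close>)

lemma vgeo_eq: assumes "u \<in> V" "v \<in> V" "vpath E u vs v" shows "vgeo E u v = vs"
  using vgeo[OF assms(1,2)] T assms unfolding vtree_def by blast

lemma seg_eq: "u \<in> V \<Longrightarrow> v \<in> V \<Longrightarrow> vpath E u vs v \<Longrightarrow> seg E u v = set vs"
  unfolding seg_def by (simp add: vgeo_eq)

lemma seg_ends: assumes "u \<in> V" "v \<in> V" shows "u \<in> seg E u v" "v \<in> seg E u v"
  using vgeo[OF assms] unfolding seg_def vpath_def by (metis hd_in_set, metis last_in_set)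

lemma seg_refl: "u \<in> V \<Longrightarrow> seg E u u = {u}"
  using seg_eq[of u u "[u]"] by (simp add: vpath_def)

lemma seg_V: assumes "u \<in> V" "v \<in> V" shows "seg E u v \<subseteq> V"
proof
  fix w assume "w \<in> seg E u v"
  then obtain xs ys where e: "vgeo E u v = xs @ w # ys" unfolding seg_def by (metis split_list)
  show "w \<in> V"
  proof (cases xs rule: rev_cases)
    case Nil then show ?thesis using e vgeo[OF assms] assms by (simp add: vpath_def)
  next
    case (snoc zs z)
    then have "(z, w) \<in> E" using e vgeo[OF assms] by (simp add: vpath_def successively_append_iff)
    then show ?thesis using E_V by blast
  qed
qed

lemma seg_sym: assumes "u \<in> V" "v \<in> V" shows "seg E u v = seg E v u"
proof -
  have "sym E" using T unfolding vtree_def by blast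
  then show ?thesis using seg_eq[OF assms(2,1) vpath_rev[OF _ vgeo[OF assms]]] unfolding seg_def by simp
qed

lemma seg_split:
  assumes "u \<in> V" "v \<in> V" "w \<in> seg E u v"
  shows "seg E u v = seg E u w \<union> seg E w v" "seg E u w \<inter> seg E w v = {w}"
proof -
  obtain xs ys where e: "vgeo E u v = xs @ w # ys" using assms(3) unfolding seg_def by (metis split_list)
  have w: "w \<in> V" using seg_V assms by blast
  note p = vgeo[OF assms(1,2), unfolded e]
  have 1: "seg E u w = insert w (set xs)" using seg_eq[OF assms(1) w vpath_appendD(1)[OF p]] by simp
  have 2: "seg E w v = insert w (set ys)" using seg_eq[OF w assms(2) vpath_appendD(2)[OF p]] by simp
  show "seg E u v = seg E u w \<union> seg E w v" unfolding 1 2 by (auto simp: seg_def e)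
  show "seg E u w \<inter> seg E w v = {w}" unfolding 1 2 using p unfolding vpath_def by auto
qed

text \<open>Follow the geodesic from \<open>u\<close> to \<open>v\<close> up to its first vertex
  \<open>x\<close> on the geodesic \<open>v w\<close>, then turn towards \<open>w\<close>. The
  choice of \<open>x\<close> makes this a path without repetition, hence the geodesic.\<close>

lemma seg_triangle:
  assumes "u \<in> V" "v \<in> V" "w \<in> V"
  shows "seg E u w \<subseteq> seg E u v \<union> seg E v w"
proof -
  have "\<exists>x\<in>set (vgeo E u v). x \<in> seg E v w" using seg_ends assms unfolding seg_def[of E u v, symmetric] by blast
  then obtain xs x ys where e: "vgeo E u v = xs @ x # ys" "x \<in> seg E v w" "\<forall>z\<in>set xs. z \<notin> seg E v w"
    using split_list_first_prop[of "vgeo E u v" "\<lambda>x. x \<in> seg E v w"] by blast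
  have x: "x \<in> V" using seg_V[OF assms(2,3)] e by blast
  have sub: "seg E x w \<subseteq> seg E v w" using seg_split[OF assms(2,3) e(2)] by blast
  obtain zs where zs: "vgeo E x w = x # zs" using vgeo[OF x assms(3)] unfolding vpath_def by (metis list.collapse)
  have "vpath E u (xs @ x # zs) w"
  proof (rule vpath_append)
    show "vpath E u (xs @ [x]) x" using vpath_appendD(1) vgeo[OF assms(1,2)] e by metis
    show "vpath E x (x # zs) w" using vgeo[OF x assms(3)] zs by simp
    show "set xs \<inter> set zs = {}" using sub e(3) unfolding seg_def[of E x w] zs by auto
  qed
  then have "seg E u w = set xs \<union> seg E x w" using seg_eq[OF assms(1,3)] by (simp add: seg_def[of E x w] zs)
  then show ?thesis using sub by (auto simp: seg_def[of E u v] e)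
qed

text \<open>Together with \<open>seg_edge_not_both\<close>, an edge \<open>p q\<close> divides the
  vertices into those that reach \<open>q\<close> through \<open>p\<close> and those that reach
  \<open>p\<close> through \<open>q\<close>. A geodesic to \<open>p\<close> that avoids
  \<open>q\<close> extends by \<open>q\<close> to a geodesic of the former kind.\<close>

lemma seg_edge_cases:
  assumes "(p, q) \<in> E" "v \<in> V" "q \<notin> seg E v p" shows "p \<in> seg E v q"
proof -
  have V: "p \<in> V" "q \<in> V" using E_V assms by blast+
  obtain xs where e: "vgeo E v p = xs @ [p]" using vgeo[OF assms(2) V(1)] unfolding vpath_def by (metis append_butlast_last_id)
  have "vpath E v (xs @ p # [q]) q"
  proof (rule vpath_append)
    show "vpath E v (xs @ [p]) p" using vgeo[OF assms(2) V(1)] e by simp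
    show "vpath E p (p # [q]) q" using assms E_V[of p q] by (auto simp: vpath_def)
    show "set xs \<inter> set [q] = {}" using assms(3) e by (auto simp: seg_def)
  qed
  then show ?thesis using seg_eq[OF assms(2) V(2)] by simp
qed

lemma seg_edge_not_both:
  assumes "(p, q) \<in> E" "v \<in> V" "q \<in> seg E v p" shows "p \<notin> seg E v q"
  using seg_split(2)[OF assms(2) _ assms(3)] E_V[OF assms(1)] seg_ends(2)[of q p] by auto

text \<open>Used with \<open>P\<close> a geodesic, to find where another one leaves it, or a single
  vertex, to find its neighbour on the way.\<close>

lemma seg_crossing:
  assumes "u \<in> V" "v \<in> V" "u \<in> P" "v \<notin> P"
  obtains p q where "(p, q) \<in> E" "p \<in> P" "q \<notin> P" "p \<in> seg E u v" "q \<in> seg E u v" "p \<in> seg E u q" "q \<in> seg E v p"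
proof -
  note p0 = vgeo[OF assms(1,2)]
  obtain xs p q ys where e: "vgeo E u v = xs @ p # q # ys" "p \<in> P" "q \<notin> P"
    using list_crossing[of "vgeo E u v" P] p0 assms unfolding vpath_def by auto
  have E: "(p, q) \<in> E" using p0 unfolding e vpath_def by (simp add: successively_append_iff)
  have V: "p \<in> V" "q \<in> V" using E_V[OF E] by auto
  have "vpath E u ((xs @ [p]) @ [q]) q" using vpath_appendD(1)[of E u "xs @ [p]" q ys v] p0 e by simp
  then have 1: "p \<in> seg E u q" using seg_eq[OF assms(1) V(2)] by simp
  have "vpath E p (p # q # ys) v" using vpath_appendD(2)[of E u xs p "q # ys" v] p0 e by simp
  then have "q \<in> seg E p v" using seg_eq[OF V(1) assms(2)] by simp
  then have "q \<in> seg E v p" using seg_sym assms V by blast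
  then show ?thesis using that E e 1 by (simp add: seg_def)
qed

lemma seg_interior:
  assumes "u \<in> V" "v \<in> V" "x \<in> seg E u v" "x \<noteq> u" "x \<noteq> v"
  obtains p q where "(x, p) \<in> E" "(x, q) \<in> E" "p \<noteq> q"
proof -
  note p0 = vgeo[OF assms(1,2)]
  obtain xs ys where e: "vgeo E u v = xs @ x # ys" using assms(3) unfolding seg_def by (metis split_list)
  obtain p xs' where xs: "xs = xs' @ [p]" using p0 e assms(4) unfolding vpath_def by (cases xs rule: rev_cases) auto
  obtain q ys' where ys: "ys = q # ys'" using p0 e assms(5) unfolding vpath_def by (cases ys) auto
  have "(p, x) \<in> E" "(x, q) \<in> E" "p \<noteq> q" using p0 unfolding e xs ys vpath_def by (auto simp: successively_append_iff)
  then show ?thesis using that E_V by blast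
qed

text \<open>\<open>p \<in> seg E w q\<close> expresses that \<open>w\<close> lies on the side of
  \<open>p\<close>. Geodesics between points of one side stay on that side, so a common point would
  lie on neither.\<close>

lemma opposite_sides_disjoint:
  assumes E: "(p, q) \<in> E" and V: "w \<in> V" "x \<in> V" "y \<in> V" "z \<in> V"
    and s: "p \<in> seg E w q" "p \<in> seg E x q" "q \<in> seg E y p" "q \<in> seg E z p"
  shows "seg E w x \<inter> seg E y z = {}"
proof -
  have *: "q \<notin> seg E t p" if E: "(p, q) \<in> E" and "w \<in> V" "x \<in> V" and s: "p \<in> seg E w q" "p \<in> seg E x q" and "t \<in> seg E w x" for p q w x t
  proof -
    have pq: "p \<in> V" "q \<in> V" "(q, p) \<in> E" using E_V[OF E] by auto
    have n: "q \<notin> seg E w p" "q \<notin> seg E x p" using seg_edge_not_both[OF pq(3)] s that by blast+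
    have "t \<in> seg E w p \<union> seg E x p" using seg_triangle[of w p x] seg_sym[of p x] that pq by blast
    then have "seg E t p \<subseteq> seg E w p \<union> seg E x p" using seg_split(1)[of w p t] seg_split(1)[of x p t] that pq by blast
    then show ?thesis using n by blast
  qed
  have "q \<notin> seg E t p" if "t \<in> seg E w x" for t using *[OF E V(1,2) s(1,2) that] .
  moreover have "p \<notin> seg E t q" if "t \<in> seg E y z" for t using *[of q p y z t] E_V[OF E] V s that by blast
  moreover have "q \<in> seg E t p \<or> p \<in> seg E t q" if "t \<in> seg E w x" for t
    using seg_edge_cases[OF E, of t] seg_V[OF V(1,2)] that by blast
  ultimately show ?thesis by blast
qed

text \<open>An edge by which the geodesic from \<open>w\<close> to \<open>y\<close> leaves the
  geodesic \<open>w x\<close> separates the pairs: were \<open>z\<close> on the side of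
  \<open>p\<close>, the geodesic \<open>y z\<close> would pass through \<open>p\<close>.\<close>

lemma disjoint_segs_sides:
  assumes V: "w \<in> V" "x \<in> V" "y \<in> V" "z \<in> V" and dis: "seg E w x \<inter> seg E y z = {}"
  obtains p q where "(p, q) \<in> E" "p \<in> seg E w q" "p \<in> seg E x q" "q \<in> seg E y p" "q \<in> seg E z p"
proof -
  have "w \<in> seg E w x" "y \<notin> seg E w x" using seg_ends V dis by blast+
  then obtain p q where E: "(p, q) \<in> E" and p: "p \<in> seg E w x" "q \<notin> seg E w x" "q \<in> seg E y p"
    using seg_crossing[of w y "seg E w x"] V by metis
  have pq: "p \<in> V" "q \<in> V" "(q, p) \<in> E" using E_V[OF E] by auto
  have "q \<notin> seg E w p" "q \<notin> seg E x p" using seg_split(1)[OF V(1,2) p(1)] seg_sym[of p x] V pq p by blast+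
  then have w: "p \<in> seg E w q" "p \<in> seg E x q" using seg_edge_cases[OF E] V by blast+
  have "q \<in> seg E z p"
  proof (rule ccontr)
    assume "q \<notin> seg E z p"
    then have "p \<in> seg E z q" using seg_edge_cases[OF E] V by blast
    then have "p \<in> seg E z y \<union> seg E y q" using seg_triangle[of z y q] V pq by blast
    moreover have "p \<notin> seg E y q" using seg_edge_not_both[OF E V(3) p(3)] .
    ultimately have "p \<in> seg E y z" using seg_sym V by blast
    then show False using p dis by blast
  qed
  then show ?thesis using that E w p(3) by blast
qed

lemma crossing_through:
  assumes E: "(p, q) \<in> E" and V: "w \<in> V" "y \<in> V" and s: "p \<in> seg E w q" "q \<in> seg E y p"
  shows "p \<in> seg E w y"
proof -
  have "p \<in> seg E w y \<union> seg E y q" using seg_triangle[of w y q] V E_V[OF E] s by blast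
  then show ?thesis using seg_edge_not_both[OF E V(2) s(2)] by blast
qed

text \<open>If \<open>x\<close> is off the geodesic \<open>w y\<close>, the median is the vertex
  \<open>p\<close> at which the geodesic from \<open>w\<close> to \<open>x\<close> leaves
  it.\<close>

lemma median:
  assumes V: "w \<in> V" "x \<in> V" "y \<in> V"
  obtains m where "m \<in> seg E w x" "m \<in> seg E w y" "m \<in> seg E x y"
proof (cases "x \<in> seg E w y")
  case True
  then show ?thesis using that[of x] seg_ends V by blast
next
  case False
  obtain p q where E: "(p, q) \<in> E" and p: "p \<in> seg E w y" "q \<notin> seg E w y" "p \<in> seg E w x" "q \<in> seg E w x" "q \<in> seg E x p"
    using seg_crossing[of w x "seg E w y"] seg_ends V False by metis
  have pq: "p \<in> V" "q \<in> V" using E_V[OF E] by auto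
  have "q \<notin> seg E y p" using seg_split(1)[OF V(1,3) p(1)] seg_sym[of p y] V pq p by blast
  then have "p \<in> seg E y q" using seg_edge_cases[OF E V(3)] by blast
  then have "p \<in> seg E y x" using crossing_through[OF E V(3,2) _ p(5)] by blast
  then show ?thesis using that[of p] p seg_sym V by blast
qed

lemma seg_first_step:
  assumes "m \<in> V" "v \<in> V" "m \<noteq> v"
  obtains n where "(m, n) \<in> E" "n \<in> seg E v m"
  using seg_crossing[of m v "{m}"] assms by (metis singletonD singletonI)

lemma branch_distinct:
  assumes "(m, n) \<in> E" "w \<in> V" "x \<in> V" "m \<in> seg E w x" "n \<in> seg E w m"
  shows "n \<notin> seg E x m"
proof -
  have V: "m \<in> V" "n \<in> V" "m \<noteq> n" using E_V[OF assms(1)] by auto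
  have "seg E w m \<inter> seg E m x = {m}" using seg_split(2)[OF assms(2,3,4)] .
  then show ?thesis using assms(5) V(3) seg_sym[OF V(1) assms(3)] by auto
qed

text \<open>Exclusion: an end \<open>p\<close> of an edge separating \<open>w x\<close> from
  \<open>y z\<close> lies on both geodesics \<open>w y\<close> and \<open>x z\<close>. Transitivity:
  \<open>u\<close> lies on one side of that edge. The last axiom is where valence three enters,
  through the median of three of the leaves.\<close>

theorem dstruct_leaves:
  assumes L: "L \<subseteq> V" and deg1: "\<And>v. v \<in> L \<Longrightarrow> card {w. (v, w) \<in> E} \<le> 1"
    and deg3: "\<And>v. v \<in> V - L \<Longrightarrow> card {w. (v, w) \<in> E} \<le> 3"
  shows "dstruct L (\<lambda>w x y z. w \<in> L \<and> x \<in> L \<and> y \<in> L \<and> z \<in> L \<and> seg E w x \<inter> seg E y z = {})"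
proof -
  let ?D = "\<lambda>w x y z. w \<in> L \<and> x \<in> L \<and> y \<in> L \<and> z \<in> L \<and> seg E w x \<inter> seg E y z = {}"
  have LV: "v \<in> L \<Longrightarrow> v \<in> V" for v using L by blast
  have finE: "finite {w. (v, w) \<in> E}" for v
  proof (rule finite_subset)
    show "{w. (v, w) \<in> E} \<subseteq> V" using E_V by blast
    show "finite V" using T by (simp add: vtree_def)
  qed
  have leaf: "x = u \<or> x = v" if h: "x \<in> L" "u \<in> V" "v \<in> V" "x \<in> seg E u v" for x u v
  proof (rule ccontr)
    assume "\<not> (x = u \<or> x = v)"
    then obtain p q where pq: "(x, p) \<in> E" "(x, q) \<in> E" "p \<noteq> q" using seg_interior[OF h(2-4)] by blast
    then have "card {p, q} \<le> card {w. (x, w) \<in> E}" by (intro card_mono finE) auto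
    then show False using deg1[OF h(1)] pq by simp
  qed
  have V_D: "w \<in> V \<and> x \<in> V \<and> y \<in> V \<and> z \<in> V" if "?D w x y z" for w x y z using that LV by blast
  show ?thesis
  proof (rule dstructI)
    fix w x y z assume D: "?D w x y z"
    then have V: "w \<in> V" "x \<in> V" "y \<in> V" "z \<in> V" using V_D by blast+
    show "w \<in> L \<and> x \<in> L \<and> y \<in> L \<and> z \<in> L" using D by blast
    show "?D x w y z" using D seg_sym[OF V(1,2)] by simp
    show "?D y z w x" using D by (simp add: Int_commute)
    have dis: "seg E w x \<inter> seg E y z = {}" using D by blast
    obtain p q where pq: "(p, q) \<in> E" "p \<in> seg E w q" "p \<in> seg E x q" "q \<in> seg E y p" "q \<in> seg E z p"
      using disjoint_segs_sides[OF V dis] by blast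
    then have "p \<in> seg E w y" "p \<in> seg E x z" using crossing_through V by blast+
    then show "\<not> ?D w y x z" by blast
  next
    fix w x y z u assume D: "?D w x y z" and u: "u \<in> L"
    then have V: "w \<in> V" "x \<in> V" "y \<in> V" "z \<in> V" "u \<in> V" using LV by blast+
    have dis: "seg E w x \<inter> seg E y z = {}" using D by blast
    obtain p q where pq: "(p, q) \<in> E" "p \<in> seg E w q" "p \<in> seg E x q" "q \<in> seg E y p" "q \<in> seg E z p"
      using disjoint_segs_sides[OF V(1-4) dis] by blast
    show "?D u x y z \<or> ?D w x y u"
    proof (cases "q \<in> seg E u p")
      case True
      then show ?thesis using opposite_sides_disjoint[OF pq(1) V(1,2,3,5)] pq D u by blast
    next
      case False
      then have "p \<in> seg E u q" using seg_edge_cases[OF pq(1) V(5)] by blast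
      then show ?thesis using opposite_sides_disjoint[OF pq(1) V(5,2,3,4)] pq D u by blast
    qed
  next
    fix x y z assume h: "x \<in> L" "y \<in> L" "z \<in> L" "x \<noteq> y" "x \<noteq> z"
    have "x \<notin> seg E y z" using leaf[of x y z] h LV by blast
    then have "seg E x x \<inter> seg E y z = {}" using seg_refl[OF LV[OF h(1)]] by simp
    then show "?D x x y z" using h by blast
  next
    fix w x y z assume h: "w \<in> L" "x \<in> L" "y \<in> L" "z \<in> L" "distinct [w, x, y, z]"
    then have V: "w \<in> V" "x \<in> V" "y \<in> V" "z \<in> V" using LV by blast+
    obtain m where m: "m \<in> seg E w x" "m \<in> seg E w y" "m \<in> seg E x y" using median[OF V(1-3)] .
    have mV: "m \<in> V" using seg_V V m by blast
    have mL: "m \<notin> L" using leaf[of m w x] leaf[of m w y] leaf[of m x y] m V h by auto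
    obtain nw where nw: "(m, nw) \<in> E" "nw \<in> seg E w m" using seg_first_step mV V(1) mL h(1) by metis
    obtain nx where nx: "(m, nx) \<in> E" "nx \<in> seg E x m" using seg_first_step mV V(2) mL h(2) by metis
    obtain ny where ny: "(m, ny) \<in> E" "ny \<in> seg E y m" using seg_first_step mV V(3) mL h(3) by metis
    obtain nz where nz: "(m, nz) \<in> E" "nz \<in> seg E z m" using seg_first_step mV V(4) mL h(4) by metis
    have dw: "nw \<notin> seg E x m" "nw \<notin> seg E y m"
      using branch_distinct[OF nw(1) V(1,2) m(1) nw(2)] branch_distinct[OF nw(1) V(1,3) m(2) nw(2)] by auto
    have dx: "nx \<notin> seg E w m" "nx \<notin> seg E y m"
      using branch_distinct[OF nx(1) V(2,1) _ nx(2)] branch_distinct[OF nx(1) V(2,3) m(3) nx(2)] m seg_sym V by auto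
    have dy: "ny \<notin> seg E w m" "ny \<notin> seg E x m"
      using branch_distinct[OF ny(1) V(3,1) _ ny(2)] branch_distinct[OF ny(1) V(3,2) _ ny(2)] m seg_sym V by auto
    \<comment> \<open>The branches at the median \<open>m\<close> towards \<open>w\<close>,
      \<open>x\<close>, \<open>y\<close> are distinct and exhaust its neighbours. So
      \<open>z\<close> lies in one of them and is paired with the leaf of that branch.\<close>
    have "nz \<in> {nw, nx, ny}"
    proof (rule ccontr)
      assume n: "nz \<notin> {nw, nx, ny}"
      have "card {nw, nx, ny, nz} \<le> card {w. (m, w) \<in> E}" using nw nx ny nz by (intro card_mono finE) auto
      moreover have "nw \<noteq> nx" "nw \<noteq> ny" "nx \<noteq> ny" using dw dx dy nw nx ny by blast+
      ultimately show False using n deg3[of m] mV mL by auto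
    qed
    have *: "seg E a z \<inter> seg E b c = {}" if n: "(m, n) \<in> E" "n \<in> seg E a m" "n \<notin> seg E b m" "n \<notin> seg E c m" "n \<in> seg E z m"
      and "a \<in> V" "b \<in> V" "c \<in> V" for n a b c
    proof -
      have "m \<in> seg E b n" "m \<in> seg E c n" using seg_edge_cases[OF n(1)] that by blast+
      then have "seg E b c \<inter> seg E a z = {}" using opposite_sides_disjoint[OF n(1)] that V by blast
      then show ?thesis by blast
    qed
    consider "nz = nw" | "nz = nx" | "nz = ny" using \<open>nz \<in> {nw, nx, ny}\<close> by blast
    then show "?D w x y z \<or> ?D w y x z \<or> ?D w z x y"
    proof cases
      case 1 then show ?thesis using *[OF nw(1,2) dw _ V(1,2,3)] nz h by blast
    next
      case 2 then show ?thesis using *[OF nx(1,2) dx _ V(2,1,3)] nz h seg_sym V by (simp add: Int_commute)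
    next
      case 3 then show ?thesis using *[OF ny(1,2) dy _ V(3,1,2)] nz h seg_sym V by (simp add: Int_commute)
    qed
  qed
qed

end

section \<open>From boron trees to disjointness structures\<close>

definition dis :: "'a qstruct \<Rightarrow> 'a \<Rightarrow> 'a \<Rightarrow> 'a \<Rightarrow> 'a \<Rightarrow> bool" where
  "dis U w x y z \<longleftrightarrow> {w, x, y, z} \<subseteq> points U \<and> (w, x, y, z) \<notin> quad U"

text \<open>The axioms are universal, and distinctness of points survives an injection.\<close>

lemma dstruct_pullback:
  assumes d: "dstruct L D" and f: "inj_on f H" "f ` H \<subseteq> L"
    and D': "\<And>w x y z. D' w x y z \<longleftrightarrow> {w, x, y, z} \<subseteq> H \<and> D (f w) (f x) (f y) (f z)"
  shows "dstruct H D'"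
  unfolding D'
proof (rule dstructI)
  fix w x y z assume h: "w \<in> H" "x \<in> H" "y \<in> H" "z \<in> H" "distinct [w, x, y, z]"
  then have "f w \<in> L" "f x \<in> L" "f y \<in> L" "f z \<in> L" using f by blast+
  moreover have "f w \<noteq> f x" "f w \<noteq> f y" "f w \<noteq> f z" "f x \<noteq> f y" "f x \<noteq> f z" "f y \<noteq> f z"
    using h f(1) by (auto dest: inj_onD)
  ultimately have "D (f w) (f x) (f y) (f z) \<or> D (f w) (f y) (f x) (f z) \<or> D (f w) (f z) (f x) (f y)"
    using d_cub[OF d] by blast
  then show "{w, x, y, z} \<subseteq> H \<and> D (f w) (f x) (f y) (f z) \<or> {w, y, x, z} \<subseteq> H \<and> D (f w) (f y) (f x) (f z) \<or>
    {w, z, x, y} \<subseteq> H \<and> D (f w) (f z) (f x) (f y)" using h by simp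
next
  fix x y z assume h: "x \<in> H" "y \<in> H" "z \<in> H" "x \<noteq> y" "x \<noteq> z"
  then have "f x \<in> L" "f y \<in> L" "f z \<in> L" "f x \<noteq> f y" "f x \<noteq> f z" using f by (auto dest: inj_onD)
  then show "{x, x, y, z} \<subseteq> H \<and> D (f x) (f x) (f y) (f z)" using h d_deg[OF d] by simp
next
  fix w x y z u assume h: "{w, x, y, z} \<subseteq> H \<and> D (f w) (f x) (f y) (f z)" "u \<in> H"
  then have "D (f u) (f x) (f y) (f z) \<or> D (f w) (f x) (f y) (f u)" using d_tr[OF d] f by blast
  then show "{u, x, y, z} \<subseteq> H \<and> D (f u) (f x) (f y) (f z) \<or> {w, x, y, u} \<subseteq> H \<and> D (f w) (f x) (f y) (f u)"
    using h by auto
next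
  fix w x y z assume h: "{w, x, y, z} \<subseteq> H \<and> D (f w) (f x) (f y) (f z)"
  then show "w \<in> H \<and> x \<in> H \<and> y \<in> H \<and> z \<in> H" by simp
  show "{x, w, y, z} \<subseteq> H \<and> D (f x) (f w) (f y) (f z)" using h d_swap[OF d] by auto
  show "{y, z, w, x} \<subseteq> H \<and> D (f y) (f z) (f w) (f x)" using h d_flip[OF d] by auto
  show "\<not> ({w, y, x, z} \<subseteq> H \<and> D (f w) (f y) (f x) (f z))" using h d_excl[OF d] by blast
qed

lemma boron_class_dstruct:
  assumes "U \<in> boron_class" shows "finite_qstruct U" "dstruct (points U) (dis U)"
proof -
  obtain T :: "nat pair_pre_digraph" and f where U: "finite_qstruct U" and T: "boron_tree T" and f: "is_isomorphism f U (hydrogen_structure T)"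
    using assms unfolding boron_class_def by blast
  show "finite_qstruct U" by fact
  let ?L = "hydrogen T" and ?E = "parcs T"
  have tg: "tree_graph T" using T unfolding boron_tree_def by blast
  then have vt: "vtree (pverts T) ?E" using tree_graph_iff_vtree by blast
  have LV: "?L \<subseteq> pverts T" unfolding hydrogen_def by blast
  let ?D = "\<lambda>w x y z. w \<in> ?L \<and> x \<in> ?L \<and> y \<in> ?L \<and> z \<in> ?L \<and> seg ?E w x \<inter> seg ?E y z = {}"
  have d: "dstruct ?L ?D"
  proof (rule dstruct_leaves[OF vt LV])
    show "card {w. (v, w) \<in> ?E} \<le> 1" if "v \<in> ?L" for v using that unfolding hydrogen_def out_degree_card by blast
    show "card {w. (v, w) \<in> ?E} \<le> 3" if "v \<in> pverts T - ?L" for v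
      using that T unfolding boron_tree_def out_degree_card by auto
  qed
  have emb: "f \<in> points U \<rightarrow> ?L" "inj_on f (points U)" and q: "\<And>w x y z. w \<in> points U \<Longrightarrow> x \<in> points U \<Longrightarrow> y \<in> points U \<Longrightarrow> z \<in> points U \<Longrightarrow>
      (w, x, y, z) \<in> quad U \<longleftrightarrow> (f w, f x, f y, f z) \<in> quad (hydrogen_structure T)"
    using f unfolding is_isomorphism_def is_embedding_def hydrogen_structure_def by (auto simp: PiE_def)
  show "dstruct (points U) (dis U)"
  proof (rule dstruct_pullback[OF d emb(2)])
    show "f ` points U \<subseteq> ?L" using emb by blast
    show "dis U w x y z \<longleftrightarrow> {w, x, y, z} \<subseteq> points U \<and> ?D (f w) (f x) (f y) (f z)" for w x y z
    proof (cases "{w, x, y, z} \<subseteq> points U")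
      case True
      then have fL: "f w \<in> ?L" "f x \<in> ?L" "f y \<in> ?L" "f z \<in> ?L" using emb by auto
      then have fV: "f w \<in> pverts T" "f x \<in> pverts T" "f y \<in> pverts T" "f z \<in> pverts T" using LV by blast+
      show ?thesis using True q[of w x y z] fL unfolding dis_def hydrogen_structure_def
        by (simp add: geodesic_eq_seg[OF tg fV(1,2)] geodesic_eq_seg[OF tg fV(3,4)])
    next
      case False
      then show ?thesis unfolding dis_def by blast
    qed
  qed
qed

section \<open>From disjointness structures to boron trees, by gluing\<close>

definition join_arcs :: "('v \<times> 'v) set \<Rightarrow> ('v \<times> 'v) set \<Rightarrow> 'v \<Rightarrow> 'v \<Rightarrow> ('v \<times> 'v) set" where
  "join_arcs E F u v = E \<union> F \<union> {(u, v), (v, u)}"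

lemma join_arcs_commute: "join_arcs E F u v = join_arcs F E v u"
  unfolding join_arcs_def by blast

text \<open>A path without repetition crosses the bridge \<open>u v\<close> at most once, as a
  return would visit \<open>u\<close> again. After the crossing the induction hypothesis is applied
  with the two trees exchanged, hence the generalisation over all parameters.\<close>

lemma join_list:
  assumes "E \<subseteq> V \<times> V" "F \<subseteq> W \<times> W" "V \<inter> W = {}" "u \<in> V" "v \<in> W"
    and "vs \<noteq> []" "distinct vs" "successively (\<lambda>a b. (a, b) \<in> join_arcs E F u v) vs" "hd vs \<in> V"
  shows "set vs \<subseteq> V \<and> successively (\<lambda>a b. (a, b) \<in> E) vs \<or>
    (\<exists>xs ys. vs = xs @ ys \<and> xs \<noteq> [] \<and> ys \<noteq> [] \<and> last xs = u \<and> hd ys = v \<and> set xs \<subseteq> V \<and> set ys \<subseteq> W \<and>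
      successively (\<lambda>a b. (a, b) \<in> E) xs \<and> successively (\<lambda>a b. (a, b) \<in> F) ys)"
  using assms
proof (induction vs arbitrary: E F V W u v)
  case (Cons a vs)
  show ?case
  proof (cases vs)
    case Nil
    then show ?thesis using Cons.prems by simp
  next
    case (Cons b ws)
    have ab: "(a, b) \<in> join_arcs E F u v" using Cons.prems(8) Cons by simp
    have aV: "a \<in> V" using Cons.prems(9) by simp
    have vs: "vs \<noteq> []" "distinct vs" "hd vs = b" using Cons Cons.prems(7) by auto
    have suc: "successively (\<lambda>a b. (a, b) \<in> join_arcs E F u v) vs" using Cons.prems(8) Cons by simp
    show ?thesis
    proof (cases "b \<in> V")
      case True
      then have E: "(a, b) \<in> E" using ab aV Cons.prems(2,3,5) unfolding join_arcs_def by blast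
      have "hd vs \<in> V" using vs(3) True by simp
      note IH = Cons.IH[OF Cons.prems(1-5) vs(1,2) suc this]
      then show ?thesis
      proof
        assume "set vs \<subseteq> V \<and> successively (\<lambda>a b. (a, b) \<in> E) vs"
        then show ?thesis using aV E Cons by simp
      next
        assume "\<exists>xs ys. vs = xs @ ys \<and> xs \<noteq> [] \<and> ys \<noteq> [] \<and> last xs = u \<and> hd ys = v \<and> set xs \<subseteq> V \<and> set ys \<subseteq> W \<and>
          successively (\<lambda>a b. (a, b) \<in> E) xs \<and> successively (\<lambda>a b. (a, b) \<in> F) ys"
        then obtain xs ys where h: "vs = xs @ ys" "xs \<noteq> []" "ys \<noteq> []" "last xs = u" "hd ys = v" "set xs \<subseteq> V" "set ys \<subseteq> W"
          "successively (\<lambda>a b. (a, b) \<in> E) xs" "successively (\<lambda>a b. (a, b) \<in> F) ys" by blast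
        have "hd xs = b" using h(1,2) vs(3) by simp
        then have "successively (\<lambda>a b. (a, b) \<in> E) (a # xs)" using h(2,8) E by (simp add: successively_Cons)
        then show ?thesis using h aV by (intro disjI2 exI[of _ "a # xs"] exI[of _ ys]) simp
      qed
    next
      case False
      have "(a, b) \<notin> E" using False Cons.prems(1) by blast
      moreover have "(a, b) \<notin> F" using aV Cons.prems(2,3) by blast
      moreover have "(a, b) \<noteq> (v, u)" using aV Cons.prems(3,5) by blast
      ultimately have eq: "a = u" "b = v" using ab unfolding join_arcs_def by blast+
      have bW: "hd vs \<in> W" using vs(3) eq Cons.prems(5) by simp
      have sym: "W \<inter> V = {}" using Cons.prems(3) by blast
      note IH = Cons.IH[OF Cons.prems(2,1) sym Cons.prems(5,4) vs(1,2) suc[unfolded join_arcs_commute[of E]] bW]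
      have "u \<notin> set vs" using Cons.prems(7) eq by simp
      moreover have "hd ys \<in> set vs" if "vs = xs @ ys" "ys \<noteq> []" for xs ys using that by simp
      ultimately have "set vs \<subseteq> W \<and> successively (\<lambda>a b. (a, b) \<in> F) vs" using IH by metis
      then show ?thesis using vs eq Cons.prems(4) by (intro disjI2 exI[of _ "[a]"] exI[of _ vs]) simp
    qed
  qed
qed simp

context
  fixes V W :: "'v set" and E F u v
  assumes T: "vtree V E" "vtree W F" and dis: "V \<inter> W = {}" and u: "u \<in> V" and v: "v \<in> W"
begin

lemma join_path_same:
  assumes "a \<in> V" "b \<in> V"
  shows "vpath (join_arcs E F u v) a vs b \<longleftrightarrow> vs = vgeo E a b"
proof
  have sub: "E \<subseteq> V \<times> V" "F \<subseteq> W \<times> W" using T by (auto simp: vtree_def)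
  assume p: "vpath (join_arcs E F u v) a vs b"
  have "set vs \<subseteq> V \<and> successively (\<lambda>a b. (a, b) \<in> E) vs"
  proof (rule ccontr)
    assume n: "\<not> ?thesis"
    have h: "vs \<noteq> []" "distinct vs" "successively (\<lambda>a b. (a, b) \<in> join_arcs E F u v) vs" "hd vs \<in> V"
      using p assms(1) unfolding vpath_def by auto
    obtain xs ys where "vs = xs @ ys" "ys \<noteq> []" "set ys \<subseteq> W" using join_list[OF sub dis u v h] n by blast
    then have "last vs \<in> W" by auto
    then show False using p assms(2) dis unfolding vpath_def by blast
  qed
  then have "vpath E a vs b" using p unfolding vpath_def by blast
  then show "vs = vgeo E a b" using vgeo_eq[OF T(1) assms] by simp
next
  assume "vs = vgeo E a b"
  then have "vpath E a vs b" using vgeo[OF T(1) assms] by simp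
  then show "vpath (join_arcs E F u v) a vs b"
    unfolding vpath_def join_arcs_def by (auto elim: successively_mono)
qed

lemma join_path_across:
  assumes "a \<in> V" "b \<in> W"
  shows "vpath (join_arcs E F u v) a vs b \<longleftrightarrow> vs = vgeo E a u @ vgeo F v b"
proof
  have sub: "E \<subseteq> V \<times> V" "F \<subseteq> W \<times> W" using T by (auto simp: vtree_def)
  assume p: "vpath (join_arcs E F u v) a vs b"
  have h: "vs \<noteq> []" "distinct vs" "successively (\<lambda>a b. (a, b) \<in> join_arcs E F u v) vs" "hd vs \<in> V"
    using p assms(1) unfolding vpath_def by auto
  have "\<not> set vs \<subseteq> V" using p assms(2) dis unfolding vpath_def by (metis disjoint_iff last_in_set subsetD)
  then obtain xs ys where x: "vs = xs @ ys" "xs \<noteq> []" "ys \<noteq> []" "last xs = u" "hd ys = v"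
     "successively (\<lambda>a b. (a, b) \<in> E) xs" "successively (\<lambda>a b. (a, b) \<in> F) ys"
    using join_list[OF sub dis u v h] by blast
  have "vpath E a xs u" "vpath F v ys b" using p x unfolding vpath_def by auto
  then show "vs = vgeo E a u @ vgeo F v b" using x(1) vgeo_eq[OF T(1) assms(1) u] vgeo_eq[OF T(2) v assms(2)] by simp
next
  assume vs: "vs = vgeo E a u @ vgeo F v b"
  have p: "vpath E a (vgeo E a u) u" "vpath F v (vgeo F v b) b" using vgeo[OF T(1) assms(1) u] vgeo[OF T(2) v assms(2)] by auto
  have "set (vgeo E a u) \<inter> set (vgeo F v b) = {}"
    using seg_V[OF T(1) assms(1) u] seg_V[OF T(2) v assms(2)] dis unfolding seg_def by blast
  moreover have "successively (\<lambda>a b. (a, b) \<in> join_arcs E F u v) (vgeo E a u)"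
    "successively (\<lambda>a b. (a, b) \<in> join_arcs E F u v) (vgeo F v b)"
    using p unfolding vpath_def join_arcs_def by (auto elim: successively_mono)
  moreover have "(u, v) \<in> join_arcs E F u v" unfolding join_arcs_def by blast
  ultimately show "vpath (join_arcs E F u v) a vs b"
    using p unfolding vs vpath_def by (auto simp: successively_append_iff)
qed

end

context
  fixes V W :: "'v set" and E F u v
  assumes T: "vtree V E" "vtree W F" and dis: "V \<inter> W = {}" and u: "u \<in> V" and v: "v \<in> W"
begin

lemma vtree_join: "vtree (V \<union> W) (join_arcs E F u v)"
proof -
  have dis': "W \<inter> V = {}" using dis by blast
  have c: "join_arcs E F u v = join_arcs F E v u" by (rule join_arcs_commute)
  have "\<exists>!vs. vpath (join_arcs E F u v) a vs b" if ab: "a \<in> V \<union> W" "b \<in> V \<union> W" for a b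
  proof -
    consider "a \<in> V" "b \<in> V" | "a \<in> V" "b \<in> W" | "a \<in> W" "b \<in> V" | "a \<in> W" "b \<in> W" using ab by blast
    then show ?thesis
    proof cases
      case 1 then show ?thesis using join_path_same[OF T dis u v] by simp
    next
      case 2 then show ?thesis using join_path_across[OF T dis u v] by simp
    next
      case 3 then show ?thesis unfolding c using join_path_across[OF T(2,1) dis' v u] by simp
    next
      case 4 then show ?thesis unfolding c using join_path_same[OF T(2,1) dis' v u] by simp
    qed
  qed
  moreover have "sym (join_arcs E F u v)" using T unfolding vtree_def join_arcs_def sym_def by blast
  moreover have "irrefl (join_arcs E F u v)" using T dis u v unfolding vtree_def join_arcs_def irrefl_def by blast
  moreover have "join_arcs E F u v \<subseteq> (V \<union> W) \<times> (V \<union> W)" using T u v unfolding vtree_def join_arcs_def by blast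
  moreover have "finite (V \<union> W)" using T unfolding vtree_def by blast
  ultimately show ?thesis unfolding vtree_def by blast
qed

lemma seg_join_same: "a \<in> V \<Longrightarrow> b \<in> V \<Longrightarrow> seg (join_arcs E F u v) a b = seg E a b"
  using seg_eq[OF vtree_join, of a b "vgeo E a b"] join_path_same[OF T dis u v] by (simp add: seg_def)

lemma seg_join_across: "a \<in> V \<Longrightarrow> b \<in> W \<Longrightarrow> seg (join_arcs E F u v) a b = seg E a u \<union> seg F v b"
  using seg_eq[OF vtree_join, of a b "vgeo E a u @ vgeo F v b"] join_path_across[OF T dis u v] by (simp add: seg_def)

lemma join_neighbours: "a \<in> V \<Longrightarrow> {w. (a, w) \<in> join_arcs E F u v} = {w. (a, w) \<in> E} \<union> (if a = u then {v} else {})"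
  using T dis u v unfolding join_arcs_def vtree_def by auto

lemma join_degree:
  assumes "a \<in> V" shows "card {w. (a, w) \<in> join_arcs E F u v} = card {w. (a, w) \<in> E} + (if a = u then 1 else 0)"
proof -
  have "{w. (a, w) \<in> E} \<subseteq> V" "finite V" using T unfolding vtree_def by blast+
  then have "finite {w. (a, w) \<in> E}" "v \<notin> {w. (a, w) \<in> E}" using finite_subset v dis by blast+
  then show ?thesis unfolding join_neighbours[OF assms] by (cases "a = u") simp_all
qed

end

lemma vtree_singleton: "vtree {n} {}" "seg {} n n = {n}"
proof -
  have "vpath {} n vs n \<longleftrightarrow> vs = [n]" for vs :: "'a list"
  proof
    assume h: "vpath {} n vs n"
    then obtain ws where "vs = n # ws" unfolding vpath_def by (metis list.collapse)
    then show "vs = [n]" using h unfolding vpath_def by (cases ws) auto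
  qed (simp add: vpath_def)
  then show T: "vtree {n} {}" unfolding vtree_def by (simp add: sym_def irrefl_def)
  show "seg {} n n = {n}" using seg_refl[OF T] by simp
qed

text \<open>
  A tree for the structure on \<open>insert x H\<close> from which the leaf \<open>x\<close> has been cut off: the root \<open>r\<close> is
  the former neighbour of \<open>x\<close>, so its valence counts one more. Two such trees are glued by joining their
  roots to a new root.
\<close>

definition rooted_model ::
  "'a set \<Rightarrow> ('a \<Rightarrow> 'a \<Rightarrow> 'a \<Rightarrow> 'a \<Rightarrow> bool) \<Rightarrow> 'a \<Rightarrow> 'v set \<Rightarrow> ('v \<times> 'v) set \<Rightarrow> 'v \<Rightarrow> ('a \<Rightarrow> 'v) \<Rightarrow> bool" where
  "rooted_model H D x V E r f \<longleftrightarrow> vtree V E \<and> r \<in> V \<and> inj_on f H \<and> f ` H \<subseteq> V \<and>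
     (\<forall>v\<in>V. card {w. (v, w) \<in> E} + (if v = r then 1 else 0) = (if v \<in> f ` H then 1 else 3)) \<and>
     (\<forall>a\<in>H. \<forall>b\<in>H. \<forall>c\<in>H. (D a b x c \<longleftrightarrow> seg E (f a) (f b) \<inter> seg E r (f c) = {}) \<and>
       (\<forall>d\<in>H. D a b c d \<longleftrightarrow> seg E (f a) (f b) \<inter> seg E (f c) (f d) = {}))"

text \<open>The new root \<open>n\<close> is the vertex to which \<open>x\<close> is attached, with
  branches \<open>A\<close> and \<open>B\<close>. Geodesics within a branch are those of its model,
  geodesics from \<open>n\<close> are those from the branch root with \<open>n\<close> added, and
  geodesics between the branches are unions of two such. The result is compared case by case with
  what \<open>edge_at_det\<close> and the split \<open>A | B\<close> prescribe.\<close>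

lemma join_models:
  assumes d: "dstruct (insert x H) D" and x: "x \<notin> H" and e: "edge_at D H x A B"
    and M: "rooted_model A D x V E r f" "rooted_model B D x W F s g" and dis: "V \<inter> W = {}" and n: "n \<notin> V" "n \<notin> W"
  shows "rooted_model H D x (insert n (V \<union> W)) (join_arcs (join_arcs {} E n r) F n s) n (\<lambda>a. if a \<in> A then f a else g a)"
proof -
  let ?J = "join_arcs {} E n r" and ?h = "\<lambda>a. if a \<in> A then f a else g a"
  let ?K = "join_arcs ?J F n s"
  note parts = edge_at_parts[OF e]
  have TV: "vtree V E" "vtree W F" "r \<in> V" "s \<in> W" "inj_on f A" "inj_on g B" "f ` A \<subseteq> V" "g ` B \<subseteq> W"
    using M unfolding rooted_model_def by simp_all
  have d1: "{n} \<inter> V = {}" "insert n V \<inter> W = {}" "W \<inter> insert n V = {}" "V \<inter> {n} = {}" using n dis by auto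
  note J1 = vtree_singleton(1)[of n] TV(1) d1(1) singletonI[of n] TV(3)
  note J1' = TV(1) vtree_singleton(1)[of n] d1(4) TV(3) singletonI[of n] 
  have J: "vtree (insert n V) ?J" using vtree_join[OF J1] by simp
  note J2 = J TV(2) d1(2) insertI1[of n V] TV(4)
  note J2' = TV(2) J d1(3) TV(4) insertI1[of n V]
  have c1: "?J = join_arcs E {} r n" and c2: "?K = join_arcs F ?J s n" by (rule join_arcs_commute)+
  have K: "vtree (insert n (V \<union> W)) ?K" using vtree_join[OF J2] by simp
  have hV: "?h a \<in> V" if "a \<in> A" for a using that TV(7) by auto
  have hB: "?h b = g b" if "b \<in> B" for b using that parts(3) by auto
  have hW: "?h b \<in> W" if "b \<in> B" for b using hB[OF that] that TV(8) by auto
  have sAA: "seg ?K (?h a) (?h b) = seg E (f a) (f b)" if "a \<in> A" "b \<in> A" for a b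
    using seg_join_same[OF J2, of "f a" "f b"] seg_join_same[OF J1', of "f a" "f b"] hV[OF that(1)] hV[OF that(2)] that
    unfolding c1 by simp
  have sBB: "seg ?K (?h a) (?h b) = seg F (g a) (g b)" if "a \<in> B" "b \<in> B" for a b
    using seg_join_same[OF J2', of "g a" "g b"] hW[OF that(1)] hW[OF that(2)] hB[OF that(1)] hB[OF that(2)] unfolding c2 by simp
  have snA: "seg ?K n (?h a) = insert n (seg E r (f a))" if "a \<in> A" for a
    using seg_join_same[OF J2, of n "f a"] seg_join_across[OF J1, of n "f a"] hV[OF that] that by (simp add: vtree_singleton(2))
  have snB: "seg ?K n (?h b) = insert n (seg F s (g b))" if "b \<in> B" for b
    using seg_join_across[OF J2, of n "g b"] hW[OF that] hB[OF that] seg_refl[OF J, of n] by simp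
  have hK: "?h a \<in> insert n (V \<union> W)" if "a \<in> H" for a using that hV[of a] hW[of a] parts(4) by blast
  have sAB: "seg ?K (?h a) (?h b) = seg ?K n (?h a) \<union> seg ?K n (?h b)" if "a \<in> A" "b \<in> B" for a b
  proof -
    have "seg ?K (?h a) (?h b) = seg ?J (f a) n \<union> seg F s (g b)"
      using seg_join_across[OF J2, of "f a" "g b"] hV[OF that(1)] hW[OF that(2)] hB[OF that(2)] that by simp
    moreover have "seg ?J (f a) n = seg ?J n (f a)" using seg_sym[OF J] hV[OF that(1)] that by simp
    moreover have "seg ?J n (f a) = seg ?K n (?h a)" using seg_join_same[OF J2, of n "f a"] hV[OF that(1)] that by simp
    moreover have "n \<in> seg ?K n (?h a)" using snA[OF that(1)] by simp
    ultimately show ?thesis unfolding snB[OF that(2)] by (metis Un_insert_right Un_insert_left insert_absorb)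
  qed
  have segV: "seg E (f a) (f b) \<subseteq> V" if "a \<in> A" "b \<in> A" for a b using seg_V[OF TV(1)] TV(7) that by blast
  have segW: "seg F (g a) (g b) \<subseteq> W" if "a \<in> B" "b \<in> B" for a b using seg_V[OF TV(2)] TV(8) that by blast
  have segVr: "seg E r (f a) \<subseteq> V" if "a \<in> A" for a using seg_V[OF TV(1,3)] TV(7) that by blast
  have segWr: "seg F s (g a) \<subseteq> W" if "a \<in> B" for a using seg_V[OF TV(2,4)] TV(8) that by blast
  \<comment> \<open>\<open>S\<close> gives the geodesics between leaves and \<open>R\<close> those
    from the root. The facts \<open>loc\<close>, \<open>far\<close> and \<open>cross\<close> about
    them replace the trees in the case analysis.\<close>
  define S where "S a b = seg ?K (?h a) (?h b)" for a b
  define R where "R a = seg ?K n (?h a)" for a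
  have Ssym: "S a b = S b a" if "a \<in> H" "b \<in> H" for a b unfolding S_def using seg_sym[OF K hK hK] that by blast
  have SR: "a \<in> A \<Longrightarrow> b \<in> A \<Longrightarrow> S a b = seg E (f a) (f b)" "a \<in> B \<Longrightarrow> b \<in> B \<Longrightarrow> S a b = seg F (g a) (g b)"
    "a \<in> A \<Longrightarrow> R a = insert n (seg E r (f a))" "a \<in> B \<Longrightarrow> R a = insert n (seg F s (g a))" for a b
    unfolding S_def R_def using sAA sBB snA snB by blast+
  have loc: "(D a b x c \<longleftrightarrow> S a b \<inter> R c = {}) \<and> (e \<in> Z \<longrightarrow> (D a b c e \<longleftrightarrow> S a b \<inter> S c e = {}))"
    if "Z = A \<or> Z = B" "a \<in> Z" "b \<in> Z" "c \<in> Z" for Z a b c e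
    using that(1)
  proof
    assume Z: "Z = A"
    have "n \<notin> seg E (f a) (f b)" using segV that Z n by blast
    then show ?thesis using M(1) that unfolding Z rooted_model_def
      by (simp add: SR)
  next
    assume Z: "Z = B"
    have "n \<notin> seg F (g a) (g b)" using segW that Z n by blast
    then show ?thesis using M(2) that unfolding Z rooted_model_def
      by (simp add: SR)
  qed
  have far: "S a b \<inter> R c = {} \<and> (e \<in> Y \<longrightarrow> S a b \<inter> S c e = {})"
    if ZY: "Z = A \<and> Y = B \<or> Z = B \<and> Y = A" and m: "a \<in> Z" "b \<in> Z" "c \<in> Y" for Z Y a b c e
    using ZY
  proof
    assume Z: "Z = A \<and> Y = B"
    then have "S a b \<subseteq> V" "R c \<subseteq> insert n W"
      using SR(1)[of a b] SR(4)[of c] segV[of a b] segWr[of c] m by auto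
    moreover have "S c e \<subseteq> W" if "e \<in> Y" using Z m that SR(2)[of c e] segW[of c e] by simp
    ultimately show ?thesis using dis n by blast
  next
    assume Z: "Z = B \<and> Y = A"
    then have "S a b \<subseteq> W" "R c \<subseteq> insert n V"
      using SR(2)[of a b] SR(3)[of c] segW[of a b] segVr[of c] m by auto
    moreover have "S c e \<subseteq> V" if "e \<in> Y" using Z m that SR(1)[of c e] segV[of c e] by simp
    ultimately show ?thesis using dis n by blast
  qed
  have cross: "S a b = R a \<union> R b \<and> n \<in> R a \<and> n \<in> R b" if "Z = A \<and> Y = B \<or> Z = B \<and> Y = A" "a \<in> Z" "b \<in> Y" for Z Y a b
    using that(1)
  proof
    assume Z: "Z = A \<and> Y = B"
    then show ?thesis using sAB[of a b] SR(3)[of a] SR(4)[of b] that unfolding S_def[symmetric] R_def[symmetric] by simp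
  next
    assume Z: "Z = B \<and> Y = A"
    then have "S b a = R b \<union> R a" "n \<in> R a" "n \<in> R b"
      using sAB[of b a] SR(3)[of b] SR(4)[of a] that unfolding S_def[symmetric] R_def[symmetric] by simp_all
    then show ?thesis using Ssym[of a b] that Z parts(5,6) by blast
  qed
  have main: "(D a b x c \<longleftrightarrow> S a b \<inter> R c = {}) \<and> (D a b c e \<longleftrightarrow> S a b \<inter> S c e = {})"
    if ZY: "Z = A \<and> Y = B \<or> Z = B \<and> Y = A" and m: "a \<in> Z" "b \<in> Z" "c \<in> H" "e \<in> H" for Z Y a b c e
  proof -
    have edge: "edge_at D H x Z Y" using ZY e edge_at_sym[OF e] by blast
    have ZA: "Z = A \<or> Z = B" using ZY by blast
    have un: "Z \<union> Y = H" using edge_at_parts(4)[OF edge] .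
    note det = edge_at_det[OF d edge x m(1)]
    have sp: "split H D Z Y" using split_edge_at[OF d edge] .
    consider "c \<in> Z" "e \<in> Z" | "c \<in> Z" "e \<in> Y" | "c \<in> Y" "e \<in> Z" | "c \<in> Y" "e \<in> Y" using m un by blast
    then show ?thesis
    proof cases
      case 1
      then show ?thesis using loc[OF ZA m(1,2)] by blast
    next
      case 2
      have "D a b x c \<longleftrightarrow> D a b c e" using edge_at_det(3)[OF d edge x m(1,2) 2] .
      \<comment> \<open>The part of the geodesic \<open>c e\<close> beyond the root misses
        \<open>S a b\<close>, so only the piece from the root to \<open>c\<close> counts.\<close>
      moreover have "S a b \<inter> S c e = S a b \<inter> R c" using cross[OF ZY 2] far[OF ZY m(1,2) 2(2)] by blast
      ultimately show ?thesis using loc[OF ZA m(1,2) 2(1)] by simp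
    next
      case 3
      have "D a b x e \<longleftrightarrow> D a b e c" using edge_at_det(3)[OF d edge x m(1,2) 3(2,1)] .
      moreover have "S a b \<inter> S c e = S a b \<inter> R e" using cross[OF ZY 3(2,1)] far[OF ZY m(1,2) 3(1)] Ssym[OF m(3,4)] by blast
      moreover have "D a b x c" using edge_at_det(2)[OF d edge x m(1,2) 3(1)] .
      ultimately show ?thesis using loc[OF ZA m(1,2) 3(2)] far[OF ZY m(1,2) 3(1)] d_swap'[OF d] by metis
    next
      case 4
      have "D a b x c" using edge_at_det(2)[OF d edge x m(1,2) 4(1)] .
      moreover have "D a b c e" using sp m 4 unfolding split_def by blast
      ultimately show ?thesis using far[OF ZY m(1,2) 4(1)] 4(2) by blast
    qed
  qed
  \<comment> \<open>The geodesic between leaves of different branches passes through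
    \<open>n\<close>, so it meets every other geodesic through \<open>n\<close>.\<close>
  have main2: "(D a b x c \<longleftrightarrow> S a b \<inter> R c = {}) \<and> (D a b c e \<longleftrightarrow> S a b \<inter> S c e = {})"
    if ZY: "Z = A \<and> Y = B \<or> Z = B \<and> Y = A" and m: "a \<in> Z" "b \<in> Y" "c \<in> H" "e \<in> H" for Z Y a b c e
  proof -
    have edge: "edge_at D H x Z Y" using ZY e edge_at_sym[OF e] by blast
    have YZ: "Y = A \<and> Z = B \<or> Y = B \<and> Z = A" using ZY by blast
    have un: "Z \<union> Y = H" using edge_at_parts(4)[OF edge] .
    have ab: "a \<in> H" "b \<in> H" using m un by blast+
    have sp: "split H D Z Y" using split_edge_at[OF d edge] .
    have n1: "n \<in> S a b" using cross[OF ZY m(1,2)] by blast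
    have "n \<in> R c" using cross[OF ZY, of c b] cross[OF ZY, of a c] m un by blast
    moreover have "\<not> D a b x c" using edge_at_det(1)[OF d edge x m(1,2,3)] .
    ultimately have 1: "D a b x c \<longleftrightarrow> S a b \<inter> R c = {}" using n1 by blast
    consider "c \<in> Z" "e \<in> Z" | "c \<in> Y" "e \<in> Y" | "c \<in> Z" "e \<in> Y" | "c \<in> Y" "e \<in> Z" using m un by blast
    then have "D a b c e \<longleftrightarrow> S a b \<inter> S c e = {}"
    proof cases
      case 1
      then have "D c e a b \<longleftrightarrow> S c e \<inter> S a b = {}" using main[OF ZY 1 ab] by blast
      then show ?thesis using d_flip[OF d] by (metis Int_commute)
    next
      case 2
      then have "D c e a b \<longleftrightarrow> S c e \<inter> S a b = {}" using main[OF YZ 2 ab] by blast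
      then show ?thesis using d_flip[OF d] by (metis Int_commute)
    next
      case 3
      have "D a c b e" using sp m 3 unfolding split_def by blast
      then have "\<not> D a b c e" using d_excl[OF d] by blast
      moreover have "n \<in> S c e" using cross[OF ZY 3] by blast
      ultimately show ?thesis using n1 by blast
    next
      case 4
      have "D a e b c" using sp m 4 unfolding split_def by blast
      then have "\<not> D a b c e" using d_excl[OF d] d_swap'[OF d] by blast
      moreover have "n \<in> S c e" using cross[OF YZ 4] by blast
      ultimately show ?thesis using n1 by blast
    qed
    then show ?thesis using 1 by blast
  qed
  have rel: "(D a b x c \<longleftrightarrow> S a b \<inter> R c = {}) \<and> (D a b c e \<longleftrightarrow> S a b \<inter> S c e = {})" if h: "a \<in> H" "b \<in> H" "c \<in> H" "e \<in> H" for a b c e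
  proof -
    consider "a \<in> A" "b \<in> A" | "a \<in> B" "b \<in> B" | "a \<in> A" "b \<in> B" | "a \<in> B" "b \<in> A" using h parts(4) by blast
    then show ?thesis
    proof cases
      case 1 then show ?thesis using main[of A B] h by blast
    next
      case 2 then show ?thesis using main[of B A] h by blast
    next
      case 3 then show ?thesis using main2[of A B] h by blast
    next
      case 4 then show ?thesis using main2[of B A] h by blast
    qed
  qed
  have hH: "?h ` H = f ` A \<union> g ` B"
  proof -
    have "?h ` A = f ` A" "?h ` B = g ` B" using hB by (auto simp: image_iff)
    moreover have "?h ` H = ?h ` A \<union> ?h ` B" unfolding parts(4)[symmetric] by (rule image_Un)
    ultimately show ?thesis by simp
  qed
  have inj: "inj_on ?h H"
  proof (rule inj_onI)
    fix a b assume h: "a \<in> H" "b \<in> H" "?h a = ?h b"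
    have *: "a \<in> A" if "a \<in> H" "b \<in> A" "?h a = ?h b" for a b
    proof (rule ccontr)
      assume "a \<notin> A"
      then have "a \<in> B" using that(1) parts(4) by blast
      then have "?h a \<in> W" by (rule hW)
      moreover have "?h b \<in> V" using that(2) by (rule hV)
      ultimately show False using dis that(3) by auto
    qed
    show "a = b"
    proof (cases "a \<in> A")
      case True
      then have "b \<in> A" using *[OF h(2) True] h(3) by simp
      then show ?thesis using True h(3) TV(5) by (simp add: inj_onD)
    next
      case False
      then have "b \<notin> A" using *[OF h(1) _ h(3)] by blast
      then have "a \<in> B" "b \<in> B" "g a = g b" using False h parts(4) by auto
      then show ?thesis using TV(6) by (simp add: inj_onD)
    qed
  qed
  have sub: "?h ` H \<subseteq> insert n (V \<union> W)" using hK by blast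
  have deg: "card {w. (v, w) \<in> ?K} + (if v = n then 1 else 0) = (if v \<in> ?h ` H then 1 else 3)" if v: "v \<in> insert n (V \<union> W)" for v
  proof -
    consider "v = n" | "v \<in> V" | "v \<in> W" using v by blast
    then show ?thesis
    proof cases
      case 1
      have "card {w. (n, w) \<in> ?K} = 2" using join_degree[OF J2, of n] join_degree[OF J1, of n] by simp
      moreover have "n \<notin> ?h ` H" unfolding hH using TV(7,8) n by blast
      ultimately show ?thesis using 1 by simp
    next
      case 2
      then have "v \<noteq> n" "v \<notin> g ` B" using n dis TV(8) by blast+
      moreover have "card {w. (v, w) \<in> ?K} = card {w. (v, w) \<in> E} + (if v = r then 1 else 0)"
        using join_degree[OF J2, of v] join_degree[OF J1', of v] 2 \<open>v \<noteq> n\<close> unfolding c1 by simp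
      moreover have "card {w. (v, w) \<in> E} + (if v = r then 1 else 0) = (if v \<in> f ` A then 1 else 3)"
        using M(1) 2 unfolding rooted_model_def by blast
      ultimately show ?thesis unfolding hH by simp
    next
      case 3
      then have "v \<noteq> n" "v \<notin> f ` A" using n dis TV(7) by blast+
      moreover have "card {w. (v, w) \<in> ?K} = card {w. (v, w) \<in> F} + (if v = s then 1 else 0)"
        using join_degree[OF J2', of v] 3 unfolding c2 by simp
      moreover have "card {w. (v, w) \<in> F} + (if v = s then 1 else 0) = (if v \<in> g ` B then 1 else 3)"
        using M(2) 3 unfolding rooted_model_def by blast
      ultimately show ?thesis unfolding hH by simp
    qed
  qed
  show ?thesis unfolding rooted_model_def using K inj sub deg rel unfolding S_def R_def by simp
qed

lemma rooted_model_cong: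
  assumes "\<And>a b c. a \<in> H \<Longrightarrow> b \<in> H \<Longrightarrow> c \<in> H \<Longrightarrow> D a b x c \<longleftrightarrow> D' a b x c"
    and "\<And>a b c e. a \<in> H \<Longrightarrow> b \<in> H \<Longrightarrow> c \<in> H \<Longrightarrow> e \<in> H \<Longrightarrow> D a b c e \<longleftrightarrow> D' a b c e"
  shows "rooted_model H D x V E r f \<longleftrightarrow> rooted_model H D' x V E r f"
  unfolding rooted_model_def using assms by simp

text \<open>The edge of \<open>x\<close> splits the leaves into the two branches at the root, and
  induction supplies a model for each. The lower bound \<open>n\<close> on the vertices is carried
  along so that the second branch can be built above all vertices of the first, which keeps the two
  disjoint and leaves \<open>n\<close> free for the root.\<close>

lemma rooted_model_exists:
  assumes "finite H" "H \<noteq> {}" "x \<notin> H" "dstruct (insert x H) D"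
  shows "\<exists>V E r f. V \<subseteq> {n::nat..} \<and> rooted_model H D x V E r f"
  using assms
proof (induction "card H" arbitrary: H D n rule: less_induct)
  case less
  show ?case
  proof (cases "card H = 1")
    case True
    then obtain a where a: "H = {a}" by (meson card_1_singletonE)
    have "\<not> D a a x a" "\<not> D a a a a" using d_ne[OF less.prems(4)] by blast+
    \<comment> \<open>The single vertex is both root and leaf: its valence zero counts one more for
      the missing edge to \<open>x\<close>.\<close>
    then have "rooted_model H D x {n} {} n (\<lambda>_. n)"
      unfolding rooted_model_def a using vtree_singleton[of n] by simp
    moreover have "{n} \<subseteq> {n..}" by simp
    ultimately show ?thesis by blast
  next
    case False
    then have c: "2 \<le> card H" using less.prems by (metis One_nat_def Suc_leI card_gt_0_iff le_neq_implies_less numeral_2_eq_2)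
    obtain A B where e: "edge_at D H x A B" using edge_at_exists[OF less.prems(4,1) refl less.prems(3) c] .
    note parts = edge_at_parts[OF e]
    have *: "\<exists>V E r f. V \<subseteq> {m..} \<and> rooted_model Z D x V E r f" if "Z \<subseteq> H" "Z \<noteq> H" "Z \<noteq> {}" for Z and m :: nat
    proof -
      have x: "x \<notin> Z" "finite Z" using that less.prems finite_subset by blast+
      have "dstruct (insert x Z) (rel_restrict (insert x Z) D)" by (rule dstruct_restrict[OF less.prems(4)]) (use that in blast)
      then have "\<exists>V E r f. V \<subseteq> {m..} \<and> rooted_model Z (rel_restrict (insert x Z) D) x V E r f"
        using less.hyps[of Z] that x psubset_card_mono[OF less.prems(1)] by blast
      moreover have "rooted_model Z (rel_restrict (insert x Z) D) x V E r f \<longleftrightarrow> rooted_model Z D x V E r f" for V E r and f :: "_ \<Rightarrow> nat"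
        by (rule rooted_model_cong) (auto simp: rel_restrict_def)
      ultimately show ?thesis by simp
    qed
    obtain V E r f where 1: "V \<subseteq> {Suc n..}" "rooted_model A D x V E r f" using *[of A "Suc n"] parts by blast
    have fin: "finite V" using 1 unfolding rooted_model_def vtree_def by blast
    obtain W F s g where 2: "W \<subseteq> {Suc (Max (insert n V))..}" "rooted_model B D x W F s g" using *[of B] parts by blast
    have big: "w > n \<and> w > v" if "w \<in> W" "v \<in> V" for w v
    proof -
      have "Suc (Max (insert n V)) \<le> w" using that 2(1) by auto
      moreover have "n \<le> Max (insert n V)" "v \<le> Max (insert n V)" using fin that by auto
      ultimately show ?thesis by linarith
    qed
    have rV: "r \<in> V" using 1 unfolding rooted_model_def by blast
    have dis: "V \<inter> W = {}" "n \<notin> V" "n \<notin> W" using big rV 1(1) by force+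
    have "insert n (V \<union> W) \<subseteq> {n..}" using 1(1) big rV by force
    then show ?thesis using join_models[OF less.prems(4,3) e 1(2) 2(2) dis] by blast
  qed
qed

text \<open>The leaf \<open>x\<close> is put back as a new vertex \<open>n\<close> joined to the
  root, which turns the corrected valences of the model into actual ones.\<close>

lemma boron_tree_from_model:
  fixes V :: "nat set"
  assumes d: "dstruct (insert x H) D" and x: "x \<notin> H" and M: "rooted_model H D x V E r f" and n: "n \<notin> V"
  shows "\<exists>T g. boron_tree (T :: nat pair_pre_digraph) \<and> inj_on g (insert x H) \<and> g ` insert x H = hydrogen T \<and>
    (\<forall>a\<in>insert x H. \<forall>b\<in>insert x H. \<forall>c\<in>insert x H. \<forall>e\<in>insert x H.
       D a b c e \<longleftrightarrow> geodesic T (g a) (g b) \<inter> geodesic T (g c) (g e) = {})"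
proof -
  let ?J = "join_arcs {} E n r"
  let ?T = "\<lparr>pverts = insert n V, parcs = ?J\<rparr>" and ?g = "f(x := n)"
  have TV: "vtree V E" "r \<in> V" "inj_on f H" "f ` H \<subseteq> V" using M unfolding rooted_model_def by simp_all
  have d1: "{n} \<inter> V = {}" "V \<inter> {n} = {}" using n by auto
  note J1 = vtree_singleton(1)[of n] TV(1) d1(1) singletonI[of n] TV(2)
  note J1' = TV(1) vtree_singleton(1)[of n] d1(2) TV(2) singletonI[of n] 
  have c1: "?J = join_arcs E {} r n" by (rule join_arcs_commute)
  have J: "vtree (insert n V) ?J" using vtree_join[OF J1] by simp
  have tg: "tree_graph ?T" using J by (simp add: tree_graph_iff_vtree)
  have deg: "out_degree (with_proj ?T) v = (if v \<in> insert n (f ` H) then 1 else 3)" if "v \<in> insert n V" for v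
  proof (cases "v = n")
    case True
    then show ?thesis using join_degree[OF J1, of n] by (simp add: out_degree_card)
  next
    case False
    then have v: "v \<in> V" using that by blast
    have "card {w. (v, w) \<in> E} + (if v = r then 1 else 0) = (if v \<in> f ` H then 1 else 3)"
      using M v unfolding rooted_model_def by blast
    then show ?thesis using join_degree[OF J1' v] False unfolding c1 by (simp add: out_degree_card)
  qed
  have sub: "insert n (f ` H) \<subseteq> insert n V" using TV(4) by blast
  have hyd: "hydrogen ?T = insert n (f ` H)" 
  proof -
    have "v \<in> hydrogen ?T \<longleftrightarrow> v \<in> insert n (f ` H)" for v
    proof (cases "v \<in> insert n V")
      case True then show ?thesis unfolding hydrogen_def using deg[OF True] by simp
    next
      case False then show ?thesis unfolding hydrogen_def using sub by auto
    qed
    then show ?thesis by blast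
  qed
  have bt: "boron_tree ?T" unfolding boron_tree_def using tg deg hyd by auto
  have g: "?g ` insert x H = insert n (f ` H)" using x by auto
  have inj: "inj_on ?g (insert x H)" using TV(3,4) n x by (auto simp: inj_on_def)
  have gV: "?g a \<in> insert n V" if "a \<in> insert x H" for a using that TV(4) by auto
  have geo: "geodesic ?T (?g a) (?g b) = seg ?J (?g a) (?g b)" if "a \<in> insert x H" "b \<in> insert x H" for a b
    using geodesic_eq_seg[OF tg, of "?g a" "?g b"] gV[OF that(1)] gV[OF that(2)] by simp
  define S where "S a b = seg ?J (?g a) (?g b)" for a b
  have Ssym: "S a b = S b a" if "a \<in> insert x H" "b \<in> insert x H" for a b
    unfolding S_def using seg_sym[OF J gV[OF that(1)] gV[OF that(2)]] .
  have fV: "f a \<in> V" if "a \<in> H" for a using TV(4) that by blast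
  have ax: "a \<noteq> x" if "a \<in> H" for a using that x by blast
  have SH: "S a b = seg E (f a) (f b)" if "a \<in> H" "b \<in> H" for a b
    unfolding S_def c1 using seg_join_same[OF J1' fV[OF that(1)] fV[OF that(2)]] ax that by simp
  have Sx: "S x a = insert n (seg E r (f a))" if "a \<in> H" for a
    unfolding S_def using seg_join_across[OF J1 singletonI fV[OF that]] ax[OF that] by (simp add: vtree_singleton(2))
  have Sxx: "S x x = {n}" unfolding S_def using seg_refl[OF J, of n] by simp
  have SV: "n \<notin> S a b" if "a \<in> H" "b \<in> H" for a b using SH[OF that] seg_V[OF TV(1) fV fV] that n by blast
  have 0: "D a b c e \<longleftrightarrow> S a b \<inter> S c e = {}" if "a \<in> H" "b \<in> H" "c \<in> H" "e \<in> H" for a b c e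
    using M that SH unfolding rooted_model_def by simp
  have 1: "D a b x e \<longleftrightarrow> S a b \<inter> S x e = {}" if "a \<in> H" "b \<in> H" "e \<in> insert x H" for a b e
  proof (cases "e = x")
    case True
    have "D x x a b" using d_deg[OF d, of x a b] that ax by blast
    then have "D a b x x" using d_flip[OF d] by blast
    then show ?thesis using True SV[OF that(1,2)] Sxx by simp
  next
    case False
    then have e: "e \<in> H" using that by blast
    then have "D a b x e \<longleftrightarrow> S a b \<inter> seg E r (f e) = {}" using M that SH unfolding rooted_model_def by simp
    then show ?thesis using Sx[OF e] SV[OF that(1,2)] by simp
  qed
  have nS: "n \<in> S x e" if "e \<in> insert x H" for e using that Sx Sxx by auto
  have rel: "D a b c e \<longleftrightarrow> S a b \<inter> S c e = {}"
    if h: "a \<in> insert x H" "b \<in> insert x H" "c \<in> insert x H" "e \<in> insert x H" for a b c e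
  proof -
    have A: "D a b c e \<longleftrightarrow> S a b \<inter> S c e = {}" if "a \<in> H" "b \<in> H" "c \<in> insert x H" "e \<in> insert x H" for a b c e
    proof -
      have "c \<in> H \<and> e \<in> H \<or> c = x \<or> e = x" using that by blast
      then consider "c \<in> H" "e \<in> H" | "c = x" | "e = x" by blast
      then show ?thesis
      proof cases
        case 1 then show ?thesis using 0 that by blast
      next
        case 2 then show ?thesis using \<open>\<And>e b a. a \<in> H \<Longrightarrow> b \<in> H \<Longrightarrow> e \<in> insert x H \<Longrightarrow> D a b x e \<longleftrightarrow> S a b \<inter> S x e = {}\<close> that by blast
      next
        case 3 then show ?thesis using 1[OF that(1,2,3)] d_swap'[OF d] Ssym that by metis
      qed
    qed
    consider "a \<in> H" "b \<in> H" | "c \<in> H" "e \<in> H" | "a = x \<or> b = x" "c = x \<or> e = x" using h by blast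
    then show ?thesis
    proof cases
      case 1 then show ?thesis using A h by blast
    next
      case 2 
      then have "D c e a b \<longleftrightarrow> S c e \<inter> S a b = {}" using A h by blast
      then show ?thesis using d_flip[OF d] by (metis Int_commute)
    next
      case 3
      then have "n \<in> S a b" "n \<in> S c e" using nS Ssym h by metis+
      moreover have "\<not> D a b c e" using 3 d_ne[OF d] by metis
      ultimately show ?thesis by blast
    qed
  qed
  show ?thesis
    by (rule exI[of _ ?T], rule exI[of _ ?g]) (use bt inj g hyd geo rel in \<open>simp add: S_def del: fun_upd_apply\<close>)
qed

lemma vtree_small_boron: "boron_tree \<lparr>pverts = {}, parcs = {}\<rparr>" "boron_tree \<lparr>pverts = {n}, parcs = {}\<rparr>"
  "hydrogen \<lparr>pverts = {}, parcs = {}\<rparr> = {}" "hydrogen \<lparr>pverts = {n}, parcs = {}\<rparr> = {n}"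
  using vtree_singleton(1)[of n]
  by (auto simp: boron_tree_def hydrogen_def tree_graph_iff_vtree out_degree_card vtree_def sym_def irrefl_def)

lemma dstruct_boron_tree:
  assumes "finite K" "dstruct K D"
  shows "\<exists>T g. boron_tree (T :: nat pair_pre_digraph) \<and> inj_on g K \<and> g ` K = hydrogen T \<and>
    (\<forall>a\<in>K. \<forall>b\<in>K. \<forall>c\<in>K. \<forall>e\<in>K. D a b c e \<longleftrightarrow> geodesic T (g a) (g b) \<inter> geodesic T (g c) (g e) = {})"
proof (cases "K = {}")
  case True
  then show ?thesis using vtree_small_boron(1,3) by (metis empty_iff image_empty inj_on_empty)
next
  case False
  then obtain x where x: "x \<in> K" by blast
  define H where "H = K - {x}"
  have K: "K = insert x H" "x \<notin> H" "finite H" using x assms unfolding H_def by auto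
  show ?thesis
  proof (cases "H = {}")
    case True
    let ?T = "\<lparr>pverts = {0::nat}, parcs = {}\<rparr>"
    have tg: "tree_graph ?T" using vtree_small_boron(2)[of "0::nat"] unfolding boron_tree_def by blast
    have "geodesic ?T 0 0 = {0}" using geodesic_eq_seg[OF tg, of 0 0] vtree_singleton(2)[of "0::nat"] by simp
    moreover have "\<not> D x x x x" using d_ne[OF assms(2)] by blast
    ultimately show ?thesis using True K vtree_small_boron(2,4)[of 0]
      by (intro exI[of _ ?T] exI[of _ "\<lambda>_. 0"]) (simp add: eq_commute[of "{0}"])
  next
    case False
    obtain V E r and f :: "'a \<Rightarrow> nat" where M: "V \<subseteq> {Suc 0..}" "rooted_model H D x V E r f"
      using rooted_model_exists[OF K(3) False K(2), of D "Suc 0"] assms(2) K(1) by blast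
    have "0 \<notin> V" using M(1) by auto
    then show ?thesis using boron_tree_from_model[OF _ K(2) M(2)] assms(2) unfolding K(1) by blast
  qed
qed

text \<open>Trees leave the argument here: membership becomes a universal condition on
  \<open>dis\<close>, which gives closure under substructures and turns amalgamation into a question
  about extending relations.\<close>

theorem boron_class_iff: "U \<in> boron_class \<longleftrightarrow> finite_qstruct U \<and> dstruct (points U) (dis U)"
proof
  assume "U \<in> boron_class" then show "finite_qstruct U \<and> dstruct (points U) (dis U)" using boron_class_dstruct by blast
next
  assume h: "finite_qstruct U \<and> dstruct (points U) (dis U)"
  then have "finite (points U)" unfolding finite_qstruct_def by blast
  from dstruct_boron_tree[OF this h[THEN conjunct2]]
  obtain T g where Tg: "boron_tree (T :: nat pair_pre_digraph) \<and> inj_on g (points U) \<and> g ` points U = hydrogen T \<and>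
    (\<forall>a\<in>points U. \<forall>b\<in>points U. \<forall>c\<in>points U. \<forall>e\<in>points U.
       dis U a b c e \<longleftrightarrow> geodesic T (g a) (g b) \<inter> geodesic T (g c) (g e) = {})" by (elim exE)
  then have T: "boron_tree T" "inj_on g (points U)" "g ` points U = hydrogen T"
    "\<And>a b c e. a \<in> points U \<Longrightarrow> b \<in> points U \<Longrightarrow> c \<in> points U \<Longrightarrow> e \<in> points U \<Longrightarrow>
       dis U a b c e \<longleftrightarrow> geodesic T (g a) (g b) \<inter> geodesic T (g c) (g e) = {}" by simp_all
  let ?f = "restrict g (points U)"
  have gL: "g a \<in> hydrogen T" if "a \<in> points U" for a using T(3) that by blast
  have "is_isomorphism ?f U (hydrogen_structure T)"
    unfolding is_isomorphism_def is_embedding_def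
  proof (intro conjI ballI)
    show "?f \<in> points U \<rightarrow>\<^sub>E points (hydrogen_structure T)" using gL by (auto simp: hydrogen_structure_def)
    show "inj_on ?f (points U)" using T(2) by (simp add: inj_on_restrict_eq)
    show "?f ` points U = points (hydrogen_structure T)" using T(3) by (simp add: hydrogen_structure_def)
    fix w x y z assume m: "w \<in> points U" "x \<in> points U" "y \<in> points U" "z \<in> points U"
    then have "(w, x, y, z) \<in> quad U \<longleftrightarrow> \<not> dis U w x y z" by (simp add: dis_def)
    then show "((w, x, y, z) \<in> quad U) = ((?f w, ?f x, ?f y, ?f z) \<in> quad (hydrogen_structure T))"
      using T(4)[OF m] m gL by (simp add: hydrogen_structure_def)
  qed
  then show "U \<in> boron_class" unfolding boron_class_def using h T(1) by blast
qed

section \<open>Embeddings and amalgamations\<close>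

definition substruct :: "'a qstruct \<Rightarrow> 'a set \<Rightarrow> 'a qstruct" where
  "substruct U S = QStruct S (quad U \<inter> S \<times> S \<times> S \<times> S)"

text \<open>\<open>is_embedding\<close> asks for functions that are \<open>undefined\<close> outside
  the source, hence the \<open>restrict\<close>. Embeddings with the same source and target are then
  equal as soon as they agree on the points.\<close>

definition emb_of :: "'a qstruct \<Rightarrow> 'a qstruct \<Rightarrow> ('a \<Rightarrow> 'a) \<Rightarrow> 'a emb" where
  "emb_of U V f = Emb U V (restrict f (points U))"

lemma points_substruct [simp]: "points (substruct U S) = S"
  by (simp add: substruct_def)

lemma dis_substruct: "S \<subseteq> points U \<Longrightarrow> dis (substruct U S) = rel_restrict S (dis U)"
  by (auto simp: fun_eq_iff dis_def substruct_def rel_restrict_def)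

lemma emb_of_simps [simp]: "src (emb_of U V f) = U" "tgt (emb_of U V f) = V"
  "x \<in> points U \<Longrightarrow> fn (emb_of U V f) x = f x"
  by (simp_all add: emb_of_def)

lemma qstruct_eqI:
  assumes "finite_qstruct U" "finite_qstruct W" "points U = points W" "dis U = dis W"
  shows "U = W"
proof -
  have q: "quad U \<subseteq> points U \<times> points U \<times> points U \<times> points U" "quad W \<subseteq> points U \<times> points U \<times> points U \<times> points U"
    using assms unfolding finite_qstruct_def by auto
  have "(w, x, y, z) \<in> quad U \<longleftrightarrow> (w, x, y, z) \<in> quad W" for w x y z
  proof (cases "{w, x, y, z} \<subseteq> points U")
    case True
    have "dis U w x y z \<longleftrightarrow> dis W w x y z" using assms(4) by simp
    then show ?thesis using True assms(3) unfolding dis_def by blast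
  next
    case False
    then show ?thesis using q by auto
  qed
  then have "quad U = quad W" by auto
  then show ?thesis using assms(3) by (cases U; cases W) auto
qed

lemma is_embedding_iff_dis:
  "is_embedding f U V \<longleftrightarrow> f \<in> points U \<rightarrow>\<^sub>E points V \<and> inj_on f (points U) \<and>
    (\<forall>w\<in>points U. \<forall>x\<in>points U. \<forall>y\<in>points U. \<forall>z\<in>points U. dis U w x y z \<longleftrightarrow> dis V (f w) (f x) (f y) (f z))"
proof -
  have "((w, x, y, z) \<in> quad U \<longleftrightarrow> (f w, f x, f y, f z) \<in> quad V) \<longleftrightarrow> (dis U w x y z \<longleftrightarrow> dis V (f w) (f x) (f y) (f z))"
    if "f \<in> points U \<rightarrow>\<^sub>E points V" "w \<in> points U" "x \<in> points U" "y \<in> points U" "z \<in> points U" for w x y z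
    using that unfolding dis_def by (auto dest: PiE_mem)
  then show ?thesis unfolding is_embedding_def by (auto simp del: PiE_iff)
qed

lemma
  assumes "e \<in> embs \<AA>"
  shows emb_src: "src e \<in> \<AA>" and emb_tgt: "tgt e \<in> \<AA>"
    and emb_maps: "x \<in> points (src e) \<Longrightarrow> fn e x \<in> points (tgt e)"
    and emb_inj: "inj_on (fn e) (points (src e))"
    and emb_dis: "w \<in> points (src e) \<Longrightarrow> x \<in> points (src e) \<Longrightarrow> y \<in> points (src e) \<Longrightarrow> z \<in> points (src e) \<Longrightarrow>
      dis (tgt e) (fn e w) (fn e x) (fn e y) (fn e z) \<longleftrightarrow> dis (src e) w x y z"
    and emb_ext: "fn e \<in> extensional (points (src e))"
  using assms unfolding embs_def is_embedding_iff_dis by (auto simp: PiE_def)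

lemma emb_inj_iff: "e \<in> embs \<AA> \<Longrightarrow> x \<in> points (src e) \<Longrightarrow> y \<in> points (src e) \<Longrightarrow> fn e x = fn e y \<longleftrightarrow> x = y"
  using emb_inj by (metis inj_onD)

lemma emb_eqI:
  assumes "e \<in> embs \<AA>" "e' \<in> embs \<AA>" "src e = src e'" "tgt e = tgt e'" "\<And>x. x \<in> points (src e) \<Longrightarrow> fn e x = fn e' x"
  shows "e = e'"
proof -
  have "fn e = fn e'" using emb_ext[OF assms(1)] emb_ext[OF assms(2)] assms(3,5) by (metis extensionalityI)
  then show ?thesis using assms(3,4) by (cases e; cases e') simp
qed

lemma emb_ofI:
  assumes "U \<in> \<AA>" "V \<in> \<AA>" "\<And>x. x \<in> points U \<Longrightarrow> f x \<in> points V" "inj_on f (points U)"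
    and "\<And>w x y z. w \<in> points U \<Longrightarrow> x \<in> points U \<Longrightarrow> y \<in> points U \<Longrightarrow> z \<in> points U \<Longrightarrow>
      dis V (f w) (f x) (f y) (f z) \<longleftrightarrow> dis U w x y z"
  shows "emb_of U V f \<in> embs \<AA>"
  unfolding embs_def is_embedding_iff_dis using assms by (auto simp: emb_of_def inj_on_restrict_eq)

lemma emb_comp_simps [simp]: "src (emb_comp i j) = src j" "tgt (emb_comp i j) = tgt i"
  "x \<in> points (src j) \<Longrightarrow> fn (emb_comp i j) x = fn i (fn j x)"
  by (simp_all add: emb_comp_def compose_eq)

lemma emb_comp_in:
  assumes "i \<in> embs \<AA>" "j \<in> embs \<AA>" "tgt j = src i"
  shows "emb_comp i j \<in> embs \<AA>"
proof -
  have "emb_comp i j = emb_of (src j) (tgt i) (fn i \<circ> fn j)"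
    unfolding emb_comp_def emb_of_def compose_def by (simp add: restrict_def comp_def)
  moreover have "emb_of (src j) (tgt i) (fn i \<circ> fn j) \<in> embs \<AA>"
  proof (rule emb_ofI)
    have m: "fn j x \<in> points (src i)" if "x \<in> points (src j)" for x using emb_maps[OF assms(2) that] assms(3) by simp
    show "src j \<in> \<AA>" "tgt i \<in> \<AA>" using emb_src emb_tgt assms by blast+
    show "(fn i \<circ> fn j) x \<in> points (tgt i)" if "x \<in> points (src j)" for x
      using emb_maps[OF assms(1) m[OF that]] by simp
    show "inj_on (fn i \<circ> fn j) (points (src j))"
      by (rule inj_onI) (simp add: emb_inj_iff[OF assms(1)] emb_inj_iff[OF assms(2)] m)
    fix w x y z assume "w \<in> points (src j)" "x \<in> points (src j)" "y \<in> points (src j)" "z \<in> points (src j)"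
    then show "dis (tgt i) ((fn i \<circ> fn j) w) ((fn i \<circ> fn j) x) ((fn i \<circ> fn j) y) ((fn i \<circ> fn j) z) \<longleftrightarrow> dis (src j) w x y z"
      using emb_dis[OF assms(1)] emb_dis[OF assms(2)] m assms(3) by simp
  qed
  ultimately show ?thesis by simp
qed

lemma emb_comp_eqI:
  assumes "i \<in> embs \<AA>" "j \<in> embs \<AA>" "tgt j = src i" "k \<in> embs \<AA>" "src k = src j" "tgt k = tgt i"
    and "\<And>x. x \<in> points (src j) \<Longrightarrow> fn i (fn j x) = fn k x"
  shows "emb_comp i j = k"
  using emb_eqI[OF emb_comp_in[OF assms(1-3)] assms(4)] assms(5-7) by simp

definition is_iso :: "'a emb \<Rightarrow> bool" where
  "is_iso e \<longleftrightarrow> is_isomorphism (fn e) (src e) (tgt e)"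

lemma is_iso_iff: "e \<in> embs \<AA> \<Longrightarrow> is_iso e \<longleftrightarrow> fn e ` points (src e) = points (tgt e)"
  unfolding is_iso_def is_isomorphism_def embs_def by blast

definition emb_inv :: "'a emb \<Rightarrow> 'a emb" where
  "emb_inv e = emb_of (tgt e) (src e) (inv_into (points (src e)) (fn e))"

lemma emb_inv_apply: "e \<in> embs \<AA> \<Longrightarrow> x \<in> points (src e) \<Longrightarrow> fn (emb_inv e) (fn e x) = x"
  unfolding emb_inv_def by (simp add: emb_maps emb_inj)

lemma emb_apply_inv: "e \<in> embs \<AA> \<Longrightarrow> is_iso e \<Longrightarrow> x \<in> points (tgt e) \<Longrightarrow> fn e (fn (emb_inv e) x) = x"
  unfolding emb_inv_def by (simp add: is_iso_iff f_inv_into_f)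

lemma emb_inv_simps [simp]: "src (emb_inv e) = tgt e" "tgt (emb_inv e) = src e"
  by (simp_all add: emb_inv_def)

lemma emb_inv_in:
  assumes "e \<in> embs \<AA>" "is_iso e" shows "emb_inv e \<in> embs \<AA>" "is_iso (emb_inv e)"
proof -
  have im: "fn e ` points (src e) = points (tgt e)" using is_iso_iff assms by blast
  have a: "inv_into (points (src e)) (fn e) x \<in> points (src e)" "fn e (inv_into (points (src e)) (fn e) x) = x"
    if "x \<in> points (tgt e)" for x using that im by (metis inv_into_into, metis f_inv_into_f)
  show 1: "emb_inv e \<in> embs \<AA>" unfolding emb_inv_def
  proof (rule emb_ofI)
    show "inj_on (inv_into (points (src e)) (fn e)) (points (tgt e))" using im by (metis inj_on_inv_into order_refl)
    fix w x y z assume h: "w \<in> points (tgt e)" "x \<in> points (tgt e)" "y \<in> points (tgt e)" "z \<in> points (tgt e)"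
    let ?g = "inv_into (points (src e)) (fn e)"
    show "dis (src e) (?g w) (?g x) (?g y) (?g z) \<longleftrightarrow> dis (tgt e) w x y z"
      using emb_dis[OF assms(1) a(1)[OF h(1)] a(1)[OF h(2)] a(1)[OF h(3)] a(1)[OF h(4)]] a(2) h by simp
  qed (use assms emb_src emb_tgt a in blast)+
  have "fn (emb_inv e) ` points (tgt e) = points (src e)"
  proof
    show "fn (emb_inv e) ` points (tgt e) \<subseteq> points (src e)" using emb_maps[OF 1] by auto
    show "points (src e) \<subseteq> fn (emb_inv e) ` points (tgt e)"
      using emb_inv_apply[OF assms(1)] emb_maps[OF assms(1)] by (metis image_eqI subsetI)
  qed
  then show "is_iso (emb_inv e)" using is_iso_iff[OF 1] by simp
qed

lemma is_isoI_card:
  assumes "e \<in> embs \<AA>" "finite (points (tgt e))" "card (points (tgt e)) \<le> card (points (src e))"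
  shows "is_iso e"
proof -
  have "fn e ` points (src e) \<subseteq> points (tgt e)" using emb_maps[OF assms(1)] by blast
  moreover have "card (fn e ` points (src e)) = card (points (src e))" using emb_inj[OF assms(1)] by (rule card_image)
  ultimately have "fn e ` points (src e) = points (tgt e)" using card_seteq[OF assms(2)] assms(3) by simp
  then show ?thesis using is_iso_iff assms(1) by blast
qed

lemma amalgamation_iff:
  assumes "i \<in> embs \<AA>" "j \<in> embs \<AA>" "src i = src j"
  shows "(i', j') \<in> amalgamations \<AA> i j \<longleftrightarrow> i' \<in> embs \<AA> \<and> j' \<in> embs \<AA> \<and> src i' = tgt j \<and> src j' = tgt i \<and> tgt i' = tgt j' \<and>
    (\<forall>y\<in>points (src j). fn i' (fn j y) = fn j' (fn i y)) \<and>
    points (tgt i') = fn i' ` points (src i') \<union> fn j' ` points (src j')"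
proof -
  have "emb_comp i' j = emb_comp j' i \<longleftrightarrow> (\<forall>y\<in>points (src j). fn i' (fn j y) = fn j' (fn i y))"
    if h: "i' \<in> embs \<AA>" "j' \<in> embs \<AA>" "src i' = tgt j" "src j' = tgt i" "tgt i' = tgt j'"
  proof
    assume "emb_comp i' j = emb_comp j' i"
    then show "\<forall>y\<in>points (src j). fn i' (fn j y) = fn j' (fn i y)" using assms by (metis emb_comp_simps(3))
  next
    assume *: "\<forall>y\<in>points (src j). fn i' (fn j y) = fn j' (fn i y)"
    show "emb_comp i' j = emb_comp j' i"
      using emb_comp_eqI[OF h(1) assms(2) h(3)[symmetric] emb_comp_in[OF h(2) assms(1) h(4)[symmetric]]] h assms * by simp
  qed
  then show ?thesis unfolding amalgamations_def by auto
qed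

section \<open>Isomorphism invariants of amalgamations\<close>

text \<open>
  An amalgamation is determined up to isomorphism by the identifications and the relation
  that it induces on the disjoint union of the two structures.
\<close>

definition glue :: "'a emb \<times> 'a emb \<Rightarrow> 'a + 'a \<Rightarrow> 'a" where
  "glue a = case_sum (fn (fst a)) (fn (snd a))"

definition glue_dom :: "'a emb \<times> 'a emb \<Rightarrow> ('a + 'a) set" where
  "glue_dom a = points (src (fst a)) <+> points (src (snd a))"

definition amalg_inv ::
  "'a emb \<times> 'a emb \<Rightarrow> ('a + 'a) rel \<times> (('a + 'a) \<times> ('a + 'a) \<times> ('a + 'a) \<times> ('a + 'a)) set" where
  "amalg_inv a = ({(p, q). p \<in> glue_dom a \<and> q \<in> glue_dom a \<and> glue a p = glue a q},
     {(p, q, r, s). p \<in> glue_dom a \<and> q \<in> glue_dom a \<and> r \<in> glue_dom a \<and> s \<in> glue_dom a \<and>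
       dis (tgt (fst a)) (glue a p) (glue a q) (glue a r) (glue a s)})"

lemma amalg_inv_eqI:
  assumes "glue_dom a = glue_dom b"
    and "\<And>p q. p \<in> glue_dom b \<Longrightarrow> q \<in> glue_dom b \<Longrightarrow> glue a p = glue a q \<longleftrightarrow> glue b p = glue b q"
    and "\<And>p q r s. p \<in> glue_dom b \<Longrightarrow> q \<in> glue_dom b \<Longrightarrow> r \<in> glue_dom b \<Longrightarrow> s \<in> glue_dom b \<Longrightarrow>
      dis (tgt (fst a)) (glue a p) (glue a q) (glue a r) (glue a s) \<longleftrightarrow> dis (tgt (fst b)) (glue b p) (glue b q) (glue b r) (glue b s)"
  shows "amalg_inv a = amalg_inv b"
  unfolding amalg_inv_def using assms by auto

lemma amalg_inv_eqD:
  assumes "amalg_inv a = amalg_inv b" "glue_dom a = glue_dom b"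
  shows "p \<in> glue_dom b \<Longrightarrow> q \<in> glue_dom b \<Longrightarrow> glue a p = glue a q \<longleftrightarrow> glue b p = glue b q"
    and "p \<in> glue_dom b \<Longrightarrow> q \<in> glue_dom b \<Longrightarrow> r \<in> glue_dom b \<Longrightarrow> s \<in> glue_dom b \<Longrightarrow>
      dis (tgt (fst a)) (glue a p) (glue a q) (glue a r) (glue a s) \<longleftrightarrow> dis (tgt (fst b)) (glue b p) (glue b q) (glue b r) (glue b s)"
proof -
  have 1: "(p, q) \<in> fst (amalg_inv a) \<longleftrightarrow> (p, q) \<in> fst (amalg_inv b)" for p q using assms(1) by simp
  have 2: "(p, q, r, s) \<in> snd (amalg_inv a) \<longleftrightarrow> (p, q, r, s) \<in> snd (amalg_inv b)" for p q r s using assms(1) by simp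
  show "p \<in> glue_dom b \<Longrightarrow> q \<in> glue_dom b \<Longrightarrow> glue a p = glue a q \<longleftrightarrow> glue b p = glue b q"
    using 1[of p q] assms(2) unfolding amalg_inv_def by simp
  show "p \<in> glue_dom b \<Longrightarrow> q \<in> glue_dom b \<Longrightarrow> r \<in> glue_dom b \<Longrightarrow> s \<in> glue_dom b \<Longrightarrow>
      dis (tgt (fst a)) (glue a p) (glue a q) (glue a r) (glue a s) \<longleftrightarrow> dis (tgt (fst b)) (glue b p) (glue b q) (glue b r) (glue b s)"
    using 2[of p q r s] assms(2) unfolding amalg_inv_def by simp
qed

context
  fixes \<AA> :: "'a qstruct set" and i j
  assumes i: "i \<in> embs \<AA>" and j: "j \<in> embs \<AA>" and ij: "src i = src j"
begin

lemma amalg_parts: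
  assumes "a \<in> amalgamations \<AA> i j"
  shows "fst a \<in> embs \<AA>" "snd a \<in> embs \<AA>" "src (fst a) = tgt j" "src (snd a) = tgt i" "tgt (snd a) = tgt (fst a)"
    "y \<in> points (src j) \<Longrightarrow> fn (fst a) (fn j y) = fn (snd a) (fn i y)"
    "points (tgt (fst a)) = fn (fst a) ` points (tgt j) \<union> fn (snd a) ` points (tgt i)"
    "glue_dom a = points (tgt j) <+> points (tgt i)"
  using assms amalgamation_iff[OF i j ij, of "fst a" "snd a"] by (auto simp: glue_dom_def)

lemma glue_image: "a \<in> amalgamations \<AA> i j \<Longrightarrow> glue a ` glue_dom a = points (tgt (fst a))"
  by (auto simp: amalg_parts(7) amalg_parts(8) glue_def Plus_def image_Un image_image)

lemma amalg_iso_glue: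
  assumes a: "a \<in> amalgamations \<AA> i j" and b: "b \<in> amalgamations \<AA> i j"
  shows "amalg_iso a b \<longleftrightarrow> (\<exists>e\<in>embs \<AA>. src e = tgt (fst a) \<and> tgt e = tgt (fst b) \<and> is_iso e \<and>
    (\<forall>p\<in>glue_dom a. fn e (glue a p) = glue b p))" (is "_ = ?R")
proof
  assume "amalg_iso a b"
  then obtain h where h: "is_isomorphism h (tgt (fst a)) (tgt (fst b))"
      "emb_comp (Emb (tgt (fst a)) (tgt (fst b)) h) (fst a) = fst b"
      "emb_comp (Emb (tgt (fst a)) (tgt (fst b)) h) (snd a) = snd b" unfolding amalg_iso_def by blast
  let ?e = "Emb (tgt (fst a)) (tgt (fst b)) h"
  have e: "?e \<in> embs \<AA>" "is_iso ?e" using h(1) emb_tgt[OF amalg_parts(1)[OF a]] emb_tgt[OF amalg_parts(1)[OF b]]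
    unfolding embs_def is_iso_def is_isomorphism_def by auto
  have "fn ?e (glue a p) = glue b p" if "p \<in> glue_dom a" for p
  proof (cases p)
    case (Inl y)
    then have "y \<in> points (src (fst a))" using that by (auto simp: glue_dom_def)
    then have "fn (fst b) y = fn ?e (fn (fst a) y)" using emb_comp_simps(3) h(2) by metis
    then show ?thesis using Inl by (simp add: glue_def)
  next
    case (Inr y)
    then have "y \<in> points (src (snd a))" using that by (auto simp: glue_dom_def)
    then have "fn (snd b) y = fn ?e (fn (snd a) y)" using emb_comp_simps(3) h(3) by metis
    then show ?thesis using Inr by (simp add: glue_def)
  qed
  then show ?R using e by (intro bexI[of _ ?e]) auto
next
  assume ?R
  then obtain e where e: "e \<in> embs \<AA>" "src e = tgt (fst a)" "tgt e = tgt (fst b)" "is_iso e"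
    "\<And>p. p \<in> glue_dom a \<Longrightarrow> fn e (glue a p) = glue b p" by blast
  have E: "Emb (tgt (fst a)) (tgt (fst b)) (fn e) = e" using e(2,3) by (cases e) simp
  have l: "fn e (fn (fst a) y) = fn (fst b) y" if "y \<in> points (tgt j)" for y
    using e(5)[of "Inl y"] that amalg_parts(8)[OF a] by (auto simp: glue_def)
  have r: "fn e (fn (snd a) y) = fn (snd b) y" if "y \<in> points (tgt i)" for y
    using e(5)[of "Inr y"] that amalg_parts(8)[OF a] by (auto simp: glue_def)
  have "emb_comp e (fst a) = fst b"
    using emb_comp_eqI[OF e(1) amalg_parts(1)[OF a] e(2)[symmetric] amalg_parts(1)[OF b]] e(3) l
      amalg_parts(3)[OF a] amalg_parts(3)[OF b] by simp
  moreover have "emb_comp e (snd a) = snd b"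
    using emb_comp_eqI[OF e(1) amalg_parts(2)[OF a] _ amalg_parts(2)[OF b]] e(2,3) r
      amalg_parts(4,5)[OF a] amalg_parts(4,5)[OF b] by simp
  ultimately show "amalg_iso a b" unfolding amalg_iso_def using e(2-4) E unfolding is_iso_def by metis
qed

lemma amalg_iso_iff:
  assumes a: "a \<in> amalgamations \<AA> i j" and b: "b \<in> amalgamations \<AA> i j"
  shows "amalg_iso a b \<longleftrightarrow> amalg_inv a = amalg_inv b"
proof -
  have dom: "glue_dom a = glue_dom b" using amalg_parts(8) a b by simp
  have ga: "glue a p \<in> points (tgt (fst a))" if "p \<in> glue_dom b" for p using glue_image[OF a] that dom by blast
  have gb: "glue b p \<in> points (tgt (fst b))" if "p \<in> glue_dom b" for p using glue_image[OF b] that by blast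
  show ?thesis
  proof
    assume "amalg_iso a b"
    then obtain e where e: "e \<in> embs \<AA>" "src e = tgt (fst a)" "tgt e = tgt (fst b)"
      "\<And>p. p \<in> glue_dom a \<Longrightarrow> fn e (glue a p) = glue b p" using amalg_iso_glue[OF a b] by blast
    show "amalg_inv a = amalg_inv b"
    proof (rule amalg_inv_eqI[OF dom])
      fix p q assume "p \<in> glue_dom b" "q \<in> glue_dom b"
      then show "glue a p = glue a q \<longleftrightarrow> glue b p = glue b q"
        using e(4)[of p] e(4)[of q] emb_inj_iff[OF e(1), of "glue a p" "glue a q"] ga e(2) dom by auto
    next
      fix p q r s assume "p \<in> glue_dom b" "q \<in> glue_dom b" "r \<in> glue_dom b" "s \<in> glue_dom b"
      then show "dis (tgt (fst a)) (glue a p) (glue a q) (glue a r) (glue a s) \<longleftrightarrow> dis (tgt (fst b)) (glue b p) (glue b q) (glue b r) (glue b s)"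
        using e(4) emb_dis[OF e(1), of "glue a p" "glue a q" "glue a r" "glue a s"] ga e(2,3) dom by auto
    qed
  next
    assume eq: "amalg_inv a = amalg_inv b"
    note D = amalg_inv_eqD[OF eq dom]
    \<comment> \<open>Defined through arbitrary preimages under \<open>glue a\<close>; equality of
      the invariants makes the choice immaterial.\<close>
    define h where "h v = glue b (SOME p. p \<in> glue_dom b \<and> glue a p = v)" for v
    have hg: "h (glue a p) = glue b p" if p: "p \<in> glue_dom b" for p
    proof -
      let ?q = "SOME q. q \<in> glue_dom b \<and> glue a q = glue a p"
      have "?q \<in> glue_dom b \<and> glue a ?q = glue a p" by (rule someI[of _ p]) (use p in simp)
      then show ?thesis unfolding h_def using D(1)[of ?q p] p by blast
    qed
    have surj: "\<exists>p\<in>glue_dom b. v = glue a p" if "v \<in> points (tgt (fst a))" for v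
      using that glue_image[OF a] dom by blast
    let ?e = "emb_of (tgt (fst a)) (tgt (fst b)) h"
    have e: "?e \<in> embs \<AA>"
    proof (rule emb_ofI)
      show "tgt (fst a) \<in> \<AA>" "tgt (fst b) \<in> \<AA>" using emb_tgt amalg_parts(1) a b by blast+
      show "h v \<in> points (tgt (fst b))" if "v \<in> points (tgt (fst a))" for v using surj[OF that] hg gb by auto
      show "inj_on h (points (tgt (fst a)))"
      proof (rule inj_onI)
        fix v w assume vw: "v \<in> points (tgt (fst a))" "w \<in> points (tgt (fst a))" "h v = h w"
        obtain p q where "p \<in> glue_dom b" "q \<in> glue_dom b" "v = glue a p" "w = glue a q" using surj vw by blast
        then show "v = w" using vw(3) hg D(1)[of p q] by simp
      qed
      fix w x y z assume "w \<in> points (tgt (fst a))" "x \<in> points (tgt (fst a))" "y \<in> points (tgt (fst a))" "z \<in> points (tgt (fst a))"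
      then obtain p q r s where "p \<in> glue_dom b" "q \<in> glue_dom b" "r \<in> glue_dom b" "s \<in> glue_dom b"
        "w = glue a p" "x = glue a q" "y = glue a r" "z = glue a s" using surj by metis
      then show "dis (tgt (fst b)) (h w) (h x) (h y) (h z) \<longleftrightarrow> dis (tgt (fst a)) w x y z" using hg D(2) by simp
    qed
    have "fn ?e ` points (src ?e) = points (tgt ?e)"
    proof -
      have "points (tgt (fst b)) = h ` (glue a ` glue_dom b)" using glue_image[OF b] hg by (simp add: image_image)
      then show ?thesis using glue_image[OF a] dom by (simp add: emb_of_def)
    qed
    then have "is_iso ?e" using is_iso_iff[OF e] by simp
    moreover have "fn ?e (glue a p) = glue b p" if "p \<in> glue_dom a" for p using that hg[of p] ga[of p] dom by simp
    ultimately show "amalg_iso a b" using amalg_iso_glue[OF a b] e by (intro iffD2[OF amalg_iso_glue[OF a b]] bexI[of _ ?e]) auto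
  qed
qed

text \<open>Isomorphism of amalgamations is equality of \<open>amalg_inv\<close>, so unique
  existence up to isomorphism becomes injectivity and surjectivity of one map.\<close>

lemma amalg_representatives_iff:
  "amalg_representatives \<AA> i j M \<longleftrightarrow> finite M \<and> M \<subseteq> amalgamations \<AA> i j \<and> inj_on amalg_inv M \<and>
    amalg_inv ` amalgamations \<AA> i j \<subseteq> amalg_inv ` M"
proof (cases "M \<subseteq> amalgamations \<AA> i j")
  case True
  have "(\<forall>a\<in>amalgamations \<AA> i j. \<exists>!m. m \<in> M \<and> amalg_iso a m) \<longleftrightarrow>
      (\<forall>a\<in>amalgamations \<AA> i j. \<exists>!m. m \<in> M \<and> amalg_inv a = amalg_inv m)"
    using amalg_iso_iff True by (intro ball_cong refl) (metis subsetD)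
  also have "\<dots> \<longleftrightarrow> inj_on amalg_inv M \<and> amalg_inv ` amalgamations \<AA> i j \<subseteq> amalg_inv ` M"
  proof
    assume h: "\<forall>a\<in>amalgamations \<AA> i j. \<exists>!m. m \<in> M \<and> amalg_inv a = amalg_inv m"
    have "inj_on amalg_inv M" using h True unfolding inj_on_def by (metis subsetD)
    moreover have "amalg_inv ` amalgamations \<AA> i j \<subseteq> amalg_inv ` M" using h by blast
    ultimately show "inj_on amalg_inv M \<and> amalg_inv ` amalgamations \<AA> i j \<subseteq> amalg_inv ` M" by blast
  next
    assume h: "inj_on amalg_inv M \<and> amalg_inv ` amalgamations \<AA> i j \<subseteq> amalg_inv ` M"
    show "\<forall>a\<in>amalgamations \<AA> i j. \<exists>!m. m \<in> M \<and> amalg_inv a = amalg_inv m"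
    proof
      fix a assume "a \<in> amalgamations \<AA> i j"
      then obtain m where "m \<in> M" "amalg_inv a = amalg_inv m" using h by blast
      then show "\<exists>!m. m \<in> M \<and> amalg_inv a = amalg_inv m" using h by (metis inj_onD)
    qed
  qed
  finally show ?thesis unfolding amalg_representatives_def using True by blast
next
  case False
  then show ?thesis unfolding amalg_representatives_def by blast
qed

end

lemma Plus_cases [consumes 1, case_names Inl Inr]:
  assumes "p \<in> A <+> B"
  obtains y where "y \<in> A" "p = Inl y" | y where "y \<in> B" "p = Inr y"
  using assms by blast

section \<open>Additivity along composites and isomorphisms\<close>

definition emb_measure :: "'a qstruct set \<Rightarrow> ('a emb \<Rightarrow> 'r::comm_ring_1) \<Rightarrow> bool" where
  "emb_measure \<AA> \<kappa> \<longleftrightarrow> (\<forall>e\<in>embs \<AA>. is_iso e \<longrightarrow> \<kappa> e = 1) \<and>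
     (\<forall>i\<in>embs \<AA>. \<forall>j\<in>embs \<AA>. tgt j = src i \<longrightarrow> \<kappa> (emb_comp i j) = \<kappa> i * \<kappa> j)"

text \<open>Relation (c) for one pair, asked for some set of representatives only;
  \<open>representatives_sum\<close> passes to any other.\<close>

definition additive_at :: "'a qstruct set \<Rightarrow> ('a emb \<Rightarrow> 'r::comm_ring_1) \<Rightarrow> 'a emb \<Rightarrow> 'a emb \<Rightarrow> bool" where
  "additive_at \<AA> \<kappa> i j \<longleftrightarrow> (\<exists>M. amalg_representatives \<AA> i j M \<and> \<kappa> i = (\<Sum>m\<in>M. \<kappa> (fst m)))"

text \<open>Equal invariants match the two sets bijectively, and the first legs of matched
  amalgamations differ by an isomorphism, whose value is one.\<close>

lemma representatives_sum:
  assumes \<kappa>: "emb_measure \<AA> \<kappa>" and e: "i \<in> embs \<AA>" "j \<in> embs \<AA>" "src i = src j"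
    and M: "amalg_representatives \<AA> i j M" "amalg_representatives \<AA> i j N"
  shows "(\<Sum>m\<in>M. \<kappa> (fst m)) = (\<Sum>m\<in>N. \<kappa> (fst m))"
proof -
  note R = M[unfolded amalg_representatives_iff[OF e]]
  define h where "h m = (THE n. n \<in> N \<and> amalg_inv n = amalg_inv m)" for m
  have h: "h m \<in> N \<and> amalg_inv (h m) = amalg_inv m" if m: "m \<in> M" for m
  proof -
    have "amalg_inv m \<in> amalg_inv ` N" using R m by blast
    then have "\<exists>!n. n \<in> N \<and> amalg_inv n = amalg_inv m" using R by (metis imageE inj_onD)
    then show ?thesis unfolding h_def by (rule theI')
  qed
  have "bij_betw h M N"
  proof (rule bij_betw_imageI)
    show "inj_on h M" using R h by (metis inj_on_def)
    show "h ` M = N"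
    proof
      show "h ` M \<subseteq> N" using h by blast
      show "N \<subseteq> h ` M"
      proof
        fix n assume n: "n \<in> N"
        then have "amalg_inv n \<in> amalg_inv ` M" using R by blast
        then obtain m where m: "m \<in> M" "amalg_inv n = amalg_inv m" by blast
        then have "h m = n" using h[OF m(1)] R n by (metis inj_onD)
        then show "n \<in> h ` M" using m by blast
      qed
    qed
  qed
  moreover have "\<kappa> (fst m) = \<kappa> (fst (h m))" if m: "m \<in> M" for m
  proof -
    have am: "m \<in> amalgamations \<AA> i j" "h m \<in> amalgamations \<AA> i j" using R h m by blast+
    have "amalg_iso m (h m)" using amalg_iso_iff[OF e am] h[OF m] by simp
    then obtain g where g: "g \<in> embs \<AA>" "src g = tgt (fst m)" "tgt g = tgt (fst (h m))" "is_iso g"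
      "\<And>p. p \<in> glue_dom m \<Longrightarrow> fn g (glue m p) = glue (h m) p" using amalg_iso_glue[OF e am] by blast
    have "fn g (fn (fst m) y) = fn (fst (h m)) y" if "y \<in> points (tgt j)" for y
      using g(5)[of "Inl y"] that amalg_parts(8)[OF e am(1)] by (auto simp: glue_def)
    then have "emb_comp g (fst m) = fst (h m)"
      using emb_comp_eqI[OF g(1) amalg_parts(1)[OF e am(1)] g(2)[symmetric] amalg_parts(1)[OF e am(2)]]
        g(3) amalg_parts(3)[OF e am(1)] amalg_parts(3)[OF e am(2)] by simp
    moreover have "\<kappa> (emb_comp g (fst m)) = \<kappa> g * \<kappa> (fst m)" "\<kappa> g = 1"
      using \<kappa> g amalg_parts(1)[OF e am(1)] unfolding emb_measure_def by auto
    ultimately show ?thesis by simp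
  qed
  ultimately show ?thesis using sum.reindex_bij_betw[of h M N "\<lambda>m. \<kappa> (fst m)"] by simp
qed

lemma additive_atD:
  assumes "emb_measure \<AA> \<kappa>" "i \<in> embs \<AA>" "j \<in> embs \<AA>" "src i = src j" "additive_at \<AA> \<kappa> i j"
    "amalg_representatives \<AA> i j M"
  shows "\<kappa> i = (\<Sum>m\<in>M. \<kappa> (fst m))"
  using representatives_sum[OF assms(1-4,6)] assms(5) unfolding additive_at_def by metis

text \<open>Stacks two squares: an amalgamation of \<open>i1\<close> with \<open>j\<close>, and on
  its second leg an amalgamation of \<open>i2\<close>.\<close>

definition comp_amalg :: "('a emb \<times> 'a emb) \<times> ('a emb \<times> 'a emb) \<Rightarrow> 'a emb \<times> 'a emb" where
  "comp_amalg x = (emb_comp (fst (snd x)) (fst (fst x)), snd (snd x))"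

locale sub_closed =
  fixes \<AA> :: "'a qstruct set"
  assumes fin: "U \<in> \<AA> \<Longrightarrow> finite_qstruct U"
    and sub: "U \<in> \<AA> \<Longrightarrow> S \<subseteq> points U \<Longrightarrow> substruct U S \<in> \<AA>"
begin

lemma finite_points: "U \<in> \<AA> \<Longrightarrow> finite (points U)"
  using fin unfolding finite_qstruct_def by blast

context
  fixes i1 i2 j M1 N
  assumes e: "i1 \<in> embs \<AA>" "i2 \<in> embs \<AA>" "j \<in> embs \<AA>" "tgt i1 = src i2" "src i1 = src j"
    and M1: "amalg_representatives \<AA> i1 j M1"
    and N: "\<And>m. m \<in> M1 \<Longrightarrow> amalg_representatives \<AA> i2 (snd m) (N m)"
begin

private lemma e12: "emb_comp i2 i1 \<in> embs \<AA>" "src (emb_comp i2 i1) = src j"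
  using e emb_comp_in by auto

private lemma m_in: "m \<in> M1 \<Longrightarrow> m \<in> amalgamations \<AA> i1 j"
  using M1 unfolding amalg_representatives_iff[OF e(1,3,5)] by blast

private lemma snd_m: "m \<in> M1 \<Longrightarrow> snd m \<in> embs \<AA> \<and> src i2 = src (snd m)"
  using amalg_parts[OF e(1,3,5) m_in] e(4) by simp

private lemma n_reps:
  assumes "m \<in> M1"
  shows "finite (N m) \<and> N m \<subseteq> amalgamations \<AA> i2 (snd m) \<and> inj_on amalg_inv (N m) \<and>
    amalg_inv ` amalgamations \<AA> i2 (snd m) \<subseteq> amalg_inv ` N m"
  using N[OF assms] amalg_representatives_iff[OF e(2)] snd_m[OF assms] by blast

private lemma n_in: "m \<in> M1 \<Longrightarrow> n \<in> N m \<Longrightarrow> n \<in> amalgamations \<AA> i2 (snd m)"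
  using n_reps by blast

private lemma n_parts:
  assumes "m \<in> M1" "n \<in> N m"
  shows "fst n \<in> embs \<AA>" "snd n \<in> embs \<AA>" "src (fst n) = tgt (fst m)" "src (snd n) = tgt i2" "tgt (snd n) = tgt (fst n)"
    "y \<in> points (tgt i1) \<Longrightarrow> fn (fst n) (fn (snd m) y) = fn (snd n) (fn i2 y)"
    "points (tgt (fst n)) = fn (fst n) ` points (tgt (fst m)) \<union> fn (snd n) ` points (tgt i2)"
proof -
  note sm = snd_m[OF assms(1)]
  note ap = amalg_parts[OF e(2) sm[THEN conjunct1] sm[THEN conjunct2] n_in[OF assms]]
  note mp = amalg_parts(4,5)[OF e(1,3,5) m_in[OF assms(1)]]
  show "fst n \<in> embs \<AA>" "snd n \<in> embs \<AA>" "src (snd n) = tgt i2" "tgt (snd n) = tgt (fst n)" by (fact ap)+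
  show "src (fst n) = tgt (fst m)" using ap(3) mp(2) by simp
  show "y \<in> points (tgt i1) \<Longrightarrow> fn (fst n) (fn (snd m) y) = fn (snd n) (fn i2 y)" using ap(6) mp(1) by simp
  show "points (tgt (fst n)) = fn (fst n) ` points (tgt (fst m)) \<union> fn (snd n) ` points (tgt i2)" using ap(7) mp(2) by simp
qed

private lemma comp_amalg_in:
  assumes m: "m \<in> M1" and n: "n \<in> N m"
  shows "comp_amalg (m, n) \<in> amalgamations \<AA> (emb_comp i2 i1) j"
proof -
  note mp = amalg_parts[OF e(1,3,5) m_in[OF m]] and np = n_parts[OF m n]
  have c: "emb_comp (fst n) (fst m) \<in> embs \<AA>" using emb_comp_in[OF np(1) mp(1)] np(3) by simp
  have i1: "fn i1 y \<in> points (tgt i1)" if "y \<in> points (src j)" for y using emb_maps[OF e(1)] that e(5) by simp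
  have j: "fn j y \<in> points (src (fst m))" if "y \<in> points (src j)" for y using emb_maps[OF e(3) that] mp(3) by simp
  have com: "fn (emb_comp (fst n) (fst m)) (fn j y) = fn (snd n) (fn (emb_comp i2 i1) y)" if y: "y \<in> points (src j)" for y
    using mp(6)[OF y] np(6)[OF i1[OF y]] j[OF y] y e(5) by simp
  have "fn (fst n) ` fn (snd m) ` points (tgt i1) \<subseteq> fn (snd n) ` points (tgt i2)"
    using np(6) emb_maps[OF e(2)] e(4) by auto
  then have "points (tgt (fst n)) = fn (fst n) ` fn (fst m) ` points (tgt j) \<union> fn (snd n) ` points (tgt i2)"
    unfolding np(7) mp(7) image_Un by blast
  moreover have "fn (emb_comp (fst n) (fst m)) ` points (tgt j) = fn (fst n) ` fn (fst m) ` points (tgt j)"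
    using mp(3) by (auto simp: image_iff)
  ultimately show ?thesis
    unfolding comp_amalg_def amalgamation_iff[OF e12(1) e(3) e12(2)] using c com np mp by simp
qed

text \<open>The lower square is recovered by pulling the invariant back along \<open>lift\<close>,
  as the first leg of \<open>n\<close> is an embedding. The upper one follows because each of its
  points comes from \<open>tgt j\<close> or from \<open>tgt i2\<close>.\<close>

private lemma comp_amalg_unique:
  assumes m: "m \<in> M1" "n \<in> N m" and m': "m' \<in> M1" "n' \<in> N m'"
    and eq: "amalg_inv (comp_amalg (m, n)) = amalg_inv (comp_amalg (m', n'))"
  shows "m = m' \<and> n = n'"
proof -
  define lift where "lift = map_sum (\<lambda>y::'a. y) (fn i2)"
  have dom: "glue_dom (comp_amalg (m, n)) = points (tgt j) <+> points (tgt i2)" if "m \<in> M1" "n \<in> N m" for m n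
    using amalg_parts(8)[OF e12(1) e(3) e12(2) comp_amalg_in[OF that]] by simp
  have domm: "glue_dom m = points (tgt j) <+> points (tgt i1)" if "m \<in> M1" for m
    using amalg_parts(8)[OF e(1,3,5) m_in[OF that]] .
  have lift: "lift p \<in> points (tgt j) <+> points (tgt i2) \<and> glue (comp_amalg (m, n)) (lift p) = fn (fst n) (glue m p) \<and>
      glue m p \<in> points (src (fst n))"
    if mn: "m \<in> M1" "n \<in> N m" and p: "p \<in> points (tgt j) <+> points (tgt i1)" for m n p
  proof -
    note mp = amalg_parts[OF e(1,3,5) m_in[OF mn(1)]] and np = n_parts[OF mn]
    have g: "glue m p \<in> points (src (fst n))" using glue_image[OF e(1,3,5) m_in[OF mn(1)]] domm[OF mn(1)] p np(3) by auto
    from p show ?thesis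
    proof (cases rule: Plus_cases)
      case (Inl y)
      then show ?thesis using mp(3) g by (simp add: lift_def glue_def comp_amalg_def InlI)
    next
      case (Inr y)
      then show ?thesis using np(6)[of y] emb_maps[OF e(2), of y] e(4) g by (simp add: lift_def glue_def comp_amalg_def InrI)
    qed
  qed
  note dom2 = dom[OF m] dom[OF m']
  note D = amalg_inv_eqD[OF eq dom2(1)[folded dom2(2)], unfolded dom2(2)]
  have t: "tgt (fst (comp_amalg (m, n))) = tgt (fst n)" for m n by (simp add: comp_amalg_def)
  have "amalg_inv m = amalg_inv m'"
  proof (rule amalg_inv_eqI)
    show "glue_dom m = glue_dom m'" using domm m m' by simp
    fix p q assume p: "p \<in> glue_dom m'" "q \<in> glue_dom m'"
    note P = p[unfolded domm[OF m'(1)]]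
    note L = lift[OF m P(1)] lift[OF m P(2)] and L' = lift[OF m' P(1)] lift[OF m' P(2)]
    show "glue m p = glue m q \<longleftrightarrow> glue m' p = glue m' q"
      using D(1)[of "lift p" "lift q"] L L' emb_inj_iff[OF n_parts(1)[OF m], of "glue m p" "glue m q"]
        emb_inj_iff[OF n_parts(1)[OF m'], of "glue m' p" "glue m' q"] by simp
    fix r s assume r: "r \<in> glue_dom m'" "s \<in> glue_dom m'"
    note R = r[unfolded domm[OF m'(1)]]
    note K = lift[OF m R(1)] lift[OF m R(2)] and K' = lift[OF m' R(1)] lift[OF m' R(2)]
    show "dis (tgt (fst m)) (glue m p) (glue m q) (glue m r) (glue m s) \<longleftrightarrow> dis (tgt (fst m')) (glue m' p) (glue m' q) (glue m' r) (glue m' s)"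
      using D(2)[of "lift p" "lift q" "lift r" "lift s"] L L' K K'
        emb_dis[OF n_parts(1)[OF m], of "glue m p" "glue m q" "glue m r" "glue m s"]
        emb_dis[OF n_parts(1)[OF m'], of "glue m' p" "glue m' q" "glue m' r" "glue m' s"]
        n_parts(3)[OF m] n_parts(3)[OF m'] unfolding t by simp
  qed
  then have mm: "m = m'" using M1 m(1) m'(1) unfolding amalg_representatives_iff[OF e(1,3,5)] by (meson inj_onD)
  have n': "n' \<in> N m" using m' mm by simp
  have domn: "glue_dom n = points (tgt (fst m)) <+> points (tgt i2)" if "n \<in> N m" for n
    using amalg_parts(8)[OF e(2) _ _ n_in[OF m(1) that]] snd_m[OF m(1)] amalg_parts(5)[OF e(1,3,5) m_in[OF m(1)]] by simp
  have surj: "\<exists>p \<in> points (tgt j) <+> points (tgt i2). \<forall>n\<in>N m. glue n q = glue (comp_amalg (m, n)) p"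
    if "q \<in> points (tgt (fst m)) <+> points (tgt i2)" for q
    using that
  proof (cases rule: Plus_cases)
    case (Inl v)
    then obtain p where "p \<in> points (tgt j) <+> points (tgt i1)" "v = glue m p"
      using glue_image[OF e(1,3,5) m_in[OF m(1)]] domm[OF m(1)] by (metis imageE)
    note p = this
    have "glue n q = fn (fst n) v" for n using Inl by (simp add: glue_def)
    then have "\<forall>n\<in>N m. glue n q = glue (comp_amalg (m, n)) (lift p)" using lift[OF m(1) _ p(1)] p(2) by simp
    moreover have "lift p \<in> points (tgt j) <+> points (tgt i2)" using lift[OF m p(1)] by blast
    ultimately show ?thesis by (rule bexI)
  next
    case (Inr v)
    then show ?thesis by (intro bexI[of _ "Inr v"]) (auto simp: glue_def comp_amalg_def)
  qed
  have "amalg_inv n = amalg_inv n'"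
  proof (rule amalg_inv_eqI)
    show "glue_dom n = glue_dom n'" using domn m n' by simp
    fix p q assume p: "p \<in> glue_dom n'" "q \<in> glue_dom n'"
    obtain p' q' where P: "p' \<in> points (tgt j) <+> points (tgt i2)" "q' \<in> points (tgt j) <+> points (tgt i2)"
      "\<forall>n\<in>N m. glue n p = glue (comp_amalg (m, n)) p'" "\<forall>n\<in>N m. glue n q = glue (comp_amalg (m, n)) q'"
      using surj p domn[OF n'] by metis
    show "glue n p = glue n q \<longleftrightarrow> glue n' p = glue n' q"
      using D(1)[OF P(1,2)] P m(2) n' mm by simp
    fix r s assume r: "r \<in> glue_dom n'" "s \<in> glue_dom n'"
    obtain r' s' where R: "r' \<in> points (tgt j) <+> points (tgt i2)" "s' \<in> points (tgt j) <+> points (tgt i2)"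
      "\<forall>n\<in>N m. glue n r = glue (comp_amalg (m, n)) r'" "\<forall>n\<in>N m. glue n s = glue (comp_amalg (m, n)) s'"
      using surj r domn[OF n'] by metis
    show "dis (tgt (fst n)) (glue n p) (glue n q) (glue n r) (glue n s) \<longleftrightarrow> dis (tgt (fst n')) (glue n' p) (glue n' q) (glue n' r) (glue n' s)"
      using D(2)[OF P(1,2) R(1,2)] P R m(2) n' mm unfolding t by simp
  qed
  then have "n = n'" using n_reps[OF m(1)] m(2) n' by (meson inj_onD)
  then show ?thesis using mm by blast
qed

text \<open>The images of \<open>tgt j\<close> and \<open>tgt i1\<close> span a substructure
  \<open>W\<close>, which belongs to the class by \<open>sub\<close> and amalgamates
  \<open>i1\<close> with \<open>j\<close>. Replacing \<open>W\<close> by its representative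
  \<open>m\<close> exhibits the whole as an amalgamation of \<open>i2\<close> with
  \<open>snd m\<close>.\<close>

private lemma comp_amalg_cover:
  assumes a: "a \<in> amalgamations \<AA> (emb_comp i2 i1) j"
  shows "\<exists>m\<in>M1. \<exists>n\<in>N m. amalg_inv a = amalg_inv (comp_amalg (m, n))"
proof -
  note ap = amalg_parts[OF e12(1) e(3) e12(2) a, simplified]
  have i2m: "fn i2 x \<in> points (tgt i2)" if "x \<in> points (tgt i1)" for x using emb_maps[OF e(2)] that e(4) by simp
  define S where "S = fn (fst a) ` points (tgt j) \<union> fn (snd a) ` fn i2 ` points (tgt i1)"
  have S: "S \<subseteq> points (tgt (fst a))" unfolding S_def ap(7) using i2m by auto
  define W where "W = substruct (tgt (fst a)) S"
  have W: "W \<in> \<AA>" "points W = S" unfolding W_def using sub[OF emb_tgt[OF ap(1)] S] by auto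
  have disW: "dis W w x y z \<longleftrightarrow> dis (tgt (fst a)) w x y z" if "w \<in> S" "x \<in> S" "y \<in> S" "z \<in> S" for w x y z
    unfolding W_def dis_substruct[OF S] rel_restrict_def using that by simp
  define b1 where "b1 = emb_of (tgt j) W (fn (fst a))"
  define b2 where "b2 = emb_of (tgt i1) W (\<lambda>x. fn (snd a) (fn i2 x))"
  have b1: "b1 \<in> embs \<AA>" unfolding b1_def
  proof (rule emb_ofI)
    show "inj_on (fn (fst a)) (points (tgt j))" using emb_inj[OF ap(1)] ap(3) by simp
    fix w x y z assume "w \<in> points (tgt j)" "x \<in> points (tgt j)" "y \<in> points (tgt j)" "z \<in> points (tgt j)"
    then show "dis W (fn (fst a) w) (fn (fst a) x) (fn (fst a) y) (fn (fst a) z) \<longleftrightarrow> dis (tgt j) w x y z"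
      using emb_dis[OF ap(1)] ap(3) disW unfolding S_def by simp
  qed (use W emb_tgt[OF e(3)] S_def in auto)
  have b2: "b2 \<in> embs \<AA>" unfolding b2_def
  proof (rule emb_ofI)
    show "inj_on (\<lambda>x. fn (snd a) (fn i2 x)) (points (tgt i1))"
      by (rule inj_onI) (use emb_inj_iff[OF ap(2)] emb_inj_iff[OF e(2)] i2m ap(4) e(4) in simp)
    fix w x y z assume "w \<in> points (tgt i1)" "x \<in> points (tgt i1)" "y \<in> points (tgt i1)" "z \<in> points (tgt i1)"
    then show "dis W (fn (snd a) (fn i2 w)) (fn (snd a) (fn i2 x)) (fn (snd a) (fn i2 y)) (fn (snd a) (fn i2 z)) \<longleftrightarrow> dis (tgt i1) w x y z"
      using emb_dis[OF ap(2)] emb_dis[OF e(2)] ap(4,5) e(4) disW i2m unfolding S_def by simp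
  qed (use W emb_tgt[OF e(1)] S_def in auto)
  have "(b1, b2) \<in> amalgamations \<AA> i1 j"
    unfolding amalgamation_iff[OF e(1,3,5)]
  proof (intro conjI ballI b1 b2)
    show "points (tgt b1) = fn b1 ` points (src b1) \<union> fn b2 ` points (src b2)"
      unfolding b1_def b2_def using W(2) by (simp add: S_def image_image)
    fix y assume y: "y \<in> points (src j)"
    then have "fn j y \<in> points (tgt j)" "fn i1 y \<in> points (tgt i1)" using emb_maps[OF e(3)] emb_maps[OF e(1)] e(5) by auto
    then show "fn b1 (fn j y) = fn b2 (fn i1 y)" unfolding b1_def b2_def using ap(6)[OF y] y e(5) by simp
  qed (simp_all add: b1_def b2_def)
  note b = this
  obtain m where m: "m \<in> M1" "amalg_inv (b1, b2) = amalg_inv m"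
    using M1 b unfolding amalg_representatives_iff[OF e(1,3,5)] by blast
  note mp = amalg_parts[OF e(1,3,5) m_in[OF m(1)]]
  have "amalg_iso m (b1, b2)" using amalg_iso_iff[OF e(1,3,5) m_in[OF m(1)] b] m(2) by simp
  then obtain h where h: "h \<in> embs \<AA>" "src h = tgt (fst m)" "tgt h = W" "is_iso h"
    "\<And>p. p \<in> glue_dom m \<Longrightarrow> fn h (glue m p) = glue (b1, b2) p"
    using amalg_iso_glue[OF e(1,3,5) m_in[OF m(1)] b] by (auto simp: b1_def)
  have h1: "fn h (fn (fst m) y) = fn (fst a) y" if "y \<in> points (tgt j)" for y
    using h(5)[of "Inl y"] that mp(8) by (auto simp: glue_def b1_def)
  have h2: "fn h (fn (snd m) x) = fn (snd a) (fn i2 x)" if "x \<in> points (tgt i1)" for x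
    using h(5)[of "Inr x"] that mp(8) by (auto simp: glue_def b2_def)
  have hS: "fn h ` points (tgt (fst m)) = S" using is_iso_iff[OF h(1)] h W(2) by simp
  define g where "g = emb_of (tgt (fst m)) (tgt (fst a)) (fn h)"
  have g: "g \<in> embs \<AA>" unfolding g_def
  proof (rule emb_ofI)
    show "tgt (fst m) \<in> \<AA>" "tgt (fst a) \<in> \<AA>" using emb_tgt mp(1) ap(1) by blast+
    show "fn h x \<in> points (tgt (fst a))" if "x \<in> points (tgt (fst m))" for x using that hS S by blast
    show "inj_on (fn h) (points (tgt (fst m)))" using emb_inj[OF h(1)] h(2) by simp
    fix w x y z assume d: "w \<in> points (tgt (fst m))" "x \<in> points (tgt (fst m))" "y \<in> points (tgt (fst m))" "z \<in> points (tgt (fst m))"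
    then have "fn h w \<in> S" "fn h x \<in> S" "fn h y \<in> S" "fn h z \<in> S" using hS by blast+
    then show "dis (tgt (fst a)) (fn h w) (fn h x) (fn h y) (fn h z) \<longleftrightarrow> dis (tgt (fst m)) w x y z"
      using disW emb_dis[OF h(1), of w x y z] h(2,3) d by simp
  qed
  have sm: "snd m \<in> embs \<AA>" "src i2 = src (snd m)" using snd_m[OF m(1)] by auto
  have "(g, snd a) \<in> amalgamations \<AA> i2 (snd m)"
    unfolding amalgamation_iff[OF e(2) sm]
  proof (intro conjI ballI g ap(2))
    show "src g = tgt (snd m)" using mp(5) by (simp add: g_def)
    show "src (snd a) = tgt i2" using ap(4) .
    show "tgt g = tgt (snd a)" using ap(5) by (simp add: g_def)
    have "fn g ` points (src g) = S" using hS by (simp add: g_def emb_of_def)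
    then show "points (tgt g) = fn g ` points (src g) \<union> fn (snd a) ` points (src (snd a))"
      using ap(7) ap(4) i2m unfolding S_def by (auto simp: g_def)
    fix y assume "y \<in> points (src (snd m))"
    then have y: "y \<in> points (tgt i1)" using mp(4) by simp
    have "fn (snd m) y \<in> points (tgt (fst m))" using emb_maps[OF mp(2), of y] y mp(4,5) by simp
    then show "fn g (fn (snd m) y) = fn (snd a) (fn i2 y)" using h2[OF y] by (simp add: g_def)
  qed
  note ga = this
  obtain n where n: "n \<in> N m" "amalg_inv (g, snd a) = amalg_inv n" using n_reps[OF m(1)] ga by blast
  note np = n_parts[OF m(1) n(1)]
  have "amalg_iso n (g, snd a)" using amalg_iso_iff[OF e(2) sm n_in[OF m(1) n(1)] ga] n(2) by simp
  then obtain k where k: "k \<in> embs \<AA>" "src k = tgt (fst n)" "tgt k = tgt (fst a)" "is_iso k"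
    "\<And>p. p \<in> glue_dom n \<Longrightarrow> fn k (glue n p) = glue (g, snd a) p"
    using amalg_iso_glue[OF e(2) sm n_in[OF m(1) n(1)] ga] by (auto simp: g_def)
  have domn: "glue_dom n = points (tgt (fst m)) <+> points (tgt i2)" using np(3,4) by (simp add: glue_dom_def)
  have k1: "fn k (fn (fst n) y) = fn h y" if "y \<in> points (tgt (fst m))" for y
    using k(5)[of "Inl y"] that domn by (auto simp: glue_def g_def)
  have k2: "fn k (fn (snd n) x) = fn (snd a) x" if "x \<in> points (tgt i2)" for x
    using k(5)[of "Inr x"] that domn by (auto simp: glue_def)
  note c = comp_amalg_in[OF m(1) n(1)]
  have "fn k (glue (comp_amalg (m, n)) p) = glue a p" if "p \<in> glue_dom (comp_amalg (m, n))" for p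
  proof -
    have "p \<in> points (tgt j) <+> points (tgt i2)" using that amalg_parts(8)[OF e12(1) e(3) e12(2) c] by simp
    then show ?thesis
    proof (cases rule: Plus_cases)
      case (Inl y)
      then show ?thesis using k1[of "fn (fst m) y"] h1[of y] emb_maps[OF mp(1), of y] mp(3)
        by (simp add: glue_def comp_amalg_def)
    next
      case (Inr y)
      then show ?thesis using k2[of y] by (simp add: glue_def comp_amalg_def)
    qed
  qed
  then have "amalg_iso (comp_amalg (m, n)) a"
    using amalg_iso_glue[OF e12(1) e(3) e12(2) c a] k by (auto simp: comp_amalg_def intro!: bexI[of _ k])
  then have "amalg_inv (comp_amalg (m, n)) = amalg_inv a" using amalg_iso_iff[OF e12(1) e(3) e12(2) c a] by simp
  then show ?thesis using m(1) n(1) by metis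
qed

lemma representatives_comp:
  shows "inj_on comp_amalg (Sigma M1 N)" "amalg_representatives \<AA> (emb_comp i2 i1) j (comp_amalg ` Sigma M1 N)"
proof -
  have uniq: "x = x'" if "x \<in> Sigma M1 N" "x' \<in> Sigma M1 N" "amalg_inv (comp_amalg x) = amalg_inv (comp_amalg x')" for x x'
    using comp_amalg_unique[of "fst x" "snd x" "fst x'" "snd x'"] that by (auto simp: prod_eq_iff)
  show "inj_on comp_amalg (Sigma M1 N)" by (rule inj_onI) (use uniq in metis)
  have "finite M1" using M1 unfolding amalg_representatives_def by blast
  then have "finite (comp_amalg ` Sigma M1 N)" using n_reps by blast
  moreover have "inj_on amalg_inv (comp_amalg ` Sigma M1 N)"
    by (rule inj_onI) (use uniq in blast)
  moreover have "comp_amalg ` Sigma M1 N \<subseteq> amalgamations \<AA> (emb_comp i2 i1) j" using comp_amalg_in by auto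
  moreover have "amalg_inv ` amalgamations \<AA> (emb_comp i2 i1) j \<subseteq> amalg_inv ` comp_amalg ` Sigma M1 N"
  proof
    fix t assume "t \<in> amalg_inv ` amalgamations \<AA> (emb_comp i2 i1) j"
    then obtain m n where "m \<in> M1" "n \<in> N m" "t = amalg_inv (comp_amalg (m, n))" using comp_amalg_cover by blast
    then show "t \<in> amalg_inv ` comp_amalg ` Sigma M1 N" by blast
  qed
  ultimately show "amalg_representatives \<AA> (emb_comp i2 i1) j (comp_amalg ` Sigma M1 N)"
    unfolding amalg_representatives_iff[OF e12(1) e(3) e12(2)] by blast
qed

end

text \<open>The sum over stacked squares factors: the inner sum over \<open>N m\<close> gives
  \<open>\<kappa> i2\<close>, the outer one gives \<open>\<kappa> i1\<close>, and multiplicativity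
  joins them.\<close>

lemma additive_at_comp:
  assumes \<kappa>: "emb_measure \<AA> \<kappa>" and e: "i1 \<in> embs \<AA>" "i2 \<in> embs \<AA>" "j \<in> embs \<AA>" "tgt i1 = src i2" "src i1 = src j"
    and g1: "additive_at \<AA> \<kappa> i1 j" and g2: "\<And>a. a \<in> amalgamations \<AA> i1 j \<Longrightarrow> additive_at \<AA> \<kappa> i2 (snd a)"
  shows "additive_at \<AA> \<kappa> (emb_comp i2 i1) j"
proof -
  obtain M1 where M1: "amalg_representatives \<AA> i1 j M1" "\<kappa> i1 = (\<Sum>m\<in>M1. \<kappa> (fst m))"
    using g1 unfolding additive_at_def by blast
  have am: "m \<in> amalgamations \<AA> i1 j" if "m \<in> M1" for m using M1 that unfolding amalg_representatives_def by blast
  obtain N where N: "\<And>m. m \<in> M1 \<Longrightarrow> amalg_representatives \<AA> i2 (snd m) (N m) \<and> \<kappa> i2 = (\<Sum>n\<in>N m. \<kappa> (fst n))"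
    using g2[OF am] unfolding additive_at_def by metis
  note R = representatives_comp[OF e M1(1), of N]
  have fin': "finite M1" "\<And>m. m \<in> M1 \<Longrightarrow> finite (N m)" using M1 N unfolding amalg_representatives_def by blast+
  have "(\<Sum>x\<in>comp_amalg ` Sigma M1 N. \<kappa> (fst x)) = (\<Sum>x\<in>Sigma M1 N. \<kappa> (fst (comp_amalg x)))"
    using R(1) N by (subst sum.reindex) auto
  also have "\<dots> = (\<Sum>m\<in>M1. \<Sum>n\<in>N m. \<kappa> (fst (comp_amalg (m, n))))" using fin' by (subst sum.Sigma) auto
  also have "\<dots> = (\<Sum>m\<in>M1. \<Sum>n\<in>N m. \<kappa> (fst n) * \<kappa> (fst m))"
  proof (intro sum.cong refl)
    fix m n assume mn: "m \<in> M1" "n \<in> N m"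
    note mp = amalg_parts[OF e(1,3,5) am[OF mn(1)]]
    have "n \<in> amalgamations \<AA> i2 (snd m)" using N mn unfolding amalg_representatives_def by blast
    then have "fst n \<in> embs \<AA>" "src (fst n) = tgt (fst m)" using amalg_parts(1,3)[OF e(2) mp(2)] mp(4,5) e(4) by simp_all
    then show "\<kappa> (fst (comp_amalg (m, n))) = \<kappa> (fst n) * \<kappa> (fst m)"
      using \<kappa> mp(1) unfolding emb_measure_def comp_amalg_def by simp
  qed
  also have "\<dots> = (\<Sum>m\<in>M1. \<kappa> i2 * \<kappa> (fst m))" using N by (intro sum.cong refl) (simp add: sum_distrib_right)
  also have "\<dots> = \<kappa> (emb_comp i2 i1)" using M1(2) \<kappa> e unfolding emb_measure_def by (simp add: sum_distrib_left)
  finally show ?thesis using R(2) N unfolding additive_at_def by (metis (no_types, lifting))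
qed

lemma amalgamations_swap:
  assumes "i \<in> embs \<AA>" "j \<in> embs \<AA>" "src i = src j"
  shows "prod.swap a \<in> amalgamations \<AA> j i \<longleftrightarrow> a \<in> amalgamations \<AA> i j"
proof -
  have "(b, a) \<in> amalgamations \<AA> j i" if "(a, b) \<in> amalgamations \<AA> i j" "i \<in> embs \<AA>" "j \<in> embs \<AA>" "src i = src j" for a b i j
    using that(1) unfolding amalgamation_iff[OF that(2-4)] amalgamation_iff[OF that(3,2) that(4)[symmetric]]
    using that(4) by (auto simp: Un_commute)
  then show ?thesis using assms by (cases a) auto
qed

lemma amalg_iso_swap: "amalg_iso a b \<Longrightarrow> tgt (snd a) = tgt (fst a) \<Longrightarrow> tgt (snd b) = tgt (fst b) \<Longrightarrow>
  amalg_iso (prod.swap a) (prod.swap b)"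
  unfolding amalg_iso_def by (cases a; cases b) auto

lemma representatives_swap:
  assumes e: "i \<in> embs \<AA>" "j \<in> embs \<AA>" "src i = src j" and M: "amalg_representatives \<AA> i j M"
  shows "amalg_representatives \<AA> j i (prod.swap ` M)"
proof -
  note sw = amalgamations_swap[OF e]
  have Mam: "M \<subseteq> amalgamations \<AA> i j" "finite M" using M unfolding amalg_representatives_def by blast+
  have iso: "amalg_iso (prod.swap a) (prod.swap b) \<longleftrightarrow> amalg_iso a b"
    if "a \<in> amalgamations \<AA> i j" "b \<in> amalgamations \<AA> i j" for a b
    using amalg_iso_swap[of a b] amalg_iso_swap[of "prod.swap a" "prod.swap b"] amalg_parts(5)[OF e that(1)] amalg_parts(5)[OF e that(2)]
    by auto
  have "\<exists>!m. m \<in> prod.swap ` M \<and> amalg_iso a m" if a: "a \<in> amalgamations \<AA> j i" for a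
  proof -
    have a': "prod.swap a \<in> amalgamations \<AA> i j" using sw[of "prod.swap a"] a by simp
    then obtain m where m: "m \<in> M" "amalg_iso (prod.swap a) m" "\<And>m'. m' \<in> M \<Longrightarrow> amalg_iso (prod.swap a) m' \<Longrightarrow> m' = m"
      using M unfolding amalg_representatives_def by metis
    have s: "amalg_iso a (prod.swap n) \<longleftrightarrow> amalg_iso (prod.swap a) n" if "n \<in> M" for n
      using iso[OF a', of n] Mam that by auto
    show ?thesis
    proof (rule ex1I[of _ "prod.swap m"])
      show "prod.swap m \<in> prod.swap ` M \<and> amalg_iso a (prod.swap m)" using m s by blast
      show "n = prod.swap m" if "n \<in> prod.swap ` M \<and> amalg_iso a n" for n using that s m by blast
    qed
  qed
  then show ?thesis unfolding amalg_representatives_def using Mam sw by blast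
qed

text \<open>The legs are exchanged, stacking is applied to \<open>j1\<close> and \<open>j2\<close>,
  and the legs are exchanged back. The first leg of a stacked square is then that of its upper
  square alone, so the sums simply nest.\<close>

lemma additive_at_comp_right:
  assumes e: "j1 \<in> embs \<AA>" "j2 \<in> embs \<AA>" "i \<in> embs \<AA>" "tgt j1 = src j2" "src i = src j1"
    and g1: "additive_at \<AA> \<kappa> i j1" and g2: "\<And>a. a \<in> amalgamations \<AA> i j1 \<Longrightarrow> additive_at \<AA> \<kappa> (fst a) j2"
  shows "additive_at \<AA> \<kappa> i (emb_comp j2 j1)"
proof -
  obtain M1 where M1: "amalg_representatives \<AA> i j1 M1" "\<kappa> i = (\<Sum>m\<in>M1. \<kappa> (fst m))"
    using g1 unfolding additive_at_def by blast
  have am: "m \<in> amalgamations \<AA> i j1" if "m \<in> M1" for m using M1 that unfolding amalg_representatives_def by blast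
  note mp = amalg_parts[OF e(3,1,5) am]
  obtain N where N: "\<And>m. m \<in> M1 \<Longrightarrow> amalg_representatives \<AA> (fst m) j2 (N m) \<and> \<kappa> (fst m) = (\<Sum>n\<in>N m. \<kappa> (fst n))"
    using g2[OF am] unfolding additive_at_def by metis
  define N' where "N' m = prod.swap ` N (prod.swap m)" for m
  have S: "amalg_representatives \<AA> j1 i (prod.swap ` M1)" using representatives_swap[OF e(3,1,5) M1(1)] .
  have N': "amalg_representatives \<AA> j2 (snd m) (N' m)" if m: "m \<in> prod.swap ` M1" for m
  proof -
    obtain m' where m': "m' \<in> M1" "m = prod.swap m'" using m by blast
    then show ?thesis using representatives_swap[OF mp(1)[OF m'(1)] e(2)] mp(3)[OF m'(1)] e(4) N[OF m'(1)]
      by (simp add: N'_def)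
  qed
  note R = representatives_comp[OF e(1,2,3,4) e(5)[symmetric] S N']
  have c: "emb_comp j2 j1 \<in> embs \<AA>" "src (emb_comp j2 j1) = src i" using emb_comp_in[OF e(2,1,4)] e(5) by auto
  let ?M = "prod.swap ` comp_amalg ` Sigma (prod.swap ` M1) N'"
  have RM: "amalg_representatives \<AA> i (emb_comp j2 j1) ?M" using representatives_swap[OF c(1) e(3) c(2) R(2)] .
  have fin': "finite M1" "\<And>m. m \<in> M1 \<Longrightarrow> finite (N m)" using M1 N unfolding amalg_representatives_def by blast+
  have "(\<Sum>x\<in>?M. \<kappa> (fst x)) = (\<Sum>x\<in>Sigma (prod.swap ` M1) N'. \<kappa> (snd (comp_amalg x)))"
    using R(1) by (subst sum.reindex, simp, subst sum.reindex) auto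
  also have "\<dots> = (\<Sum>m\<in>prod.swap ` M1. \<Sum>n\<in>N' m. \<kappa> (snd n))"
    using fin' by (subst sum.Sigma) (auto simp: N'_def comp_amalg_def case_prod_unfold)
  also have "\<dots> = (\<Sum>m\<in>M1. \<Sum>n\<in>N m. \<kappa> (fst n))"
    by (subst sum.reindex, simp, intro sum.cong refl) (simp add: N'_def sum.reindex)
  also have "\<dots> = \<kappa> i" using M1(2) N by simp
  finally show ?thesis using RM unfolding additive_at_def by metis
qed

text \<open>There is one amalgamation only, the target of \<open>i\<close> itself, with
  \<open>i\<close> after the inverse of \<open>j\<close> as first leg.\<close>

lemma additive_at_iso_right:
  assumes \<kappa>: "emb_measure \<AA> \<kappa>" and e: "i \<in> embs \<AA>" "j \<in> embs \<AA>" "src i = src j" and iso: "is_iso j"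
  shows "additive_at \<AA> \<kappa> i j"
proof -
  note inv = emb_inv_in[OF e(2) iso]
  let ?l = "emb_comp i (emb_inv j)" and ?r = "emb_of (tgt i) (tgt i) (\<lambda>x. x)"
  have l: "?l \<in> embs \<AA>" using emb_comp_in[OF e(1) inv(1)] e(3) by simp
  have r: "?r \<in> embs \<AA>" by (rule emb_ofI) (use emb_tgt[OF e(1)] in \<open>auto\<close>)
  have lx: "fn ?l (fn j y) = fn i y" if "y \<in> points (src j)" for y
    using emb_inv_apply[OF e(2) that] emb_maps[OF e(2) that] by simp
  have a: "(?l, ?r) \<in> amalgamations \<AA> i j" unfolding amalgamation_iff[OF e]
  proof (intro conjI ballI l r)
    show "fn ?l (fn j y) = fn ?r (fn i y)" if "y \<in> points (src j)" for y using lx[OF that] that emb_maps[OF e(1)] e(3) by simp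
    have "fn ?l ` points (src ?l) \<subseteq> points (tgt i)" using emb_maps[OF l] by auto
    moreover have "fn ?r ` points (tgt i) = points (tgt i)" by (simp add: emb_of_def)
    ultimately show "points (tgt ?l) = fn ?l ` points (src ?l) \<union> fn ?r ` points (src ?r)" by auto
  qed (simp_all add: e)
  have "amalg_inv b = amalg_inv (?l, ?r)" if b: "b \<in> amalgamations \<AA> i j" for b
  proof -
    note bp = amalg_parts[OF e b]
    have sb: "fn (fst b) y = fn (snd b) (fn ?l y)" if y: "y \<in> points (tgt j)" for y
    proof -
      have y': "fn (emb_inv j) y \<in> points (src j)" using emb_maps[OF inv(1), of y] y by simp
      have "fn (fst b) (fn j (fn (emb_inv j) y)) = fn (snd b) (fn i (fn (emb_inv j) y))" using bp(6)[OF y'] .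
      then show ?thesis using emb_apply_inv[OF e(2) iso y] y by simp
    qed
    have lm: "fn ?l y \<in> points (tgt i)" if "y \<in> points (tgt j)" for y using emb_maps[OF l, of y] that by simp
    have "fn (snd b) (glue (?l, ?r) p) = glue b p \<and> glue (?l, ?r) p \<in> points (tgt i)" if "p \<in> glue_dom (?l, ?r)" for p
    proof -
      have "p \<in> points (tgt j) <+> points (tgt i)" using that amalg_parts(8)[OF e a] by simp
      then show ?thesis by (cases rule: Plus_cases) (use sb lm in \<open>auto simp: glue_def\<close>)
    qed
    then have g: "glue b p = fn (snd b) (glue (?l, ?r) p)" "glue (?l, ?r) p \<in> points (src (snd b))" if "p \<in> glue_dom (?l, ?r)" for p
      using that bp(4) by auto
    show ?thesis
    proof (rule amalg_inv_eqI)
      show "glue_dom b = glue_dom (?l, ?r)" using amalg_parts(8)[OF e a] bp(8) by simp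
      fix p q assume p: "p \<in> glue_dom (?l, ?r)" "q \<in> glue_dom (?l, ?r)"
      show "glue b p = glue b q \<longleftrightarrow> glue (?l, ?r) p = glue (?l, ?r) q"
        unfolding g(1)[OF p(1)] g(1)[OF p(2)] by (rule emb_inj_iff[OF bp(2) g(2)[OF p(1)] g(2)[OF p(2)]])
      fix r s assume r: "r \<in> glue_dom (?l, ?r)" "s \<in> glue_dom (?l, ?r)"
      show "dis (tgt (fst b)) (glue b p) (glue b q) (glue b r) (glue b s) \<longleftrightarrow>
        dis (tgt (fst (?l, ?r))) (glue (?l, ?r) p) (glue (?l, ?r) q) (glue (?l, ?r) r) (glue (?l, ?r) s)"
        unfolding g(1)[OF p(1)] g(1)[OF p(2)] g(1)[OF r(1)] g(1)[OF r(2)]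
        using emb_dis[OF bp(2) g(2)[OF p(1)] g(2)[OF p(2)] g(2)[OF r(1)] g(2)[OF r(2)]] bp(4,5) by simp
    qed
  qed
  then have "amalg_inv ` amalgamations \<AA> i j \<subseteq> amalg_inv ` {(?l, ?r)}" by blast
  then have "amalg_representatives \<AA> i j {(?l, ?r)}" unfolding amalg_representatives_iff[OF e] using a by simp
  moreover have "\<kappa> ?l = \<kappa> i" using \<kappa> e inv unfolding emb_measure_def by simp
  ultimately show ?thesis unfolding additive_at_def by force
qed

text \<open>Again there is one amalgamation, and its first leg is an isomorphism, so both sides of
  the relation are one.\<close>

lemma additive_at_iso_left:
  assumes \<kappa>: "emb_measure \<AA> \<kappa>" and e: "i \<in> embs \<AA>" "j \<in> embs \<AA>" "src i = src j" and iso: "is_iso i"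
  shows "additive_at \<AA> \<kappa> i j"
proof -
  obtain M where M: "amalg_representatives \<AA> j i M" using additive_at_iso_right[OF \<kappa> e(2,1) e(3)[symmetric] iso]
    unfolding additive_at_def by blast
  let ?l = "emb_of (tgt j) (tgt j) (\<lambda>x. x)" and ?r = "emb_comp j (emb_inv i)"
  note inv = emb_inv_in[OF e(1) iso]
  note R = representatives_swap[OF e(2,1) e(3)[symmetric] M]
  have iso': "is_iso (fst a)" if a: "a \<in> amalgamations \<AA> i j" for a
  proof -
    note ap = amalg_parts[OF e a]
    have "fn (snd a) x \<in> fn (fst a) ` points (tgt j)" if x: "x \<in> points (tgt i)" for x
    proof -
      have y: "fn (emb_inv i) x \<in> points (src j)" using emb_maps[OF inv(1), of x] x e(3) by simp
      have "fn (snd a) x = fn (fst a) (fn j (fn (emb_inv i) x))" using ap(6)[OF y] emb_apply_inv[OF e(1) iso x] by simp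
      then show ?thesis using emb_maps[OF e(2) y] by blast
    qed
    then have "points (tgt (fst a)) = fn (fst a) ` points (tgt j)" using ap(7) by blast
    then show ?thesis using is_iso_iff[OF ap(1)] ap(3) by simp
  qed
  have sw: "prod.swap ` M \<subseteq> amalgamations \<AA> i j" using R unfolding amalg_representatives_def by blast
  have one: "\<kappa> (fst m) = 1" if "m \<in> prod.swap ` M" for m
    using that sw iso' amalg_parts(1)[OF e] \<kappa> unfolding emb_measure_def by blast
  have eqinv: "amalg_inv a = amalg_inv b" if ab: "a \<in> amalgamations \<AA> i j" "b \<in> amalgamations \<AA> i j" for a b
  proof -
    note ap = amalg_parts[OF e ab(1)] and bp = amalg_parts[OF e ab(2)]
    define q where "q p = (case p of Inl y \<Rightarrow> y | Inr x \<Rightarrow> fn j (fn (emb_inv i) x))" for p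
    have q: "q p \<in> points (tgt j) \<and> glue a p = fn (fst a) (q p)" if a: "a \<in> amalgamations \<AA> i j" "p \<in> points (tgt j) <+> points (tgt i)" for a p
      using a(2)
    proof (cases rule: Plus_cases)
      case (Inl y) then show ?thesis by (simp add: q_def glue_def)
    next
      case (Inr x)
      have y: "fn (emb_inv i) x \<in> points (src j)" using emb_maps[OF inv(1), of x] Inr e(3) by simp
      have "fn (snd a) x = fn (fst a) (fn j (fn (emb_inv i) x))"
        using amalg_parts(6)[OF e a(1) y] emb_apply_inv[OF e(1) iso Inr(1)] by simp
      then show ?thesis using emb_maps[OF e(2) y] Inr by (simp add: q_def glue_def)
    qed
    show ?thesis
    proof (rule amalg_inv_eqI)
      show "glue_dom a = glue_dom b" using ap(8) bp(8) by simp
    qed (use q[OF ab(1)] q[OF ab(2)] bp(8) emb_inj_iff[OF ap(1)] emb_inj_iff[OF bp(1)] emb_dis[OF ap(1)] emb_dis[OF bp(1)] ap(3) bp(3) in auto)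
  qed
  have "inj_on amalg_inv (prod.swap ` M)" using R unfolding amalg_representatives_iff[OF e] by blast
  then have single: "m = m'" if "m \<in> prod.swap ` M" "m' \<in> prod.swap ` M" for m m'
    using that eqinv sw by (meson inj_onD subsetD)
  have "amalgamations \<AA> i j \<noteq> {}"
  proof -
    have "amalgamations \<AA> j i \<noteq> {}"
    proof -
      have "M \<noteq> {}"
      proof
        assume "M = {}"
        \<comment> \<open>Existence of an amalgamation is read off from additivity of the constant
          measure one: without representatives it would say \<open>1 = 0\<close>.\<close>
        then have "additive_at \<AA> (\<lambda>_. 1 :: int) j i \<Longrightarrow> (1 :: int) = 0"
          using additive_atD[of \<AA> "\<lambda>_. 1 :: int" j i M] e M unfolding emb_measure_def by simp
        moreover have "additive_at \<AA> (\<lambda>_. 1 :: int) j i"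
          using additive_at_iso_right[of "\<lambda>_. 1 :: int" j i] e iso unfolding emb_measure_def by simp
        ultimately show False by simp
      qed
      then show ?thesis using M unfolding amalg_representatives_def by blast
    qed
    then show ?thesis using amalgamations_swap[OF e(2,1) e(3)[symmetric]] by blast
  qed
  then have "prod.swap ` M \<noteq> {}" using R unfolding amalg_representatives_iff[OF e] by blast
  then obtain m where "prod.swap ` M = {m}" using single by blast
  moreover have "\<kappa> i = 1" using \<kappa> e(1) iso unfolding emb_measure_def by blast
  ultimately have "\<kappa> i = (\<Sum>m\<in>prod.swap ` M. \<kappa> (fst m))" using one[of m] by simp
  then show ?thesis using R unfolding additive_at_def by blast
qed

end

section \<open>The class of boron structures\<close>

text \<open>The relation of a structure says that geodesics meet, so \<open>D\<close> enters
  negated.\<close>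

definition mk_struct :: "'a set \<Rightarrow> ('a \<Rightarrow> 'a \<Rightarrow> 'a \<Rightarrow> 'a \<Rightarrow> bool) \<Rightarrow> 'a qstruct" where
  "mk_struct H D = QStruct H {(w, x, y, z). {w, x, y, z} \<subseteq> H \<and> \<not> D w x y z}"

definition incl :: "'a qstruct \<Rightarrow> 'a qstruct \<Rightarrow> 'a emb" where
  "incl U V = emb_of U V (\<lambda>x. x)"

lemma points_mk_struct [simp]: "points (mk_struct H D) = H"
  by (simp add: mk_struct_def)

lemma dis_mk_struct: "dis (mk_struct H D) = rel_restrict H D"
  by (auto simp: fun_eq_iff dis_def mk_struct_def rel_restrict_def)

lemma rel_restrict_dstruct: "dstruct H D \<Longrightarrow> rel_restrict H D = D"
  using d_in[of H D] by (auto simp: fun_eq_iff rel_restrict_def)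

lemma rel_restrict_eqI:
  assumes "dstruct K D" "\<And>w x y z. w \<in> K \<Longrightarrow> x \<in> K \<Longrightarrow> y \<in> K \<Longrightarrow> z \<in> K \<Longrightarrow> E w x y z \<longleftrightarrow> D w x y z"
  shows "rel_restrict K E = D"
proof -
  have "rel_restrict K E = rel_restrict K D" using assms(2) by (auto simp: rel_restrict_def fun_eq_iff)
  then show ?thesis using rel_restrict_dstruct[OF assms(1)] by simp
qed

lemma dis_mk_dstruct: "dstruct H D \<Longrightarrow> dis (mk_struct H D) = D"
  by (simp add: dis_mk_struct rel_restrict_dstruct)

lemma finite_mk_struct: "finite H \<Longrightarrow> finite_qstruct (mk_struct H D)"
  unfolding finite_qstruct_def mk_struct_def by auto

lemma mk_struct_boron: "finite H \<Longrightarrow> dstruct H D \<Longrightarrow> mk_struct H D \<in> boron_class"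
  unfolding boron_class_iff by (simp add: finite_mk_struct dis_mk_dstruct)

interpretation boron: sub_closed boron_class
proof
  fix U :: "'a qstruct" and S assume U: "U \<in> boron_class"
  then show fin: "finite_qstruct U" unfolding boron_class_iff by blast
  assume S: "S \<subseteq> points U"
  have "dstruct S (dis (substruct U S))" unfolding dis_substruct[OF S]
    by (rule dstruct_restrict[OF _ S]) (use U in \<open>simp add: boron_class_iff\<close>)
  moreover have "finite_qstruct (substruct U S)"
    using fin S unfolding finite_qstruct_def substruct_def by (auto intro: finite_subset)
  ultimately show "substruct U S \<in> boron_class" unfolding boron_class_iff by simp
qed

lemma boron_dstruct: "U \<in> boron_class \<Longrightarrow> dstruct (points U) (dis U)"
  unfolding boron_class_iff by blast

lemma mk_struct_dis: "U \<in> boron_class \<Longrightarrow> mk_struct (points U) (dis U) = U"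
  by (rule qstruct_eqI) (auto simp: boron.fin boron.finite_points finite_mk_struct dis_mk_dstruct boron_dstruct)

lemma amalg_inv_map:
  assumes "glue_dom a = glue_dom b" "\<And>p. p \<in> glue_dom b \<Longrightarrow> glue b p = g (glue a p) \<and> glue a p \<in> P" "inj_on g P"
    and "\<And>w x y z. w \<in> P \<Longrightarrow> x \<in> P \<Longrightarrow> y \<in> P \<Longrightarrow> z \<in> P \<Longrightarrow>
      dis (tgt (fst b)) (g w) (g x) (g y) (g z) \<longleftrightarrow> dis (tgt (fst a)) w x y z"
  shows "amalg_inv a = amalg_inv b"
proof (rule amalg_inv_eqI[OF assms(1)])
  fix p q assume "p \<in> glue_dom b" "q \<in> glue_dom b"
  then show "glue a p = glue a q \<longleftrightarrow> glue b p = glue b q" using assms(2)[of p] assms(2)[of q] assms(3) by (metis inj_onD)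
next
  fix p q r s assume "p \<in> glue_dom b" "q \<in> glue_dom b" "r \<in> glue_dom b" "s \<in> glue_dom b"
  then show "dis (tgt (fst a)) (glue a p) (glue a q) (glue a r) (glue a s) \<longleftrightarrow> dis (tgt (fst b)) (glue b p) (glue b q) (glue b r) (glue b s)"
    using assms(2)[of p] assms(2)[of q] assms(2)[of r] assms(2)[of s] assms(4) by simp
qed

text \<open>With two or more old points the type determines the edge and hence the extension; with
  fewer there is only one structure.\<close>

lemma dstruct_type_unique:
  assumes d: "dstruct (insert x H) D" "dstruct (insert x H) E" and fin: "finite H" and x: "x \<notin> H"
    and r: "rel_restrict H D = rel_restrict H E"
    and t: "\<And>a b c. a \<in> H \<Longrightarrow> b \<in> H \<Longrightarrow> c \<in> H \<Longrightarrow> D a b x c \<longleftrightarrow> E a b x c"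
  shows "D = E"
proof (cases "2 \<le> card H")
  case True
  obtain A B where AB: "edge_at D H x A B" using edge_at_exists[OF d(1) fin refl x True] .
  moreover have "edge_at D H x A B \<longleftrightarrow> edge_at E H x A B" by (rule edge_at_cong) (rule t)
  ultimately show ?thesis using edge_at_extension_unique[OF d x _ _ r] by blast
next
  case False
  then have "card (insert x H) \<le> 3" "finite (insert x H)" using fin by (auto simp: card_insert_if)
  then show ?thesis using dstruct_small[OF d(1)] dstruct_small[OF d(2)] by simp
qed

section \<open>Representatives for a pair of one-point extensions\<close>

context two_extensions
begin

definition "base = mk_struct H (rel_restrict H D)"
definition "ext_x = mk_struct (insert x H) D'"
definition "ext_y = mk_struct (insert y H) D"
definition "ext_xy E = mk_struct (insert x (insert y H)) E"
definition "joint E = (incl ext_y (ext_xy E), incl ext_x (ext_xy E))"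
definition "merged = (incl ext_y ext_y, emb_of ext_x ext_y (\<lambda>v. if v = x then y else v))"
text \<open>One representative for each way of keeping \<open>x\<close> and \<open>y\<close> apart,
  and one more that identifies them whenever their types agree.\<close>

definition "joint_reps = joint ` fibre H x y D D' \<union> (if same_type H D y D' x then {merged} else {})"

lemma structs: "base \<in> boron_class" "ext_x \<in> boron_class" "ext_y \<in> boron_class"
  "E \<in> fibre H x y D D' \<Longrightarrow> ext_xy E \<in> boron_class"
  unfolding base_def ext_x_def ext_y_def ext_xy_def fibre_def extensions_def
  using fin dD dD' dstruct_restrict[OF dD, of H] by (auto intro!: mk_struct_boron)

lemma dis_structs: "dis base = rel_restrict H D" "dis ext_x = D'" "dis ext_y = D"
  "E \<in> fibre H x y D D' \<Longrightarrow> dis (ext_xy E) = E"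
  "points base = H" "points ext_x = insert x H" "points ext_y = insert y H" "points (ext_xy E) = insert x (insert y H)"
  unfolding base_def ext_x_def ext_y_def ext_xy_def fibre_def extensions_def
  using dD dD' by (auto simp: dis_mk_dstruct) (auto simp: dis_mk_struct rel_restrict_def fun_eq_iff)

lemma fibreD:
  assumes "E \<in> fibre H x y D D'"
  shows "\<lbrakk>a \<in> insert y H; b \<in> insert y H; c \<in> insert y H; e \<in> insert y H\<rbrakk> \<Longrightarrow> E a b c e \<longleftrightarrow> D a b c e"
    and "\<lbrakk>a \<in> insert x H; b \<in> insert x H; c \<in> insert x H; e \<in> insert x H\<rbrakk> \<Longrightarrow> E a b c e \<longleftrightarrow> D' a b c e"
  using assms unfolding fibre_def extensions_def rel_restrict_def by auto

lemma incl_x: "incl base ext_x \<in> embs boron_class"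
  unfolding incl_def by (rule emb_ofI) (use structs agree' in \<open>auto simp: dis_structs rel_restrict_def\<close>)

lemma incl_y: "incl base ext_y \<in> embs boron_class"
  unfolding incl_def by (rule emb_ofI) (use structs in \<open>auto simp: dis_structs rel_restrict_def\<close>)

lemma src_incl: "src (incl base ext_x) = src (incl base ext_y)"
  by (simp add: incl_def)

lemma joint_amalg:
  assumes E: "E \<in> fibre H x y D D'" shows "joint E \<in> amalgamations boron_class (incl base ext_x) (incl base ext_y)"
proof -
  have 1: "incl ext_y (ext_xy E) \<in> embs boron_class"
    unfolding incl_def by (rule emb_ofI) (use structs E fibreD(1)[OF E] in \<open>auto simp: dis_structs\<close>)
  have 2: "incl ext_x (ext_xy E) \<in> embs boron_class"
    unfolding incl_def by (rule emb_ofI) (use structs E fibreD(2)[OF E] in \<open>auto simp: dis_structs\<close>)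
  show ?thesis unfolding joint_def amalgamation_iff[OF incl_x incl_y src_incl]
    using 1 2 by (auto simp: incl_def dis_structs emb_of_def)
qed

text \<open>Renaming \<open>x\<close> to \<open>y\<close> must carry \<open>D'\<close> to
  \<open>D\<close>: the pullback of \<open>D\<close> agrees with \<open>D'\<close> on
  \<open>H\<close> and in the type of \<open>x\<close>, so \<open>dstruct_type_unique\<close>
  applies.\<close>

lemma merged_amalg:
  assumes s: "same_type H D y D' x" shows "merged \<in> amalgamations boron_class (incl base ext_x) (incl base ext_y)"
proof -
  let ?f = "\<lambda>v. if v = x then y else v"
  have inj: "inj_on ?f (insert x H)" using x y by (auto simp: inj_on_def)
  have f: "?f ` insert x H \<subseteq> insert y H" by auto
  define E where "E a b c e \<longleftrightarrow> {a, b, c, e} \<subseteq> insert x H \<and> D (?f a) (?f b) (?f c) (?f e)" for a b c e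
  have dE: "dstruct (insert x H) E" by (rule dstruct_pullback[OF dD inj f]) (rule E_def)
  have "D' = E"
  proof (rule dstruct_type_unique[OF dD' dE fin x])
    have "E a b c e \<longleftrightarrow> D a b c e" if "a \<in> H" "b \<in> H" "c \<in> H" "e \<in> H" for a b c e
      using that x unfolding E_def by auto
    then show "rel_restrict H D' = rel_restrict H E" using agree' by (auto simp: rel_restrict_def fun_eq_iff)
    show "D' a b x c \<longleftrightarrow> E a b x c" if "a \<in> H" "b \<in> H" "c \<in> H" for a b c
      using that s x unfolding E_def same_type_def by auto
  qed
  note D'E = this
  have 2: "emb_of ext_x ext_y ?f \<in> embs boron_class"
  proof (rule emb_ofI)
    show "ext_x \<in> boron_class" "ext_y \<in> boron_class" by (fact structs)+
    show "?f v \<in> points ext_y" if "v \<in> points ext_x" for v using that unfolding dis_structs by auto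
    show "inj_on ?f (points ext_x)" unfolding dis_structs by (rule inj)
    fix a b c e assume "a \<in> points ext_x" "b \<in> points ext_x" "c \<in> points ext_x" "e \<in> points ext_x"
    then have "{a, b, c, e} \<subseteq> insert x H" unfolding dis_structs by blast
    then show "dis ext_y (?f a) (?f b) (?f c) (?f e) \<longleftrightarrow> dis ext_x a b c e"
      unfolding dis_structs(2,3) unfolding D'E by (simp only: E_def simp_thms)
  qed
  have 1: "incl ext_y ext_y \<in> embs boron_class"
    unfolding incl_def by (rule emb_ofI) (use structs in \<open>auto simp: dis_structs\<close>)
  show ?thesis unfolding merged_def amalgamation_iff[OF incl_x incl_y src_incl]
    using 1 2 x by (auto simp: incl_def dis_structs emb_of_def)
qed

lemma glue_joint: "glue_dom (joint E) = insert y H <+> insert x H"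
  "v \<in> insert y H \<Longrightarrow> glue (joint E) (Inl v) = v" "v \<in> insert x H \<Longrightarrow> glue (joint E) (Inr v) = v"
  by (auto simp: glue_dom_def glue_def joint_def incl_def dis_structs)

lemma glue_merged: "glue_dom merged = insert y H <+> insert x H"
  "v \<in> insert y H \<Longrightarrow> glue merged (Inl v) = v" "v \<in> H \<Longrightarrow> glue merged (Inr v) = v" "glue merged (Inr x) = y"
  using x by (auto simp: glue_dom_def glue_def merged_def incl_def dis_structs)

lemma tgt_joint: "tgt (fst (joint E)) = ext_xy E" "tgt (fst merged) = ext_y"
  by (auto simp: joint_def merged_def incl_def)

lemma joint_inj:
  assumes E: "E \<in> fibre H x y D D'" "E' \<in> fibre H x y D D'" and eq: "amalg_inv (joint E) = amalg_inv (joint E')"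
  shows "E = E'"
proof -
  have dom: "glue_dom (joint E) = glue_dom (joint E')" unfolding glue_joint ..
  \<comment> \<open>A section of \<open>glue\<close> that serves both members of the fibre, so the
    two invariants can be compared quadruple by quadruple.\<close>
  define l where "l v = (if v = x then Inr v else Inl v)" for v
  have l: "l v \<in> glue_dom (joint E')" "glue (joint E) (l v) = v" "glue (joint E') (l v) = v" if "v \<in> insert x (insert y H)" for v
    using that glue_joint by (auto simp: l_def)
  have "E a b c e \<longleftrightarrow> E' a b c e" for a b c e
  proof (cases "{a, b, c, e} \<subseteq> insert x (insert y H)")
    case True
    then show ?thesis using amalg_inv_eqD(2)[OF eq dom, of "l a" "l b" "l c" "l e"] l E by (simp add: tgt_joint dis_structs)
  next
    case False
    have "dstruct (insert x (insert y H)) E" "dstruct (insert x (insert y H)) E'" using E unfolding fibre_def extensions_def by auto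
    then show ?thesis using False d_in by (metis insert_subset empty_subsetI)
  qed
  then show ?thesis by (simp add: fun_eq_iff)
qed

lemma joint_ne_merged: "amalg_inv (joint E) \<noteq> amalg_inv merged"
proof
  assume eq: "amalg_inv (joint E) = amalg_inv merged"
  have dom: "glue_dom (joint E) = glue_dom merged" unfolding glue_joint glue_merged ..
  have "Inl y \<in> glue_dom merged" "Inr x \<in> glue_dom merged" unfolding glue_merged by auto
  then have "glue (joint E) (Inl y) = glue (joint E) (Inr x)"
    using amalg_inv_eqD(1)[OF eq dom, of "Inl y" "Inr x"] glue_merged by simp
  then show False using glue_joint xy by simp
qed

text \<open>If the image of \<open>x\<close> is also reached by the other leg, it can only be the
  image of \<open>y\<close>, and the points merge. Otherwise the relation pulled back to
  \<open>insert x (insert y H)\<close> is a member of the fibre.\<close>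

lemma joint_cover:
  assumes a: "a \<in> amalgamations boron_class (incl base ext_x) (incl base ext_y)"
  shows "(same_type H D y D' x \<and> amalg_inv merged = amalg_inv a) \<or> (\<exists>E\<in>fibre H x y D D'. amalg_inv (joint E) = amalg_inv a)"
proof -
  note ap = amalg_parts[OF incl_x incl_y src_incl a, unfolded incl_def emb_of_simps dis_structs]
  let ?i = "fn (fst a)" and ?j = "fn (snd a)"
  have src: "points (src (fst a)) = insert y H" "points (src (snd a)) = insert x H" using ap(3,4) dis_structs by auto
  have ij: "?i v = ?j v" if "v \<in> H" for v using ap(6)[of v] that by (simp add: dis_structs)
  have di: "dis (tgt (fst a)) (?i b) (?i c) (?i d) (?i e) \<longleftrightarrow> D b c d e"
    if "b \<in> insert y H" "c \<in> insert y H" "d \<in> insert y H" "e \<in> insert y H" for b c d e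
    using emb_dis[OF ap(1), of b c d e] that src ap(3) by (simp add: dis_structs)
  have dj: "dis (tgt (fst a)) (?j b) (?j c) (?j d) (?j e) \<longleftrightarrow> D' b c d e"
    if "b \<in> insert x H" "c \<in> insert x H" "d \<in> insert x H" "e \<in> insert x H" for b c d e
    using emb_dis[OF ap(2), of b c d e] that src ap(4,5) by (simp add: dis_structs)
  have ii: "?i v = ?i w \<longleftrightarrow> v = w" if "v \<in> insert y H" "w \<in> insert y H" for v w using emb_inj_iff[OF ap(1)] that src by simp
  have jj: "?j v = ?j w \<longleftrightarrow> v = w" if "v \<in> insert x H" "w \<in> insert x H" for v w using emb_inj_iff[OF ap(2)] that src by simp
  have doma: "glue_dom a = insert y H <+> insert x H" using ap(8) dis_structs by simp
  show ?thesis
  proof (cases "?j x \<in> ?i ` insert y H")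
    case True
    then obtain v where v: "v \<in> insert y H" "?j x = ?i v" by blast
    have "v \<notin> H" using v(2) ij[of v] jj[of x v] x by auto
    then have jx: "?j x = ?i y" using v by blast
    have "D b c y e \<longleftrightarrow> D' b c x e" if "b \<in> H" "c \<in> H" "e \<in> H" for b c e
      using di[of b c y e] dj[of b c x e] ij that jx by simp
    then have "same_type H D y D' x" unfolding same_type_def by blast
    moreover have "amalg_inv merged = amalg_inv a"
    proof (rule amalg_inv_map[where P = "insert y H" and g = ?i])
      show "glue_dom merged = glue_dom a" unfolding doma glue_merged ..
      show "inj_on ?i (insert y H)" using ii by (auto intro: inj_onI)
      show "glue a p = ?i (glue merged p) \<and> glue merged p \<in> insert y H" if "p \<in> glue_dom a" for p
        using that unfolding doma
      proof (cases rule: Plus_cases)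
        case (Inl v) then show ?thesis using glue_merged by (simp add: glue_def)
      next
        case (Inr v)
        then show ?thesis using glue_merged(3)[of v] glue_merged(4) ij[of v] jx by (cases "v = x") (auto simp: glue_def)
      qed
    qed (use di in \<open>simp add: tgt_joint dis_structs\<close>)
    ultimately show ?thesis by blast
  next
    case False
    define g where "g v = (if v = x then ?j x else ?i v)" for v
    let ?K = "insert x (insert y H)"
    have gi: "g v = ?i v" if "v \<in> insert y H" for v using that x xy by (auto simp: g_def)
    have gj: "g v = ?j v" if "v \<in> insert x H" for v using that ij by (auto simp: g_def)
    have inj: "inj_on g ?K"
    proof (rule inj_onI)
      fix v w assume h: "v \<in> ?K" "w \<in> ?K" "g v = g w"
      have "?j x \<noteq> ?i u" "?i u \<noteq> ?j x" if "u \<in> insert y H" for u using False that by (metis imageI)+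
      note n = this
      show "v = w"
      proof (cases "v = x \<or> w = x")
        case True
        then show ?thesis using h n[of v] n[of w] unfolding g_def by (metis insertE)
      next
        case False
        then show ?thesis using h ii[of v w] by (simp add: g_def)
      qed
    qed
    define E where "E b c d e \<longleftrightarrow> {b, c, d, e} \<subseteq> ?K \<and> dis (tgt (fst a)) (g b) (g c) (g d) (g e)" for b c d e
    have "g ` ?K \<subseteq> points (tgt (fst a))" using emb_maps[OF ap(1)] emb_maps[OF ap(2)] src ap(5) gi gj by auto
    then have dE: "dstruct ?K E" by (rule dstruct_pullback[OF boron_dstruct[OF emb_tgt[OF ap(1)]] inj]) (rule E_def)
    have "E b c d e \<longleftrightarrow> D b c d e" if "b \<in> insert y H" "c \<in> insert y H" "d \<in> insert y H" "e \<in> insert y H" for b c d e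
      using that di[OF that] gi unfolding E_def by simp
    then have r1: "rel_restrict (insert y H) E = D" by (rule rel_restrict_eqI[OF dD])
    have "E b c d e \<longleftrightarrow> D' b c d e" if "b \<in> insert x H" "c \<in> insert x H" "d \<in> insert x H" "e \<in> insert x H" for b c d e
      using that dj[OF that] gj unfolding E_def by auto
    then have r2: "rel_restrict (insert x H) E = D'" by (rule rel_restrict_eqI[OF dD'])
    have E: "E \<in> fibre H x y D D'" unfolding fibre_def extensions_def using dE r1 r2 by blast
    moreover have "amalg_inv (joint E) = amalg_inv a"
    proof (rule amalg_inv_map[where P = ?K and g = g])
      show "glue_dom (joint E) = glue_dom a" unfolding doma glue_joint ..
      show "glue a p = g (glue (joint E) p) \<and> glue (joint E) p \<in> ?K" if "p \<in> glue_dom a" for p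
        using that unfolding doma
      proof (cases rule: Plus_cases)
        case (Inl v) then show ?thesis using glue_joint gi by (simp add: glue_def[of a])
      next
        case (Inr v) then show ?thesis using glue_joint gj by (auto simp: glue_def[of a])
      qed
      show "dis (tgt (fst a)) (g b) (g c) (g d) (g e) \<longleftrightarrow> dis (tgt (fst (joint E))) b c d e"
        if "b \<in> ?K" "c \<in> ?K" "d \<in> ?K" "e \<in> ?K" for b c d e
        using that unfolding tgt_joint dis_structs(4)[OF E] E_def by simp
    qed (rule inj)
    ultimately show ?thesis by blast
  qed
qed

lemma joint_representatives:
  "amalg_representatives boron_class (incl base ext_x) (incl base ext_y) joint_reps"
  unfolding amalg_representatives_iff[OF incl_x incl_y src_incl]
proof (intro conjI)
  show "finite joint_reps" unfolding joint_reps_def using finite_fibre by simp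
  show "joint_reps \<subseteq> amalgamations boron_class (incl base ext_x) (incl base ext_y)"
    unfolding joint_reps_def using joint_amalg merged_amalg by auto
  show "inj_on amalg_inv joint_reps"
  proof (rule inj_onI)
    fix a b assume ab: "a \<in> joint_reps" "b \<in> joint_reps" "amalg_inv a = amalg_inv b"
    have *: "(\<exists>E\<in>fibre H x y D D'. a = joint E) \<or> a = merged" if "a \<in> joint_reps" for a
      using that unfolding joint_reps_def by (auto split: if_splits)
    show "a = b" using *[OF ab(1)] *[OF ab(2)] ab(3) joint_inj joint_ne_merged by metis
  qed
  show "amalg_inv ` amalgamations boron_class (incl base ext_x) (incl base ext_y) \<subseteq> amalg_inv ` joint_reps"
  proof
    fix t assume "t \<in> amalg_inv ` amalgamations boron_class (incl base ext_x) (incl base ext_y)"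
    then obtain a where "a \<in> amalgamations boron_class (incl base ext_x) (incl base ext_y)" "t = amalg_inv a" by blast
    then consider "same_type H D y D' x" "t = amalg_inv merged" | E where "E \<in> fibre H x y D D'" "t = amalg_inv (joint E)"
      using joint_cover[of a] by metis
    then show "t \<in> amalg_inv ` joint_reps"
    proof cases
      case 1
      then show ?thesis unfolding joint_reps_def by simp
    next
      case 2
      then show ?thesis unfolding joint_reps_def by blast
    qed
  qed
qed

lemma sum_joint_reps:
  "(\<Sum>m\<in>joint_reps. f (fst m)) =
     (if same_type H D y D' x then f (incl ext_y ext_y) else (0 :: 'r::comm_ring_1)) +
     (\<Sum>E\<in>fibre H x y D D'. f (incl ext_y (ext_xy E)))"
proof -
  have inj: "inj_on joint (fibre H x y D D')" by (rule inj_onI) (use joint_inj in metis)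
  have nm: "merged \<notin> joint ` fibre H x y D D'" 
  proof
    assume "merged \<in> joint ` fibre H x y D D'"
    then obtain E where "merged = joint E" by blast
    then show False using joint_ne_merged[of E] by simp
  qed
  have "(\<Sum>m\<in>joint ` fibre H x y D D'. f (fst m)) = (\<Sum>E\<in>fibre H x y D D'. f (incl ext_y (ext_xy E)))"
    using inj by (subst sum.reindex) (auto simp: joint_def)
  then show ?thesis unfolding joint_reps_def using nm finite_fibre by (auto simp: merged_def)
qed

end

section \<open>Reduction of all embeddings to one-point extensions\<close>

lemma card_insert_le_Suc: "card (insert x A) \<le> Suc (card A)"
  by (cases "finite A") (auto simp: card_insert_if)

lemma (in sub_closed) factor_one_point:
  assumes e: "e \<in> embs \<AA>" and n: "\<not> is_iso e"
  obtains e1 e2 where "e1 \<in> embs \<AA>" "e2 \<in> embs \<AA>" "e = emb_comp e2 e1" "tgt e1 = src e2" "src e1 = src e" "tgt e2 = tgt e"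
    "card (points (tgt e1)) = Suc (card (points (src e)))"
proof -
  let ?P = "points (tgt e)" and ?S = "fn e ` points (src e)"
  have sub1: "?S \<subseteq> ?P" using emb_maps[OF e] by blast
  moreover have "?S \<noteq> ?P" using n is_iso_iff[OF e] by blast
  ultimately obtain y where y: "y \<in> ?P" "y \<notin> ?S" by blast
  define W where "W = substruct (tgt e) (insert y ?S)"
  have W: "W \<in> \<AA>" "points W = insert y ?S" unfolding W_def using sub[OF emb_tgt[OF e]] y sub1 by auto
  have disW: "dis W w x y' z \<longleftrightarrow> dis (tgt e) w x y' z" if "w \<in> points W" "x \<in> points W" "y' \<in> points W" "z \<in> points W" for w x y' z
    using that y sub1 W(2) unfolding W_def by (subst dis_substruct) (auto simp: rel_restrict_def)
  let ?e1 = "emb_of (src e) W (fn e)" and ?e2 = "incl W (tgt e)"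
  have e1: "?e1 \<in> embs \<AA>"
  proof (rule emb_ofI)
    show "src e \<in> \<AA>" "W \<in> \<AA>" using emb_src[OF e] W by auto
    show "fn e x \<in> points W" if "x \<in> points (src e)" for x using W that by simp
    show "inj_on (fn e) (points (src e))" using emb_inj[OF e] .
    fix w x y z assume "w \<in> points (src e)" "x \<in> points (src e)" "y \<in> points (src e)" "z \<in> points (src e)"
    then show "dis W (fn e w) (fn e x) (fn e y) (fn e z) \<longleftrightarrow> dis (src e) w x y z"
      using disW[of "fn e w" "fn e x" "fn e y" "fn e z"] W(2) emb_dis[OF e] by simp
  qed
  have e2: "?e2 \<in> embs \<AA>" unfolding incl_def
    by (rule emb_ofI) (use emb_tgt[OF e] W disW y sub1 in auto)
  have "emb_comp ?e2 ?e1 = e"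
    by (rule emb_comp_eqI[OF e2 e1 _ e]) (use W in \<open>auto simp: incl_def\<close>)
  moreover have "card (points W) = Suc (card (points (src e)))"
  proof -
    have "finite ?S" using finite_points[OF emb_src[OF e]] by blast
    then show ?thesis using W(2) y(2) card_image[OF emb_inj[OF e]] by simp
  qed
  ultimately show ?thesis using that[OF e1 e2] by (simp add: incl_def)
qed

text \<open>Up to an isomorphism onto the target, the source is kept and the added point is renamed
  to an \<open>x\<close> outside \<open>F\<close>. This freedom, which comes from the infinite type,
  keeps the new points of two extensions apart.\<close>

lemma one_point_form:
  fixes i :: "'a::infinite emb"
  assumes i: "i \<in> embs boron_class" and c: "card (points (tgt i)) = Suc (card (points (src i)))" and F: "finite F"
  obtains x D' \<alpha> where "x \<notin> points (src i)" "x \<notin> F" "dstruct (insert x (points (src i))) D'"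
    "rel_restrict (points (src i)) D' = dis (src i)" "\<alpha> \<in> embs boron_class" "is_iso \<alpha>"
    "src \<alpha> = mk_struct (insert x (points (src i))) D'" "tgt \<alpha> = tgt i"
    "i = emb_comp \<alpha> (incl (src i) (mk_struct (insert x (points (src i))) D'))"
proof -
  let ?H = "points (src i)" and ?P = "points (tgt i)"
  have fin: "finite ?H" "finite ?P" using boron.finite_points emb_src[OF i] emb_tgt[OF i] by auto
  obtain x where x: "x \<notin> ?H \<union> F" using ex_new_if_finite[of "?H \<union> F"] fin F infinite_UNIV by blast
  have im: "fn i ` ?H \<subseteq> ?P" using emb_maps[OF i] by blast
  have "card (fn i ` ?H) = card ?H" using emb_inj[OF i] by (rule card_image)
  then have "card (?P - fn i ` ?H) = 1" using c fin im by (simp add: card_Diff_subset)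
  then obtain z where z: "?P - fn i ` ?H = {z}" by (meson card_1_singletonE)
  define f where "f = (fn i)(x := z)"
  have fi: "f v = fn i v" if "v \<in> ?H" for v using that x by (auto simp: f_def)
  have fx: "f x = z" by (simp add: f_def)
  have fim: "f ` insert x ?H = ?P"
  proof -
    have "f ` ?H = fn i ` ?H" using fi by simp
    then show ?thesis using z im fx by auto
  qed
  have inj: "inj_on f (insert x ?H)"
  proof -
    have "inj_on f ?H" using emb_inj[OF i] fi by (simp add: inj_on_def)
    moreover have "f x \<notin> f ` ?H" using z fx fi by auto
    ultimately show ?thesis using x by simp
  qed
  define D' where "D' a b c d \<longleftrightarrow> {a, b, c, d} \<subseteq> insert x ?H \<and> dis (tgt i) (f a) (f b) (f c) (f d)" for a b c d
  have dD': "dstruct (insert x ?H) D'"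
    by (rule dstruct_pullback[OF boron_dstruct[OF emb_tgt[OF i]] inj]) (use fim in blast, rule D'_def)
  have r: "rel_restrict ?H D' = dis (src i)"
  proof (rule rel_restrict_eqI[OF boron_dstruct[OF emb_src[OF i]]])
    fix w x' y z assume "w \<in> ?H" "x' \<in> ?H" "y \<in> ?H" "z \<in> ?H"
    then show "D' w x' y z \<longleftrightarrow> dis (src i) w x' y z" using emb_dis[OF i, of w x' y z] fi unfolding D'_def by simp
  qed
  let ?U = "mk_struct (insert x ?H) D'"
  let ?\<alpha> = "emb_of ?U (tgt i) f"
  have U: "?U \<in> boron_class" using mk_struct_boron[OF _ dD'] fin by simp
  have a: "?\<alpha> \<in> embs boron_class"
  proof (rule emb_ofI[OF U emb_tgt[OF i]])
    show "f v \<in> ?P" if "v \<in> points ?U" for v using fim that by auto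
    show "inj_on f (points ?U)" using inj by simp
    fix w x' y z assume "w \<in> points ?U" "x' \<in> points ?U" "y \<in> points ?U" "z \<in> points ?U"
    then show "dis (tgt i) (f w) (f x') (f y) (f z) \<longleftrightarrow> dis ?U w x' y z"
      unfolding dis_mk_dstruct[OF dD'] D'_def by simp
  qed
  have iso: "is_iso ?\<alpha>" using is_iso_iff[OF a] fim by (simp add: emb_of_def)
  have inc: "incl (src i) ?U \<in> embs boron_class" unfolding incl_def
  proof (rule emb_ofI[OF emb_src[OF i] U])
    fix w x' y z assume h: "w \<in> ?H" "x' \<in> ?H" "y \<in> ?H" "z \<in> ?H"
    have "dis (src i) w x' y z \<longleftrightarrow> rel_restrict ?H D' w x' y z" using r by simp
    then show "dis ?U w x' y z \<longleftrightarrow> dis (src i) w x' y z" unfolding dis_mk_dstruct[OF dD'] using h by (simp add: rel_restrict_def)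
  qed auto
  have "emb_comp ?\<alpha> (incl (src i) ?U) = i"
    by (rule emb_comp_eqI[OF a inc _ i]) (use fi in \<open>auto simp: incl_def\<close>)
  then show ?thesis using that[of x D' ?\<alpha>] x dD' r a iso by simp
qed

lemma two_extensionsI:
  assumes "U \<in> boron_class" "x \<notin> points U" "y \<notin> points U" "x \<noteq> y"
    "dstruct (insert x (points U)) D'" "rel_restrict (points U) D' = dis U"
    "dstruct (insert y (points U)) D" "rel_restrict (points U) D = dis U"
  shows "two_extensions (points U) x y D D'" "two_extensions.base (points U) D = U"
proof -
  show *: "two_extensions (points U) x y D D'" by unfold_locales (use assms boron.finite_points in auto)
  show "two_extensions.base (points U) D = U"
    unfolding two_extensions.base_def[OF *] assms(8) by (rule mk_struct_dis[OF assms(1)])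
qed

text \<open>What the proof of relation (c) rests on: multiplicativity, and the values on one-point
  inclusions.\<close>

locale point_measure =
  fixes \<kappa> :: "'a::infinite emb \<Rightarrow> 'r::comm_ring_1" and c :: 'r
  assumes measure: "emb_measure boron_class \<kappa>"
    and point: "finite H \<Longrightarrow> x \<notin> H \<Longrightarrow> dstruct (insert x H) D \<Longrightarrow>
      \<kappa> (incl (mk_struct H (rel_restrict H D)) (mk_struct (insert x H) D)) = point_value c H D x"
begin

lemma additive_joint:
  assumes "two_extensions H x y D D'"
  shows "additive_at boron_class \<kappa> (incl (two_extensions.base H D) (two_extensions.ext_x H x D'))
    (incl (two_extensions.base H D) (two_extensions.ext_y H y D))"
proof -
  interpret two_extensions H x y D D' by fact
  have "\<kappa> (incl base ext_x) = point_value c H D' x"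
    using point[OF fin x dD'] agree by (simp add: base_def ext_x_def)
  moreover have "\<kappa> (incl ext_y (ext_xy E)) = point_value c (insert y H) E x" if E: "E \<in> fibre H x y D D'" for E
  proof -
    have "dstruct (insert x (insert y H)) E" "rel_restrict (insert y H) E = D" using E unfolding fibre_def extensions_def by auto
    then show ?thesis using point[of "insert y H" x E] fin x xy by (simp add: ext_y_def ext_xy_def)
  qed
  moreover have "\<kappa> (incl ext_y ext_y) = 1"
  proof -
    have i: "incl ext_y ext_y \<in> embs boron_class" unfolding incl_def by (rule emb_ofI) (use structs in auto)
    then have "is_iso (incl ext_y ext_y)" using is_iso_iff[OF i] by (simp add: incl_def emb_of_def)
    then show ?thesis using measure i unfolding emb_measure_def by blast
  qed
  ultimately have "\<kappa> (incl base ext_x) = (\<Sum>m\<in>joint_reps. \<kappa> (fst m))"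
    unfolding sum_joint_reps using point_value_additive[of c] by simp
  then show ?thesis unfolding additive_at_def using joint_representatives by blast
qed

text \<open>Both embeddings are inclusions in normal form followed by isomorphisms. The inclusions
  are treated by \<open>additive_joint\<close>, and the isomorphisms are absorbed one argument at a
  time.\<close>

lemma additive_one_one:
  assumes i: "i \<in> embs boron_class" and j: "j \<in> embs boron_class" and ij: "src i = src j"
    and c: "card (points (tgt i)) = Suc (card (points (src i)))" "card (points (tgt j)) = Suc (card (points (src j)))"
  shows "additive_at boron_class \<kappa> i j"
proof -
  obtain y D \<beta> where py: "y \<notin> points (src j)" "y \<notin> {}" "dstruct (insert y (points (src j))) D"
    "rel_restrict (points (src j)) D = dis (src j)" "\<beta> \<in> embs boron_class" "is_iso \<beta>"
    "src \<beta> = mk_struct (insert y (points (src j))) D" "tgt \<beta> = tgt j"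
    "j = emb_comp \<beta> (incl (src j) (mk_struct (insert y (points (src j))) D))"
    by (rule one_point_form[OF j c(2) finite.emptyI])
  obtain x D' \<alpha> where px: "x \<notin> points (src i)" "x \<notin> {y}" "dstruct (insert x (points (src i))) D'"
    "rel_restrict (points (src i)) D' = dis (src i)" "\<alpha> \<in> embs boron_class" "is_iso \<alpha>"
    "src \<alpha> = mk_struct (insert x (points (src i))) D'" "tgt \<alpha> = tgt i"
    "i = emb_comp \<alpha> (incl (src i) (mk_struct (insert x (points (src i))) D'))"
    by (rule one_point_form[OF i c(1), of "{y}"]) auto
  have two: "two_extensions (points (src j)) x y D D'" and b: "two_extensions.base (points (src j)) D = src j"
    using two_extensionsI[OF emb_src[OF j], of x y D' D] px(1-4) py(1,3,4) ij by auto
  interpret two_extensions "points (src j)" x y D D' by (rule two)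
  have bi: "base = src i" using b ij by simp
  have ex: "mk_struct (insert x (points (src i))) D' = ext_x" "mk_struct (insert y (points (src j))) D = ext_y"
    using ij by (simp_all add: ext_x_def ext_y_def)
  have j': "j = emb_comp \<beta> (incl base ext_y)" unfolding b ex(2)[symmetric] by (rule py(9))
  have i': "i = emb_comp \<alpha> (incl base ext_x)" unfolding bi ex(1)[symmetric] by (rule px(9))
  have t: "tgt (incl base ext_x) = src \<alpha>" "tgt (incl base ext_y) = src \<beta>" using px(7) py(7) ex by (auto simp: incl_def)
  have 1: "additive_at boron_class \<kappa> (incl base ext_x) (incl base ext_y)" using additive_joint[OF two] .
  have "additive_at boron_class \<kappa> (incl base ext_x) (emb_comp \<beta> (incl base ext_y))"
  proof (rule boron.additive_at_comp_right[OF incl_y py(5) incl_x t(2) src_incl 1])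
    fix a assume "a \<in> amalgamations boron_class (incl base ext_x) (incl base ext_y)"
    note ap = amalg_parts[OF incl_x incl_y src_incl this]
    show "additive_at boron_class \<kappa> (fst a) \<beta>"
      by (rule boron.additive_at_iso_right[OF measure ap(1) py(5) _ py(6)]) (use ap(3) t in simp)
  qed
  then have 2: "additive_at boron_class \<kappa> (incl base ext_x) j" by (simp only: j'[symmetric])
  have s: "src (incl base ext_x) = src j" using b by (simp add: incl_def)
  show ?thesis unfolding i'
  proof (rule boron.additive_at_comp[OF measure incl_x px(5) j t(1) s 2])
    fix a assume "a \<in> amalgamations boron_class (incl base ext_x) j"
    note ap = amalg_parts[OF incl_x j s this]
    show "additive_at boron_class \<kappa> \<alpha> (snd a)"
      by (rule boron.additive_at_iso_left[OF measure px(5) ap(2) _ px(6)]) (use ap(4) t in simp)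
  qed
qed

lemma emb_card_le: "e \<in> embs boron_class \<Longrightarrow> card (points (src e)) \<le> card (points (tgt e))"
  using card_inj_on_le[OF emb_inj] emb_maps boron.finite_points[OF emb_tgt] by (metis image_subsetI)

text \<open>Induction on the points added by \<open>j\<close>: amalgamating a one-point extension
  with \<open>j1\<close> again adds at most one point to \<open>tgt j1\<close>, so the hypothesis
  covers the remaining factor \<open>j2\<close>.\<close>

lemma additive_one_any:
  assumes "i \<in> embs boron_class" "j \<in> embs boron_class" "src i = src j" "card (points (tgt i)) \<le> Suc (card (points (src i)))"
  shows "additive_at boron_class \<kappa> i j"
  using assms
proof (induction "card (points (tgt j)) - card (points (src j))" arbitrary: i j rule: less_induct)
  case less
  show ?case
  proof (cases "is_iso i \<or> is_iso j")
    case True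
    then show ?thesis using boron.additive_at_iso_left[OF measure less.prems(1-3)] boron.additive_at_iso_right[OF measure less.prems(1-3)] by blast
  next
    case False
    have fini: "finite (points (tgt i))" using boron.finite_points[OF emb_tgt[OF less.prems(1)]] .
    have ci: "card (points (tgt i)) = Suc (card (points (src i)))"
      using False is_isoI_card[OF less.prems(1) fini] less.prems(4) by linarith
    obtain j1 j2 where f: "j1 \<in> embs boron_class" "j2 \<in> embs boron_class" "j = emb_comp j2 j1" "tgt j1 = src j2" "src j1 = src j" "tgt j2 = tgt j"
      "card (points (tgt j1)) = Suc (card (points (src j)))" using boron.factor_one_point[OF less.prems(2)] False by blast
    have s: "src i = src j1" using f less.prems(3) by simp
    have 1: "additive_at boron_class \<kappa> i j1" using additive_one_one[OF less.prems(1) f(1) s ci] f(5,7) by simp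
    show ?thesis unfolding f(3)
    proof (rule boron.additive_at_comp_right[OF f(1,2) less.prems(1) f(4) s 1])
      fix a assume "a \<in> amalgamations boron_class i j1"
      note ap = amalg_parts[OF less.prems(1) f(1) s this]
      show "additive_at boron_class \<kappa> (fst a) j2"
      proof (rule less.hyps[OF _ ap(1) f(2)])
        show "src (fst a) = src j2" using ap(3) f(4) by simp
        have "card (points (src j2)) \<le> card (points (tgt j2))" using emb_card_le[OF f(2)] .
        then show "card (points (tgt j2)) - card (points (src j2)) < card (points (tgt j)) - card (points (src j))"
          using f(7)[unfolded f(4)] unfolding f(6) by linarith
        have im: "fn i ` points (src i) \<subseteq> points (tgt i)" using emb_maps[OF less.prems(1)] by blast
        have "card (points (tgt i) - fn i ` points (src i)) = 1"
          using ci fini im card_image[OF emb_inj[OF less.prems(1)]] by (simp add: card_Diff_subset finite_subset)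
        then obtain z where z: "points (tgt i) - fn i ` points (src i) = {z}" by (meson card_1_singletonE)
        \<comment> \<open>The only possibly new point of the amalgam is the image of the point
          \<open>z\<close> added by \<open>i\<close>.\<close>
        have "fn (snd a) v \<in> insert (fn (snd a) z) (fn (fst a) ` points (tgt j1))" if v: "v \<in> points (tgt i)" for v
        proof (cases "v = z")
          case False
          then obtain u where u: "u \<in> points (src j1)" "v = fn i u" using z v s by auto
          then show ?thesis using ap(6)[OF u(1)] emb_maps[OF f(1) u(1)] by (metis imageI insertI2)
        qed simp
        then have "points (tgt (fst a)) \<subseteq> insert (fn (snd a) z) (fn (fst a) ` points (tgt j1))" using ap(7) by blast
        then have "card (points (tgt (fst a))) \<le> card (insert (fn (snd a) z) (fn (fst a) ` points (tgt j1)))"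
          using boron.finite_points[OF emb_tgt[OF f(1)]] by (intro card_mono) auto
        also have "\<dots> \<le> Suc (card (fn (fst a) ` points (tgt j1)))" by (rule card_insert_le_Suc)
        also have "\<dots> = Suc (card (points (src (fst a))))" using card_image[OF emb_inj[OF ap(1)]] ap(3) by simp
        finally show "card (points (tgt (fst a))) \<le> Suc (card (points (src (fst a))))" .
      qed
    qed
  qed
qed

text \<open>Induction on the points added by \<open>i\<close>: a one-point factor is split off, and
  it is already known to be additive against an arbitrary second argument.\<close>

theorem additive_everywhere:
  assumes "i \<in> embs boron_class" "j \<in> embs boron_class" "src i = src j"
  shows "additive_at boron_class \<kappa> i j"
  using assms
proof (induction "card (points (tgt i)) - card (points (src i))" arbitrary: i j rule: less_induct)
  case less
  show ?case
  proof (cases "is_iso i")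
    case True
    then show ?thesis using boron.additive_at_iso_left[OF measure less.prems(1-3)] by blast
  next
    case False
    obtain i1 i2 where f: "i1 \<in> embs boron_class" "i2 \<in> embs boron_class" "i = emb_comp i2 i1" "tgt i1 = src i2" "src i1 = src i" "tgt i2 = tgt i"
      "card (points (tgt i1)) = Suc (card (points (src i)))" using boron.factor_one_point[OF less.prems(1)] False by blast
    have s: "src i1 = src j" using f less.prems(3) by simp
    have 1: "additive_at boron_class \<kappa> i1 j" using additive_one_any[OF f(1) less.prems(2) s] f(5,7) by simp
    show ?thesis unfolding f(3)
    proof (rule boron.additive_at_comp[OF measure f(1,2) less.prems(2) f(4) s 1])
      fix a assume "a \<in> amalgamations boron_class i1 j"
      note ap = amalg_parts[OF f(1) less.prems(2) s this]
      have "card (points (src i2)) \<le> card (points (tgt i2))" using emb_card_le[OF f(2)] .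
      then have "card (points (tgt i2)) - card (points (src i2)) < card (points (tgt i)) - card (points (src i))"
        using f(7)[unfolded f(4)] unfolding f(6) by linarith
      moreover have "src i2 = src (snd a)" unfolding ap(4) f(4) ..
      ultimately show "additive_at boron_class \<kappa> i2 (snd a)" by (rule less.hyps[OF _ f(2) ap(2)])
    qed
  qed
qed

theorem relation:
  assumes "i \<in> embs boron_class" "j \<in> embs boron_class" "src i = src j" "amalg_representatives boron_class i j M"
  shows "\<kappa> i = (\<Sum>m\<in>M. \<kappa> (fst m))"
  using additive_atD[OF measure assms(1-3) additive_everywhere[OF assms(1-3)] assms(4)] .

end

section \<open>Products along chains of one-point extensions\<close>

text \<open>
  The points of \<open>P - S\<close> are added in an arbitrary order, which does not matter if
  \<open>2 * c ^ 2 + c = 0\<close>.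
\<close>

primrec chain_value ::
  "'r::comm_ring_1 \<Rightarrow> ('a \<Rightarrow> 'a \<Rightarrow> 'a \<Rightarrow> 'a \<Rightarrow> bool) \<Rightarrow> 'a set \<Rightarrow> nat \<Rightarrow> 'a set \<Rightarrow> 'r" where
  "chain_value c D P 0 S = 1"
| "chain_value c D P (Suc n) S =
    point_value c S D (SOME x. x \<in> P - S) * chain_value c D P n (insert (SOME x. x \<in> P - S) S)"

definition set_value :: "'r::comm_ring_1 \<Rightarrow> ('a \<Rightarrow> 'a \<Rightarrow> 'a \<Rightarrow> 'a \<Rightarrow> bool) \<Rightarrow> 'a set \<Rightarrow> 'a set \<Rightarrow> 'r" where
  "set_value c D P S = chain_value c D P (card (P - S)) S"

lemma set_value_all: "set_value c D P P = 1"
  by (simp add: set_value_def)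

lemma card_diff_insert: "finite P \<Longrightarrow> x \<in> P - S \<Longrightarrow> card (P - S) = Suc (card (P - insert x S))"
  by (metis Diff_insert card_Suc_Diff1 finite_Diff)

context
  fixes c :: "'r::comm_ring_1"
  assumes c: "2 * c ^ 2 + c = 0"
begin

lemma point_value_swap:
  assumes d: "dstruct K D" and S: "insert x (insert y S) \<subseteq> K" "finite S" "x \<notin> S" "y \<notin> S" "x \<noteq> y"
  shows "point_value c S D x * point_value c (insert x S) D y = point_value c S D y * point_value c (insert y S) D x"
proof -
  let ?E = "rel_restrict (insert x (insert y S)) D"
  have "point_value c S ?E x = point_value c S D x" "point_value c S ?E y = point_value c S D y"
    "point_value c (insert x S) ?E y = point_value c (insert x S) D y" "point_value c (insert y S) ?E x = point_value c (insert y S) D x"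
    by (rule point_value_cong; auto simp: rel_restrict_def)+
  then show ?thesis using point_value_commute[OF c dstruct_restrict[OF d S(1)] S(2-5)] by simp
qed

text \<open>The definition makes one arbitrary choice \<open>x0\<close>. For another
  \<open>x\<close>, both orders of adding the two points lead to the same larger set; the induction
  hypothesis reaches it from either side, and \<open>point_value_swap\<close> compares the two
  leading factors.\<close>

lemma set_value_step:
  assumes d: "dstruct K D" and P: "P \<subseteq> K" "finite P" and S: "S \<subseteq> P" "x \<in> P - S"
  shows "set_value c D P S = point_value c S D x * set_value c D P (insert x S)"
  using S
proof (induction "card (P - S)" arbitrary: S x rule: less_induct)
  case less
  define x0 where "x0 = (SOME x. x \<in> P - S)"
  have x0: "x0 \<in> P - S" unfolding x0_def using less.prems(2) by (rule someI)
  have st: "set_value c D P S = point_value c S D x0 * set_value c D P (insert x0 S)"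
    unfolding set_value_def card_diff_insert[OF P(2) x0] chain_value.simps x0_def ..
  show ?case
  proof (cases "x = x0")
    case True then show ?thesis using st by simp
  next
    case False
    have lt: "card (P - insert x0 S) < card (P - S)" "card (P - insert x S) < card (P - S)"
      using card_diff_insert[OF P(2) x0] card_diff_insert[OF P(2) less.prems(2)] by auto
    have 1: "set_value c D P (insert x0 S) = point_value c (insert x0 S) D x * set_value c D P (insert x (insert x0 S))"
      by (rule less.hyps[OF lt(1)]) (use x0 less.prems False in auto)
    have 2: "set_value c D P (insert x S) = point_value c (insert x S) D x0 * set_value c D P (insert x0 (insert x S))"
      by (rule less.hyps[OF lt(2)]) (use x0 less.prems False in auto)
    have "point_value c S D x * point_value c (insert x S) D x0 = point_value c S D x0 * point_value c (insert x0 S) D x"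
      by (rule point_value_swap[OF d]) (use x0 less.prems False P finite_subset in auto)
    then show ?thesis unfolding st 1 2 by (simp add: insert_commute mult.assoc[symmetric])
  qed
qed

lemma set_value_mult:
  assumes d: "dstruct K D" and P: "P \<subseteq> K" "finite P" and U: "S \<subseteq> U" "U \<subseteq> P"
  shows "set_value c D P S = set_value c D U S * set_value c D P U"
  using U(1)
proof (induction "card (U - S)" arbitrary: S rule: less_induct)
  case less
  have fU: "finite U" "U \<subseteq> K" using U P finite_subset by auto
  show ?case
  proof (cases "S = U")
    case True then show ?thesis by (simp add: set_value_all)
  next
    case False
    then obtain x where x: "x \<in> U - S" using less.prems by blast
    have lt: "card (U - insert x S) < card (U - S)" using card_diff_insert[OF fU(1) x] by simp
    have "set_value c D P S = point_value c S D x * set_value c D P (insert x S)"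
      by (rule set_value_step[OF d P]) (use x less.prems U in auto)
    also have "set_value c D P (insert x S) = set_value c D U (insert x S) * set_value c D P U"
      by (rule less.hyps[OF lt]) (use x less.prems in auto)
    also have "point_value c S D x * (set_value c D U (insert x S) * set_value c D P U) = set_value c D U S * set_value c D P U"
      using set_value_step[OF d fU(2,1) less.prems x] by (simp add: mult.assoc)
    finally show ?thesis .
  qed
qed

lemma point_value_image:
  assumes "inj_on f (insert x S)" "\<And>a b d e. a \<in> insert x S \<Longrightarrow> b \<in> insert x S \<Longrightarrow> d \<in> insert x S \<Longrightarrow> e \<in> insert x S \<Longrightarrow>
      D' (f a) (f b) (f d) (f e) \<longleftrightarrow> D a b d e"
  shows "point_value c (f ` S) D' (f x) = point_value c S D x"
proof -
  have inj: "inj_on f S" using assms(1) by (simp add: inj_on_insert)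
  have "f ` S - {f a} = f ` (S - {a})" if "a \<in> S" for a using inj that by (auto simp: inj_on_def)
  then have "leaf_at (f ` S) D' (f x) \<longleftrightarrow> leaf_at S D x" unfolding leaf_at_def using assms(2) by simp
  then show ?thesis unfolding point_value_def by (simp add: card_image[OF inj])
qed

text \<open>The arbitrary choices before and after renaming need not correspond, but
  \<open>set_value_step\<close> allows any point to be added next.\<close>

lemma set_value_image:
  assumes d: "dstruct K D" "dstruct K' D'" and P: "P \<subseteq> K" "finite P" "f ` P \<subseteq> K'" and f: "inj_on f P"
    "\<And>a b c e. a \<in> P \<Longrightarrow> b \<in> P \<Longrightarrow> c \<in> P \<Longrightarrow> e \<in> P \<Longrightarrow> D' (f a) (f b) (f c) (f e) \<longleftrightarrow> D a b c e"
    and S: "S \<subseteq> P"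
  shows "set_value c D' (f ` P) (f ` S) = set_value c D P S"
  using S
proof (induction "card (P - S)" arbitrary: S rule: less_induct)
  case less
  show ?case
  proof (cases "S = P")
    case True then show ?thesis by (simp add: set_value_all)
  next
    case False
    then obtain x where x: "x \<in> P - S" using less.prems by blast
    have lt: "card (P - insert x S) < card (P - S)" using card_diff_insert[OF P(2) x] by simp
    have xS: "insert x S \<subseteq> P" using x less.prems by auto
    have "f x \<in> f ` P - f ` S" using x less.prems f(1) by (auto simp: inj_on_def)
    then have "set_value c D' (f ` P) (f ` S) = point_value c (f ` S) D' (f x) * set_value c D' (f ` P) (insert (f x) (f ` S))"
      using set_value_step[OF d(2) P(3)] P(2) less.prems by (metis finite_imageI image_mono)
    also have "insert (f x) (f ` S) = f ` insert x S" by simp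
    also have "set_value c D' (f ` P) (f ` insert x S) = set_value c D P (insert x S)" by (rule less.hyps[OF lt xS])
    also have "point_value c (f ` S) D' (f x) = point_value c S D x"
    proof (rule point_value_image)
      show "inj_on f (insert x S)" using f(1) xS by (rule inj_on_subset)
    qed (use f(2) xS in blast)
    also have "point_value c S D x * set_value c D P (insert x S) = set_value c D P S"
      using set_value_step[OF d(1) P(1,2) less.prems x] by simp
    finally show ?thesis .
  qed
qed

end

definition emb_value :: "'r::comm_ring_1 \<Rightarrow> 'a emb \<Rightarrow> 'r" where
  "emb_value c e = set_value c (dis (tgt e)) (points (tgt e)) (fn e ` points (src e))"

lemma emb_value_measure:
  fixes c :: "'r::comm_ring_1"
  assumes c: "2 * c ^ 2 + c = 0"
  shows "emb_measure boron_class (emb_value c :: 'a emb \<Rightarrow> 'r)"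
  unfolding emb_measure_def
proof (intro conjI ballI impI)
  fix e :: "'a emb" assume "e \<in> embs boron_class" "is_iso e"
  then have "fn e ` points (src e) = points (tgt e)" using is_iso_iff by blast
  then show "emb_value c e = 1" unfolding emb_value_def by (simp add: set_value_all)
next
  fix i j :: "'a emb" assume e: "i \<in> embs boron_class" "j \<in> embs boron_class" and t: "tgt j = src i"
  let ?P = "points (tgt i)" and ?U = "points (src i)" and ?S = "fn j ` points (src j)"
  have d: "dstruct ?P (dis (tgt i))" "dstruct ?U (dis (src i))" using boron_dstruct emb_tgt[OF e(1)] emb_src[OF e(1)] by auto
  have fin: "finite ?P" "finite ?U" using boron.finite_points emb_tgt[OF e(1)] emb_src[OF e(1)] by auto
  have S: "?S \<subseteq> ?U" using emb_maps[OF e(2)] t by auto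
  have U: "fn i ` ?U \<subseteq> ?P" using emb_maps[OF e(1)] by blast
  have "fn (emb_comp i j) ` points (src j) = fn i ` ?S" by (simp add: image_image)
  then have "emb_value c (emb_comp i j) = set_value c (dis (tgt i)) ?P (fn i ` ?S)" unfolding emb_value_def by simp
  also have "\<dots> = set_value c (dis (tgt i)) (fn i ` ?U) (fn i ` ?S) * set_value c (dis (tgt i)) ?P (fn i ` ?U)"
    by (rule set_value_mult[OF c d(1) order_refl fin(1) image_mono[OF S] U])
  also have "set_value c (dis (tgt i)) (fn i ` ?U) (fn i ` ?S) = set_value c (dis (src i)) ?U ?S"
    by (rule set_value_image[OF c d(2,1) order_refl fin(2) U emb_inj[OF e(1)] emb_dis[OF e(1)] S])
  finally show "emb_value c (emb_comp i j) = emb_value c i * emb_value c j"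
    unfolding emb_value_def t by (simp add: mult.commute)
qed

lemma emb_value_point:
  assumes c: "2 * c ^ 2 + c = 0" and h: "finite H" "x \<notin> H" "dstruct (insert x H) D"
  shows "emb_value c (incl (mk_struct H (rel_restrict H D)) (mk_struct (insert x H) D)) = point_value c H D x"
proof -
  have "emb_value c (incl (mk_struct H (rel_restrict H D)) (mk_struct (insert x H) D)) = set_value c D (insert x H) H"
    unfolding emb_value_def incl_def by (simp add: emb_of_def dis_mk_dstruct[OF h(3)])
  also have "\<dots> = point_value c H D x * set_value c D (insert x H) (insert x H)"
    by (rule set_value_step[OF c h(3)]) (use h in auto)
  finally show ?thesis by (simp add: set_value_all)
qed

lemma point_measure_emb_value: "2 * c ^ 2 + c = 0 \<Longrightarrow> point_measure (emb_value c) c"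
  by unfold_locales (auto intro: emb_value_measure emb_value_point)

section \<open>Classes of one-point extensions\<close>

definition point_incl :: "'a set \<Rightarrow> ('a \<Rightarrow> 'a \<Rightarrow> 'a \<Rightarrow> 'a \<Rightarrow> bool) \<Rightarrow> 'a \<Rightarrow> 'a emb" where
  "point_incl H D x = incl (mk_struct H D) (mk_struct (insert x H) D)"

lemma mk_struct_rel_restrict: "H \<subseteq> K \<Longrightarrow> mk_struct H (rel_restrict K D) = mk_struct H D"
  unfolding mk_struct_def rel_restrict_def by auto

lemma point_incl_restrict: "insert x H \<subseteq> K \<Longrightarrow> point_incl H (rel_restrict K D) x = point_incl H D x"
  unfolding point_incl_def by (simp add: mk_struct_rel_restrict)

lemma mk_struct_boron': "finite H \<Longrightarrow> dstruct K D \<Longrightarrow> H \<subseteq> K \<Longrightarrow> mk_struct H D \<in> boron_class"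
  using mk_struct_boron[of H "rel_restrict H D"] dstruct_restrict[of K D H] mk_struct_rel_restrict[of H H D] by simp

lemma incl_mk_struct:
  assumes "finite K" "dstruct K D" "H \<subseteq> K"
  shows "incl (mk_struct H D) (mk_struct K D) \<in> embs boron_class"
  unfolding incl_def
  by (rule emb_ofI) (use assms mk_struct_boron'[OF finite_subset[OF assms(3,1)] assms(2,3)] mk_struct_boron[OF assms(1,2)]
    in \<open>auto simp: dis_mk_struct rel_restrict_def\<close>)

lemma point_incl_in: "finite H \<Longrightarrow> dstruct K D \<Longrightarrow> insert x H \<subseteq> K \<Longrightarrow> point_incl H D x \<in> embs boron_class"
  using incl_mk_struct[of "insert x H" "rel_restrict (insert x H) D" H] dstruct_restrict[of K D "insert x H"]
    mk_struct_rel_restrict[of H "insert x H" D] mk_struct_rel_restrict[of "insert x H" "insert x H" D]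
  unfolding point_incl_def by (simp add: subset_insertI)

text \<open>
  Everything is done modulo the ideal \<open>I\<close>, before passing to the quotient ring.
\<close>

locale theta_congruence =
  fixes \<kappa> :: "'a::infinite emb \<Rightarrow> 'r::comm_ring_1" and C I :: "'r set"
  assumes zero: "0 \<in> I" and add: "p \<in> I \<Longrightarrow> q \<in> I \<Longrightarrow> p + q \<in> I" and neg: "p \<in> I \<Longrightarrow> - p \<in> I"
    and mult: "r \<in> C \<Longrightarrow> p \<in> I \<Longrightarrow> r * p \<in> I" and carrier: "e \<in> embs boron_class \<Longrightarrow> \<kappa> e \<in> C"
    and C1: "1 \<in> C" "- 1 \<in> C" "r \<in> C \<Longrightarrow> s \<in> C \<Longrightarrow> r + s \<in> C" "r \<in> C \<Longrightarrow> s \<in> C \<Longrightarrow> r * s \<in> C"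
    and iso: "e \<in> embs boron_class \<Longrightarrow> is_iso e \<Longrightarrow> \<kappa> e - 1 \<in> I"
    and comp: "i \<in> embs boron_class \<Longrightarrow> j \<in> embs boron_class \<Longrightarrow> tgt j = src i \<Longrightarrow> \<kappa> (emb_comp i j) - \<kappa> i * \<kappa> j \<in> I"
    and rel: "i \<in> embs boron_class \<Longrightarrow> j \<in> embs boron_class \<Longrightarrow> src i = src j \<Longrightarrow>
      amalg_representatives boron_class i j M \<Longrightarrow> \<kappa> i - (\<Sum>m\<in>M. \<kappa> (fst m)) \<in> I"
begin

definition eqv (infix "\<approx>" 50) where "p \<approx> q \<longleftrightarrow> p - q \<in> I"

lemma eqv_refl: "p \<approx> p" by (simp add: eqv_def zero)

lemma eqv_sym: "p \<approx> q \<Longrightarrow> q \<approx> p" unfolding eqv_def using neg[of "p - q"] by simp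

lemma eqv_trans: "p \<approx> q \<Longrightarrow> q \<approx> r \<Longrightarrow> p \<approx> r" unfolding eqv_def using add[of "p - q" "q - r"] by simp

lemma eqv_add: "p \<approx> q \<Longrightarrow> r \<approx> s \<Longrightarrow> p + r \<approx> q + s" unfolding eqv_def using add[of "p - q" "r - s"] by (simp add: algebra_simps)

lemma eqv_minus: "p \<approx> q \<Longrightarrow> - p \<approx> - q" unfolding eqv_def using neg[of "p - q"] by (simp add: algebra_simps)

lemma eqv_diff: "p \<approx> q \<Longrightarrow> r \<approx> s \<Longrightarrow> p - r \<approx> q - s" using eqv_add[OF _ eqv_minus, of p q r s] by simp

text \<open>The ideal absorbs multiplication by \<open>C\<close> only. Writing
  \<open>p * r - q * s\<close> as \<open>p * (r - s) + s * (p - q)\<close> shows which two factors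
  must lie in \<open>C\<close>.\<close>

lemma eqv_mult: "p \<approx> q \<Longrightarrow> r \<approx> s \<Longrightarrow> p \<in> C \<Longrightarrow> s \<in> C \<Longrightarrow> p * r \<approx> q * s"
  unfolding eqv_def using add[OF mult[of p "r - s"] mult[of s "p - q"]] by (simp add: algebra_simps)

lemma eqv_sum: "(\<And>x. x \<in> A \<Longrightarrow> f x \<approx> g x) \<Longrightarrow> sum f A \<approx> sum g A"
  by (induction A rule: infinite_finite_induct) (auto intro: eqv_refl eqv_add)

lemma comp_iso_right: "i \<in> embs boron_class \<Longrightarrow> j \<in> embs boron_class \<Longrightarrow> tgt j = src i \<Longrightarrow> is_iso j \<Longrightarrow> \<kappa> (emb_comp i j) \<approx> \<kappa> i"
  using eqv_trans[of "\<kappa> (emb_comp i j)" "\<kappa> i * \<kappa> j" "\<kappa> i * 1"] comp[of i j] eqv_mult[OF eqv_refl, of "\<kappa> j" 1 "\<kappa> i"] iso[of j] carrier[of i] C1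
  by (simp add: eqv_def)

lemma comp_iso_left: "i \<in> embs boron_class \<Longrightarrow> j \<in> embs boron_class \<Longrightarrow> tgt j = src i \<Longrightarrow> is_iso i \<Longrightarrow> \<kappa> (emb_comp i j) \<approx> \<kappa> j"
  using eqv_trans[of "\<kappa> (emb_comp i j)" "\<kappa> i * \<kappa> j" "1 * \<kappa> j"] comp[of i j] eqv_mult[OF _ eqv_refl, of "\<kappa> i" 1 "\<kappa> j"] iso[of i] carrier[of i] carrier[of j] C1
  by (simp add: eqv_def)

definition pt where "pt H D x = \<kappa> (point_incl H D x)"

lemma pt_restrict: "insert x H \<subseteq> K \<Longrightarrow> pt H (rel_restrict K D) x = pt H D x"
  by (simp add: pt_def point_incl_restrict)

text \<open>The two inclusions form a commuting square with the isomorphisms induced by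
  \<open>f\<close>, and isomorphisms have class one.\<close>

lemma pt_image:
  assumes fin: "finite H" and d: "dstruct (insert x H) D" "dstruct (insert (f x) (f ` H)) E"
    and f: "inj_on f (insert x H)" and x: "x \<notin> H"
    and DE: "\<And>a b c e. a \<in> insert x H \<Longrightarrow> b \<in> insert x H \<Longrightarrow> c \<in> insert x H \<Longrightarrow> e \<in> insert x H \<Longrightarrow> E (f a) (f b) (f c) (f e) \<longleftrightarrow> D a b c e"
  shows "pt (f ` H) E (f x) \<approx> pt H D x"
proof -
  let ?K = "insert x H"
  let ?b = "emb_of (mk_struct ?K D) (mk_struct (f ` ?K) E) f"
  let ?a = "emb_of (mk_struct H D) (mk_struct (f ` H) E) f"
  have dE: "dstruct (f ` ?K) E" using d(2) by simp
  have s: "mk_struct ?K D \<in> boron_class" "mk_struct (f ` ?K) E \<in> boron_class" "mk_struct H D \<in> boron_class" "mk_struct (f ` H) E \<in> boron_class"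
    using mk_struct_boron'[OF _ d(1), of ?K] mk_struct_boron'[OF _ dE, of "f ` ?K"] mk_struct_boron'[OF _ d(1), of H]
      mk_struct_boron'[OF _ dE, of "f ` H"] fin by auto
  have b: "?b \<in> embs boron_class"
    by (rule emb_ofI[OF s(1,2)]) (use f DE in \<open>auto simp: dis_mk_struct rel_restrict_def\<close>)
  have a: "?a \<in> embs boron_class"
    by (rule emb_ofI[OF s(3,4)]) (use f DE in \<open>auto simp: dis_mk_struct rel_restrict_def inj_on_insert\<close>)
  have iso: "is_iso ?a" "is_iso ?b" unfolding is_iso_iff[OF a] is_iso_iff[OF b] by (auto simp: emb_of_def)
  have p: "point_incl H D x \<in> embs boron_class" "point_incl (f ` H) E (f x) \<in> embs boron_class"
    using point_incl_in[OF _ d(1), of H x] point_incl_in[OF _ d(2), of "f ` H" "f x"] fin by auto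
  have "emb_comp (point_incl (f ` H) E (f x)) ?a = emb_comp ?b (point_incl H D x)"
    by (rule emb_comp_eqI[OF p(2) a _ emb_comp_in[OF b p(1)]]) (auto simp: point_incl_def incl_def)
  moreover have "\<kappa> (emb_comp (point_incl (f ` H) E (f x)) ?a) \<approx> pt (f ` H) E (f x)"
    unfolding pt_def by (rule comp_iso_right[OF p(2) a _ iso(1)]) (simp add: point_incl_def incl_def)
  moreover have "\<kappa> (emb_comp ?b (point_incl H D x)) \<approx> pt H D x"
    unfolding pt_def by (rule comp_iso_left[OF b p(1) _ iso(2)]) (simp add: point_incl_def incl_def)
  ultimately show ?thesis using eqv_sym eqv_trans by metis
qed

lemma pt_additive:
  assumes "two_extensions H x y D D'"
  shows "pt H D' x \<approx> (if same_type H D y D' x then 1 else 0) + (\<Sum>E\<in>fibre H x y D D'. pt (insert y H) E x)"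
proof -
  interpret two_extensions H x y D D' by fact
  have i: "incl ext_y ext_y \<in> embs boron_class" unfolding incl_def by (rule emb_ofI) (use structs in auto)
  have "is_iso (incl ext_y ext_y)" using is_iso_iff[OF i] by (simp add: incl_def emb_of_def)
  then have 1: "\<kappa> (incl ext_y ext_y) \<approx> 1" using iso[OF i] by (simp add: eqv_def)
  have 2: "\<kappa> (incl ext_y (ext_xy E)) = pt (insert y H) E x" if E: "E \<in> fibre H x y D D'" for E
  proof -
    have "rel_restrict (insert y H) E = D" using E unfolding fibre_def extensions_def by blast
    then have "ext_y = mk_struct (insert y H) E" using mk_struct_rel_restrict[of "insert y H" "insert y H" E] by (simp add: ext_y_def)
    then show ?thesis by (simp add: pt_def point_incl_def ext_xy_def)
  qed
  have 3: "incl base ext_x = point_incl H D' x"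
    unfolding base_def ext_x_def point_incl_def agree using mk_struct_rel_restrict[of H H D'] by simp
  have "pt H D' x \<approx> (\<Sum>m\<in>joint_reps. \<kappa> (fst m))"
    unfolding pt_def 3[symmetric] eqv_def by (rule rel[OF incl_x incl_y src_incl joint_representatives])
  moreover have "(\<Sum>m\<in>joint_reps. \<kappa> (fst m)) \<approx>
      (if same_type H D y D' x then 1 else 0) + (\<Sum>E\<in>fibre H x y D D'. pt (insert y H) E x)"
    unfolding sum_joint_reps by (rule eqv_add) (use 1 2 in \<open>auto intro: eqv_refl eqv_sum\<close>)
  ultimately show ?thesis by (rule eqv_trans)
qed

definition good where
  "good c H D x \<longleftrightarrow> pt H D x \<approx> point_value c H D x"

lemma good_down:
  assumes "two_extensions H x y D D'" "\<And>E. E \<in> fibre H x y D D' \<Longrightarrow> good c (insert y H) E x"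
  shows "good c H D' x"
proof -
  have "pt H D' x \<approx> (if same_type H D y D' x then 1 else 0) + (\<Sum>E\<in>fibre H x y D D'. point_value c (insert y H) E x)"
    by (rule eqv_trans[OF pt_additive[OF assms(1)]], rule eqv_add[OF eqv_refl eqv_sum])
      (use assms(2) in \<open>simp add: good_def\<close>)
  then show ?thesis unfolding good_def two_extensions.point_value_additive[OF assms(1), of c, symmetric] .
qed

text \<open>The additivity equation holds both for \<open>pt\<close> and for
  \<open>point_value\<close>; if all terms but one are known to agree, so does the last.\<close>

lemma good_up:
  assumes two: "two_extensions H x y D D'" and E: "E \<in> fibre H x y D D'" and g: "good c H D' x"
    and others: "\<And>F. F \<in> fibre H x y D D' \<Longrightarrow> F \<noteq> E \<Longrightarrow> good c (insert y H) F x"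
  shows "good c (insert y H) E x"
proof -
  let ?s = "if same_type H D y D' x then 1 else 0 :: 'r" and ?F = "fibre H x y D D'"
  have fin: "finite ?F" using two_extensions.finite_fibre[OF two] .
  have split: "sum f ?F = f E + sum f (?F - {E})" for f :: "_ \<Rightarrow> 'r" using sum.remove[OF fin E] .
  have "pt H D' x \<approx> ?s + (pt (insert y H) E x + (\<Sum>F\<in>?F - {E}. pt (insert y H) F x))"
    using pt_additive[OF two] unfolding split .
  moreover have "pt H D' x \<approx> ?s + (point_value c (insert y H) E x + (\<Sum>F\<in>?F - {E}. point_value c (insert y H) F x))"
    using g unfolding good_def two_extensions.point_value_additive[OF two, of c] split .
  ultimately have "?s + (pt (insert y H) E x + (\<Sum>F\<in>?F - {E}. pt (insert y H) F x)) \<approx>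
      ?s + (point_value c (insert y H) E x + (\<Sum>F\<in>?F - {E}. point_value c (insert y H) F x))"
    using eqv_sym eqv_trans by blast
  from eqv_diff[OF this eqv_refl[of ?s]]
  have "pt (insert y H) E x + (\<Sum>F\<in>?F - {E}. pt (insert y H) F x) \<approx>
      point_value c (insert y H) E x + (\<Sum>F\<in>?F - {E}. point_value c (insert y H) F x)" by simp
  moreover have "(\<Sum>F\<in>?F - {E}. pt (insert y H) F x) \<approx> (\<Sum>F\<in>?F - {E}. point_value c (insert y H) F x)"
    by (rule eqv_sum) (use others in \<open>auto simp: good_def\<close>)
  ultimately have "pt (insert y H) E x + (\<Sum>F\<in>?F - {E}. pt (insert y H) F x) - (\<Sum>F\<in>?F - {E}. pt (insert y H) F x) \<approx>
      point_value c (insert y H) E x + (\<Sum>F\<in>?F - {E}. point_value c (insert y H) F x) - (\<Sum>F\<in>?F - {E}. point_value c (insert y H) F x)"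
    by (rule eqv_diff)
  then show ?thesis unfolding good_def by simp
qed

text \<open>Over three points every edge is pendant, so any two such extensions are isomorphic:
  match the singleton sides, the other sides by any bijection, and the new points.\<close>

lemma pt_card3:
  assumes H: "card H = 3" "x \<notin> H" "dstruct (insert x H) D" and H': "card H' = 3" "x' \<notin> H'" "dstruct (insert x' H') D'"
  shows "pt H' D' x' \<approx> pt H D x"
proof -
  have fin: "finite H" "finite H'" using H(1) H'(1) by (auto intro: card_ge_0_finite)
  have ex: "\<exists>a B. edge_at D H x {a} B" if h: "card H = 3" "x \<notin> H" "dstruct (insert x H) D" "finite H" for H x and D :: "'a \<Rightarrow> 'a \<Rightarrow> 'a \<Rightarrow> 'a \<Rightarrow> bool"
  proof -
    obtain A B where AB: "edge_at D H x A B" using edge_at_exists[OF h(3,4) refl h(2)] h(1) by auto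
    then show ?thesis using edge_at_singleton_side[OF AB h(4)] edge_at_sym[OF AB] h(1) unfolding is_singleton_def by blast
  qed
  obtain a B where e: "edge_at D H x {a} B" using ex[OF H fin(1)] by blast
  obtain a' B' where e': "edge_at D' H' x' {a'} B'" using ex[OF H' fin(2)] by blast
  note P = edge_at_parts[OF e] and P' = edge_at_parts[OF e']
  have B: "finite B" "finite B'" using P P' fin finite_subset by auto
  have cB: "card B = card B'"
  proof -
    have "card H = Suc (card B)" "card H' = Suc (card B')" using P(3,4) P'(3,4) B by (metis Un_insert_left card_insert_disjoint disjoint_insert(1) sup_bot_left inf_commute)+
    then show ?thesis using H H' by simp
  qed
  obtain h where h: "bij_betw h B B'" using finite_same_card_bij[OF B cB] by blast
  define f where "f = h(a := a', x := x')"
  have ne: "a \<noteq> x" "x \<notin> B" "a \<notin> B" "a' \<noteq> x'" "x' \<notin> B'" "a' \<notin> B'" using P P' H(2) H'(2) by auto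
  have fB: "f b = h b" if "b \<in> B" for b using that ne by (auto simp: f_def)
  have fB': "f ` B = B'" using h fB unfolding bij_betw_def by simp
  have fa: "f a = a'" "f x = x'" using ne by (auto simp: f_def)
  have fH: "f ` H = H'" using P(4) P'(4) fB' fa by (metis Un_insert_left image_insert sup_bot_left)
  have inj: "inj_on f (insert x H)"
  proof -
    have "inj_on f B" using h fB unfolding bij_betw_def by (simp add: inj_on_def)
    then have "inj_on f (insert a B)" using fB' fa ne by (simp add: inj_on_insert)
    then have "inj_on f H" by (simp add: P(4)[symmetric])
    then show ?thesis using fH fa H(2) H'(2) by simp
  qed
  define E where "E p q r s \<longleftrightarrow> {p, q, r, s} \<subseteq> insert x H \<and> D' (f p) (f q) (f r) (f s)" for p q r s
  have sub: "f ` insert x H \<subseteq> insert x' H'" using fH fa by auto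
  have dE: "dstruct (insert x H) E" by (rule dstruct_pullback[OF H'(3) inj sub]) (rule E_def)
  have "D = E"
  proof (rule edge_at_extension_unique[OF H(3) dE H(2) e])
    have "dstruct H (rel_restrict H D)" "dstruct H (rel_restrict H E)" using dstruct_restrict[OF H(3)] dstruct_restrict[OF dE] by blast+
    then show "rel_restrict H D = rel_restrict H E" using dstruct_small fin H(1) by (metis order_refl)
    show "edge_at E H x {a} B" unfolding edge_at_def
    proof (intro conjI ballI)
      have BH: "b \<in> insert x H" if "b \<in> B" for b using that P by blast
      have aH: "a \<in> insert x H" using P by blast
      show "E p p' x b" if "p \<in> {a}" "p' \<in> {a}" "b \<in> B" for p p' b
      proof -
        have "D' a' a' x' (f b)" using e' fB' that(3) unfolding edge_at_def by blast
        then show ?thesis using that BH aH fa unfolding E_def by simp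
      qed
      show "E b b' x p" if "b \<in> B" "b' \<in> B" "p \<in> {a}" for b b' p
      proof -
        have "D' (f b) (f b') x' a'" using e' fB' that(1,2) unfolding edge_at_def by blast
        then show ?thesis using that BH aH fa unfolding E_def by simp
      qed
    qed (use P in auto)
  qed
  then have "D' (f p) (f q) (f r) (f s) \<longleftrightarrow> D p q r s" if "p \<in> insert x H" "q \<in> insert x H" "r \<in> insert x H" "s \<in> insert x H" for p q r s
    using that by (simp add: E_def)
  then have "pt (f ` H) D' (f x) \<approx> pt H D x" using H'(3) unfolding fH[symmetric] fa(2)[symmetric]
    by (intro pt_image[OF fin(1) H(3) _ inj H(2)])
  then show ?thesis by (simp add: fH fa)
qed

section \<open>Values of one-point extensions modulo the ideal\<close>

context
  fixes H0 :: "'a set" and D0 x0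
  assumes base: "card H0 = 3" "x0 \<notin> H0" "dstruct (insert x0 H0) D0"
begin

abbreviation "cc \<equiv> pt H0 D0 x0"

lemma good3:
  assumes "card H = 3" "x \<notin> H" "dstruct (insert x H) D" shows "good cc H D x"
proof -
  have fin: "finite H" using assms(1) by (auto intro: card_ge_0_finite)
  obtain A B where AB: "edge_at D H x A B" using edge_at_exists[OF assms(3) fin refl assms(2)] assms(1) by auto
  have "point_value cc H D x = cc"
    using point_value_edge[OF assms(3) AB assms(2) fin, of cc] edge_at_singleton_side[OF AB fin] assms(1) by simp
  then show ?thesis unfolding good_def using pt_card3[OF base assms] by simp
qed

text \<open>Descending induction from three points: the value over \<open>H\<close> is one, if the
  types agree, plus values over one more point.\<close>

lemma good_small:
  assumes "finite H" "card H \<le> 3" "x \<notin> H" "dstruct (insert x H) D'" shows "good cc H D' x"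
  using assms
proof (induction "3 - card H" arbitrary: H D' rule: less_induct)
  case less
  show ?case
  proof (cases "card H = 3")
    case True then show ?thesis using good3 less.prems by blast
  next
    case False
    obtain y where y: "y \<notin> insert x H" using ex_new_if_finite[of "insert x H"] less.prems(1) infinite_UNIV by blast
    have f: "finite (insert y H)" "card (insert y H) \<le> 3" "card (insert y H) = Suc (card H)" using y less.prems False by auto
    have dD: "dstruct (insert y H) (disjoint_rel (insert y H))" using dstruct_disjoint_rel f by blast
    have "dstruct H (rel_restrict H D')" using dstruct_restrict[OF less.prems(4)] by blast
    then have "rel_restrict H D' = disjoint_rel H" using dstruct_small less.prems(1,2) by blast
    then have two: "two_extensions H x y (disjoint_rel (insert y H)) D'"
      by unfold_locales (use less.prems y dD rel_restrict_disjoint_rel[of H "insert y H"] in auto)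
    show ?thesis
    proof (rule good_down[OF two])
      fix E assume "E \<in> fibre H x y (disjoint_rel (insert y H)) D'"
      then have "dstruct (insert x (insert y H)) E" unfolding fibre_def extensions_def by blast
      then show "good cc (insert y H) E x" using f y less.prems False by (intro less.hyps) auto
    qed
  qed
qed

text \<open>Removing an old point \<open>y\<close> exhibits \<open>D\<close> as a member of a fibre
  over fewer points, ready for \<open>good_up\<close>.\<close>

lemma remove_point:
  assumes d: "dstruct (insert x H) D" and x: "x \<notin> H" and y: "y \<in> H" and fin: "finite H"
  defines "G \<equiv> H - {y}"
  shows "two_extensions G x y (rel_restrict H D) (rel_restrict (insert x G) D)" "insert y G = H"
    "D \<in> fibre G x y (rel_restrict H D) (rel_restrict (insert x G) D)"
proof -
  show G: "insert y G = H" unfolding G_def using y by blast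
  have sub: "H \<subseteq> insert x H" "insert x G \<subseteq> insert x H" unfolding G_def by blast+
  have "rel_restrict G (rel_restrict H D) = rel_restrict G (rel_restrict (insert x G) D)"
    unfolding rel_restrict_def G_def by (auto simp: fun_eq_iff)
  moreover have "dstruct H (rel_restrict H D)" "dstruct (insert x G) (rel_restrict (insert x G) D)"
    using dstruct_restrict[OF d] sub by blast+
  moreover have "x \<notin> G" "y \<notin> G" "x \<noteq> y" "finite G" using x y fin unfolding G_def by auto
  ultimately show "two_extensions G x y (rel_restrict H D) (rel_restrict (insert x G) D)"
    by unfold_locales (auto simp: G)
  show "D \<in> fibre G x y (rel_restrict H D) (rel_restrict (insert x G) D)"
    unfolding fibre_def extensions_def G using d by simp
qed

text \<open>Removing a suitable \<open>y\<close> from \<open>A\<close> leaves \<open>x\<close> and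
  \<open>y\<close> of different type, so that \<open>D\<close> is alone in its fibre and is settled
  by the value over fewer points. A bad choice is a \<open>y\<close> that would sit on the same edge
  as \<open>x\<close>; with three points in \<open>A\<close> at most one choice is bad.\<close>

lemma good_side:
  assumes d: "dstruct (insert x H) D" and xH: "x \<notin> H" and finH: "finite H" and e: "edge_at D H x A B" and A: "3 \<le> card A"
    and IH: "\<And>y D'. y \<in> H \<Longrightarrow> dstruct (insert x (H - {y})) D' \<Longrightarrow> good cc (H - {y}) D' x"
  shows "good cc H D x"
proof -
  note P = edge_at_parts[OF e]
  have finA: "finite A" using P finH finite_subset by blast
  define bad where "bad y \<longleftrightarrow> y \<in> A \<and> edge_at D (H - {y}) y (A - {y}) B" for y
  have one_bad: "y = z" if "bad y" "bad z" for y z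
  proof (rule ccontr)
    assume yz: "y \<noteq> z"
    have "card {y, z} < card A" using A yz by simp
    \<comment> \<open>With a third point \<open>w\<close> of \<open>A\<close>, two bad points would
      give the exclusive quartets \<open>w z | y b\<close> and \<open>w y | z b\<close>.\<close>
    then obtain w where w: "w \<in> A" "w \<noteq> y" "w \<noteq> z" using card_mono[of "{y, z}" A] by (metis card_mono finite.emptyI finite_insert insert_iff leD subsetI)
    obtain b where b: "b \<in> B" using P by blast
    have "D w z y b" using that(1) w yz b that(2) unfolding bad_def edge_at_def by blast
    moreover have "D w y z b" using that(2) w yz b that(1) unfolding bad_def edge_at_def by blast
    ultimately show False using d_excl[OF d] by blast
  qed
  obtain y where yy: "y \<in> A" "\<not> bad y"
  proof -
    have "card A \<noteq> 0" "\<not> card A \<le> 1" using A by auto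
    then obtain u v where "u \<in> A" "v \<in> A" "u \<noteq> v" using card_le_Suc0_iff_eq[OF finA] by auto
    then show ?thesis using that one_bad by blast
  qed
  have yH: "y \<in> H" using yy P by blast
  let ?G = "H - {y}"
  note R = remove_point[OF d xH yH finH]
  interpret two_extensions ?G x y "rel_restrict H D" "rel_restrict (insert x ?G) D" by (rule R(1))
  have sub: "A \<inter> ?G = A - {y}" "B \<inter> ?G = B" using P(3,5,6) yy(1) by auto
  have ne: "A - {y} \<noteq> {}"
  proof
    assume "A - {y} = {}"
    then have "card A \<le> card {y}" by (intro card_mono) auto
    then show False using A by simp
  qed
  have ex: "edge_at D ?G x (A - {y}) B" using edge_at_subset[OF e, of ?G] ne P(2) unfolding sub by blast
  have ex': "edge_at (rel_restrict (insert x ?G) D) ?G x (A - {y}) B" using ex edge_at_rel_restrict[of x ?G "insert x ?G"] by simp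
  have ns: "\<not> same_type ?G (rel_restrict H D) y (rel_restrict (insert x ?G) D) x"
  proof
    assume "same_type ?G (rel_restrict H D) y (rel_restrict (insert x ?G) D) x"
    then have "edge_at (rel_restrict H D) ?G y (A - {y}) B" using same_type_edge ex' by blast
    then have "edge_at D ?G y (A - {y}) B" using edge_at_rel_restrict[of y ?G H] yH by (simp add: insert_absorb)
    then show False using yy unfolding bad_def by blast
  qed
  have c2: "2 \<le> card ?G"
  proof -
    have "card A \<le> card H" using finH P by (intro card_mono) auto
    then show ?thesis using A finH yH by simp
  qed
  obtain E where E: "fibre ?G x y (rel_restrict H D) (rel_restrict (insert x ?G) D) = {E}" using fibre_different[OF c2 ns] by blast
  have "good cc ?G (rel_restrict (insert x ?G) D) x" using IH[OF yH dD'] .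
  then have "good cc (insert y ?G) D x" using good_up[OF R(1) R(3)] E R(3) by simp
  then show ?thesis using R(2) by simp
qed

text \<open>What \<open>good_side\<close> leaves is four points split two against two. There the
  fibre over a removed point of \<open>A\<close> has three members; two of them have a side with
  three points and are settled by \<open>good_side\<close>, and \<open>good_up\<close> yields the
  third.\<close>

lemma good_all:
  assumes "finite H" "x \<notin> H" "dstruct (insert x H) D" shows "good cc H D x"
  using assms
proof (induction "card H" arbitrary: H D rule: less_induct)
  case less
  show ?case
  proof (cases "card H \<le> 3")
    case True then show ?thesis using good_small less.prems by blast
  next
    case False
    have IH: "good cc (H - {y}) D' x" if "y \<in> H" "dstruct (insert x (H - {y})) D'" for y D'
      using less.hyps[of "H - {y}" D'] that less.prems card_Diff1_less[OF less.prems(1)] by simp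
    have side: "good cc H F x" if "dstruct (insert x H) F" "edge_at F H x A B" "3 \<le> card A \<or> 3 \<le> card B" for F A B
      using good_side[OF that(1) less.prems(2,1) that(2) _ IH] good_side[OF that(1) less.prems(2,1) edge_at_sym[OF that(2)] _ IH] that(3) by blast
    obtain A B where e: "edge_at D H x A B" using edge_at_exists[OF less.prems(3,1) refl less.prems(2)] False by auto
    note P = edge_at_parts[OF e]
    have finAB: "finite A" "finite B" using P less.prems(1) finite_subset by auto
    have cAB: "card A + card B = card H" using card_Un_disjoint[OF finAB P(3)] P(4) by simp
    show ?thesis
    proof (cases "3 \<le> card A \<or> 3 \<le> card B")
      case True then show ?thesis using side[OF less.prems(3) e] by blast
    next
      case False': False
      then have c2: "card A = 2" "card B = 2" using cAB False by linarith+
      then obtain a y where A: "A = {a, y}" "a \<noteq> y" by (meson card_2_iff)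
      have yH: "y \<in> H" using P A by blast
      let ?G = "H - {y}"
      note R = remove_point[OF less.prems(3,2) yH less.prems(1)]
      interpret two_extensions ?G x y "rel_restrict H D" "rel_restrict (insert x ?G) D" by (rule R(1))
      have sub: "A \<inter> ?G = {a}" "B \<inter> ?G = B" using P A by blast+
      have ex: "edge_at D ?G x {a} B" using edge_at_subset[OF e, of ?G] P(2) unfolding sub by blast
      have ex': "edge_at (rel_restrict (insert x ?G) D) ?G x {a} B" using ex edge_at_rel_restrict[of x ?G "insert x ?G"] by simp
      have "D b b' y a" if "b \<in> B" "b' \<in> B" for b b'
        using split_edge_at[OF less.prems(3) e] d_flip[OF less.prems(3)] that A unfolding split_def by blast
      moreover have "D a a y b" if "b \<in> B" for b using d_deg[OF less.prems(3), of a y b] that A P by blast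
      moreover have "{a} \<union> B = ?G" using P(3,4) A by auto
      ultimately have "edge_at D ?G y {a} B" unfolding edge_at_def using P A by simp
      then have "edge_at (rel_restrict H D) ?G y {a} B" using edge_at_rel_restrict[of y ?G H] yH by (simp add: insert_absorb)
      then have s: "same_type ?G (rel_restrict H D) y (rel_restrict (insert x ?G) D) x" using same_typeI ex' by blast
      have cG: "card ?G = 3" using cAB c2 less.prems(1) yH by simp
      \<comment> \<open>The sides with three points are \<open>?G\<close> for \<open>E1\<close> and
        \<open>insert y B\<close> for \<open>E3\<close>, while \<open>E2\<close> has the edge
        \<open>A | B\<close> that \<open>D\<close> has.\<close>
      obtain E1 E2 E3 where F: "fibre ?G x y (rel_restrict H D) (rel_restrict (insert x ?G) D) = {E1, E2, E3}" "distinct [E1, E2, E3]"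
        "edge_at E1 (insert y ?G) x {y} ?G" "edge_at E2 (insert y ?G) x (insert y {a}) B"
        "edge_at E3 (insert y ?G) x (insert y B) {a}"
      proof -
        have "2 \<le> card ?G" using cG by simp
        show ?thesis by (rule fibre_same[OF \<open>2 \<le> card ?G\<close> s ex']) (rule that)
      qed
      have dE: "dstruct (insert x (insert y ?G)) E" if "E \<in> fibre ?G x y (rel_restrict H D) (rel_restrict (insert x ?G) D)" for E
        using that unfolding fibre_def extensions_def by blast
      have E13: "good cc (insert y ?G) E1 x" "good cc (insert y ?G) E3 x"
      proof -
        show "good cc (insert y ?G) E1 x" using side[of E1 "{y}" ?G] dE[of E1] F(1,3) cG R(2) by simp
        have "card (insert y B) = 3" using c2 finAB A P(3) by auto
        then show "good cc (insert y ?G) E3 x" using side[of E3 "insert y B" "{a}"] dE[of E3] F(1,5) R(2) by simp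
      qed
      have "good cc ?G (rel_restrict (insert x ?G) D) x" using IH[OF yH dD'] .
      moreover have "D = E1 \<or> D = E2 \<or> D = E3" using R(3) F(1) by blast
      ultimately have "good cc (insert y ?G) D x"
      proof (elim disjE)
        assume D: "D = E2"
        assume "good cc ?G (rel_restrict (insert x ?G) D) x"
        then show ?thesis by (rule good_up[OF R(1) R(3)]) (use F(1) D E13 in auto)
      qed (use E13 in auto)
      then show ?thesis using R(2) by simp
    qed
  qed
qed

lemma point_class:
  assumes "i \<in> embs boron_class" "card (points (tgt i)) = Suc (card (points (src i)))"
  obtains H :: "'a set" and D x where "finite H" "x \<notin> H" "card H = card (points (src i))" "dstruct (insert x H) D"
    "\<kappa> i \<approx> point_value cc H D x"
proof -
  let ?H = "points (src i)"
  obtain x D \<alpha> where a: "x \<notin> ?H" "x \<notin> {}" "dstruct (insert x ?H) D"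
    "rel_restrict ?H D = dis (src i)" "\<alpha> \<in> embs boron_class" "is_iso \<alpha>"
    "src \<alpha> = mk_struct (insert x ?H) D" "tgt \<alpha> = tgt i"
    "i = emb_comp \<alpha> (incl (src i) (mk_struct (insert x ?H) D))"
    by (rule one_point_form[OF assms finite.emptyI])
  have fin: "finite ?H" using boron.finite_points[OF emb_src[OF assms(1)]] .
  have "mk_struct ?H D = src i" using mk_struct_rel_restrict[of ?H ?H D] a(4) mk_struct_dis[OF emb_src[OF assms(1)]] by simp
  then have pi: "point_incl ?H D x = incl (src i) (mk_struct (insert x ?H) D)" by (simp add: point_incl_def)
  have "\<kappa> (emb_comp \<alpha> (point_incl ?H D x)) \<approx> pt ?H D x" unfolding pt_def
    by (rule comp_iso_left[OF a(5) point_incl_in[OF fin a(3)] _ a(6)]) (use a(7) in \<open>auto simp: point_incl_def incl_def\<close>)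
  then have "\<kappa> i \<approx> pt ?H D x" unfolding pi a(9)[symmetric] .
  moreover have "pt ?H D x \<approx> point_value cc ?H D x" using good_all[OF fin a(1,3)] by (simp only: good_def)
  ultimately have "\<kappa> i \<approx> point_value cc ?H D x" by (rule eqv_trans)
  then show ?thesis using fin a(1,3) by (intro that[of ?H x D]) auto
qed

lemma class_T34:
  assumes "i \<in> embs boron_class" "card (points (src i)) = 3" "card (points (tgt i)) = 4"
  shows "\<kappa> i \<approx> cc"
proof -
  obtain H :: "'a set" and D x where h: "finite H" "x \<notin> H" "card H = 3" "dstruct (insert x H) D" "\<kappa> i \<approx> point_value cc H D x"
    by (rule point_class[OF assms(1)]) (use assms(2,3) in auto)
  obtain A B where AB: "edge_at D H x A B" using edge_at_exists[OF h(4,1) refl h(2)] h(3) by auto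
  have "point_value cc H D x = cc"
    using point_value_edge[OF h(4) AB h(2,1), of cc] edge_at_singleton_side[OF AB h(1)] h(3) by simp
  then show ?thesis using h(5) by simp
qed

text \<open>In the five-point structure \<open>E\<close> the leaf \<open>y\<close> sits on the
  pendant edge of \<open>a\<close>, and \<open>x0\<close> on the inner edge between
  \<open>{a, y}\<close> and \<open>B\<close>. Adding \<open>y\<close> before \<open>x0\<close> gives
  \<open>(- 1 - cc) * cc\<close>, whereas adding \<open>x0\<close> before \<open>y\<close> uses
  pendant edges only and gives \<open>cc * cc\<close>.\<close>

lemma quadratic_relation: "2 * cc ^ 2 + cc \<approx> 0"
proof -
  have fin: "finite H0" using base(1) by (auto intro: card_ge_0_finite)
  obtain A0 B0 where e0: "edge_at D0 H0 x0 A0 B0" using edge_at_exists[OF base(3) fin refl base(2)] base(1) by auto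
  then obtain a B where e: "edge_at D0 H0 x0 {a} B"
    using edge_at_singleton_side[OF e0 fin] edge_at_sym[OF e0] base(1) unfolding is_singleton_def by blast
  note P = edge_at_parts[OF e]
  obtain y where yy: "y \<notin> insert x0 H0" using ex_new_if_finite[of "insert x0 H0"] fin infinite_UNIV by blast
  have sp: "split H0 (rel_restrict H0 D0) {a} B"
    using split_edge_at[OF base(3) e] P unfolding split_def rel_restrict_def by auto
  have dH: "dstruct H0 (rel_restrict H0 D0)" using dstruct_restrict[OF base(3)] by blast
  have yH: "y \<notin> H0" using yy by blast
  obtain D where D: "D \<in> extensions H0 (rel_restrict H0 D0) y" "edge_at D H0 y {a} B" using extension_with_edge[OF dH sp yH] by blast
  have two: "two_extensions H0 x0 y D D0"
    by unfold_locales (use D yy base fin in \<open>auto simp: extensions_def\<close>)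
  interpret two_extensions H0 x0 y D D0 by (rule two)
  have s: "same_type H0 D y D0 x0" using same_typeI[OF D(2) e] .
  have "2 \<le> card H0" using \<open>card H0 = 3\<close> by simp
  then obtain E1 E E3 where F: "fibre H0 x0 y D D0 = {E1, E, E3}" "distinct [E1, E, E3]"
    "edge_at E1 (insert y H0) x0 {y} H0" "edge_at E (insert y H0) x0 (insert y {a}) B"
    "edge_at E3 (insert y H0) x0 (insert y B) {a}" by (rule fibre_same[OF _ s e])
  have E: "E \<in> fibre H0 x0 y D D0" "edge_at E (insert y H0) x0 (insert y {a}) B" using F(1,4) by auto
  have dE: "dstruct (insert x0 (insert y H0)) E" using E unfolding fibre_def extensions_def by blast
  have dE': "dstruct (insert y (insert x0 H0)) E" using dE by (simp add: insert_commute)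
  let ?x = x0
  have B2: "card B = 2" using P base(1) fin by (metis Un_insert_left add_diff_cancel_left' card_insert_disjoint disjoint_insert(1) eval_nat_numeral(3) finite_Un inf_commute plus_1_eq_Suc sup_bot_left)
  have yB: "y \<notin> B" "?x \<notin> B" "a \<notin> B" "a \<noteq> ?x" "a \<noteq> y" "?x \<noteq> y" using P yH base(2) yy by auto
  have edge2: "edge_at E (insert ?x H0) y {a} (insert ?x B)"
    unfolding edge_at_def
  proof (intro conjI ballI)
    show "{a} \<union> insert ?x B = insert ?x H0" using P(4) by blast
    show "E p p' y b" if "p \<in> {a}" "p' \<in> {a}" "b \<in> insert ?x B" for p p' b
      using d_deg[OF dE, of a y b] that yB P by auto
    have BB: "E b b' y a" if "b \<in> B" "b' \<in> B" for b b'
    proof -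
      have "E b b' ?x y" "E b b' ?x a" using E(2) that unfolding edge_at_def by simp_all
      then show ?thesis by (rule d_trans[OF dE])
    qed
    have xB: "E ?x b y a" "E b ?x y a" if "b \<in> B" for b
    proof -
      have "E a y ?x b" using E(2) that unfolding edge_at_def by blast
      then have "E ?x b a y" using d_flip[OF dE] by blast
      then show "E ?x b y a" "E b ?x y a" using d_swap'[OF dE] d_swap[OF dE] by blast+
    qed
    have xx: "E ?x ?x y a" using d_deg[OF dE, of ?x y a] yB P by auto
    show "E b b' y p" if "b \<in> insert ?x B" "b' \<in> insert ?x B" "p \<in> {a}" for b b' p
      using that BB xB xx by blast
  qed (use P yB in auto)
  have c4: "3 \<le> card (insert ?x H0)" "3 \<le> card (insert y H0)" using base yH fin by auto
  have fx: "finite (insert ?x H0)" "finite (insert y H0)" "?x \<notin> insert y H0" "y \<notin> insert ?x H0" using fin yy base(2) by auto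
  have ns: "\<not> is_singleton B" "\<not> is_singleton (insert y {a})" "\<not> is_singleton (insert ?x B)"
    using B2 yB card_ge_0_finite[of B] by (auto simp: is_singleton_altdef card_insert_if)
  have v1: "point_value cc (insert y H0) E ?x = - 1 - cc"
    using point_value_edge[OF dE E(2) fx(3,2) c4(2), of cc] ns by simp
  have v2: "point_value cc (insert ?x H0) E y = cc"
    using point_value_edge[OF dE' edge2 fx(4,1) c4(1), of cc] by (simp add: is_singleton_def)
  have g1: "pt (insert y H0) E ?x \<approx> - 1 - cc" using good_all[OF fx(2,3) dE] unfolding good_def v1 .
  have g2: "pt (insert ?x H0) E y \<approx> cc" using good_all[OF fx(1,4) dE'] unfolding good_def v2 .
  have pt3: "pt H0 E z \<approx> cc" if z: "z \<notin> H0" "z \<in> insert ?x (insert y H0)" for z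
  proof -
    have "dstruct (insert z H0) (rel_restrict (insert z H0) E)" by (rule dstruct_restrict[OF dE]) (use z in blast)
    then have "pt H0 (rel_restrict (insert z H0) E) z \<approx> cc" by (rule pt_card3[OF base base(1) z(1)])
    then show ?thesis using pt_restrict[of z H0 "insert z H0" E] by simp
  qed
  have in': "point_incl H0 E y \<in> embs boron_class" "point_incl H0 E ?x \<in> embs boron_class"
    "point_incl (insert y H0) E ?x \<in> embs boron_class" "point_incl (insert ?x H0) E y \<in> embs boron_class"
    using point_incl_in[OF fin dE] point_incl_in[OF fx(2) dE] point_incl_in[OF fx(1) dE] by auto
  have ic: "insert y (insert ?x H0) = insert ?x (insert y H0)" by blast
  have cm: "emb_comp (point_incl (insert y H0) E ?x) (point_incl H0 E y) = emb_comp (point_incl (insert ?x H0) E y) (point_incl H0 E ?x)"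
    by (rule emb_comp_eqI[OF in'(3,1) _ emb_comp_in[OF in'(4,2)]]) (auto simp: point_incl_def incl_def ic)
  have t: "tgt (point_incl H0 E y) = src (point_incl (insert y H0) E ?x)" "tgt (point_incl H0 E ?x) = src (point_incl (insert ?x H0) E y)"
    by (simp_all add: point_incl_def incl_def)
  have cC: "cc \<in> C" "- 1 - cc \<in> C"
  proof -
    show "cc \<in> C" unfolding pt_def by (rule carrier) (rule point_incl_in[OF fin base(3) order_refl])
    then have "- 1 + (- 1) * cc \<in> C" using C1 by blast
    then show "- 1 - cc \<in> C" by simp
  qed
  have m1: "pt (insert y H0) E ?x * pt H0 E y \<approx> (- 1 - cc) * cc"
    by (rule eqv_mult[OF g1 pt3]) (use cC yH carrier[OF in'(3)] in \<open>auto simp: pt_def[symmetric]\<close>)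
  have m2: "pt (insert ?x H0) E y * pt H0 E ?x \<approx> cc * cc"
    by (rule eqv_mult[OF g2 pt3]) (use cC base(2) carrier[OF in'(4)] in \<open>auto simp: pt_def[symmetric]\<close>)
  have "pt (insert y H0) E ?x * pt H0 E y \<approx> pt (insert ?x H0) E y * pt H0 E ?x"
  proof -
    have "\<kappa> (emb_comp (point_incl (insert y H0) E ?x) (point_incl H0 E y)) \<approx> pt (insert y H0) E ?x * pt H0 E y"
      unfolding pt_def eqv_def by (rule comp[OF in'(3,1) t(1)])
    moreover have "\<kappa> (emb_comp (point_incl (insert y H0) E ?x) (point_incl H0 E y)) \<approx> pt (insert ?x H0) E y * pt H0 E ?x"
      unfolding cm pt_def eqv_def by (rule comp[OF in'(4,2) t(2)])
    ultimately show ?thesis using eqv_sym eqv_trans by blast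
  qed
  then have "(- 1 - cc) * cc \<approx> cc * cc" by (rule eqv_trans[OF eqv_trans[OF eqv_sym[OF m1]] m2])
  from eqv_diff[OF eqv_refl[of "cc * cc"] this] have "cc * cc - (- 1 - cc) * cc \<approx> cc * cc - cc * cc" .
  then show ?thesis by (simp add: algebra_simps power2_eq_square)
qed

end

end

section \<open>Free commutative rings\<close>

lemma poly_mapping_sum_single:
  fixes p :: "'k \<Rightarrow>\<^sub>0 'v::comm_monoid_add"
  shows "p = (\<Sum>m\<in>Poly_Mapping.keys p. Poly_Mapping.single m (Poly_Mapping.lookup p m))"
proof (rule poly_mapping_eqI)
  fix k
  have "(\<Sum>m\<in>Poly_Mapping.keys p. Poly_Mapping.lookup (Poly_Mapping.single m (Poly_Mapping.lookup p m)) k) =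
      (\<Sum>m\<in>Poly_Mapping.keys p. if m = k then Poly_Mapping.lookup p k else 0)"
    by (intro sum.cong refl) (simp add: lookup_single when_def)
  also have "\<dots> = Poly_Mapping.lookup p k" by (simp add: in_keys_iff)
  finally show "Poly_Mapping.lookup p k =
      Poly_Mapping.lookup (\<Sum>m\<in>Poly_Mapping.keys p. Poly_Mapping.single m (Poly_Mapping.lookup p m)) k"
    by (simp add: lookup_sum)
qed

section \<open>Evaluation of polynomials in the generators\<close>

definition monom_value :: "('e \<Rightarrow> 'r::comm_ring_1) \<Rightarrow> ('e \<Rightarrow>\<^sub>0 nat) \<Rightarrow> 'r" where
  "monom_value \<kappa> m = (\<Prod>e\<in>Poly_Mapping.keys m. \<kappa> e ^ Poly_Mapping.lookup m e)"

definition poly_value :: "('e \<Rightarrow> 'r::comm_ring_1) \<Rightarrow> (('e \<Rightarrow>\<^sub>0 nat) \<Rightarrow>\<^sub>0 int) \<Rightarrow> 'r" where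
  "poly_value \<kappa> p = (\<Sum>m\<in>Poly_Mapping.keys p. of_int (Poly_Mapping.lookup p m) * monom_value \<kappa> m)"

lemma monom_value_superset:
  assumes "finite A" "Poly_Mapping.keys m \<subseteq> A"
  shows "monom_value \<kappa> m = (\<Prod>e\<in>A. \<kappa> e ^ Poly_Mapping.lookup m e)"
  unfolding monom_value_def by (rule prod.mono_neutral_left) (use assms in \<open>auto simp: in_keys_iff\<close>)

lemma monom_value_add: "monom_value \<kappa> (m + n) = monom_value \<kappa> m * monom_value \<kappa> n"
proof -
  let ?A = "Poly_Mapping.keys m \<union> Poly_Mapping.keys n"
  have "Poly_Mapping.keys (m + n) \<subseteq> ?A" by (rule keys_add)
  then show ?thesis
    using monom_value_superset[of ?A "m + n" \<kappa>] monom_value_superset[of ?A m \<kappa>] monom_value_superset[of ?A n \<kappa>]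
    by (simp add: lookup_add power_add prod.distrib)
qed

lemma poly_value_superset:
  assumes "finite A" "Poly_Mapping.keys p \<subseteq> A"
  shows "poly_value \<kappa> p = (\<Sum>m\<in>A. of_int (Poly_Mapping.lookup p m) * monom_value \<kappa> m)"
  unfolding poly_value_def by (rule sum.mono_neutral_left) (use assms in \<open>auto simp: in_keys_iff\<close>)

lemma poly_value_add: "poly_value \<kappa> (p + q) = poly_value \<kappa> p + poly_value \<kappa> q"
proof -
  let ?A = "Poly_Mapping.keys p \<union> Poly_Mapping.keys q"
  have "Poly_Mapping.keys (p + q) \<subseteq> ?A" by (rule keys_add)
  then show ?thesis
    using poly_value_superset[of ?A "p + q" \<kappa>] poly_value_superset[of ?A p \<kappa>] poly_value_superset[of ?A q \<kappa>]
    by (simp add: lookup_add distrib_right sum.distrib)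
qed

lemma poly_value_0 [simp]: "poly_value \<kappa> 0 = 0"
  by (simp add: poly_value_def)

lemma poly_value_sum: "poly_value \<kappa> (sum f A) = (\<Sum>x\<in>A. poly_value \<kappa> (f x))"
  by (induction A rule: infinite_finite_induct) (simp_all add: poly_value_add)

lemma poly_value_minus: "poly_value \<kappa> (- p) = - poly_value \<kappa> p"
  using poly_value_add[of \<kappa> p "- p"] by (simp add: eq_neg_iff_add_eq_0 add.commute)

lemma poly_value_diff: "poly_value \<kappa> (p - q) = poly_value \<kappa> p - poly_value \<kappa> q"
  using poly_value_add[of \<kappa> p "- q"] by (simp add: poly_value_minus)

lemma poly_value_single: "poly_value \<kappa> (Poly_Mapping.single m a) = of_int a * monom_value \<kappa> m"
  using poly_value_superset[of "{m}" "Poly_Mapping.single m a" \<kappa>] by (simp add: lookup_single)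

lemma poly_value_mult: "poly_value \<kappa> (p * q) = poly_value \<kappa> p * poly_value \<kappa> q"
proof -
  have "p * q = (\<Sum>m\<in>Poly_Mapping.keys p. \<Sum>n\<in>Poly_Mapping.keys q.
      Poly_Mapping.single (m + n) (Poly_Mapping.lookup p m * Poly_Mapping.lookup q n))"
    by (subst (1) poly_mapping_sum_single[of p], subst (1) poly_mapping_sum_single[of q])
       (simp add: sum_product mult_single)
  then have "poly_value \<kappa> (p * q) = (\<Sum>m\<in>Poly_Mapping.keys p. \<Sum>n\<in>Poly_Mapping.keys q.
      poly_value \<kappa> (Poly_Mapping.single (m + n) (Poly_Mapping.lookup p m * Poly_Mapping.lookup q n)))"
    by (simp only: poly_value_sum)
  also have "\<dots> = (\<Sum>m\<in>Poly_Mapping.keys p. \<Sum>n\<in>Poly_Mapping.keys q.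
      (of_int (Poly_Mapping.lookup p m) * monom_value \<kappa> m) * (of_int (Poly_Mapping.lookup q n) * monom_value \<kappa> n))"
    by (intro sum.cong refl) (simp add: poly_value_single monom_value_add algebra_simps)
  also have "\<dots> = poly_value \<kappa> p * poly_value \<kappa> q" by (simp only: poly_value_def sum_product)
  finally show ?thesis .
qed

lemma poly_value_1 [simp]: "poly_value \<kappa> 1 = 1"
  using poly_value_single[of \<kappa> 0 1] by (simp add: monom_value_def)

lemma poly_value_gen: "poly_value \<kappa> (gen e) = \<kappa> e"
  unfolding gen_def poly_value_single by (simp add: monom_value_def lookup_single)

lemma single_add_one:
  "Poly_Mapping.single (m + n) (1::int) = Poly_Mapping.single m 1 * Poly_Mapping.single n 1"
  by (simp add: mult_single)

lemma gen_power: "Poly_Mapping.single (Poly_Mapping.single e k) 1 = gen e ^ k"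
proof (induction k)
  case (Suc k)
  have "Poly_Mapping.single e (Suc k) = Poly_Mapping.single e 1 + Poly_Mapping.single e k"
    by (simp flip: single_add)
  then show ?case using Suc by (simp add: single_add_one gen_def del: single_add)
qed simp

lemma single_eq_prod_gen:
  "Poly_Mapping.single m (a::int) = of_int a * (\<Prod>e\<in>Poly_Mapping.keys m. gen e ^ Poly_Mapping.lookup m e)"
proof -
  have 1: "Poly_Mapping.single (\<Sum>e\<in>A. f e) (1::int) = (\<Prod>e\<in>A. Poly_Mapping.single (f e) 1)"
    for A :: "'a set" and f :: "'a \<Rightarrow> 'a \<Rightarrow>\<^sub>0 nat"
    by (induction A rule: infinite_finite_induct) (simp_all add: single_add_one)
  have "Poly_Mapping.single m (1::int) = (\<Prod>e\<in>Poly_Mapping.keys m. gen e ^ Poly_Mapping.lookup m e)"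
    by (subst (1) poly_mapping_sum_single[of m]) (simp only: 1 gen_power)
  moreover have "Poly_Mapping.single m a = of_int a * Poly_Mapping.single m (1::int)"
  proof -
    have "(of_int a :: ('a \<Rightarrow>\<^sub>0 nat) \<Rightarrow>\<^sub>0 int) = Poly_Mapping.single 0 a"
    proof (rule poly_mapping_eqI)
      fix k :: "'a \<Rightarrow>\<^sub>0 nat"
      have "Poly_Mapping.lookup (of_nat n :: ('a \<Rightarrow>\<^sub>0 nat) \<Rightarrow>\<^sub>0 int) k = (int n when k = 0)" for n
        by (induction n) (auto simp: lookup_add lookup_one when_def)
      then show "Poly_Mapping.lookup (of_int a) k = Poly_Mapping.lookup (Poly_Mapping.single 0 a) k"
        by (cases a rule: int_cases2) (auto simp: lookup_single when_def)
    qed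
    then show ?thesis by (simp add: mult_single)
  qed
  ultimately show ?thesis by simp
qed

section \<open>The free ring and its ideal of relations\<close>

definition free_carrier :: "'e set \<Rightarrow> (('e \<Rightarrow>\<^sub>0 nat) \<Rightarrow>\<^sub>0 int) set" where
  "free_carrier E = {p. \<forall>m\<in>Poly_Mapping.keys p. Poly_Mapping.keys m \<subseteq> E}"

lemma free_comm_ring_simps [simp]:
  "carrier (free_comm_ring E) = free_carrier E" "p \<otimes>\<^bsub>free_comm_ring E\<^esub> q = p * q" "p \<oplus>\<^bsub>free_comm_ring E\<^esub> q = p + q"
  "\<one>\<^bsub>free_comm_ring E\<^esub> = 1" "\<zero>\<^bsub>free_comm_ring E\<^esub> = 0"
  by (simp_all add: free_comm_ring_def ring_of_type_algebra_def free_carrier_def)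

lemma free_carrier_add: "p \<in> free_carrier E \<Longrightarrow> q \<in> free_carrier E \<Longrightarrow> p + q \<in> free_carrier E"
  unfolding free_carrier_def using keys_add[of p q] by blast

lemma free_carrier_minus: "p \<in> free_carrier E \<Longrightarrow> - p \<in> free_carrier E"
  unfolding free_carrier_def by simp

lemma free_carrier_diff: "p \<in> free_carrier E \<Longrightarrow> q \<in> free_carrier E \<Longrightarrow> p - q \<in> free_carrier E"
  using free_carrier_add[OF _ free_carrier_minus, of p E q] by simp

lemma free_carrier_mult:
  assumes "p \<in> free_carrier E" "q \<in> free_carrier E" shows "p * q \<in> free_carrier E"
  unfolding free_carrier_def
proof (intro CollectI ballI)
  fix m assume "m \<in> Poly_Mapping.keys (p * q)"
  then obtain a b where "m = a + b" "a \<in> Poly_Mapping.keys p" "b \<in> Poly_Mapping.keys q" using keys_mult[of p q] by blast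
  then show "Poly_Mapping.keys m \<subseteq> E" using keys_add[of a b] assms unfolding free_carrier_def by blast
qed

lemma free_carrier_0: "0 \<in> free_carrier E" and free_carrier_1: "1 \<in> free_carrier E"
  by (auto simp: free_carrier_def)

lemma free_carrier_gen: "e \<in> E \<Longrightarrow> gen e \<in> free_carrier E"
  by (auto simp: free_carrier_def gen_def)

lemma free_carrier_of_int: "of_int a \<in> free_carrier E"
proof -
  have "of_nat n \<in> free_carrier E" for n by (induction n) (auto intro: free_carrier_0 free_carrier_1 free_carrier_add)
  then show ?thesis by (cases a rule: int_cases2) (auto intro: free_carrier_minus)
qed

lemma free_carrier_sum: "(\<And>x. x \<in> A \<Longrightarrow> f x \<in> free_carrier E) \<Longrightarrow> sum f A \<in> free_carrier E"
  by (induction A rule: infinite_finite_induct) (auto intro: free_carrier_0 free_carrier_add)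

text \<open>Every element is a sum of integers times products of powers of variables from
  \<open>E\<close>.\<close>

lemma free_carrier_induct [consumes 1, case_names const gen add mult]:
  assumes "p \<in> free_carrier E"
    and const: "\<And>a. P (of_int a)" and gen: "\<And>e. e \<in> E \<Longrightarrow> P (gen e)"
    and add: "\<And>p q. p \<in> free_carrier E \<Longrightarrow> q \<in> free_carrier E \<Longrightarrow> P p \<Longrightarrow> P q \<Longrightarrow> P (p + q)"
    and mult: "\<And>p q. p \<in> free_carrier E \<Longrightarrow> q \<in> free_carrier E \<Longrightarrow> P p \<Longrightarrow> P q \<Longrightarrow> P (p * q)"
  shows "P p"
proof -
  have P01: "P 0" "P 1" using const[of 0] const[of 1] by simp_all
  have pow: "P (gen e ^ k) \<and> gen e ^ k \<in> free_carrier E" if "e \<in> E" for e k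
    using that by (induction k) (auto intro: P01 gen mult free_carrier_1 free_carrier_gen free_carrier_mult)
  have prd: "P (\<Prod>e\<in>A. gen e ^ f e) \<and> (\<Prod>e\<in>A. gen e ^ f e) \<in> free_carrier E" if "A \<subseteq> E" for A and f :: "_ \<Rightarrow> nat"
    using that by (induction A rule: infinite_finite_induct) (auto intro: P01 mult free_carrier_1 free_carrier_mult simp: pow)
  have single: "P (Poly_Mapping.single m a) \<and> Poly_Mapping.single m a \<in> free_carrier E" if "Poly_Mapping.keys m \<subseteq> E" for m a
    unfolding single_eq_prod_gen using prd[OF that] by (auto intro: mult const free_carrier_of_int free_carrier_mult)
  have sums: "P (\<Sum>m\<in>A. Poly_Mapping.single m (f m)) \<and> (\<Sum>m\<in>A. Poly_Mapping.single m (f m)) \<in> free_carrier E"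
    if "\<And>m. m \<in> A \<Longrightarrow> Poly_Mapping.keys m \<subseteq> E" for A and f :: "_ \<Rightarrow> int"
    using that by (induction A rule: infinite_finite_induct) (auto intro: P01 add free_carrier_0 free_carrier_add simp: single)
  have "P (\<Sum>m\<in>Poly_Mapping.keys p. Poly_Mapping.single m (Poly_Mapping.lookup p m))"
    using sums[of "Poly_Mapping.keys p" "Poly_Mapping.lookup p"] assms(1) unfolding free_carrier_def by blast
  then show ?thesis by (simp only: poly_mapping_sum_single[symmetric])
qed

lemma cring_free_comm_ring: "cring (free_comm_ring E)"
proof (rule cringI)
  show "abelian_group (free_comm_ring E)"
  proof (rule abelian_groupI)
    fix p assume "p \<in> carrier (free_comm_ring E)"
    then show "\<exists>q\<in>carrier (free_comm_ring E). q \<oplus>\<^bsub>free_comm_ring E\<^esub> p = \<zero>\<^bsub>free_comm_ring E\<^esub>"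
      by (intro bexI[of _ "- p"]) (auto intro: free_carrier_minus)
  qed (auto intro: free_carrier_add free_carrier_0 simp: algebra_simps)
  show "comm_monoid (free_comm_ring E)"
    by (rule comm_monoidI) (auto intro: free_carrier_mult free_carrier_1 simp: algebra_simps)
qed (simp add: algebra_simps)

lemma free_comm_ring_uminus: "p \<in> free_carrier E \<Longrightarrow> \<ominus>\<^bsub>free_comm_ring E\<^esub> p = - p"
proof -
  interpret cring "free_comm_ring E" by (rule cring_free_comm_ring)
  assume "p \<in> free_carrier E"
  then show ?thesis by (intro minus_equality) (auto intro: free_carrier_minus)
qed

lemma theta_relations_carrier: "theta_relations \<AA> \<subseteq> free_carrier (embs \<AA>)"
proof -
  have "emb_comp i j \<in> embs \<AA>" if "i \<in> embs \<AA>" "j \<in> embs \<AA>" "tgt j = src i" for i j using emb_comp_in that by blast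
  moreover have "fst m \<in> embs \<AA>" if "amalg_representatives \<AA> i j M" "m \<in> M" for i j M m
    using that unfolding amalg_representatives_def amalgamations_def by auto
  ultimately show ?thesis unfolding theta_relations_def
    by (auto intro!: free_carrier_diff free_carrier_gen free_carrier_1 free_carrier_mult free_carrier_sum)
qed

lemma theta_ideal: "ideal (theta_ideal \<AA>) (free_comm_ring (embs \<AA>))"
proof -
  interpret cring "free_comm_ring (embs \<AA>)" by (rule cring_free_comm_ring)
  show ?thesis unfolding theta_ideal_def by (rule genideal_ideal) (use theta_relations_carrier in simp)
qed

lemma theta_relations_ideal: "theta_relations \<AA> \<subseteq> theta_ideal \<AA>"
proof -
  interpret cring "free_comm_ring (embs \<AA>)" by (rule cring_free_comm_ring)
  show ?thesis unfolding theta_ideal_def by (rule genideal_self) (use theta_relations_carrier in simp)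
qed

lemma theta_ideal_props:
  shows "theta_ideal \<AA> \<subseteq> free_carrier (embs \<AA>)" "0 \<in> theta_ideal \<AA>"
    "p \<in> theta_ideal \<AA> \<Longrightarrow> q \<in> theta_ideal \<AA> \<Longrightarrow> p + q \<in> theta_ideal \<AA>"
    "p \<in> theta_ideal \<AA> \<Longrightarrow> - p \<in> theta_ideal \<AA>"
    "r \<in> free_carrier (embs \<AA>) \<Longrightarrow> p \<in> theta_ideal \<AA> \<Longrightarrow> r * p \<in> theta_ideal \<AA>"
proof -
  interpret ideal "theta_ideal \<AA>" "free_comm_ring (embs \<AA>)" by (rule theta_ideal)
  show *: "theta_ideal \<AA> \<subseteq> free_carrier (embs \<AA>)" using a_subset by simp
  show "0 \<in> theta_ideal \<AA>" using additive_subgroup.zero_closed[OF ideal.axioms(1)[OF theta_ideal]] by simp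
  show "p \<in> theta_ideal \<AA> \<Longrightarrow> q \<in> theta_ideal \<AA> \<Longrightarrow> p + q \<in> theta_ideal \<AA>"
    using additive_subgroup.a_closed[OF ideal.axioms(1)[OF theta_ideal], of p \<AA> q] by simp
  show "p \<in> theta_ideal \<AA> \<Longrightarrow> - p \<in> theta_ideal \<AA>" 
    using additive_subgroup.a_inv_closed[OF ideal.axioms(1)[OF theta_ideal], of p \<AA>]
      free_comm_ring_uminus[OF subsetD[OF *]] by simp
  show "r \<in> free_carrier (embs \<AA>) \<Longrightarrow> p \<in> theta_ideal \<AA> \<Longrightarrow> r * p \<in> theta_ideal \<AA>" using I_l_closed by simp
qed

interpretation theta: theta_congruence gen "free_carrier (embs boron_class)" "theta_ideal boron_class"
proof
  fix p q r s :: "('a emb \<Rightarrow>\<^sub>0 nat) \<Rightarrow>\<^sub>0 int" and e i j :: "'a emb" and M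
  let ?I = "theta_ideal (boron_class :: 'a qstruct set)" and ?C = "free_carrier (embs (boron_class :: 'a qstruct set))"
  show "0 \<in> ?I" by (rule theta_ideal_props)
  show "p \<in> ?I \<Longrightarrow> q \<in> ?I \<Longrightarrow> p + q \<in> ?I" by (rule theta_ideal_props)
  show "p \<in> ?I \<Longrightarrow> - p \<in> ?I" by (rule theta_ideal_props)
  show "r \<in> ?C \<Longrightarrow> p \<in> ?I \<Longrightarrow> r * p \<in> ?I" by (rule theta_ideal_props)
  show "e \<in> embs boron_class \<Longrightarrow> gen e \<in> ?C" by (rule free_carrier_gen)
  show "1 \<in> ?C" "- 1 \<in> ?C" using free_carrier_1 free_carrier_minus by blast+
  show "r \<in> ?C \<Longrightarrow> s \<in> ?C \<Longrightarrow> r + s \<in> ?C" "r \<in> ?C \<Longrightarrow> s \<in> ?C \<Longrightarrow> r * s \<in> ?C"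
    by (rule free_carrier_add free_carrier_mult; assumption)+
  note R = subsetD[OF theta_relations_ideal[of "boron_class :: 'a qstruct set"]]
  show "e \<in> embs boron_class \<Longrightarrow> is_iso e \<Longrightarrow> gen e - 1 \<in> ?I"
    by (rule R) (auto simp: theta_relations_def is_iso_def)
  show "i \<in> embs boron_class \<Longrightarrow> j \<in> embs boron_class \<Longrightarrow> tgt j = src i \<Longrightarrow> gen (emb_comp i j) - gen i * gen j \<in> ?I"
    by (rule R) (auto simp: theta_relations_def)
  show "i \<in> embs boron_class \<Longrightarrow> j \<in> embs boron_class \<Longrightarrow> src i = src j \<Longrightarrow> amalg_representatives boron_class i j M \<Longrightarrow>
      gen i - (\<Sum>m\<in>M. gen (fst m)) \<in> ?I"
    by (rule R) (auto simp: theta_relations_def)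
qed

text \<open>The elements with vanishing value form an ideal, and it contains the three families of
  relations because \<open>emb_value c\<close> is a multiplicative and additive measure.\<close>

lemma theta_ideal_value:
  fixes c :: "'r::comm_ring_1"
  assumes c: "2 * c ^ 2 + c = 0" and p: "p \<in> theta_ideal (boron_class :: 'a::infinite qstruct set)"
  shows "poly_value (emb_value c) p = 0"
proof -
  let ?R = "free_comm_ring (embs (boron_class :: 'a qstruct set))"
  let ?J = "{p \<in> carrier ?R. poly_value (emb_value c) p = 0}"
  interpret cring ?R by (rule cring_free_comm_ring)
  interpret m: point_measure "emb_value c :: 'a emb \<Rightarrow> 'r" c by (rule point_measure_emb_value[OF c])
  have "ideal ?J ?R"
  proof (rule idealI)
    show "ring ?R" by (rule ring_axioms)
    show "subgroup ?J (add_monoid ?R)"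
    proof (rule group.subgroupI[OF a_group])
      have "0 \<in> ?J" by (simp add: free_carrier_0)
      then show "?J \<noteq> {}" by blast
      show "inv\<^bsub>add_monoid ?R\<^esub> p \<in> ?J" if "p \<in> ?J" for p
      proof -
        have "inv\<^bsub>add_monoid ?R\<^esub> p = - p" by (rule free_comm_ring_uminus[unfolded a_inv_def]) (use that in simp)
        then show ?thesis using that by (simp add: poly_value_minus free_carrier_minus)
      qed
    qed (auto simp: poly_value_add intro: free_carrier_add)
  qed (auto simp: poly_value_mult intro: free_carrier_mult)
  moreover have "theta_relations boron_class \<subseteq> ?J"
  proof
    fix r assume r: "r \<in> theta_relations (boron_class :: 'a qstruct set)"
    have M: "emb_measure boron_class (emb_value c :: 'a emb \<Rightarrow> 'r)" by (rule m.measure)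
    have "poly_value (emb_value c) r = 0"
      using r M m.relation unfolding theta_relations_def emb_measure_def is_iso_def
      by (auto simp: poly_value_diff poly_value_mult poly_value_gen poly_value_sum)
    then show "r \<in> ?J" using r theta_relations_carrier[of "boron_class :: 'a qstruct set"] by auto
  qed
  ultimately have "theta_ideal boron_class \<subseteq> ?J" unfolding theta_ideal_def by (rule genideal_minimal)
  then show ?thesis using p by blast
qed

section \<open>The ring and its localization\<close>

definition eval_int_poly :: "'r::comm_ring_1 \<Rightarrow> int poly \<Rightarrow> 'r" where
  "eval_int_poly c f = poly (map_poly of_int f) c"

lemma eval_int_poly_pCons [simp]: "eval_int_poly c (pCons a f) = of_int a + c * eval_int_poly c f"
  by (simp add: eval_int_poly_def map_poly_pCons)

lemma eval_int_poly_0 [simp]: "eval_int_poly c 0 = 0"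
  by (simp add: eval_int_poly_def)

lemma eval_int_poly_1 [simp]: "eval_int_poly c 1 = 1"
  unfolding one_pCons by simp

lemma eval_int_poly_numeral [simp]: "eval_int_poly c (numeral n) = numeral n"
  unfolding numeral_poly by simp

lemma eval_int_poly_add: "eval_int_poly c (f + g) = eval_int_poly c f + eval_int_poly c g"
proof -
  have "map_poly of_int (f + g) = map_poly of_int f + (map_poly of_int g :: 'a poly)"
    by (rule poly_eqI) (simp add: coeff_map_poly)
  then show ?thesis by (simp add: eval_int_poly_def)
qed

lemma eval_int_poly_minus: "eval_int_poly c (- f) = - eval_int_poly c f"
  using eval_int_poly_add[of c f "- f"] by (simp add: eq_neg_iff_add_eq_0 add.commute)

lemma eval_int_poly_diff: "eval_int_poly c (f - g) = eval_int_poly c f - eval_int_poly c g"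
  using eval_int_poly_add[of c f "- g"] by (simp add: eval_int_poly_minus)

lemma eval_int_poly_smult: "eval_int_poly c (smult a f) = of_int a * eval_int_poly c f"
  by (induction f) (simp_all add: algebra_simps)

lemma eval_int_poly_mult: "eval_int_poly c (f * g) = eval_int_poly c f * eval_int_poly c g"
  by (induction f) (simp_all add: eval_int_poly_add eval_int_poly_smult algebra_simps)

lemma eval_int_poly_power: "eval_int_poly c (f ^ n) = eval_int_poly c f ^ n"
  by (induction n) (simp_all add: eval_int_poly_mult)

text \<open>Division by \<open>1 + 2 * x\<close> proceeds from the constant term, where its
  coefficient is one, and so stays within the integers.\<close>

lemma root_minus_half_factor:
  assumes "eval_int_poly (- 1 / 2 :: rat) f = 0"
  obtains g where "f = [:1, 2:] * g"
proof -
  have "\<exists>g. f = [:1, 2:] * g" using assms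
  proof (induction "degree f" arbitrary: f rule: less_induct)
    case less
    obtain a h where f: "f = pCons a h" by (cases f)
    show ?case
    proof (cases "h = 0")
      case True then show ?thesis using less.prems f by (intro exI[of _ 0]) simp
    next
      case False
      \<comment> \<open>For \<open>f = a + x * h\<close> the root forces \<open>h\<close> to take
        the value \<open>2 * a\<close> at \<open>- 1 / 2\<close>. Then
        \<open>f = a * (1 + 2 * x) + x * (h - 2 * a)\<close>, and the last bracket has the same
        root.\<close>
      define h' where "h' = h - [:2 * a:]"
      have "degree h' \<le> degree h" unfolding h'_def using degree_diff_le[of h "degree h" "[:2 * a:]"] by simp
      then have lt: "degree h' < degree f" using f False by simp
      have "eval_int_poly (- 1 / 2 :: rat) h' = 0" using less.prems f by (simp add: h'_def eval_int_poly_diff)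
      then obtain g where g: "h' = [:1, 2:] * g" using less.hyps[OF lt] by blast
      have "f = pCons a (h' + [:2 * a:])" by (simp add: f h'_def)
      also have "\<dots> = [:1, 2:] * pCons a g" unfolding g by (simp add: algebra_simps)
      finally show ?thesis by blast
    qed
  qed
  then show ?thesis using that by blast
qed

text \<open>The root zero removes the constant term, and \<open>- 1 / 2\<close> is a root of the
  remaining cofactor of \<open>x\<close>.\<close>

lemma double_root_factor:
  assumes "eval_int_poly (0 :: rat) f = 0" "eval_int_poly (- 1 / 2 :: rat) f = 0"
  obtains g where "f = [:0, 1, 2:] * g"
proof -
  obtain a h where f: "f = pCons a h" by (cases f)
  have a: "a = 0" using assms(1) f by simp
  have "eval_int_poly (- 1 / 2 :: rat) h = 0" using assms(2) f a by simp
  then obtain g where "h = [:1, 2:] * g" by (rule root_minus_half_factor)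
  then have "f = [:0, 1, 2:] * g" using f a by simp
  then show ?thesis using that by blast
qed

lemma poly_value_of_int [simp]: "poly_value \<kappa> (of_int a) = of_int a"
proof -
  have "poly_value \<kappa> (of_nat n) = of_nat n" for n by (induction n) (simp_all add: poly_value_add)
  then show ?thesis by (cases a rule: int_cases2) (simp_all add: poly_value_minus)
qed

lemma poly_value_power: "poly_value \<kappa> (p ^ n) = poly_value \<kappa> p ^ n"
  by (induction n) (simp_all add: poly_value_mult)

lemma poly_value_eval_int_poly: "poly_value \<kappa> (eval_int_poly p f) = eval_int_poly (poly_value \<kappa> p) f"
  by (induction f) (simp_all add: poly_value_add poly_value_mult)

text \<open>The values are integer polynomials in \<open>c\<close>, found by computing with the
  variable \<open>[:0, 1:]\<close> in place of \<open>c\<close>. This is why a single class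
  generates the ring.\<close>

lemma point_value_eval_int_poly: "point_value c H D x = eval_int_poly c (point_value [:0, 1:] H D x)"
  by (simp add: point_value_def eval_int_poly_add eval_int_poly_mult eval_int_poly_diff eval_int_poly_minus)

context theta_congruence
begin

lemma C_of_int: "of_int a \<in> C"
proof -
  have "0 \<in> C" using C1(3)[OF C1(1,2)] by simp
  then have n: "of_nat n \<in> C" for n by (induction n) (auto intro: C1)
  have "- of_nat n \<in> C" for n using C1(4)[OF C1(2) n[of n]] by simp
  then show ?thesis using n by (cases a rule: int_cases2) auto
qed

lemma eval_int_poly_C: "c \<in> C \<Longrightarrow> eval_int_poly c f \<in> C"
  by (induction f) (use C_of_int[of 0] in \<open>auto intro: C1 C_of_int\<close>)

text \<open>Multiplicativity reduces to one-point factors, whose classes are values of integer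
  polynomials at the class of the base extension.\<close>

lemma emb_polynomial:
  assumes base: "card H0 = 3" "x0 \<notin> H0" "dstruct (insert x0 H0) D0" and "i \<in> embs boron_class"
  shows "\<exists>f. \<kappa> i \<approx> eval_int_poly (pt H0 D0 x0) f"
  using assms(4)
proof (induction "card (points (tgt i)) - card (points (src i))" arbitrary: i rule: less_induct)
  case less
  have ccC: "pt H0 D0 x0 \<in> C" unfolding pt_def
    by (rule carrier, rule point_incl_in[OF _ base(3)]) (use base(1) in \<open>auto intro: card_ge_0_finite\<close>)
  show ?case
  proof (cases "is_iso i")
    case True
    then show ?thesis using iso[OF less.prems] by (intro exI[of _ 1]) (simp add: eqv_def)
  next
    case False
    obtain i1 i2 where f: "i1 \<in> embs boron_class" "i2 \<in> embs boron_class" "i = emb_comp i2 i1" "tgt i1 = src i2" "src i1 = src i" "tgt i2 = tgt i"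
      "card (points (tgt i1)) = Suc (card (points (src i)))" using boron.factor_one_point[OF less.prems False] by blast
    have "card (points (src i2)) \<le> card (points (tgt i2))"
      by (rule card_inj_on_le[OF emb_inj[OF f(2)]]) (use emb_maps[OF f(2)] boron.finite_points[OF emb_tgt[OF f(2)]] in auto)
    then have "card (points (tgt i2)) - card (points (src i2)) < card (points (tgt i)) - card (points (src i))"
      using f(7)[unfolded f(4)] unfolding f(6) by linarith
    then obtain g2 where g2: "\<kappa> i2 \<approx> eval_int_poly (pt H0 D0 x0) g2" using less.hyps f(2) by blast
    have c1: "card (points (tgt i1)) = Suc (card (points (src i1)))" using f(5,7) by simp
    obtain H :: "'a set" and D x where "finite H" "x \<notin> H" "card H = card (points (src i1))"
      "dstruct (insert x H) D" "\<kappa> i1 \<approx> point_value (pt H0 D0 x0) H D x"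
      by (rule point_class[OF base f(1) c1])
    then obtain g1 where g1: "\<kappa> i1 \<approx> eval_int_poly (pt H0 D0 x0) g1"
      using point_value_eval_int_poly[of "pt H0 D0 x0" H D x] by auto
    have "\<kappa> i \<approx> \<kappa> i2 * \<kappa> i1" using comp[OF f(2,1,4)] unfolding f(3) eqv_def .
    moreover have "\<kappa> i2 * \<kappa> i1 \<approx> eval_int_poly (pt H0 D0 x0) g2 * eval_int_poly (pt H0 D0 x0) g1"
      by (rule eqv_mult[OF g2 g1 carrier[OF f(2)] eval_int_poly_C[OF ccC]])
    ultimately have "\<kappa> i \<approx> eval_int_poly (pt H0 D0 x0) (g2 * g1)" unfolding eval_int_poly_mult by (rule eqv_trans)
    then show ?thesis by blast
  qed
qed

end

lemma free_carrier_polynomial: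
  fixes H0 :: "'a::infinite set"
  assumes base: "card H0 = 3" "x0 \<notin> H0" "dstruct (insert x0 H0) D0" and "p \<in> free_carrier (embs boron_class)"
  shows "\<exists>f. theta.eqv p (eval_int_poly (gen (point_incl H0 D0 x0)) f)"
  using assms(4)
proof (induction rule: free_carrier_induct)
  case (const a)
  show ?case using theta.eqv_refl[of "of_int a"] by (intro exI[of _ "[:a:]"]) simp
next
  case (gen e)
  show ?case using theta.emb_polynomial[OF base gen] by (simp add: theta.pt_def)
next
  case (add p q)
  then obtain f g where "theta.eqv p (eval_int_poly (gen (point_incl H0 D0 x0)) f)" "theta.eqv q (eval_int_poly (gen (point_incl H0 D0 x0)) g)" by blast
  then show ?case using theta.eqv_add by (intro exI[of _ "f + g"]) (simp add: eval_int_poly_add)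
next
  case (mult p q)
  then obtain f g where fg: "theta.eqv p (eval_int_poly (gen (point_incl H0 D0 x0)) f)" "theta.eqv q (eval_int_poly (gen (point_incl H0 D0 x0)) g)" by blast
  have "point_incl H0 D0 x0 \<in> embs boron_class"
    by (rule point_incl_in[OF _ base(3)]) (use base(1) in \<open>auto intro: card_ge_0_finite\<close>)
  then have "eval_int_poly (gen (point_incl H0 D0 x0)) g \<in> free_carrier (embs boron_class)"
    by (intro theta.eval_int_poly_C theta.carrier)
  then show ?case using theta.eqv_mult[OF fg mult.hyps(1)] by (intro exI[of _ "f * g"]) (simp add: eval_int_poly_mult)
qed

lemma four_point_structure:
  obtains H0 :: "'a::infinite set" and D0 x0 where "card H0 = 3" "x0 \<notin> H0" "dstruct (insert x0 H0) D0"
proof -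
  obtain H0 :: "'a set" where H0: "finite H0" "card H0 = 3" using infinite_arbitrarily_large[OF infinite_UNIV, of 3] by blast
  then obtain x0 where x0: "x0 \<notin> H0" using ex_new_if_finite infinite_UNIV by blast
  obtain a where a: "a \<in> H0" using H0 by fastforce
  have "H0 - {a} \<noteq> {}" using H0 a by (metis Diff_eq_empty_iff card_mono finite.emptyI finite_insert is_singletonI is_singleton_altdef numeral_le_one_iff semiring_norm(70))
  then have s: "split H0 (disjoint_rel H0) {a} (H0 - {a})"
    using a unfolding split_def disjoint_rel_def by auto
  have d: "dstruct H0 (disjoint_rel H0)" using dstruct_disjoint_rel[of H0] H0 by simp
  obtain E where "E \<in> extensions H0 (disjoint_rel H0) x0" using extension_with_edge[OF d s x0] by blast
  then have "dstruct (insert x0 H0) E" unfolding extensions_def by blast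
  then show ?thesis using that[OF H0(2) x0] by blast
qed

section \<open>Localization detected by values in a field\<close>

definition value_fraction_set :: "('r, 'm) ring_scheme \<Rightarrow> 'r set \<Rightarrow> ('r \<Rightarrow> 'k::field) \<Rightarrow> 'k \<Rightarrow> ('r \<times> 'r) set" where
  "value_fraction_set R S \<chi> q = {(b, t). b \<in> carrier R \<and> t \<in> S \<and> \<chi> b = q * \<chi> t}"

text \<open>The denominator \<open>u\<close> annihilates the kernel of \<open>\<chi>\<close>, and no
  denominator has value zero, so two fractions are equal exactly when their values in the field are.
  The isomorphism is written from values to fractions: \<open>q\<close> goes to the set of all pairs
  of value \<open>q\<close>, which is one class of \<open>frac_rel\<close>.\<close>

lemma localization_by_value:
  fixes R :: "'r ring" and \<chi> :: "'r \<Rightarrow> 'k::field"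
  assumes R: "cring R" and S: "S \<subseteq> carrier R" "\<one>\<^bsub>R\<^esub> \<in> S" "\<And>s t. s \<in> S \<Longrightarrow> t \<in> S \<Longrightarrow> s \<otimes>\<^bsub>R\<^esub> t \<in> S"
    and \<chi>: "\<And>a b. a \<in> carrier R \<Longrightarrow> b \<in> carrier R \<Longrightarrow> \<chi> (a \<otimes>\<^bsub>R\<^esub> b) = \<chi> a * \<chi> b"
      "\<And>a b. a \<in> carrier R \<Longrightarrow> b \<in> carrier R \<Longrightarrow> \<chi> (a \<oplus>\<^bsub>R\<^esub> b) = \<chi> a + \<chi> b" "\<chi> \<one>\<^bsub>R\<^esub> = 1"
    and nz: "\<And>s. s \<in> S \<Longrightarrow> \<chi> s \<noteq> 0"
    and u: "u \<in> S" "\<And>a. a \<in> carrier R \<Longrightarrow> \<chi> a = 0 \<Longrightarrow> u \<otimes>\<^bsub>R\<^esub> a = \<zero>\<^bsub>R\<^esub>"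
  shows "value_fraction_set R S \<chi> \<in>
      ring_iso (ring_of_type_algebra\<lparr>carrier := {\<chi> a / \<chi> s | a s. a \<in> carrier R \<and> s \<in> S}\<rparr>) (localization R S)"
    and "a \<in> carrier R \<Longrightarrow> value_fraction_set R S \<chi> (\<chi> a) = ring_frac R S a \<one>\<^bsub>R\<^esub>"
proof -
  interpret cring R by fact
  let ?\<psi> = "value_fraction_set R S \<chi>"
  let ?Z = "{\<chi> a / \<chi> s | a s. a \<in> carrier R \<and> s \<in> S}"
  have Sc: "s \<in> carrier R" if "s \<in> S" for s using S(1) that by blast
  have \<chi>0: "\<chi> \<zero>\<^bsub>R\<^esub> = 0" using \<chi>(2)[OF zero_closed zero_closed] by (metis l_zero zero_closed add_cancel_left_left)
  have \<chi>m: "\<chi> (a \<ominus>\<^bsub>R\<^esub> b) = \<chi> a - \<chi> b" if ab: "a \<in> carrier R" "b \<in> carrier R" for a b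
  proof -
    have "\<chi> (\<ominus>\<^bsub>R\<^esub> b) = - \<chi> b" using \<chi>(2)[of b "\<ominus>\<^bsub>R\<^esub> b"] ab \<chi>0 by (simp add: r_neg eq_neg_iff_add_eq_0 add.commute)
    then show ?thesis using ab \<chi>(2)[of a "\<ominus>\<^bsub>R\<^esub> b"] by (simp add: a_minus_def)
  qed
  have rel: "((a, s), (b, t)) \<in> frac_rel R S \<longleftrightarrow> \<chi> a * \<chi> t = \<chi> b * \<chi> s"
    if h: "a \<in> carrier R" "s \<in> S" "b \<in> carrier R" "t \<in> S" for a s b t
  proof
    assume "((a, s), (b, t)) \<in> frac_rel R S"
    then obtain v where v: "v \<in> S" "v \<otimes>\<^bsub>R\<^esub> (t \<otimes>\<^bsub>R\<^esub> a) = v \<otimes>\<^bsub>R\<^esub> (s \<otimes>\<^bsub>R\<^esub> b)" unfolding frac_rel_def by auto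
    have "\<chi> (v \<otimes>\<^bsub>R\<^esub> (t \<otimes>\<^bsub>R\<^esub> a)) = \<chi> v * (\<chi> t * \<chi> a)" "\<chi> (v \<otimes>\<^bsub>R\<^esub> (s \<otimes>\<^bsub>R\<^esub> b)) = \<chi> v * (\<chi> s * \<chi> b)"
      using v(1) h Sc \<chi>(1) by simp_all
    then show "\<chi> a * \<chi> t = \<chi> b * \<chi> s" using v(2) nz[OF v(1)] by (simp add: mult.commute)
  next
    assume e: "\<chi> a * \<chi> t = \<chi> b * \<chi> s"
    let ?y = "t \<otimes>\<^bsub>R\<^esub> a" and ?z = "s \<otimes>\<^bsub>R\<^esub> b"
    have yz: "?y \<in> carrier R" "?z \<in> carrier R" using h Sc by auto
    have "\<chi> (?y \<ominus>\<^bsub>R\<^esub> ?z) = 0" using \<chi>m[OF yz] e h Sc \<chi>(1) by (simp add: mult.commute)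
    then have "u \<otimes>\<^bsub>R\<^esub> (?y \<ominus>\<^bsub>R\<^esub> ?z) = \<zero>\<^bsub>R\<^esub>" using u(2) yz by simp
    then have "u \<otimes>\<^bsub>R\<^esub> ?y \<ominus>\<^bsub>R\<^esub> u \<otimes>\<^bsub>R\<^esub> ?z = \<zero>\<^bsub>R\<^esub>" using yz Sc[OF u(1)] by (simp add: a_minus_def r_distr r_minus)
    then have "u \<otimes>\<^bsub>R\<^esub> ?y = u \<otimes>\<^bsub>R\<^esub> ?z" using yz Sc[OF u(1)] by simp
    then show "((a, s), (b, t)) \<in> frac_rel R S" unfolding frac_rel_def using h u(1) by blast
  qed
  have frac: "ring_frac R S a s = ?\<psi> (\<chi> a / \<chi> s)" if h: "a \<in> carrier R" "s \<in> S" for a s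
  proof (rule Set.set_eqI)
    fix z :: "'r \<times> 'r"
    obtain b t where z: "z = (b, t)" by (cases z)
    have "((a, s), (b, t)) \<in> frac_rel R S \<Longrightarrow> b \<in> carrier R \<and> t \<in> S" unfolding frac_rel_def by blast
    then show "z \<in> ring_frac R S a s \<longleftrightarrow> z \<in> ?\<psi> (\<chi> a / \<chi> s)"
      unfolding z ring_frac_def value_fraction_set_def using rel[OF h, of b t] nz[OF h(2)] by (auto simp: field_simps)
  qed
  have ne: "\<exists>a s. (a, s) \<in> ?\<psi> p" if p: "p \<in> ?Z" for p
  proof -
    obtain a s where "p = \<chi> a / \<chi> s" "a \<in> carrier R" "s \<in> S" using p by blast
    then have "(a, s) \<in> ?\<psi> p" using nz[of s] unfolding value_fraction_set_def by simp
    then show ?thesis by blast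
  qed
  have mem: "a \<in> carrier R" "s \<in> S" "\<chi> a / \<chi> s = p" if "(a, s) \<in> ?\<psi> p" for a s p
    using that nz unfolding value_fraction_set_def by auto
  have UN: "(\<Union>(a, s)\<in>?\<psi> p. \<Union>(b, t)\<in>?\<psi> q. F a s b t) = G"
    if h: "p \<in> ?Z" "q \<in> ?Z" "\<And>a s b t. (a, s) \<in> ?\<psi> p \<Longrightarrow> (b, t) \<in> ?\<psi> q \<Longrightarrow> F a s b t = G"
    for p q and F :: "_ \<Rightarrow> _ \<Rightarrow> _ \<Rightarrow> _ \<Rightarrow> ('r \<times> 'r) set" and G
  proof -
    obtain a s b t where "(a, s) \<in> ?\<psi> p" "(b, t) \<in> ?\<psi> q" using ne[OF h(1)] ne[OF h(2)] by blast
    then show ?thesis using h(3) by fastforce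
  qed
  let ?A = "ring_of_type_algebra\<lparr>carrier := ?Z\<rparr> :: 'k ring"
  have carL: "carrier (localization R S) = ?\<psi> ` ?Z"
  proof -
    have "carrier (localization R S) = (\<lambda>(a, s). ring_frac R S a s) ` (carrier R \<times> S)"
      unfolding localization_def quotient_def ring_frac_def by auto
    also have "\<dots> = (\<lambda>(a, s). ?\<psi> (\<chi> a / \<chi> s)) ` (carrier R \<times> S)"
      by (rule image_cong) (use frac in auto)
    also have "\<dots> = ?\<psi> ` ?Z" by auto
    finally show ?thesis .
  qed
  have "?\<psi> \<in> ring_hom ?A (localization R S)"
  proof (rule ring_hom_memI)
    fix p assume p: "p \<in> carrier ?A"
    then show "?\<psi> p \<in> carrier (localization R S)" unfolding carL by auto
    fix q assume q: "q \<in> carrier ?A"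
    have pq: "p \<in> ?Z" "q \<in> ?Z" using p q by auto
    have m: "p \<otimes>\<^bsub>?A\<^esub> q = p * q" "p \<oplus>\<^bsub>?A\<^esub> q = p + q" by (simp_all add: ring_of_type_algebra_def)
    have "?\<psi> p \<otimes>\<^bsub>localization R S\<^esub> ?\<psi> q = ?\<psi> (p * q)"
      unfolding localization_def monoid.simps
    proof (rule UN[OF pq])
      fix a s b t assume h: "(a, s) \<in> ?\<psi> p" "(b, t) \<in> ?\<psi> q"
      note m1 = mem[OF h(1)] and m2 = mem[OF h(2)]
      have "\<chi> (a \<otimes>\<^bsub>R\<^esub> b) / \<chi> (s \<otimes>\<^bsub>R\<^esub> t) = p * q" using m1 m2 \<chi>(1) Sc by auto
      then show "ring_frac R S (a \<otimes>\<^bsub>R\<^esub> b) (s \<otimes>\<^bsub>R\<^esub> t) = ?\<psi> (p * q)" using frac[of "a \<otimes>\<^bsub>R\<^esub> b" "s \<otimes>\<^bsub>R\<^esub> t"] m1 m2 S(3) by simp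
    qed
    then show "?\<psi> (p \<otimes>\<^bsub>?A\<^esub> q) = ?\<psi> p \<otimes>\<^bsub>localization R S\<^esub> ?\<psi> q" unfolding m by simp
    have "?\<psi> p \<oplus>\<^bsub>localization R S\<^esub> ?\<psi> q = ?\<psi> (p + q)"
      unfolding localization_def ring.simps
    proof (rule UN[OF pq])
      fix a s b t assume h: "(a, s) \<in> ?\<psi> p" "(b, t) \<in> ?\<psi> q"
      note m1 = mem[OF h(1)] and m2 = mem[OF h(2)]
      have "\<chi> (t \<otimes>\<^bsub>R\<^esub> a \<oplus>\<^bsub>R\<^esub> s \<otimes>\<^bsub>R\<^esub> b) = \<chi> t * \<chi> a + \<chi> s * \<chi> b" "\<chi> (s \<otimes>\<^bsub>R\<^esub> t) = \<chi> s * \<chi> t"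
        using m1 m2 \<chi>(1,2) Sc by simp_all
      then have "\<chi> (t \<otimes>\<^bsub>R\<^esub> a \<oplus>\<^bsub>R\<^esub> s \<otimes>\<^bsub>R\<^esub> b) / \<chi> (s \<otimes>\<^bsub>R\<^esub> t) = p + q"
        using m1 m2 nz by (auto simp: field_simps)
      then show "ring_frac R S (t \<otimes>\<^bsub>R\<^esub> a \<oplus>\<^bsub>R\<^esub> s \<otimes>\<^bsub>R\<^esub> b) (s \<otimes>\<^bsub>R\<^esub> t) = ?\<psi> (p + q)"
        using frac[of "t \<otimes>\<^bsub>R\<^esub> a \<oplus>\<^bsub>R\<^esub> s \<otimes>\<^bsub>R\<^esub> b" "s \<otimes>\<^bsub>R\<^esub> t"] m1 m2 S(3) Sc by simp
    qed
    then show "?\<psi> (p \<oplus>\<^bsub>?A\<^esub> q) = ?\<psi> p \<oplus>\<^bsub>localization R S\<^esub> ?\<psi> q" unfolding m by simp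
  next
    have "ring_frac R S \<one>\<^bsub>R\<^esub> \<one>\<^bsub>R\<^esub> = ?\<psi> 1" using frac[of "\<one>\<^bsub>R\<^esub>" "\<one>\<^bsub>R\<^esub>"] S(2) \<chi>(3) by simp
    then show "?\<psi> \<one>\<^bsub>?A\<^esub> = \<one>\<^bsub>localization R S\<^esub>" by (simp add: localization_def ring_of_type_algebra_def)
  qed
  moreover have "inj_on ?\<psi> ?Z"
  proof (rule inj_onI)
    fix p q assume h: "p \<in> ?Z" "q \<in> ?Z" "?\<psi> p = ?\<psi> q"
    obtain a s where as: "(a, s) \<in> ?\<psi> p" using ne[OF h(1)] by blast
    have as': "(a, s) \<in> ?\<psi> q" using as unfolding h(3) .
    show "p = q" by (rule trans[OF mem(3)[OF as, symmetric] mem(3)[OF as']])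
  qed
  moreover have "carrier ?A = ?Z" by simp
  ultimately show "?\<psi> \<in> ring_iso ?A (localization R S)"
    unfolding ring_iso_def bij_betw_def mem_Collect_eq carL by (intro conjI) (simp_all only:)
  show "?\<psi> (\<chi> a) = ring_frac R S a \<one>\<^bsub>R\<^esub>" if "a \<in> carrier R" using frac[OF that S(2)] \<chi>(3) by simp
qed

lemma ring_of_type_algebra_simps [simp]:
  "carrier ring_of_type_algebra = UNIV" "p \<otimes>\<^bsub>ring_of_type_algebra\<^esub> q = p * q" "p \<oplus>\<^bsub>ring_of_type_algebra\<^esub> q = p + q"
  "\<one>\<^bsub>ring_of_type_algebra\<^esub> = 1" "\<zero>\<^bsub>ring_of_type_algebra\<^esub> = 0"
  by (simp_all add: ring_of_type_algebra_def)

section \<open>Cosets, denominators and the value at \<open>- 1 / 2\<close>\<close>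

abbreviation boron_coset :: "(('a::infinite emb \<Rightarrow>\<^sub>0 nat) \<Rightarrow>\<^sub>0 int) \<Rightarrow> (('a emb \<Rightarrow>\<^sub>0 nat) \<Rightarrow>\<^sub>0 int) set" where
  "boron_coset p \<equiv> theta_ideal boron_class +>\<^bsub>free_comm_ring (embs boron_class)\<^esub> p"

lemma boron_coset_eq_iff: "boron_coset p = boron_coset q \<longleftrightarrow> theta.eqv p q"
proof -
  have c: "boron_coset r = {h + r | h. h \<in> theta_ideal boron_class}" for r :: "('a emb \<Rightarrow>\<^sub>0 nat) \<Rightarrow>\<^sub>0 int"
    unfolding a_r_coset_def' by auto
  show ?thesis
  proof
    assume e: "boron_coset p = boron_coset q"
    have "0 + p \<in> boron_coset p" unfolding c using theta_ideal_props(2) by blast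
    then obtain h where "p = h + q" "h \<in> theta_ideal boron_class" unfolding e unfolding c by auto
    then show "theta.eqv p q" unfolding theta.eqv_def by simp
  next
    have sub: "boron_coset r \<subseteq> boron_coset s" if h: "theta.eqv r s" for r s :: "('a emb \<Rightarrow>\<^sub>0 nat) \<Rightarrow>\<^sub>0 int"
    proof
      fix z assume "z \<in> boron_coset r"
      then obtain h where h': "z = h + r" "h \<in> theta_ideal boron_class" unfolding c by auto
      have "h + (r - s) \<in> theta_ideal boron_class" using theta_ideal_props(3)[OF h'(2)] h unfolding theta.eqv_def by blast
      moreover have "z = (h + (r - s)) + s" using h'(1) by simp
      ultimately show "z \<in> boron_coset s" unfolding c by blast
    qed
    assume "theta.eqv p q"
    then show "boron_coset p = boron_coset q" using sub[of p q] sub[of q p] theta.eqv_sym by blast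
  qed
qed

lemma carrier_Theta: "carrier (Theta boron_class) = boron_coset ` free_carrier (embs boron_class)"
  by (auto simp: Theta_def FactRing_def A_RCOSETS_def')

lemma boron_coset_hom: "boron_coset \<in> ring_hom (free_comm_ring (embs boron_class)) (Theta boron_class)"
  unfolding Theta_def by (rule ideal.rcos_ring_hom[OF theta_ideal])

lemma boron_coset_ring:
  shows "p \<in> free_carrier (embs boron_class) \<Longrightarrow> q \<in> free_carrier (embs boron_class) \<Longrightarrow>
      boron_coset p \<otimes>\<^bsub>Theta boron_class\<^esub> boron_coset q = boron_coset (p * q)"
    and "p \<in> free_carrier (embs boron_class) \<Longrightarrow> q \<in> free_carrier (embs boron_class) \<Longrightarrow>
      boron_coset p \<oplus>\<^bsub>Theta boron_class\<^esub> boron_coset q = boron_coset (p + q)"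
    and "\<one>\<^bsub>Theta boron_class\<^esub> = boron_coset 1"
  using ring_hom_mult[OF boron_coset_hom, of p q] ring_hom_add[OF boron_coset_hom, of p q]
  by (simp_all add: ring_hom_one[OF boron_coset_hom, symmetric])

lemma cring_Theta: "cring (Theta \<AA>)"
  unfolding Theta_def by (rule ideal.quotient_is_cring[OF theta_ideal cring_free_comm_ring])

lemma zero_Theta: "\<zero>\<^bsub>Theta boron_class\<^esub> = boron_coset 0"
  by (auto simp: Theta_def FactRing_def a_r_coset_def')

text \<open>Evaluation at the root \<open>- 1 / 2\<close>, carried to cosets through an arbitrary
  representative; it is well defined because the ideal evaluates to zero.\<close>

definition half_value :: "(('a::infinite emb \<Rightarrow>\<^sub>0 nat) \<Rightarrow>\<^sub>0 int) set \<Rightarrow> rat" where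
  "half_value V = poly_value (emb_value (- 1 / 2)) (SOME p. V = boron_coset p)"

lemma half_value_coset: "half_value (boron_coset p) = poly_value (emb_value (- 1 / 2)) p"
proof -
  let ?q = "SOME q. boron_coset p = boron_coset q"
  have "boron_coset p = boron_coset ?q" by (rule someI[of _ p]) (rule refl)
  then have "p - ?q \<in> theta_ideal boron_class" unfolding boron_coset_eq_iff theta.eqv_def .
  then have "poly_value (emb_value (- 1 / 2 :: rat)) (p - ?q) = 0"
    by (rule theta_ideal_value[rotated]) (simp add: power2_eq_square)
  then show ?thesis unfolding half_value_def poly_value_diff by simp
qed

definition six_fractions :: "rat set" where
  "six_fractions = {of_int a / 6 ^ n | (a :: int) (n :: nat). True}"

lemma six_fractionsI: "of_int a / 6 ^ n \<in> six_fractions"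
  unfolding six_fractions_def by blast

lemma six_fractions_mult:
  assumes "p \<in> six_fractions" "q \<in> six_fractions" shows "p * q \<in> six_fractions"
proof -
  obtain a b and m n :: nat where "p = of_int a / 6 ^ m" "q = of_int b / 6 ^ n" using assms unfolding six_fractions_def by blast
  then have "p * q = of_int (a * b) / 6 ^ (m + n)" by (simp add: power_add)
  then show ?thesis by (simp only: six_fractionsI)
qed

lemma six_fractions_add:
  assumes "p \<in> six_fractions" "q \<in> six_fractions" shows "p + q \<in> six_fractions"
proof -
  obtain a b and m n :: nat where pq: "p = of_int a / 6 ^ m" "q = of_int b / 6 ^ n" using assms unfolding six_fractions_def by blast
  have "p + q = of_int (a * 6 ^ n + b * 6 ^ m) / 6 ^ (m + n)" unfolding pq by (simp add: power_add add_frac_eq)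
  then show ?thesis by (simp only: six_fractionsI)
qed

lemma six_fractions_of_int: "of_int a \<in> six_fractions"
  using six_fractionsI[of a 0] by simp

text \<open>All denominators have their values here, so quotients of values remain within
  \<open>six_fractions\<close>.\<close>

definition six_units :: "rat set" where
  "six_units = {q. q \<noteq> 0 \<and> q \<in> six_fractions \<and> 1 / q \<in> six_fractions}"

lemma six_units_1: "1 \<in> six_units"
  using six_fractions_of_int[of 1] by (simp add: six_units_def)

lemma six_units_mult: "p \<in> six_units \<Longrightarrow> q \<in> six_units \<Longrightarrow> p * q \<in> six_units"
  using six_fractions_mult[of p q] six_fractions_mult[of "1 / p" "1 / q"] by (simp add: six_units_def)

text \<open>At \<open>c = - 1 / 2\<close> the three small cases give \<open>3 / 2\<close>,
  \<open>1 / 2\<close>, \<open>- 1 / 2\<close>, and both pendant and inner edges give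
  \<open>- 1 / 2\<close>.\<close>

lemma point_value_six_unit: "point_value (- 1 / 2) H D x \<in> six_units"
proof -
  have "3 / 2 \<in> six_units" "1 / 2 \<in> six_units" "- 1 / 2 \<in> six_units"
    \<comment> \<open>The numerators over six are those of \<open>3 / 2\<close>, of its inverse
      \<open>2 / 3\<close>, and of \<open>1 / 2\<close> and \<open>- 1 / 2\<close>.\<close>
    using six_fractionsI[of 9 1] six_fractionsI[of 4 1] six_fractionsI[of 3 1] six_fractionsI[of "-3" 1]
      six_fractions_of_int[of 2] six_fractions_of_int[of "-2"] by (simp_all add: six_units_def)
  then show ?thesis by (simp add: point_value_def)
qed

lemma emb_value_six_unit: "e \<in> embs (boron_class :: 'a::infinite qstruct set) \<Longrightarrow> emb_value (- 1 / 2) e \<in> six_units"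
proof (induction "card (points (tgt e)) - card (points (src e))" arbitrary: e rule: less_induct)
  case less
  have half: "2 * (- 1 / 2 :: rat) ^ 2 + (- 1 / 2) = 0" by (simp add: power2_eq_square)
  note m = emb_value_measure[OF half, where 'a = 'a, unfolded emb_measure_def]
  show ?case
  proof (cases "is_iso e")
    case True
    then show ?thesis using m less.prems six_units_1 by simp
  next
    case False
    obtain e1 e2 where f: "e1 \<in> embs boron_class" "e2 \<in> embs boron_class" "e = emb_comp e2 e1" "tgt e1 = src e2" "src e1 = src e" "tgt e2 = tgt e"
      "card (points (tgt e1)) = Suc (card (points (src e)))" using boron.factor_one_point[OF less.prems False] by blast
    have "card (points (src e2)) \<le> card (points (tgt e2))"
      by (rule card_inj_on_le[OF emb_inj[OF f(2)]]) (use emb_maps[OF f(2)] boron.finite_points[OF emb_tgt[OF f(2)]] in auto)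
    then have "card (points (tgt e2)) - card (points (src e2)) < card (points (tgt e)) - card (points (src e))"
      using f(7)[unfolded f(4)] unfolding f(6) by linarith
    then have 2: "emb_value (- 1 / 2) e2 \<in> six_units" using less.hyps f(2) by blast
    have c1: "card (points (tgt e1)) = Suc (card (points (src e1)))" using f(5,7) by simp
    obtain x D \<alpha> where a: "x \<notin> points (src e1)" "x \<notin> {}" "dstruct (insert x (points (src e1))) D"
      "rel_restrict (points (src e1)) D = dis (src e1)" "\<alpha> \<in> embs boron_class" "is_iso \<alpha>"
      "src \<alpha> = mk_struct (insert x (points (src e1))) D" "tgt \<alpha> = tgt e1"
      "e1 = emb_comp \<alpha> (incl (src e1) (mk_struct (insert x (points (src e1))) D))"
      by (rule one_point_form[OF f(1) c1 finite.emptyI])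
    let ?H = "points (src e1)"
    have fin: "finite ?H" using boron.finite_points[OF emb_src[OF f(1)]] .
    have src: "mk_struct ?H (rel_restrict ?H D) = src e1" unfolding a(4) by (rule mk_struct_dis[OF emb_src[OF f(1)]])
    have "mk_struct ?H D = src e1" using mk_struct_rel_restrict[of ?H ?H D] src by simp
    then have i: "incl (src e1) (mk_struct (insert x ?H) D) \<in> embs boron_class"
      using incl_mk_struct[OF _ a(3) subset_insertI] fin by simp
    have v: "emb_value (- 1 / 2) (incl (src e1) (mk_struct (insert x ?H) D)) = (point_value (- 1 / 2) ?H D x :: rat)"
      using emb_value_point[OF half fin a(1,3)] unfolding src .
    have t: "tgt (incl (src e1) (mk_struct (insert x ?H) D)) = src \<alpha>" using a(7) by (simp add: incl_def)
    have "emb_value (- 1 / 2) (emb_comp \<alpha> (incl (src e1) (mk_struct (insert x ?H) D))) = emb_value (- 1 / 2 :: rat) \<alpha> * point_value (- 1 / 2) ?H D x"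
      using m a(5) i t unfolding v[symmetric] by blast
    then have "emb_value (- 1 / 2) e1 = emb_value (- 1 / 2 :: rat) \<alpha> * point_value (- 1 / 2) ?H D x" using a(9) by simp
    moreover have "emb_value (- 1 / 2 :: rat) \<alpha> = 1" using m a(5,6) by blast
    ultimately have 1: "emb_value (- 1 / 2) e1 \<in> six_units" using point_value_six_unit[of ?H D x] by simp
    have "emb_value (- 1 / 2 :: rat) e = emb_value (- 1 / 2) e2 * emb_value (- 1 / 2) e1" using m f(1,2,4) unfolding f(3) by blast
    then show ?thesis using six_units_mult[OF 2 1] by simp
  qed
qed

lemma half_value_six_fraction:
  assumes "V \<in> carrier (Theta boron_class)" shows "half_value V \<in> six_fractions"
proof -
  obtain p where p: "V = boron_coset p" "p \<in> free_carrier (embs boron_class)" using assms unfolding carrier_Theta by blast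
  have "poly_value (emb_value (- 1 / 2)) p \<in> six_fractions" using p(2)
  proof (induction rule: free_carrier_induct)
    case (gen e) then show ?case using emb_value_six_unit[of e] by (simp add: poly_value_gen six_units_def)
  qed (simp_all add: poly_value_add poly_value_mult six_fractions_of_int six_fractions_add six_fractions_mult)
  then show ?thesis unfolding p(1) half_value_coset .
qed

lemma denominators:
  assumes "s \<in> theta_denominators boron_class"
  shows "s \<in> carrier (Theta boron_class)" "half_value s \<in> six_units"
proof -
  have "s \<in> carrier (Theta boron_class) \<and> half_value s \<in> six_units"
    using assms unfolding theta_denominators_def
  proof (induction rule: mult_closure.induct)
    case one
    show ?case
      by (rule conjI, rule cring.cring_simprules(6)[OF cring_Theta], simp add: boron_coset_ring(3) half_value_coset six_units_1)
  next
    case (mult g s)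
    then obtain e where e: "e \<in> embs boron_class" "g = boron_coset (gen e)" unfolding theta_class_def by blast
    obtain p where p: "s = boron_coset p" "p \<in> free_carrier (embs boron_class)" using mult.IH unfolding carrier_Theta by blast
    have g: "gen e \<in> free_carrier (embs boron_class)" using e(1) by (rule free_carrier_gen)
    have prod: "g \<otimes>\<^bsub>Theta boron_class\<^esub> s = boron_coset (gen e * p)" unfolding e(2) p(1) by (rule boron_coset_ring(1)[OF g p(2)])
    have "half_value (boron_coset (gen e * p)) = emb_value (- 1 / 2) e * half_value s"
      unfolding p(1) half_value_coset by (simp add: poly_value_mult poly_value_gen)
    then have "half_value (boron_coset (gen e * p)) \<in> six_units" using six_units_mult[OF emb_value_six_unit[OF e(1)]] mult.IH by simp
    moreover have "boron_coset (gen e * p) \<in> carrier (Theta boron_class)" unfolding carrier_Theta using free_carrier_mult[OF g p(2)] by blast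
    ultimately show ?case unfolding prod by blast
  qed
  then show "s \<in> carrier (Theta boron_class)" "half_value s \<in> six_units" by blast+
qed

lemma denominators_mult:
  assumes s: "s \<in> theta_denominators boron_class" and t: "t \<in> theta_denominators (boron_class :: 'a::infinite qstruct set)"
  shows "s \<otimes>\<^bsub>Theta boron_class\<^esub> t \<in> theta_denominators boron_class"
proof -
  interpret cring "Theta (boron_class :: 'a qstruct set)" by (rule cring_Theta)
  note tc = denominators(1)[OF t]
  from s show ?thesis unfolding theta_denominators_def
  proof (induction rule: mult_closure.induct)
    case one then show ?case using t tc by (simp add: theta_denominators_def)
  next
    case (mult g s)
    obtain e where e: "e \<in> embs boron_class" "g = boron_coset (gen e)" using mult(1) unfolding theta_class_def by (rule imageE)
    have "g \<in> carrier (Theta boron_class)"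
      unfolding e(2) carrier_Theta by (rule imageI[OF free_carrier_gen[OF e(1)]])
    moreover have "s \<in> carrier (Theta boron_class)" using denominators(1)[unfolded theta_denominators_def] mult(2) by blast
    ultimately have "(g \<otimes>\<^bsub>Theta boron_class\<^esub> s) \<otimes>\<^bsub>Theta boron_class\<^esub> t = g \<otimes>\<^bsub>Theta boron_class\<^esub> (s \<otimes>\<^bsub>Theta boron_class\<^esub> t)"
      using m_assoc tc by blast
    then show ?case using mult_closure.mult[OF mult(1) mult.IH] by simp
  qed
qed

lemma gen_power_denominator:
  assumes e: "e \<in> embs boron_class" shows "boron_coset (gen e ^ k) \<in> theta_denominators boron_class"
proof (induction k)
  case 0
  show ?case by (simp add: theta_denominators_def boron_coset_ring(3)[symmetric] mult_closure.one)
next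
  case (Suc k)
  have g: "gen e \<in> free_carrier (embs boron_class)" using e by (rule free_carrier_gen)
  have "gen e ^ k \<in> free_carrier (embs boron_class)" by (induction k) (auto intro: free_carrier_1 free_carrier_mult g)
  then have "boron_coset (gen e ^ Suc k) = theta_class boron_class e \<otimes>\<^bsub>Theta boron_class\<^esub> boron_coset (gen e ^ k)"
    using boron_coset_ring(1)[OF g] by (simp add: theta_class_def)
  then show ?case
    using mult_closure.mult[OF imageI[OF e, of "theta_class boron_class"] Suc[unfolded theta_denominators_def]]
    by (simp only: theta_denominators_def)
qed

theorem theorem17p6:
  fixes \<AA> :: "'a :: infinite qstruct set"
  assumes "\<AA> = boron_class"
  shows "\<exists>c \<phi> \<psi>.
    {theta_class \<AA> i | i. i \<in> embs \<AA> \<and> src i \<in> boron_T 3 \<and> tgt i \<in> boron_T 4} = {c} \<and>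
    \<phi> \<in> ring_iso Zx_quot (Theta \<AA>) \<and>
    \<phi> (Zx_class [:0, 1:]) = c \<and>
    \<psi> \<in> ring_iso Z_one_sixth (Theta_star \<AA>) \<and>
    (\<forall>p :: int poly.
       \<psi> (poly (map_poly of_int p) (- 1 / 2)) = to_Theta_star \<AA> (\<phi> (Zx_class p)))"
proof -
  obtain H0 :: "'a set" and D0 x0 where base: "card H0 = 3" "x0 \<notin> H0" "dstruct (insert x0 H0) D0" by (rule four_point_structure)
  have fin: "finite H0" using base(1) by (auto intro: card_ge_0_finite)
  define e0 where "e0 = point_incl H0 D0 x0"
  have e0: "e0 \<in> embs boron_class" unfolding e0_def by (rule point_incl_in[OF fin base(3) order_refl])
  have pt: "theta.pt H0 D0 x0 = gen e0" by (simp add: theta.pt_def e0_def)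
  let ?T = "Theta (boron_class :: 'a qstruct set)" and ?F = "free_carrier (embs (boron_class :: 'a qstruct set))"
  let ?S = "theta_denominators (boron_class :: 'a qstruct set)"
  have g0: "gen e0 \<in> ?F" using e0 by (rule free_carrier_gen)
  \<comment> \<open>The generator takes the root itself as its value, so evaluating a class at a
    root is evaluating its polynomial there.\<close>
  have val_e0: "poly_value (emb_value c) (gen e0) = c" if c: "2 * c ^ 2 + c = 0" for c :: rat
  proof -
    have "mk_struct H0 (rel_restrict H0 D0) = mk_struct H0 D0" by (rule mk_struct_rel_restrict) (rule order_refl)
    then have "emb_value c e0 = point_value c H0 D0 x0"
      using emb_value_point[OF c fin base(2,3)] by (simp add: e0_def point_incl_def)
    moreover obtain A B where AB: "edge_at D0 H0 x0 A B" using edge_at_exists[OF base(3) fin refl base(2)] base(1) by auto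
    have "point_value c H0 D0 x0 = c"
      using point_value_edge[OF base(3) AB base(2) fin, of c] edge_at_singleton_side[OF AB fin] base(1) by simp
    ultimately show ?thesis by (simp add: poly_value_gen)
  qed
  have half: "2 * (- 1 / 2 :: rat) ^ 2 + (- 1 / 2) = 0" by (simp add: power2_eq_square)
  have zero: "2 * (0 :: rat) ^ 2 + 0 = 0" by simp

  \<comment> \<open>Evaluation at the class of \<open>e0\<close>, on integer polynomials; the
    desired isomorphism is what it induces on the quotient.\<close>
  define \<Phi> where "\<Phi> f = boron_coset (eval_int_poly (gen e0) f)" for f
  have evF: "eval_int_poly (gen e0) f \<in> ?F" for f by (rule theta.eval_int_poly_C[OF g0])
  have \<Phi>_half: "half_value (\<Phi> f) = eval_int_poly (- 1 / 2) f" for f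
    unfolding \<Phi>_def half_value_coset poly_value_eval_int_poly val_e0[OF half] ..
  interpret T: cring ?T by (rule cring_Theta)
  have hom: "\<Phi> \<in> ring_hom ring_of_type_algebra ?T"
    by (rule ring_hom_memI) (use evF in \<open>auto simp: \<Phi>_def carrier_Theta boron_coset_ring eval_int_poly_add eval_int_poly_mult\<close>)
  interpret \<Phi>: ring_hom_ring "ring_of_type_algebra :: int poly ring" ?T \<Phi>
    by (rule ring_hom_ringI2[OF ring_from_type_algebra T.ring_axioms hom])
  have surj: "\<Phi> ` carrier ring_of_type_algebra = carrier ?T"
  proof -
    have ex: "\<exists>f. boron_coset p = \<Phi> f" if "p \<in> ?F" for p
      using free_carrier_polynomial[OF base that] unfolding \<Phi>_def boron_coset_eq_iff e0_def .
    show ?thesis unfolding carrier_Theta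
    proof (intro subset_antisym subsetI)
      fix v assume "v \<in> \<Phi> ` carrier ring_of_type_algebra"
      then show "v \<in> boron_coset ` ?F" using evF unfolding \<Phi>_def by blast
    next
      fix v assume "v \<in> boron_coset ` ?F"
      then obtain p where p: "p \<in> ?F" "v = boron_coset p" by blast
      obtain f where "v = \<Phi> f" using ex[OF p(1)] unfolding p(2) by blast
      then show "v \<in> \<Phi> ` carrier ring_of_type_algebra" by simp
    qed
  qed
  \<comment> \<open>The quadratic relation puts the ideal into the kernel. Conversely, a polynomial
    in the kernel vanishes at both rational roots, which forces divisibility by
    \<open>x + 2 * x ^ 2\<close> over the integers.\<close>
  have \<Phi>_zero: "\<Phi> f = \<zero>\<^bsub>?T\<^esub> \<longleftrightarrow> f \<in> Zx_ideal" for f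
  proof -
    have idl: "ideal Zx_ideal ring_of_type_algebra" unfolding Zx_ideal_def by (rule ring.genideal_ideal[OF ring_from_type_algebra]) simp
    have gen: "[:0, 1, 2:] \<in> Zx_ideal" unfolding Zx_ideal_def by (rule ring.genideal_self'[OF ring_from_type_algebra]) simp
    have "theta.eqv (eval_int_poly (gen e0) [:0, 1, 2:]) 0"
      using theta.quadratic_relation[OF base] unfolding pt by (simp add: power2_eq_square algebra_simps)
    then have "[:0, 1, 2:] \<in> a_kernel ring_of_type_algebra ?T \<Phi>"
      unfolding a_kernel_def' by (simp add: \<Phi>_def zero_Theta boron_coset_eq_iff)
    then have "Zx_ideal \<subseteq> a_kernel ring_of_type_algebra ?T \<Phi>"
      unfolding Zx_ideal_def by (intro ring.genideal_minimal[OF ring_from_type_algebra \<Phi>.kernel_is_ideal]) simp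
    then have 1: "\<Phi> f = \<zero>\<^bsub>?T\<^esub>" if "f \<in> Zx_ideal" using that unfolding a_kernel_def' by blast
    have 2: "f \<in> Zx_ideal" if "\<Phi> f = \<zero>\<^bsub>?T\<^esub>"
    proof -
      have I: "eval_int_poly (gen e0) f \<in> theta_ideal boron_class"
        using that unfolding \<Phi>_def zero_Theta boron_coset_eq_iff theta.eqv_def by simp
      have "eval_int_poly c f = 0" if c: "2 * c ^ 2 + c = 0" for c :: rat
        using theta_ideal_value[OF c I] unfolding poly_value_eval_int_poly val_e0[OF c] .
      from double_root_factor[OF this[OF zero] this[OF half]] obtain g where g: "f = [:0, 1, 2:] * g" .
      show ?thesis unfolding g using ideal.I_r_closed[OF idl gen, of g] by simp
    qed
    from 1 2 show ?thesis by blast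
  qed
  then have ker: "a_kernel ring_of_type_algebra ?T \<Phi> = Zx_ideal" unfolding a_kernel_def' by simp
  define \<phi> where "\<phi> V = the_elem (\<Phi> ` V)" for V
  have \<phi>: "\<phi> \<in> ring_iso Zx_quot ?T"
    using \<Phi>.FactRing_iso_set[OF surj] unfolding ker Zx_quot_def \<phi>_def .
  have \<phi>_class: "\<phi> (Zx_class p) = \<Phi> p" for p
    using \<Phi>.the_elem_simp[of p] unfolding ker Zx_class_def \<phi>_def by simp

  have c: "{theta_class boron_class i | i. i \<in> embs boron_class \<and> src i \<in> boron_T 3 \<and> tgt i \<in> boron_T 4} = {\<Phi> [:0, 1:]}"
  proof -
    have c0: "\<Phi> [:0, 1:] = boron_coset (gen e0)" by (simp add: \<Phi>_def)
    have "theta_class boron_class i = \<Phi> [:0, 1:]" if "i \<in> embs boron_class" "src i \<in> boron_T 3" "tgt i \<in> boron_T 4" for i :: "'a emb"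
      using theta.class_T34[OF base that(1)] that(2,3) unfolding c0 pt theta_class_def boron_coset_eq_iff boron_T_def by blast
    moreover have "src e0 \<in> boron_T 3" "tgt e0 \<in> boron_T 4"
      using emb_src[OF e0] emb_tgt[OF e0] base fin by (auto simp: boron_T_def e0_def point_incl_def incl_def)
    ultimately show ?thesis using e0 by blast
  qed

  define \<psi> where "\<psi> = value_fraction_set ?T ?S half_value"
  have fractions: "{half_value a / half_value s | a s. a \<in> carrier ?T \<and> s \<in> ?S} = six_fractions"
  proof (intro subset_antisym subsetI)
    fix q assume "q \<in> {half_value a / half_value s | a s. a \<in> carrier ?T \<and> s \<in> ?S}"
    then obtain a s where q: "q = half_value a / half_value s" "a \<in> carrier ?T" "s \<in> ?S" by blast
    have "1 / half_value s \<in> six_fractions" using denominators(2)[OF q(3)] unfolding six_units_def by blast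
    from six_fractions_mult[OF half_value_six_fraction[OF q(2)] this] show "q \<in> six_fractions" unfolding q(1) by simp
  next
    fix q assume "q \<in> six_fractions"
    then obtain n :: int and k :: nat where q: "q = of_int n / 6 ^ k" unfolding six_fractions_def by blast
    \<comment> \<open>The embedding of the empty structure into one point has value
      \<open>3 / 2\<close> and supplies the prime three in the denominators.\<close>
    define e1 where "e1 = point_incl {} D0 x0"
    have d1: "dstruct (insert x0 {}) (rel_restrict {x0} D0)" using dstruct_restrict[OF base(3), of "{x0}"] by simp
    have e1: "e1 \<in> embs boron_class" unfolding e1_def by (rule point_incl_in[OF _ base(3)]) auto
    have "e1 = point_incl {} (rel_restrict {x0} D0) x0" unfolding e1_def by (rule point_incl_restrict[symmetric]) simp
    then have "emb_value (- 1 / 2) e1 = point_value (- 1 / 2 :: rat) {} (rel_restrict {x0} D0) x0"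
      using emb_value_point[OF half _ _ d1] mk_struct_rel_restrict[of "{}" "{}" "rel_restrict {x0} D0"] by (simp add: point_incl_def)
    then have v1: "emb_value (- 1 / 2 :: rat) e1 = 3 / 2" by (simp add: point_value_def)
    \<comment> \<open>Since \<open>6 = 4 * (3 / 2)\<close>, the number \<open>n / 6 ^ k\<close> is
      \<open>n * (1 / 4) ^ k\<close> divided by \<open>(3 / 2) ^ k\<close>, and \<open>1 / 4\<close>
      is the square of the value of \<open>x\<close>.\<close>
    let ?a = "\<Phi> ([:n:] * [:0, 1:] ^ (2 * k))" and ?s = "boron_coset (gen e1 ^ k)"
    have as: "?a \<in> carrier ?T" "?s \<in> ?S"
      unfolding carrier_Theta \<Phi>_def using evF gen_power_denominator[OF e1] by blast+
    have "half_value ?a = of_int n * (1 / 4) ^ k"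
      unfolding \<Phi>_half eval_int_poly_mult eval_int_poly_power power_mult by (simp add: power2_eq_square)
    moreover have "half_value ?s = (3 / 2) ^ k" unfolding half_value_coset poly_value_power poly_value_gen v1 ..
    moreover have "q = of_int n * (1 / 4) ^ k / (3 / 2) ^ k"
    proof -
      have "(6::rat) ^ k = 4 ^ k * (3 / 2) ^ k" by (simp flip: power_mult_distrib)
      then show ?thesis by (simp add: q power_one_over)
    qed
    ultimately have "q = half_value ?a / half_value ?s" by (simp only:)
    with as show "q \<in> {half_value a / half_value s | a s. a \<in> carrier ?T \<and> s \<in> ?S}" by blast
  qed
  have loc: "\<psi> \<in> ring_iso (ring_of_type_algebra\<lparr>carrier := {half_value a / half_value s | a s. a \<in> carrier ?T \<and> s \<in> ?S}\<rparr>) (localization ?T ?S)"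
    "\<And>a. a \<in> carrier ?T \<Longrightarrow> \<psi> (half_value a) = ring_frac ?T ?S a \<one>\<^bsub>?T\<^esub>"
  proof -
    have S: "?S \<subseteq> carrier ?T" "\<one>\<^bsub>?T\<^esub> \<in> ?S" "\<And>s t. s \<in> ?S \<Longrightarrow> t \<in> ?S \<Longrightarrow> s \<otimes>\<^bsub>?T\<^esub> t \<in> ?S"
      using denominators(1) denominators_mult mult_closure.one unfolding theta_denominators_def by blast+
    have hv: "half_value (a \<otimes>\<^bsub>?T\<^esub> b) = half_value a * half_value b \<and> half_value (a \<oplus>\<^bsub>?T\<^esub> b) = half_value a + half_value b"
      if h: "a \<in> carrier ?T" "b \<in> carrier ?T" for a b
    proof -
      obtain p q where pq: "a = boron_coset p" "b = boron_coset q" "p \<in> ?F" "q \<in> ?F" using h unfolding carrier_Theta by blast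
      show ?thesis unfolding pq(1,2) boron_coset_ring(1,2)[OF pq(3,4)] half_value_coset poly_value_mult poly_value_add by simp
    qed
    have h1: "half_value \<one>\<^bsub>?T\<^esub> = 1" unfolding boron_coset_ring(3) half_value_coset by simp
    have nz: "half_value s \<noteq> 0" if "s \<in> ?S" for s using denominators(2)[OF that] unfolding six_units_def by blast
    have u: "\<Phi> [:0, 1:] \<in> ?S" using gen_power_denominator[OF e0, of 1] by (simp add: \<Phi>_def)
    \<comment> \<open>A polynomial vanishing at \<open>- 1 / 2\<close> has the factor
      \<open>1 + 2 * x\<close>, which multiplication by \<open>x\<close> completes to the relation.
      So the class of \<open>x\<close>, itself a denominator, annihilates the kernel.\<close>
    have kill: "\<Phi> [:0, 1:] \<otimes>\<^bsub>?T\<^esub> a = \<zero>\<^bsub>?T\<^esub>" if h: "a \<in> carrier ?T" "half_value a = 0" for a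
    proof -
      obtain f where f: "a = \<Phi> f" using h(1) surj by auto
      have "eval_int_poly (- 1 / 2 :: rat) f = 0" using h(2) unfolding f \<Phi>_half .
      then obtain g where g: "f = [:1, 2:] * g" by (rule root_minus_half_factor)
      have x: "[:0, 1:] * f = [:0, 1, 2:] * g" unfolding g by simp
      have hm: "\<Phi> (p * q) = \<Phi> p \<otimes>\<^bsub>?T\<^esub> \<Phi> q" for p q using ring_hom_mult[OF hom, of p q] by simp
      have "\<Phi> [:0, 1, 2:] = \<zero>\<^bsub>?T\<^esub>"
        unfolding \<Phi>_zero Zx_ideal_def by (rule ring.genideal_self'[OF ring_from_type_algebra]) simp
      moreover have "\<Phi> g \<in> carrier ?T" using ring_hom_closed[OF hom] by simp
      ultimately show ?thesis unfolding f hm[symmetric] x unfolding hm by simp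
    qed
    show "\<psi> \<in> ring_iso (ring_of_type_algebra\<lparr>carrier := {half_value a / half_value s | a s. a \<in> carrier ?T \<and> s \<in> ?S}\<rparr>) (localization ?T ?S)"
      unfolding \<psi>_def by (rule localization_by_value(1)[where u = "\<Phi> [:0, 1:]"]) (use T.cring_axioms S hv h1 nz u kill in blast)+
    show "\<psi> (half_value a) = ring_frac ?T ?S a \<one>\<^bsub>?T\<^esub>" if "a \<in> carrier ?T" for a
      unfolding \<psi>_def by (rule localization_by_value(2)[where u = "\<Phi> [:0, 1:]"]) (use T.cring_axioms S hv h1 nz u kill that in blast)+
  qed
  have \<psi>: "\<psi> \<in> ring_iso Z_one_sixth (Theta_star boron_class)"
    using loc(1) unfolding fractions Z_one_sixth_def Theta_star_def six_fractions_def .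
  have compatible: "\<psi> (poly (map_poly of_int p) (- 1 / 2)) = to_Theta_star boron_class (\<phi> (Zx_class p))" for p
  proof -
    have "\<Phi> p \<in> carrier ?T" using ring_hom_closed[OF hom] by simp
    then show ?thesis using loc(2) \<Phi>_half[of p] unfolding eval_int_poly_def to_Theta_star_def \<phi>_class by metis
  qed
  show ?thesis unfolding assms
    by (rule exI[of _ "\<Phi> [:0, 1:]"], rule exI[of _ \<phi>], rule exI[of _ \<psi>])
      (intro conjI allI c \<phi> \<phi>_class \<psi> compatible)
qed

end
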